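(* Let $\omega>0$, $\alpha\le 0$, and $\beta=-\tfrac{16}{3}\alpha\omega$ with $0\le\beta<1$. Let $a>0$ and let $d_2\in\mathbb R$ satisfy $$d_2-\tfrac13\alpha a<0 .$$ Set $$b^*=-\frac{\partial_\omega\Lambda_{d_2}}{\partial_\omega\Lambda_{24}}\Bigl(d_2-\tfrac13\alpha a\Bigr)<0 .$$ Let $b\in\mathbb R$ and let $0<\epsilon\ll1$ (i.e. $\epsilon$ is positive and sufficiently small, depending on the other parameters). Suppose that $d_1=d_1^*$, so that the bright solitary wave $\tilde{\mathbf A}$ exists, and let $-J\mathcal L$ be the linearization of the perturbed cubic-quintic Schrödinger equation about $\tilde{\mathbf A}$. (1) If $0>b^*>b$, then $-J\mathcal L$ has one stable real eigenvalue (negative) and one unstable real eigenvalue (positive), both of which are $O(\epsilon)$. (2) If $0>b>b^*$, then $-J\mathcal L$ has two stable real eigenvalues of $O(\epsilon)$ and no unstable eigenvalues of $O(\epsilon)$. Furthermore, except for the double eigenvalue at zero, there are no other eigenvalues of $-J\mathcal L$ which are of $O(\epsilon)$.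
   Context: The perturbed cubic-quintic Schrödinger equation (PCQNLS) is $$iA_t=(1+i\epsilon a)A_{xx}+i\epsilon bA+(1+i\epsilon d_1)|A|^2A+(\alpha+i\epsilon d_2)|A|^4A,$$ with $A(x,t)\in\mathbb C$, $x\in\mathbb R$, $t\ge0$, and all parameters real. After $A\to Ae^{-i\omega t}$ and writing $A=A_1+iA_2$, $\mathbf A=(A_1,A_2)^T$, it becomes $J\mathbf A_t=B\mathbf A_{xx}+F(\mathbf A,\omega,\epsilon)$, where $J=\begin{pmatrix}0&-1\\1&0\end{pmatrix}$, $B=I_2+\epsilon aJ$, and $$F(\mathbf A,\omega,\epsilon)=(-\omega I_2+\epsilon bJ)\mathbf A+(I_2+\epsilon d_1J)|\mathbf A|^2\mathbf A+(\alpha I_2+\epsilon d_2J)|\mathbf A|^4\mathbf A .$$ Bright solitary wave. For $\epsilon=0$ it is $\tilde{\mathbf A}=(R_0,0)^T$ with $$R_0^2(x)=\frac{4\omega}{1+\sqrt{1-\beta}\,\cosh(2\sqrt\omega\,x)},\qquad \beta=-\tfrac{16}{3}\alpha\omega .$$ It is known (and taken as given) that for small $\epsilon>0$ there is a value $d_1=d_1^*=d_1^*(a,b,d_2,\omega)$ (also depending on $\alpha,\epsilon$), with $$d_1^*=\tfrac14a-\Lambda_{24}b-\Lambda_{d_2}\bigl(d_2-\tfrac13\alpha a\bigr)+O(\epsilon),$$ for which there is a stationary solution $\tilde{\mathbf A}$ of $B\mathbf A''+F(\mathbf A,\omega,\epsilon)=0$ that is even, tends to $0$ as $|x|\to\infty$,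 depends smoothly on $\epsilon$, and tends to $(R_0,0)^T$ as $\epsilon\to0$. Constants. $\Lambda_i=\int_{-\infty}^\infty R_0^i(x)\,dx$, $\Lambda_{24}=\Lambda_2/\Lambda_4$, $\Lambda_{d_2}=-\frac{8\omega}{\beta}\bigl(\omega\Lambda_{24}-\frac34\bigr)$, the latter being equal to $\Lambda_6/\Lambda_4$ (which is its meaning when $\beta=0$). These are functions of $\omega$; $\partial_\omega$ is taken with $\alpha$ fixed. One has $\partial_\omega\Lambda_{d_2}/\partial_\omega\Lambda_{24}<0$ for $0\le\beta<1$. Linearization. $\mathcal L=B\partial_x^2+D_{\mathbf A}F(\tilde{\mathbf A},\omega,\epsilon)$, and $\lambda$ is an eigenvalue if $-J\mathcal L\mathbf A=\lambda\mathbf A$ has a nonzero localized (square-integrable) solution; eigenvalues are counted with algebraic multiplicity. An eigenvalue is stable (unstable) if its real part is negative (positive). Zero is always an eigenvalue with eigenfunctions $\tilde{\mathbf A}'$ and $J\tilde{\mathbf A}$, by translation and rotation invariance. *)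

theory Defs
  imports
    "HOL-Analysis.Analysis"
    "HOL-Library.Landau_Symbols"
    "HOL-Library.Function_Algebras"
begin

definition J :: "real^2^2" where
  "J = vector [vector [0, -1], vector [1, 0]]"

definition B :: "real \<Rightarrow> real \<Rightarrow> real^2^2" where
  "B a \<epsilon> = mat 1 + (\<epsilon> * a) *\<^sub>R J"

definition F :: "real \<Rightarrow> real \<Rightarrow> real \<Rightarrow> real \<Rightarrow> real \<Rightarrow> real \<Rightarrow> real^2 \<Rightarrow> real^2" where
  "F \<alpha> b d1 d2 \<omega> \<epsilon> v =
     (- \<omega> *\<^sub>R mat 1 + (\<epsilon> * b) *\<^sub>R J) *v v
     + (norm v)^2 *\<^sub>R ((mat 1 + (\<epsilon> * d1) *\<^sub>R J) *v v)
     + (norm v)^4 *\<^sub>R ((\<alpha> *\<^sub>R mat 1 + (\<epsilon> * d2) *\<^sub>R J) *v v)"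


definition beta :: "real \<Rightarrow> real \<Rightarrow> real" where
  "beta \<alpha> \<omega> = - (16/3) * \<alpha> * \<omega>"

definition R0 :: "real \<Rightarrow> real \<Rightarrow> real \<Rightarrow> real" where
  "R0 \<alpha> \<omega> x = sqrt (4 * \<omega> / (1 + sqrt (1 - beta \<alpha> \<omega>) * cosh (2 * sqrt \<omega> * x)))"

definition Lam :: "nat \<Rightarrow> real \<Rightarrow> real \<Rightarrow> real" where
  "Lam i \<alpha> \<omega> = (\<integral>x. R0 \<alpha> \<omega> x ^ i \<partial>lborel)"

definition Lam24 :: "real \<Rightarrow> real \<Rightarrow> real" where
  "Lam24 \<alpha> \<omega> = Lam 2 \<alpha> \<omega> / Lam 4 \<alpha> \<omega>"

definition Lamd2 :: "real \<Rightarrow> real \<Rightarrow> real" where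
  "Lamd2 \<alpha> \<omega> =
     (if beta \<alpha> \<omega> = 0 then Lam 6 \<alpha> \<omega> / Lam 4 \<alpha> \<omega>
      else - (8 * \<omega> / beta \<alpha> \<omega>) * (\<omega> * Lam24 \<alpha> \<omega> - 3/4))"

definition bstar :: "real \<Rightarrow> real \<Rightarrow> real \<Rightarrow> real \<Rightarrow> real" where
  "bstar \<alpha> a d2 \<omega> = - (deriv (Lamd2 \<alpha>) \<omega> / deriv (Lam24 \<alpha>) \<omega>) * (d2 - \<alpha> * a / 3)"

definition d1_lead :: "real \<Rightarrow> real \<Rightarrow> real \<Rightarrow> real \<Rightarrow> real \<Rightarrow> real" where
  "d1_lead \<alpha> a b d2 \<omega> =
     a / 4 - Lam24 \<alpha> \<omega> * b - Lamd2 \<alpha> \<omega> * (d2 - \<alpha> * a / 3)"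


definition Dx :: "(real \<Rightarrow> 'v::real_normed_vector) \<Rightarrow> real \<Rightarrow> 'v" where
  "Dx u x = vector_derivative u (at x)"

definition twice_diff :: "(real \<Rightarrow> 'v::real_normed_vector) \<Rightarrow> bool" where
  "twice_diff u \<longleftrightarrow> (\<forall>x. u differentiable (at x)) \<and> (\<forall>x. Dx u differentiable (at x))"

text \<open>Infinitely differentiable on \<open>S\<close>, with one-sided derivatives at boundary points of \<open>S\<close>.\<close>

definition smooth_curve_on :: "real set \<Rightarrow> (real \<Rightarrow> 'v::real_normed_vector) \<Rightarrow> bool" where
  "smooth_curve_on S f \<longleftrightarrow>
     (\<exists>D. D 0 = f \<and> (\<forall>n::nat. \<forall>s\<in>S. (D n has_vector_derivative D (Suc n) s) (at s within S)))"

definition stationary ::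
  "real \<Rightarrow> real \<Rightarrow> real \<Rightarrow> real \<Rightarrow> real \<Rightarrow> real \<Rightarrow> real \<Rightarrow> (real \<Rightarrow> real^2) \<Rightarrow> bool" where
  "stationary \<alpha> a b d1 d2 \<omega> \<epsilon> A \<longleftrightarrow>
     twice_diff A \<and> (\<forall>x. B a \<epsilon> *v Dx (Dx A) x + F \<alpha> b d1 d2 \<omega> \<epsilon> (A x) = 0)"

text \<open>
  A branch \<open>\<epsilon> \<mapsto> (d\<^sub>1\<^sup>*, A)\<close> of bright solitary waves. Smooth dependence on \<open>\<epsilon>\<close> is
  understood in the supremum norm over \<open>x\<close> and up to \<open>\<epsilon> = 0\<close>, where the branch starts at
  \<open>(R\<^sub>0, 0)\<close>; in particular \<open>A \<epsilon>\<close> tends to \<open>(R\<^sub>0, 0)\<close> uniformly in \<open>x\<close> as \<open>\<epsilon> \<rightarrow> 0\<close>.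
\<close>

definition bright_branch ::
  "real \<Rightarrow> real \<Rightarrow> real \<Rightarrow> real \<Rightarrow> real \<Rightarrow> (real \<Rightarrow> real) \<Rightarrow> (real \<Rightarrow> real \<Rightarrow>\<^sub>C (real^2)) \<Rightarrow> bool" where
  "bright_branch \<alpha> a b d2 \<omega> d1s A \<longleftrightarrow>
     (\<lambda>\<epsilon>. d1s \<epsilon> - d1_lead \<alpha> a b d2 \<omega>) \<in> O[at_right 0](\<lambda>\<epsilon>. \<epsilon>) \<and>
     (\<forall>x. A 0 x = vector [R0 \<alpha> \<omega> x, 0]) \<and>
     (\<exists>\<epsilon>0>0. smooth_curve_on {0..<\<epsilon>0} A \<and>
        (\<forall>\<epsilon>\<in>{0<..<\<epsilon>0}.
           stationary \<alpha> a b (d1s \<epsilon>) d2 \<omega> \<epsilon> (A \<epsilon>) \<and>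
           (\<forall>x. A \<epsilon> (- x) = A \<epsilon> x) \<and>
           (A \<epsilon> \<longlongrightarrow> 0) at_infinity))"


text \<open>The linearization is a real operator; eigenvalues and eigenfunctions are complex, so its
  coefficient matrices are complexified.\<close>

abbreviation cplx :: "real^2^2 \<Rightarrow> complex^2^2" where
  "cplx \<equiv> map_matrix complex_of_real"

definition lin ::
  "real \<Rightarrow> real \<Rightarrow> real \<Rightarrow> real \<Rightarrow> real \<Rightarrow> real \<Rightarrow> real \<Rightarrow> (real \<Rightarrow> real^2) \<Rightarrow>
   (real \<Rightarrow> complex^2) \<Rightarrow> real \<Rightarrow> complex^2" where
  "lin \<alpha> a b d1 d2 \<omega> \<epsilon> A u x =
     cplx (B a \<epsilon>) *v Dx (Dx u) x
     + cplx (matrix (frechet_derivative (F \<alpha> b d1 d2 \<omega> \<epsilon>) (at (A x)))) *v u x"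

definition mJL ::
  "real \<Rightarrow> real \<Rightarrow> real \<Rightarrow> real \<Rightarrow> real \<Rightarrow> real \<Rightarrow> real \<Rightarrow> (real \<Rightarrow> real^2) \<Rightarrow>
   (real \<Rightarrow> complex^2) \<Rightarrow> real \<Rightarrow> complex^2" where
  "mJL \<alpha> a b d1 d2 \<omega> \<epsilon> A u x = cplx (- J) *v lin \<alpha> a b d1 d2 \<omega> \<epsilon> A u x"

definition localized :: "(real \<Rightarrow> complex^2) \<Rightarrow> bool" where
  "localized u \<longleftrightarrow> twice_diff u \<and> integrable lborel (\<lambda>x. (norm (u x))^2)"

definition is_eigenvalue ::
  "((real \<Rightarrow> complex^2) \<Rightarrow> real \<Rightarrow> complex^2) \<Rightarrow> complex \<Rightarrow> bool" where
  "is_eigenvalue T \<mu> \<longleftrightarrow>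
     (\<exists>u. localized u \<and> (\<exists>x. u x \<noteq> 0) \<and> (\<forall>x. T u x = \<mu> *s u x))"

text \<open>The kernel of \<open>(T - \<mu>)\<^sup>k\<close>, with all intermediate functions in the domain.\<close>

primrec gen_kernel ::
  "((real \<Rightarrow> complex^2) \<Rightarrow> real \<Rightarrow> complex^2) \<Rightarrow> complex \<Rightarrow> nat \<Rightarrow> (real \<Rightarrow> complex^2) set" where
  "gen_kernel T \<mu> 0 = {\<lambda>x. 0}"
| "gen_kernel T \<mu> (Suc k) = {u. localized u \<and> (\<lambda>x. T u x - \<mu> *s u x) \<in> gen_kernel T \<mu> k}"

text \<open>The value is \<open>0\<close> if \<open>\<mu>\<close> is not an eigenvalue, but also (by the convention for \<open>dim\<close>) if the
  generalized eigenspace is infinite-dimensional; a positive value is a genuine dimension.\<close>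

definition alg_mult :: "((real \<Rightarrow> complex^2) \<Rightarrow> real \<Rightarrow> complex^2) \<Rightarrow> complex \<Rightarrow> nat" where
  "alg_mult T \<mu> = vector_space.dim (\<lambda>(c::complex) u x. c *s u x) (\<Union>k. gen_kernel T \<mu> k)"

text \<open>
  Counted with algebraic multiplicity, the eigenvalues of \<open>T \<epsilon>\<close> of size \<open>O(\<epsilon>)\<close> are: \<open>0\<close>, twice,
  and the real numbers \<open>\<mu>\<^sub>1 \<epsilon>\<close> and \<open>\<mu>\<^sub>2 \<epsilon>\<close>, which may coincide. Absence of further ones means
  that for every constant \<open>C\<close> there are no others in the disc of radius \<open>C \<epsilon>\<close>, once \<open>\<epsilon>\<close> is
  small. Meant for nonzero \<open>\<mu>\<^sub>1 \<epsilon>\<close> and \<open>\<mu>\<^sub>2 \<epsilon>\<close>.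
\<close>

definition order_eps_eigenvalues ::
  "(real \<Rightarrow> (real \<Rightarrow> complex^2) \<Rightarrow> real \<Rightarrow> complex^2) \<Rightarrow> (real \<Rightarrow> real) \<Rightarrow> (real \<Rightarrow> real) \<Rightarrow> bool" where
  "order_eps_eigenvalues T \<mu>1 \<mu>2 \<longleftrightarrow>
     \<mu>1 \<in> O[at_right 0](\<lambda>\<epsilon>. \<epsilon>) \<and> \<mu>2 \<in> O[at_right 0](\<lambda>\<epsilon>. \<epsilon>) \<and>
     (\<forall>\<^sub>F \<epsilon> in at_right 0.
        is_eigenvalue (T \<epsilon>) (\<mu>1 \<epsilon>) \<and> is_eigenvalue (T \<epsilon>) (\<mu>2 \<epsilon>) \<and>
        alg_mult (T \<epsilon>) (\<mu>1 \<epsilon>) = (if \<mu>1 \<epsilon> = \<mu>2 \<epsilon> then 2 else 1) \<and>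
        alg_mult (T \<epsilon>) (\<mu>2 \<epsilon>) = (if \<mu>1 \<epsilon> = \<mu>2 \<epsilon> then 2 else 1) \<and>
        is_eigenvalue (T \<epsilon>) 0 \<and> alg_mult (T \<epsilon>) 0 = 2) \<and>
     (\<forall>C>0. \<forall>\<^sub>F \<epsilon> in at_right 0. \<forall>\<mu>. is_eigenvalue (T \<epsilon>) \<mu> \<and> cmod \<mu> \<le> C * \<epsilon> \<longrightarrow>
        \<mu> \<in> {0, complex_of_real (\<mu>1 \<epsilon>), complex_of_real (\<mu>2 \<epsilon>)})"

end

theory Submission imports Defs begin

text \<open>
  At \<open>\<epsilon> = 0\<close> the linearization has eigenvalue \<open>0\<close> with two Jordan chains of length two, one of even
  functions (from the rotation mode \<open>J A\<close>) and one of odd functions (from the translation mode \<open>A'\<close>).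
  The wave is even, so the parity sectors stay invariant, and in each of them the kernel function \<open>\<phi>\<close>
  persists while the chain is broken. Writing an eigenfunction as \<open>\<phi> + \<mu> v\<close> and testing the equation for
  \<open>v\<close> with the almost adjoint kernel function \<open>\<phi>\<close> gives a scalar equation
  \<open>\<epsilon> q + \<mu> c + \<dots> = 0\<close>, which has a unique root \<open>\<mu> = - \<epsilon> q / c + o(\<epsilon>)\<close> in every disc of radius of
  order \<open>\<epsilon>\<close>; the root is real because the equation is invariant under conjugation. The moments
  \<open>q\<close> and \<open>c\<close> are explicit. In the odd sector they yield a negative eigenvalue because \<open>a > 0\<close>. In the even
  sector \<open>q\<close> is a positive multiple of \<open>b - b\<^sup>*\<close>, which uses that the even chain at \<open>\<epsilon> = 0\<close> is generated by
  the derivative of the wave with respect to \<open>\<omega>\<close>.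
\<close>

subsection \<open>Calculus on the line\<close>

text \<open>The analysis takes place in bounded continuous functions with the supremum norm. At
  \<epsilon> = 0 the system decouples into two scalar equations whose second solutions are explicit,
  so the inverse is an integral formula with a concrete bound, and the perturbed system follows by
  contraction. Square-integrable solutions are bounded by a local estimate, and bounded solutions of
  the eigenvalue equation decay exponentially because its coefficients are close to \<omega> at
  infinity; so both notions of eigenfunction agree for small spectral parameter.

  Eigenvalues and perturbation have the same size \<epsilon>, so convergence of the operators alone
  would not locate the former. The way out is an exact factor: the adjoint maps the kernel function
  to \<open>\<epsilon> \<theta>\<close>, where \<open>\<theta>\<close> is explicit algebra in the
  wave. Hence only limits of \<open>\<phi>\<close> and \<open>\<theta>\<close> enter, and the wave
  is never expanded in powers of \<epsilon>. The leading value of \<open>d1s\<close> is what turns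
  the limiting moments into \<open>a * K\<close> and into derivatives of \<open>Lam24\<close> and
  \<open>Lamd2\<close>.\<close>

definition second_deriv :: "(real \<Rightarrow> 'a::real_normed_vector) \<Rightarrow> (real \<Rightarrow> 'a) \<Rightarrow> (real \<Rightarrow> 'a) \<Rightarrow> bool" where
  "second_deriv u u1 u2 \<longleftrightarrow>
     (\<forall>x. (u has_vector_derivative u1 x) (at x)) \<and> (\<forall>x. (u1 has_vector_derivative u2 x) (at x))"

lemma second_derivD:
  assumes "second_deriv u u1 u2"
  shows "(u has_vector_derivative u1 x) (at x)" "(u1 has_vector_derivative u2 x) (at x)"
  using assms by (auto simp: second_deriv_def)

lemma second_deriv_Dx:
  assumes "second_deriv u u1 u2"
  shows "twice_diff u" "Dx u = u1" "Dx (Dx u) = u2"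
proof -
  have a: "Dx u = u1"
    using assms by (auto simp: second_deriv_def Dx_def fun_eq_iff intro: vector_derivative_at)
  show "Dx (Dx u) = u2"
    unfolding a using assms by (auto simp: second_deriv_def Dx_def fun_eq_iff intro: vector_derivative_at)
  show "twice_diff u"
    unfolding twice_diff_def a using assms
    by (auto simp: second_deriv_def differentiable_def has_vector_derivative_def)
  show "Dx u = u1" by (rule a)
qed

lemma twice_diff_second_deriv:
  assumes "twice_diff u"
  shows "second_deriv u (Dx u) (Dx (Dx u))"
  using assms by (simp add: twice_diff_def second_deriv_def Dx_def vector_derivative_works[symmetric])

lemma second_deriv_continuous:
  assumes "second_deriv u u1 u2"
  shows "continuous_on S u" "continuous_on S u1"
  using assms unfolding second_deriv_def
  by (meson has_vector_derivative_continuous continuous_at_imp_continuous_on)+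

lemma second_deriv_add:
  assumes "second_deriv u u1 u2" "second_deriv v v1 v2"
  shows "second_deriv (\<lambda>x. u x + v x) (\<lambda>x. u1 x + v1 x) (\<lambda>x. u2 x + v2 x)"
  using assms by (auto simp: second_deriv_def intro!: derivative_eq_intros has_vector_derivative_add)

lemma second_deriv_diff:
  assumes "second_deriv u u1 u2" "second_deriv v v1 v2"
  shows "second_deriv (\<lambda>x. u x - v x) (\<lambda>x. u1 x - v1 x) (\<lambda>x. u2 x - v2 x)"
  using assms by (auto simp: second_deriv_def intro!: has_vector_derivative_diff)

lemma second_deriv_linear:
  assumes "bounded_linear f" "second_deriv u u1 u2"
  shows "second_deriv (\<lambda>x. f (u x)) (\<lambda>x. f (u1 x)) (\<lambda>x. f (u2 x))"
  using assms bounded_linear.has_vector_derivative[OF assms(1)] by (auto simp: second_deriv_def)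

lemma second_deriv_reflect:
  assumes "second_deriv u u1 u2"
  shows "second_deriv (\<lambda>x. u (- x)) (\<lambda>x. - u1 (- x)) (\<lambda>x. u2 (- x))"
proof -
  have "((u \<circ> uminus) has_vector_derivative (-1) *\<^sub>R u1 (- x)) (at x)" for x
    by (rule vector_diff_chain_at) (auto intro!: derivative_eq_intros second_derivD[OF assms])
  moreover have "((u1 \<circ> uminus) has_vector_derivative (-1) *\<^sub>R u2 (- x)) (at x)" for x
    by (rule vector_diff_chain_at) (auto intro!: derivative_eq_intros second_derivD[OF assms])
  ultimately show ?thesis
    unfolding second_deriv_def o_def
    using has_vector_derivative_minus by fastforce
qed

lemma second_deriv_unique:
  assumes "second_deriv u u1 u2" "second_deriv u v1 v2"
  shows "u1 = v1" "u2 = v2"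
  using second_deriv_Dx(2,3)[OF assms(1)] second_deriv_Dx(2,3)[OF assms(2)] by auto

text \<open>Taylor expansion on a unit interval: \<open>u1 x\<close> differs from
  \<open>u (x+1) - u x\<close> by a remainder controlled by the second derivative. It turns bounds
  or convergence of a function and its second derivative, which the equations provide, into the same
  for the first derivative.\<close>

lemma derivative_interpolation:
  assumes "second_deriv u u1 u2"
    and a: "\<And>y. y \<in> {x..x+1} \<Longrightarrow> norm (u y) \<le> a"
    and b: "\<And>y. y \<in> {x..x+1} \<Longrightarrow> norm (u2 y) \<le> b"
  shows "norm (u1 x) \<le> 2 * a + b"
proof -
  note d = second_derivD[OF assms(1)]
  have b0: "0 \<le> b" by (rule order_trans[OF norm_ge_zero b[of x]]) simp
  have n1: "norm (u1 y - u1 x) \<le> b" if "y \<in> {x..x+1}" for y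
  proof (cases "y = x")
    case False
    then have "norm (u1 y - u1 x) \<le> b * y - b * x"
      using that
      by (intro differentiable_bound_general[where f'=u2 and \<phi>'="\<lambda>_. b"])
         (auto intro!: d b derivative_eq_intros second_deriv_continuous[OF assms(1)] continuous_intros)
    also have "\<dots> = b * (y - x)" by (simp add: algebra_simps)
    also have "\<dots> \<le> b * 1" using that b0 by (intro mult_left_mono) auto
    finally show ?thesis by simp
  qed (use b0 in auto)
  have "norm ((u (x+1) - (x+1) *\<^sub>R u1 x) - (u x - x *\<^sub>R u1 x)) \<le> b * (x+1) - b * x"
    by (rule differentiable_bound_general[where f'="\<lambda>y. u1 y - u1 x" and \<phi>'="\<lambda>_. b" and
          f="\<lambda>y. u y - y *\<^sub>R u1 x" and \<phi>="\<lambda>y. b * y"])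
       (auto intro!: d n1 derivative_eq_intros second_deriv_continuous[OF assms(1)] continuous_intros)
  then have "norm ((u (x+1) - u x) - u1 x) \<le> b" by (simp add: algebra_simps)
  moreover have "norm (u (x+1) - u x) \<le> 2 * a"
    using norm_triangle_ineq4[of "u (x+1)" "u x"] a[of x] a[of "x+1"] by simp
  ultimately show ?thesis
    using norm_triangle_ineq4[of "u (x+1) - u x" "(u (x+1) - u x) - u1 x"] by simp
qed

text \<open>Maximum principle: both exponentials in \<open>g\<close> solve g'' = k^2 g, so g'' >=
  k^2 g, and \<open>g\<close> has no positive interior maximum. The small growing exponential makes
  \<open>g\<close> negative far out, where only boundedness of \<open>f\<close> is known.\<close>

lemma exponential_decay_half_line:
  fixes f :: "real \<Rightarrow> real"
  assumes "second_deriv f f1 f2" and k: "k > 0"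
    and conv: "\<And>x. x \<ge> X \<Longrightarrow> f2 x \<ge> k\<^sup>2 * f x"
    and bd: "\<And>x. x \<ge> X \<Longrightarrow> f x \<le> M" and M: "0 \<le> M" and x: "x \<ge> X"
  shows "f x \<le> M * exp (- k * (x - X))"
proof (rule field_le_epsilon)
  fix e :: real assume e: "e > 0"
  \<comment> \<open>The growing barrier then has exactly the value \<open>e\<close> at the point
    \<open>x\<close> under consideration.\<close>
  define \<delta> where "\<delta> = e / exp (k * (x - X))"
  have \<delta>: "\<delta> > 0" using e by (simp add: \<delta>_def)
  define g where "g y = f y - M * exp (- k * (y - X)) - \<delta> * exp (k * (y - X))" for y
  define g1 where "g1 y = f1 y + k * M * exp (- k * (y - X)) - k * \<delta> * exp (k * (y - X))" for y
  define g2 where "g2 y = f2 y - k * k * M * exp (- k * (y - X)) - k * k * \<delta> * exp (k * (y - X))" for y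
  have f': "(f has_real_derivative f1 y) (at y)" "(f1 has_real_derivative f2 y) (at y)" for y
    using second_derivD[OF assms(1)] by (auto simp: has_real_derivative_iff_has_vector_derivative)
  have g': "(g has_real_derivative g1 y) (at y)" "(g1 has_real_derivative g2 y) (at y)" for y
    unfolding g_def g1_def g2_def by (auto intro!: derivative_eq_intros f')
  have g2: "g2 y \<ge> k\<^sup>2 * g y" if "y \<ge> X" for y
    using conv[OF that] by (simp add: g2_def g_def power2_eq_square algebra_simps)
  have "g x \<le> 0"
  proof (rule ccontr)
    assume pos: "\<not> g x \<le> 0"
    \<comment> \<open>By exp t >= 1 + t, the growing barrier at \<open>Y\<close> exceeds
      \<open>M\<close>, so \<open>g\<close> is negative there.\<close>
    define Y where "Y = x + M / (\<delta> * k) + 1"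
    have Yx: "Y > x" using M \<delta> k by (simp add: Y_def add_nonneg_pos)
    have "\<delta> * exp (k * (Y - X)) \<ge> \<delta> * (1 + k * (Y - X))"
      using \<delta> by (intro mult_left_mono) auto
    moreover have "\<delta> * (1 + k * (Y - X)) = \<delta> + \<delta> * k * (x - X) + M + \<delta> * k"
      using \<delta> k by (simp add: Y_def field_simps)
    moreover have "\<delta> * k * (x - X) \<ge> 0" "\<delta> * k > 0" using \<delta> k x by auto
    ultimately have "\<delta> * exp (k * (Y - X)) > M" using \<delta> by linarith
    moreover have "f Y \<le> M" using bd[of Y] Yx x by simp
    moreover have "M * exp (- k * (Y - X)) \<ge> 0" using M by simp
    ultimately have gY: "g Y < 0" unfolding g_def by linarith
    have gX: "g X < 0" using bd[of X] \<delta> by (simp add: g_def)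
    have "continuous_on {X..Y} g" using g' DERIV_continuous_on has_field_derivative_at_within by blast
    then obtain c where c: "c \<in> {X..Y}" "\<And>y. y \<in> {X..Y} \<Longrightarrow> g y \<le> g c"
      using continuous_attains_sup[of "{X..Y}" g] x Yx by fastforce
    have gc: "g c > 0" using c(2)[of x] x Yx pos by force
    then have cXY: "X < c" "c < Y" using gX gY c(1) by (auto simp: le_less)
    have g1c: "g1 c = 0"
    proof (rule DERIV_local_max[OF g'(1)])
      show "0 < min (c - X) (Y - c)" using cXY by simp
      show "\<forall>y. \<bar>c - y\<bar> < min (c - X) (Y - c) \<longrightarrow> g y \<le> g c"
      proof (intro allI impI)
        fix y assume "\<bar>c - y\<bar> < min (c - X) (Y - c)"
        then have "y \<in> {X..Y}" unfolding atLeastAtMost_iff by linarith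
        then show "g y \<le> g c" by (rule c(2))
      qed
    qed
    \<comment> \<open>At the maximum the slope is zero and the second derivative is positive, so
      \<open>g\<close> strictly increases to the right of \<open>c\<close>, which is absurd.\<close>
    have "g2 c > 0" using g2[of c] cXY gc k by (smt (verit) mult_pos_pos zero_less_power)
    then obtain d where d: "d > 0" "\<And>h. 0 < h \<Longrightarrow> h < d \<Longrightarrow> g1 c < g1 (c + h)"
      using DERIV_pos_inc_right[OF g'(2)] by blast
    define h where "h = min (d / 2) (Y - c)"
    have h: "0 < h" "h < d" "c + h \<le> Y" using d cXY by (auto simp: h_def)
    have "g c < g (c + h)"
    proof (rule DERIV_pos_imp_increasing_open[where f=g and a=c and b="c + h"])
      show "c < c + h" using h by simp
      show "continuous_on {c..c+h} g" using g' DERIV_continuous_on has_field_derivative_at_within by blast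
      fix y assume "c < y" "y < c + h"
      then have "g1 y > 0" using d(2)[of "y - c"] h g1c by simp
      then show "\<exists>z. (g has_real_derivative z) (at y) \<and> 0 < z" using g'(1) by blast
    qed
    then show False using c(2)[of "c + h"] h cXY by auto
  qed
  then show "f x \<le> M * exp (- k * (x - X)) + e"
    by (simp add: g_def \<delta>_def)
qed

lemma exponential_decay_line:
  fixes u :: "real \<Rightarrow> 'a::real_inner"
  assumes u: "second_deriv u u1 u2" and k: "k > 0"
    and conv: "\<And>x. \<bar>x\<bar> \<ge> X \<Longrightarrow> u x \<bullet> u2 x \<ge> k\<^sup>2 / 2 * (norm (u x))\<^sup>2"
    and bd: "\<And>x. norm (u x) \<le> M"
  shows "norm (u x) \<le> M * exp (k * X / 2) * exp (- (k/2) * \<bar>x\<bar>)"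
proof -
  have half: "norm (w x) \<le> M * exp (k * X / 2) * exp (- (k/2) * x)"
    if w: "second_deriv w w1 w2" and conv: "\<And>x. x \<ge> X \<Longrightarrow> w x \<bullet> w2 x \<ge> k\<^sup>2 / 2 * (norm (w x))\<^sup>2"
      and bd: "\<And>x. norm (w x) \<le> M" for w w1 w2 :: "real \<Rightarrow> 'a" and x
  proof -
    note d = second_derivD[OF w]
    have M: "M \<ge> 0" using bd[of 0] norm_ge_zero[of "w 0"] by linarith
    show ?thesis
    proof (cases "x \<ge> X")
      case True
      have "second_deriv (\<lambda>x. w x \<bullet> w x) (\<lambda>x. 2 * (w x \<bullet> w1 x)) (\<lambda>x. 2 * (w1 x \<bullet> w1 x + w x \<bullet> w2 x))"
        unfolding second_deriv_def
      proof (intro conjI allI)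
        fix x
        have "((\<lambda>x. w x \<bullet> w x) has_vector_derivative (w x \<bullet> w1 x + w1 x \<bullet> w x)) (at x)"
          by (rule bounded_bilinear.has_vector_derivative[OF bounded_bilinear_inner d(1) d(1)])
        then show "((\<lambda>x. w x \<bullet> w x) has_vector_derivative 2 * (w x \<bullet> w1 x)) (at x)"
          by (simp add: inner_commute)
        have "((\<lambda>x. w x \<bullet> w1 x) has_vector_derivative (w x \<bullet> w2 x + w1 x \<bullet> w1 x)) (at x)"
          by (rule bounded_bilinear.has_vector_derivative[OF bounded_bilinear_inner d(1) d(2)])
        from has_vector_derivative_mult_right[OF this, of 2]
        show "((\<lambda>x. 2 * (w x \<bullet> w1 x)) has_vector_derivative 2 * (w1 x \<bullet> w1 x + w x \<bullet> w2 x)) (at x)"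
          by (simp add: add.commute)
      qed
      moreover have "k\<^sup>2 * (w y \<bullet> w y) \<le> 2 * (w1 y \<bullet> w1 y + w y \<bullet> w2 y)" if "y \<ge> X" for y

      proof -
        have "k\<^sup>2 * (w y \<bullet> w y) = 2 * (k\<^sup>2 / 2 * (norm (w y))\<^sup>2)"
          unfolding power2_norm_eq_inner by simp
        also have "\<dots> \<le> 2 * (w y \<bullet> w2 y)" using conv[OF that] by (rule mult_left_mono) simp
        also have "\<dots> \<le> 2 * (w1 y \<bullet> w1 y + w y \<bullet> w2 y)" by simp
        finally show ?thesis .
      qed
      moreover have "w y \<bullet> w y \<le> M\<^sup>2" for y
        unfolding power2_norm_eq_inner[symmetric] using bd[of y] by (intro power_mono) auto
      ultimately have "w x \<bullet> w x \<le> M\<^sup>2 * exp (- k * (x - X))"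
        using True k by (intro exponential_decay_half_line[where f="\<lambda>x. w x \<bullet> w x"]) auto
      also have "exp (- k * (x - X)) = (exp (k * X / 2) * exp (- (k/2) * x))\<^sup>2"
        unfolding power2_eq_square exp_add[symmetric] by (rule arg_cong[of _ _ exp]) (simp add: field_simps)
      finally have "(norm (w x))\<^sup>2 \<le> (M * exp (k * X / 2) * exp (- (k/2) * x))\<^sup>2"
        unfolding power2_norm_eq_inner mult.assoc power_mult_distrib[of M] .
      then show ?thesis
        by (rule power2_le_imp_le) (intro mult_nonneg_nonneg M exp_ge_zero)
    next
      case False
      have "M * 1 \<le> M * (exp (k * X / 2) * exp (- (k/2) * x))"
      proof (rule mult_left_mono[OF _ M])
        have "exp (k * X / 2) * exp (- (k/2) * x) = exp (k / 2 * (X - x))"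
          unfolding exp_add[symmetric] by (rule arg_cong[of _ _ exp]) (simp add: field_simps)
        then show "1 \<le> exp (k * X / 2) * exp (- (k/2) * x)" using False k by simp
      qed
      then show ?thesis unfolding mult.assoc mult_1_right by (rule order_trans[OF bd])
    qed
  qed
  show ?thesis
  proof (cases "x \<ge> 0")
    case True
    then show ?thesis using half[OF u, of x] conv bd by auto
  next
    case False
    have "norm (u (- (- x))) \<le> M * exp (k * X / 2) * exp (- (k/2) * (- x))"
      by (rule half[OF second_deriv_reflect[OF u], of "-x"]) (use conv bd in auto)
    then show ?thesis using False by simp
  qed
qed

lemma integral_line_eq_limits:
  fixes W :: "real \<Rightarrow> 'a::euclidean_space"
  assumes W: "\<And>x. (W has_vector_derivative w x) (at x)" and c: "continuous_on UNIV w"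
    and i: "integrable lborel w" and l: "(W \<longlongrightarrow> a) at_bot" "(W \<longlongrightarrow> b) at_top"
  shows "(\<integral>x. w x \<partial>lborel) = b - a"
proof -
  have u: "einterval (- \<infinity>) \<infinity> = (UNIV::real set)" by (auto simp: einterval_def)
  have "(LBINT x=-\<infinity>..\<infinity>. w x) = b - a"
  proof (rule interval_integral_FTC_integrable)
    show "set_integrable lborel (einterval (- \<infinity>) \<infinity>) w" using i by (simp add: u set_integrable_def)
    show "((W \<circ> real_of_ereal) \<longlongrightarrow> a) (at_right (- \<infinity>))"
      using l(1) by (simp add: ereal_tendsto_simps)
    show "((W \<circ> real_of_ereal) \<longlongrightarrow> b) (at_left \<infinity>)"
      using l(2) by (simp add: ereal_tendsto_simps)
    show "isCont w x" for x using c by (simp add: continuous_on_eq_continuous_at)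
  qed (use W in auto)
  then show ?thesis by (simp add: interval_lebesgue_integral_def u set_lebesgue_integral_def)
qed

text \<open>Integration by parts on [x, x+1] represents \<open>u x\<close> as an integral of
  \<open>u\<close> and \<open>u2\<close> alone, hence through the growth bound as a local integral
  of |u|, which 1 + |u|^2 dominates.\<close>

lemma square_integrable_imp_bounded:
  fixes u :: "real \<Rightarrow> 'a::euclidean_space"
  assumes u: "second_deriv u u1 u2"
    and i: "integrable lborel (\<lambda>x. (norm (u x))\<^sup>2)"
    and b: "\<And>x. norm (u2 x) \<le> K * norm (u x) + G"
  shows "bounded (range u)"
proof -
  note d = second_derivD[OF u]
  have K: "norm (u2 x) \<le> \<bar>K\<bar> * norm (u x) + \<bar>G\<bar>" for x
    using b[of x] by (smt (verit) mult_right_mono norm_ge_zero)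
  define I where "I = integral UNIV (\<lambda>x. (norm (u x))\<^sup>2)"
  have iU: "(\<lambda>x. (norm (u x))\<^sup>2) integrable_on UNIV" using i integrable_on_lborel by blast
  have "norm (u x) \<le> (\<bar>K\<bar> + 6) * (1 + I) + \<bar>G\<bar>" for x
  proof -
    \<comment> \<open>The weight p(t) = t (1 - t)^2 with t = y - x vanishes at both ends, with p'(0)
      = 1 and p'(1) = 0. Thus \<open>W\<close> = p u' - p' u is 0 at x+1 and - u x at x, and its
      derivative p u'' - p'' u contains no u'.\<close>
    define W where "W y = ((y - x) * (1 - (y - x))\<^sup>2) *\<^sub>R u1 y - ((1 - (y - x)) * (1 - 3 * (y - x))) *\<^sub>R u y" for y
    define w where "w y = ((y - x) * (1 - (y - x))\<^sup>2) *\<^sub>R u2 y - (6 * (y - x) - 4) *\<^sub>R u y" for y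
    have "((\<lambda>y. ((y - x) * (1 - (y - x))\<^sup>2) *\<^sub>R u1 y) has_vector_derivative
            ((y - x) * (1 - (y - x))\<^sup>2) *\<^sub>R u2 y + ((1 - (y - x)) * (1 - 3 * (y - x))) *\<^sub>R u1 y) (at y)" for y
      by (rule has_vector_derivative_scaleR)
         (auto intro!: derivative_eq_intros d simp: power2_eq_square algebra_simps)
    moreover have "((\<lambda>y. ((1 - (y - x)) * (1 - 3 * (y - x))) *\<^sub>R u y) has_vector_derivative
            ((1 - (y - x)) * (1 - 3 * (y - x))) *\<^sub>R u1 y + (6 * (y - x) - 4) *\<^sub>R u y) (at y)" for y
      by (rule has_vector_derivative_scaleR)
         (auto intro!: derivative_eq_intros d simp: power2_eq_square algebra_simps)
    ultimately have "(W has_vector_derivative w y) (at y)" for y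
      unfolding W_def w_def by (auto intro!: has_vector_derivative_eq_rhs[OF has_vector_derivative_diff])
    then have "(w has_integral (W (x+1) - W x)) {x..x+1}"
      by (intro fundamental_theorem_of_calculus) (auto intro: has_vector_derivative_at_within)
    then have hw: "(w has_integral u x) {x..x+1}" by (simp add: W_def)
    have "norm (u x) \<le> integral {x..x+1} (\<lambda>y. (\<bar>K\<bar> + 6) * norm (u y) + \<bar>G\<bar>)"
    proof -
      have "norm (integral {x..x+1} w) \<le> integral {x..x+1} (\<lambda>y. (\<bar>K\<bar> + 6) * norm (u y) + \<bar>G\<bar>)"
      proof (rule integral_norm_bound_integral)
        show "w integrable_on {x..x+1}" using hw by blast
        show "(\<lambda>y. (\<bar>K\<bar> + 6) * norm (u y) + \<bar>G\<bar>) integrable_on {x..x+1}"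
          by (intro integrable_continuous_real continuous_intros second_deriv_continuous[OF u])
        fix y assume y: "y \<in> {x..x+1}"
        have 1: "\<bar>(y - x) * (1 - (y - x))\<^sup>2\<bar> \<le> 1"
          using y by (auto simp: abs_mult intro!: mult_le_one power_le_one)
        have 2: "\<bar>6 * (y - x) - 4\<bar> \<le> 6" using y by auto
        have "norm (w y) \<le> \<bar>(y - x) * (1 - (y - x))\<^sup>2\<bar> * norm (u2 y) + \<bar>6 * (y - x) - 4\<bar> * norm (u y)"
          unfolding w_def by (metis norm_scaleR norm_triangle_ineq4)
        also have "\<dots> \<le> 1 * norm (u2 y) + 6 * norm (u y)"
          using 1 2 by (intro add_mono mult_right_mono) auto
        also have "\<dots> \<le> (\<bar>K\<bar> + 6) * norm (u y) + \<bar>G\<bar>" using K[of y] by (simp add: algebra_simps)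
        finally show "norm (w y) \<le> (\<bar>K\<bar> + 6) * norm (u y) + \<bar>G\<bar>" .
      qed
      then show ?thesis using hw by (simp add: integral_unique)
    qed
    also have "\<dots> \<le> integral {x..x+1} (\<lambda>y. (\<bar>K\<bar> + 6) * (1 + (norm (u y))\<^sup>2) + \<bar>G\<bar>)"
    proof (rule integral_le)
      fix y
      have "norm (u y) \<le> 1 + (norm (u y))\<^sup>2"
        using zero_le_power2[of "norm (u y) - 1"] by (simp add: power2_eq_square algebra_simps)
          (smt (verit) norm_ge_zero)
      then show "(\<bar>K\<bar> + 6) * norm (u y) + \<bar>G\<bar> \<le> (\<bar>K\<bar> + 6) * (1 + (norm (u y))\<^sup>2) + \<bar>G\<bar>"
        by (intro add_mono mult_left_mono) auto
    qed (intro integrable_continuous_real continuous_intros second_deriv_continuous[OF u])+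
    also have "\<dots> = (\<bar>K\<bar> + 6) * (1 + integral {x..x+1} (\<lambda>y. (norm (u y))\<^sup>2)) + \<bar>G\<bar>"
    proof -
      have "(\<lambda>y. (norm (u y))\<^sup>2) integrable_on {x..x+1}"
        by (intro integrable_continuous_real continuous_intros second_deriv_continuous[OF u])
      then have "((\<lambda>y. (\<bar>K\<bar> + 6) * (1 + (norm (u y))\<^sup>2) + \<bar>G\<bar>) has_integral
        (\<bar>K\<bar> + 6) * (1 + integral {x..x+1} (\<lambda>y. (norm (u y))\<^sup>2)) + \<bar>G\<bar>) {x..x+1}"
        using has_integral_const_real[of "1::real" x "x+1"] has_integral_const_real[of "\<bar>G\<bar>" x "x+1"]
        by (intro has_integral_add has_integral_mult_right) (auto simp: integrable_integral)
      then show ?thesis by (rule integral_unique)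
    qed
    also have "\<dots> \<le> (\<bar>K\<bar> + 6) * (1 + I) + \<bar>G\<bar>"
    proof -
      have "integral {x..x+1} (\<lambda>y. (norm (u y))\<^sup>2) \<le> I" unfolding I_def
        by (rule integral_subset_le) (auto intro!: iU integrable_continuous_real continuous_intros second_deriv_continuous[OF u])
      then show ?thesis by (intro add_mono mult_left_mono) auto
    qed
    finally show ?thesis .
  qed
  then show ?thesis by (auto simp: bounded_iff)
qed

subsection \<open>A scalar Schroedinger equation with a decaying solution\<close>

lemma exp_minus_abs_integrable:
  fixes k :: real
  assumes k: "k > 0"
  shows "integrable lborel (\<lambda>x. exp (- k * \<bar>x\<bar>))" "(\<integral>x. exp (- k * \<bar>x\<bar>) \<partial>lborel) \<le> 4 / k"
proof -
  \<comment> \<open>The logistic function: its derivative \<open>f\<close> is smooth across 0, has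
    total integral 1, and dominates \<open>exp (- k * \<bar>x\<bar>)\<close> up to the factor 4/k,
    so no splitting at the kink is necessary.\<close>
  define F where "F x = 1 / (1 + exp (- k * x))" for x :: real
  define f where "f x = k * exp (- k * x) / (1 + exp (- k * x))\<^sup>2" for x :: real
  have u: "einterval (- \<infinity>) \<infinity> = (UNIV::real set)" by (auto simp: einterval_def)
  have pos: "1 + exp (- k * x) > 0" for x :: real by (simp add: add_pos_pos)
  have D: "DERIV F x :> f x" for x
    unfolding F_def f_def using pos[of x]
    by (auto intro!: derivative_eq_intros simp: power2_eq_square add_eq_0_iff)
  have lim1: "filterlim (\<lambda>x. - k * x) at_bot at_top"
    using k by (intro filterlim_tendsto_neg_mult_at_bot[OF tendsto_const]) (auto simp: filterlim_ident)
  have lim2: "filterlim (\<lambda>x. - k * x) at_top at_bot"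
    unfolding filterlim_at_bot_mirror
    using k filterlim_tendsto_pos_mult_at_top[OF tendsto_const k filterlim_ident] by simp
  have Ft: "(F \<longlongrightarrow> 1) at_top"
    unfolding F_def using tendsto_divide[OF tendsto_const tendsto_add[OF tendsto_const
      filterlim_compose[OF exp_at_bot lim1]], of 1 1] by simp
  have Fb: "(F \<longlongrightarrow> 0) at_bot"
    unfolding F_def
    by (rule tendsto_divide_0[OF tendsto_const filterlim_mono[OF
      filterlim_tendsto_add_at_top[OF tendsto_const filterlim_compose[OF exp_at_top lim2]] at_top_le_at_infinity order_refl]])
  have fnn: "0 \<le> f x" for x using k by (simp add: f_def)
  have c: "isCont f x" for x unfolding f_def using pos[of x] by (intro continuous_intros) auto
  have si: "set_integrable lborel (einterval (- \<infinity>) \<infinity>) f" and sv: "(LBINT x=-\<infinity>..\<infinity>. f x) = 1 - 0"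
    using interval_integral_FTC_nonneg[of "-\<infinity>" \<infinity> F f 0 1] D c fnn Ft Fb
    by (auto simp: ereal_tendsto_simps)
  have fi: "integrable lborel f" using si by (simp add: u set_integrable_def)
  have fv: "(\<integral>x. f x \<partial>lborel) = 1"
    using sv by (simp add: interval_lebesgue_integral_def u set_lebesgue_integral_def)
  have le: "exp (- k * \<bar>x\<bar>) \<le> 4 / k * f x" for x
  proof -
    define E where "E = exp (- k * \<bar>x\<bar>)"
    have E: "0 < E" "E \<le> 1" using k by (auto simp: E_def)
    have "f x = k * (E / (1 + E)\<^sup>2)"
    proof (cases "x \<ge> 0")
      case False
      then have e: "exp (- k * x) = 1 / E" by (simp add: E_def exp_minus field_simps)
      show ?thesis unfolding f_def e using E by (simp add: field_simps power2_eq_square)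
    qed (simp add: f_def E_def)
    moreover have "E / (1 + E)\<^sup>2 \<ge> E / 4"
    proof (rule divide_left_mono)
      show "(1 + E)\<^sup>2 \<le> 4" using E power_mono[of "1 + E" 2 2] by simp
    qed (use E in auto)
    ultimately show ?thesis using k unfolding E_def[symmetric] by (simp add: field_simps)
  qed
  show i: "integrable lborel (\<lambda>x. exp (- k * \<bar>x\<bar>))"
    by (rule Bochner_Integration.integrable_bound[OF integrable_mult_right[OF fi, of "4/k"]])
       (use le fnn k in \<open>auto intro!: borel_measurable_continuous_onI continuous_intros AE_I2 simp: abs_mult\<close>)
  have "(\<integral>x. exp (- k * \<bar>x\<bar>) \<partial>lborel) \<le> (\<integral>x. 4 / k * f x \<partial>lborel)"
    by (rule integral_mono[OF i]) (use fi le in auto)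
  also have "\<dots> = 4 / k" using fv by simp
  finally show "(\<integral>x. exp (- k * \<bar>x\<bar>) \<partial>lborel) \<le> 4 / k" .
qed

lemma exp_bound_integral:
  fixes f :: "real \<Rightarrow> 'a::euclidean_space"
  assumes k: "k > 0" and c: "continuous_on UNIV f" and b: "\<And>x. norm (f x) \<le> C * exp (- k * \<bar>x\<bar>)"
  shows "integrable lborel f" "norm (\<integral>x. f x \<partial>lborel) \<le> 4 * C / k"
proof -
  have i: "integrable lborel (\<lambda>x. C * exp (- k * \<bar>x\<bar>))"
    using exp_minus_abs_integrable[OF k] by auto
  show fi: "integrable lborel f"
    by (rule Bochner_Integration.integrable_bound[OF i])
       (use b c in \<open>auto intro!: borel_measurable_continuous_onI AE_I2 intro: order_trans[OF _ abs_ge_self]\<close>)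
  have C: "C \<ge> 0" using order_trans[OF norm_ge_zero b[of 0]] by simp
  have "norm (\<integral>x. f x \<partial>lborel) \<le> (\<integral>x. norm (f x) \<partial>lborel)" by (rule integral_norm_bound)
  also have "\<dots> \<le> (\<integral>x. C * exp (- k * \<bar>x\<bar>) \<partial>lborel)"
    by (rule integral_mono[OF _ i]) (use fi b in auto)
  also have "\<dots> \<le> C * (4 / k)"
    using mult_left_mono[OF exp_minus_abs_integrable(2)[OF k] C] by simp
  finally show "norm (\<integral>x. f x \<partial>lborel) \<le> 4 * C / k" by (simp add: mult.commute)
qed

lemma exp_bound_tendsto_0:
  fixes f :: "real \<Rightarrow> 'a::real_normed_vector"
  assumes k: "k > 0" and b: "\<And>x. norm (f x) \<le> C * exp (- k * \<bar>x\<bar>)"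
  shows "(f \<longlongrightarrow> 0) at_top" "(f \<longlongrightarrow> 0) at_bot"
proof -
  have lim1: "filterlim (\<lambda>x. - k * x) at_bot at_top"
    using k by (intro filterlim_tendsto_neg_mult_at_bot[OF tendsto_const]) (auto simp: filterlim_ident)
  have t: "((\<lambda>x. C * exp (- k * x)) \<longlongrightarrow> 0) at_top"
    by (rule tendsto_mult_right_zero[OF filterlim_compose[OF exp_at_bot lim1]])
  show "(f \<longlongrightarrow> 0) at_top"
    by (rule Lim_null_comparison[OF _ t])
       (use b in \<open>auto intro!: eventually_at_top_linorderI[of 0] elim: order_trans\<close>, metis abs_of_nonneg mult_minus_left)
  have "((\<lambda>x. f (- x)) \<longlongrightarrow> 0) at_top"
    by (rule Lim_null_comparison[OF _ t])
       (auto intro!: eventually_at_top_linorderI[of 0], metis b abs_minus abs_of_nonneg mult_minus_left)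
  then show "(f \<longlongrightarrow> 0) at_bot" by (simp add: filterlim_at_bot_mirror)
qed

lemma antiderivative_line:
  fixes g :: "real \<Rightarrow> 'a::euclidean_space"
  assumes "continuous_on UNIV g"
  obtains P where "P 0 = 0" "\<And>x. (P has_vector_derivative g x) (at x)"
proof -
  define P where "P u = (LBINT y=ereal 0..ereal u. g y)" for u
  have "P 0 = 0" by (simp add: P_def)
  moreover have "(P has_vector_derivative g x) (at x)" for x
  proof -
    define b where "b = \<bar>x\<bar> + 1"
    have "(P has_vector_derivative g x) (at x within {-b..b})"
      unfolding P_def by (rule interval_integral_FTC2[of "-b" 0 b])
        (auto simp: b_def intro: continuous_on_subset[OF assms])
    then show ?thesis by (simp add: at_within_Icc_at b_def)
  qed
  ultimately show thesis by (rule that)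
qed

text \<open>A zero integral would make \<open>f\<close> vanish almost everywhere; its zero set is
  closed, and a closed set of full measure is everything.\<close>

lemma integral_continuous_pos:
  fixes f :: "real \<Rightarrow> real"
  assumes c: "continuous_on UNIV f" and nn: "\<And>x. 0 \<le> f x" and i: "integrable lborel f" and x: "0 < f x"
  shows "0 < (\<integral>x. f x \<partial>lborel)"
proof -
  have "(\<integral>x. f x \<partial>lborel) \<ge> 0" by (rule integral_nonneg_AE) (use nn in auto)
  moreover have "(\<integral>x. f x \<partial>lborel) \<noteq> 0"
  proof
    assume "(\<integral>x. f x \<partial>lborel) = 0"
    then have "AE x in lborel. f x = 0" using integral_nonneg_eq_0_iff_AE[OF i] nn by simp
    then have "AE x in lebesgue. x \<in> {x. f x = 0}" by (simp add: AE_completion)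
    moreover have "closed {x. f x = 0}" by (intro closed_Collect_eq c continuous_intros)
    ultimately have "x \<in> {x. f x = 0}" by (rule mem_closed_if_AE_lebesgue[rotated])
    then show False using x by simp
  qed
  ultimately show ?thesis by simp
qed

lemma exp_limit:
  fixes P :: "real \<Rightarrow> 'a::euclidean_space"
  assumes P: "\<And>x. (P has_vector_derivative p x) (at x)" and k: "k > 0"
    and b: "\<And>x. x \<ge> 0 \<Longrightarrow> norm (p x) \<le> c * exp (- k * x)"
  obtains L where "\<And>x. x \<ge> 0 \<Longrightarrow> norm (P x - L) \<le> c / k * exp (- k * x)"
proof -
  have c: "c \<ge> 0" using order_trans[OF norm_ge_zero b[of 0]] by simp
  have cP: "continuous_on S P" for S
    using P by (meson has_vector_derivative_continuous continuous_at_imp_continuous_on)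
  have d: "norm (P y - P x) \<le> c / k * exp (- k * x)" if "0 \<le> x" "x \<le> y" for x y
  proof (cases "x = y")
    case False
    have "norm (P y - P x) \<le> - c / k * exp (- k * y) - (- c / k * exp (- k * x))"
      using that False k
    proof (intro differentiable_bound_general[where f'=p and \<phi>'="\<lambda>x. c * exp (- k * x)"])
      show "norm (p z) \<le> c * exp (- k * z)" if "x < z" for z using b[of z] that \<open>0 \<le> x\<close> by simp
    qed (auto intro!: P cP continuous_intros derivative_eq_intros
           simp: has_real_derivative_iff_has_vector_derivative[symmetric])
    also have "\<dots> \<le> c / k * exp (- k * x)" using c k by simp
    finally show ?thesis .
  qed (use c k in auto)
  have lim: "(\<lambda>n. c / k * exp (- k * real n)) \<longlonglongrightarrow> 0"
  proof -
    have "filterlim (\<lambda>n. - k * real n) at_bot sequentially"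
      using k by (intro filterlim_tendsto_neg_mult_at_bot[OF tendsto_const]) (auto simp: filterlim_real_sequentially)
    from tendsto_mult_right_zero[OF filterlim_compose[OF exp_at_bot this]] show ?thesis .
  qed
  have "Cauchy (\<lambda>n. P (real n))"
  proof (rule metric_CauchyI)
    fix e :: real assume e: "0 < e"
    obtain M where M: "\<And>n. n \<ge> M \<Longrightarrow> norm (c / k * exp (- k * real n)) < e"
      using LIMSEQ_D[OF lim e] by auto
    have *: "dist (P (real m)) (P (real n)) < e" if "M \<le> n" "n \<le> m" for m n
      unfolding dist_norm using that
      by (intro le_less_trans[OF order_trans[OF d[of "real n" "real m"] abs_ge_self] M[OF that(1), unfolded real_norm_def]]) auto
    show "\<exists>M. \<forall>m\<ge>M. \<forall>n\<ge>M. dist (P (real m)) (P (real n)) < e"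
      by (rule exI[of _ M]) (metis * dist_commute nle_le)
  qed
  then obtain L where L: "(\<lambda>n. P (real n)) \<longlonglongrightarrow> L" using Cauchy_convergent_iff convergent_def by blast
  show thesis
  proof
    fix x :: real assume x: "x \<ge> 0"
    have "norm (L - P x) \<le> c / k * exp (- k * x)"
    proof (rule Lim_norm_ubound[OF _ tendsto_diff[OF L tendsto_const]])
      show "\<forall>\<^sub>F n in sequentially. norm (P (real n) - P x) \<le> c / k * exp (- k * x)"
        by (rule eventually_sequentiallyI[of "nat \<lceil>x\<rceil>"]) (rule d[OF x], linarith)
    qed auto
    then show "norm (P x - L) \<le> c / k * exp (- k * x)" by (simp add: norm_minus_commute)
  qed
qed

text \<open>Variation of parameters with the decaying solution \<open>h\<close> and the growing solution \<open>k\<close> inverts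
  \<open>\<partial>\<^sup>2 - V\<close> on bounded functions orthogonal to \<open>h\<close>.\<close>

locale decay_pair =
  fixes h h1 k k1 V :: "real \<Rightarrow> real" and C \<kappa> :: real
  assumes kappa: "\<kappa> > 0"
    and h: "second_deriv h h1 (\<lambda>x. V x * h x)" and k: "second_deriv k k1 (\<lambda>x. V x * k x)"
    and wronskian: "\<And>x. h x * k1 x - h1 x * k x = 1"
    and h_bd: "\<And>x. \<bar>h x\<bar> \<le> C * exp (- \<kappa> * \<bar>x\<bar>)"
    and h1_bd: "\<And>x. \<bar>h1 x\<bar> \<le> C * exp (- \<kappa> * \<bar>x\<bar>)"
    and k_bd: "\<And>x. \<bar>k x\<bar> \<le> C * exp (\<kappa> * \<bar>x\<bar>)"
    and V_bd: "bounded (range V)"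
begin

lemma C_nonneg: "C \<ge> 0" using order_trans[OF abs_ge_zero h_bd[of 0]] by simp

lemma h_cont: "continuous_on S h" "continuous_on S h1" using second_deriv_continuous[OF h] by auto

lemma k_cont: "continuous_on S k" "continuous_on S k1" using second_deriv_continuous[OF k] by auto

lemma dh: "((\<lambda>x. of_real (h x) :: complex) has_vector_derivative of_real (h1 x)) (at x)"
    "((\<lambda>x. of_real (h1 x) :: complex) has_vector_derivative of_real (V x * h x)) (at x)"
  by (intro bounded_linear.has_vector_derivative[OF bounded_linear_of_real] second_derivD[OF h])+

lemma dk: "((\<lambda>x. of_real (k x) :: complex) has_vector_derivative of_real (k1 x)) (at x)"
    "((\<lambda>x. of_real (k1 x) :: complex) has_vector_derivative of_real (V x * k x)) (at x)"
  by (intro bounded_linear.has_vector_derivative[OF bounded_linear_of_real] second_derivD[OF k])+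

lemma wronskian_c: "complex_of_real (h x) * of_real (k1 x) - of_real (h1 x) * of_real (k x) = 1"
  using wronskian[of x] by (metis of_real_1 of_real_diff of_real_mult)

lemma h_pairing:
  fixes g :: "real \<Rightarrow> complex"
  assumes "continuous_on UNIV g" "\<And>x. norm (g x) \<le> G"
  shows "integrable lborel (\<lambda>x. of_real (h x) * g x)" "norm (\<integral>x. of_real (h x) * g x \<partial>lborel) \<le> 4 * (C * G) / \<kappa>"
    "\<And>x. norm (of_real (h x) * g x) \<le> C * G * exp (- \<kappa> * \<bar>x\<bar>)"
proof -
  show b: "norm (of_real (h x) * g x) \<le> C * G * exp (- \<kappa> * \<bar>x\<bar>)" for x
  proof -
    have "norm (of_real (h x) * g x) \<le> (C * exp (- \<kappa> * \<bar>x\<bar>)) * G"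
      unfolding norm_mult using C_nonneg by (intro mult_mono assms(2)) (use h_bd[of x] in auto)
    then show ?thesis by (simp add: mult_ac)
  qed
  have c: "continuous_on UNIV (\<lambda>x. of_real (h x) * g x)" by (intro continuous_intros h_cont assms)
  show "integrable lborel (\<lambda>x. of_real (h x) * g x)" "norm (\<integral>x. of_real (h x) * g x \<partial>lborel) \<le> 4 * (C * G) / \<kappa>"
    using exp_bound_integral[OF kappa c b] by auto
qed

text \<open>The solution is u = k (P - L) - h Q with antiderivatives \<open>P\<close> of h g and
  \<open>Q\<close> of k g. The factor \<open>P - L\<close> must offset the growth of
  \<open>k\<close> at both ends, which is possible with one constant \<open>L\<close> exactly if h g
  has integral zero. The growth of \<open>Q\<close> is offset by the decay of
  \<open>h\<close>.\<close>

lemma particular_solution: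
  fixes g :: "real \<Rightarrow> complex"
  assumes gc: "continuous_on UNIV g" and gb: "\<And>x. norm (g x) \<le> G"
    and orth: "(\<integral>x. of_real (h x) * g x \<partial>lborel) = 0"
  obtains u u1 where "second_deriv u u1 (\<lambda>x. of_real (V x) * u x + g x)"
    "\<And>x. norm (u x) \<le> 2 * C\<^sup>2 / \<kappa> * G"
proof -
  have G: "G \<ge> 0" using order_trans[OF norm_ge_zero gb[of 0]] .
  have hgc: "continuous_on UNIV (\<lambda>x. of_real (h x) * g x)" and kgc: "continuous_on UNIV (\<lambda>x. of_real (k x) * g x)"
    by (intro continuous_intros h_cont k_cont gc)+
  obtain P where P: "P 0 = 0" "\<And>x. (P has_vector_derivative of_real (h x) * g x) (at x)"
    using antiderivative_line[OF hgc] by blast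
  obtain Q where Q: "Q 0 = 0" "\<And>x. (Q has_vector_derivative of_real (k x) * g x) (at x)"
    using antiderivative_line[OF kgc] by blast
  have refl: "((\<lambda>x. F (- x)) has_vector_derivative - f (- x)) (at x)"
    if "\<And>x. (F has_vector_derivative f x) (at x)" for F f :: "real \<Rightarrow> complex" and x
  proof -
    have "((F \<circ> uminus) has_vector_derivative (-1) *\<^sub>R f (- x)) (at x)"
      by (rule vector_diff_chain_at) (auto intro!: derivative_eq_intros that)
    then show ?thesis by (simp add: o_def)
  qed
  note hg = h_pairing[OF gc gb]
  have "\<exists>L. \<forall>x\<ge>0. norm (P x - L) \<le> C * G / \<kappa> * exp (- \<kappa> * x)"
  proof (rule exp_limit[OF P(2) kappa, of "C * G"])
    show "norm (of_real (h x) * g x) \<le> C * G * exp (- \<kappa> * x)" if "0 \<le> x" for x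
      using hg(3)[of x] that by simp
  qed blast
  then obtain L where L: "\<And>x. x \<ge> 0 \<Longrightarrow> norm (P x - L) \<le> C * G / \<kappa> * exp (- \<kappa> * x)" by blast
  have "\<exists>L. \<forall>x\<ge>0. norm (P (- x) - L) \<le> C * G / \<kappa> * exp (- \<kappa> * x)"
  proof (rule exp_limit[OF refl[OF P(2)] kappa, of "C * G"])
    show "norm (- (of_real (h (- x)) * g (- x))) \<le> C * G * exp (- \<kappa> * x)" if "0 \<le> x" for x
      using hg(3)[of "- x"] that by simp
  qed blast
  then obtain L' where L': "\<And>x. x \<ge> 0 \<Longrightarrow> norm (P (- x) - L') \<le> C * G / \<kappa> * exp (- \<kappa> * x)" by blast
  have lim: "((\<lambda>x. C * G / \<kappa> * exp (- \<kappa> * x)) \<longlongrightarrow> 0) at_top"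
  proof -
    have "filterlim (\<lambda>x. - \<kappa> * x) at_bot at_top"
      using kappa by (intro filterlim_tendsto_neg_mult_at_bot[OF tendsto_const]) (auto simp: filterlim_ident)
    from tendsto_mult_right_zero[OF filterlim_compose[OF exp_at_bot this]] show ?thesis .
  qed
  have "((\<lambda>x. P x - L) \<longlongrightarrow> 0) at_top"
    by (rule Lim_null_comparison[OF _ lim]) (auto intro!: eventually_at_top_linorderI[of 0] dest: L)
  then have P1: "(P \<longlongrightarrow> L) at_top" by (simp add: Lim_null[symmetric])
  have "((\<lambda>x. P (- x) - L') \<longlongrightarrow> 0) at_top"
    by (rule Lim_null_comparison[OF _ lim]) (auto intro!: eventually_at_top_linorderI[of 0] dest: L')
  then have P2: "(P \<longlongrightarrow> L') at_bot" by (simp add: Lim_null[symmetric] filterlim_at_bot_mirror)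
  have "(\<integral>x. of_real (h x) * g x \<partial>lborel) = L - L'"
    by (rule integral_line_eq_limits[OF P(2) _ hg(1) P2 P1]) (intro continuous_intros h_cont gc)
  \<comment> \<open>The integral of h g is the difference of the two limits of \<open>P\<close>;
    orthogonality makes them equal.\<close>
  then have LL: "L' = L" using orth by simp
  have Pb: "norm (P x - L) \<le> C * G / \<kappa> * exp (- \<kappa> * \<bar>x\<bar>)" for x
    using L[of x] L'[of "-x"] LL by (cases "x \<ge> 0") auto
  have half: "norm (F x) \<le> C * G / \<kappa> * exp (\<kappa> * x)"
    if F: "F 0 = 0" "\<And>x. (F has_vector_derivative f x) (at x)"
      and fb: "\<And>x. x \<ge> 0 \<Longrightarrow> norm (f x) \<le> C * G * exp (\<kappa> * x)" and x: "x \<ge> 0"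
    for F f :: "real \<Rightarrow> complex" and x
  proof (cases "x = 0")
    case True
    then show ?thesis using F C_nonneg G kappa by simp
  next
    case False
    have "continuous_on {0..x} F"
      using F(2) by (meson has_vector_derivative_continuous continuous_at_imp_continuous_on)
    then have "norm (F x - F 0) \<le> C * G / \<kappa> * exp (\<kappa> * x) - C * G / \<kappa> * exp (\<kappa> * 0)"
      using x False kappa
      by (intro differentiable_bound_general[where f'=f and \<phi>'="\<lambda>x. C * G * exp (\<kappa> * x)"])
         (auto intro!: F(2) fb continuous_intros derivative_eq_intros
           simp: has_real_derivative_iff_has_vector_derivative[symmetric])
    also have "\<dots> \<le> C * G / \<kappa> * exp (\<kappa> * x)" using C_nonneg G kappa by simp
    finally show ?thesis using F by simp
  qed
  have kg: "norm (of_real (k x) * g x) \<le> C * G * exp (\<kappa> * \<bar>x\<bar>)" for x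
  proof -
    have "norm (of_real (k x) * g x) \<le> (C * exp (\<kappa> * \<bar>x\<bar>)) * G"
      unfolding norm_mult using C_nonneg by (intro mult_mono gb) (use k_bd[of x] in auto)
    then show ?thesis by (simp add: mult_ac)
  qed
  have Qb: "norm (Q x) \<le> C * G / \<kappa> * exp (\<kappa> * \<bar>x\<bar>)" for x
  proof (cases "x \<ge> 0")
    case True
    have "norm (Q x) \<le> C * G / \<kappa> * exp (\<kappa> * x)"
    proof (rule half[OF Q(1) Q(2) _ True])
      show "norm (of_real (k x) * g x) \<le> C * G * exp (\<kappa> * x)" if "0 \<le> x" for x
        using kg[of x] that by simp
    qed
    then show ?thesis using True by simp
  next
    case False
    have "norm (Q (- (- x))) \<le> C * G / \<kappa> * exp (\<kappa> * (- x))"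
    proof (rule half[of "\<lambda>x. Q (- x)", OF _ refl[OF Q(2)]])
      show "norm (- (of_real (k (- x)) * g (- x))) \<le> C * G * exp (\<kappa> * x)" if "0 \<le> x" for x
        using kg[of "- x"] that by simp
    qed (use False Q(1) in auto)
    then show ?thesis using False by simp
  qed
  define u where "u x = of_real (k x) * (P x - L) - of_real (h x) * Q x" for x
  define u1 where "u1 x = of_real (k1 x) * (P x - L) - of_real (h1 x) * Q x" for x
  show thesis
  proof
    show "second_deriv u u1 (\<lambda>x. of_real (V x) * u x + g x)"
      unfolding second_deriv_def
    proof (intro conjI allI)
      fix x
      have P': "((\<lambda>x. P x - L) has_vector_derivative of_real (h x) * g x) (at x)"
        using P(2) by (auto intro!: derivative_eq_intros)
      have "(u has_vector_derivative (of_real (k x) * (of_real (h x) * g x) + of_real (k1 x) * (P x - L))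
          - (of_real (h x) * (of_real (k x) * g x) + of_real (h1 x) * Q x)) (at x)"
        unfolding u_def by (intro has_vector_derivative_diff has_vector_derivative_mult dk dh P' Q)
      then show "(u has_vector_derivative u1 x) (at x)" by (simp add: u1_def algebra_simps)
      have "(u1 has_vector_derivative (of_real (k1 x) * (of_real (h x) * g x) + of_real (V x * k x) * (P x - L))
          - (of_real (h1 x) * (of_real (k x) * g x) + of_real (V x * h x) * Q x)) (at x)"
        unfolding u1_def by (intro has_vector_derivative_diff has_vector_derivative_mult dk dh P' Q)
      moreover have "(of_real (k1 x) * (of_real (h x) * g x) + of_real (V x * k x) * (P x - L))
          - (of_real (h1 x) * (of_real (k x) * g x) + of_real (V x * h x) * Q x)
          = of_real (V x) * u x + (of_real (h x) * of_real (k1 x) - of_real (h1 x) * of_real (k x)) * g x"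
        by (simp add: u_def algebra_simps)
      ultimately show "(u1 has_vector_derivative of_real (V x) * u x + g x) (at x)"
        by (simp add: wronskian_c)
    qed
    fix x
    have e: "exp (\<kappa> * \<bar>x\<bar>) * exp (- \<kappa> * \<bar>x\<bar>) = 1" by (simp add: exp_add[symmetric])
    have "norm (u x) \<le> norm (of_real (k x) * (P x - L)) + norm (of_real (h x) * Q x)"
      unfolding u_def by (rule norm_triangle_ineq4)
    also have "\<dots> \<le> (C * exp (\<kappa> * \<bar>x\<bar>)) * (C * G / \<kappa> * exp (- \<kappa> * \<bar>x\<bar>))
         + (C * exp (- \<kappa> * \<bar>x\<bar>)) * (C * G / \<kappa> * exp (\<kappa> * \<bar>x\<bar>))"
      unfolding norm_mult using C_nonneg
      by (intro add_mono mult_mono Pb Qb) (use h_bd[of x] k_bd[of x] in auto)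
    also have "\<dots> = 2 * (C * (C * G / \<kappa>)) * (exp (\<kappa> * \<bar>x\<bar>) * exp (- \<kappa> * \<bar>x\<bar>))" by algebra
    also have "\<dots> = 2 * C\<^sup>2 / \<kappa> * G" unfolding e by (simp add: power2_eq_square)
    finally show "norm (u x) \<le> 2 * C\<^sup>2 / \<kappa> * G" .
  qed
qed

text \<open>The Wronskian \<open>W\<close> = h u' - h' u has derivative h g and vanishes at both
  ends, since \<open>h\<close>, \<open>h1\<close> decay while \<open>u\<close>, \<open>u1\<close>
  are bounded. If g = 0, then \<open>W\<close> is zero and the Wronskian \<open>X\<close> with
  \<open>k\<close> is constant, and u = X h + W k because the Wronskian of \<open>h\<close> and
  \<open>k\<close> is 1.\<close>

lemma bounded_solution_orthogonal:
  fixes g u :: "real \<Rightarrow> complex"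
  assumes gc: "continuous_on UNIV g" and gb: "\<And>x. norm (g x) \<le> G"
    and u: "second_deriv u u1 (\<lambda>x. of_real (V x) * u x + g x)" and ub: "bounded (range u)"
  shows "(\<integral>x. of_real (h x) * g x \<partial>lborel) = 0"
    and "(\<And>x. g x = 0) \<Longrightarrow> \<exists>c. \<forall>x. u x = c * of_real (h x)"
proof -
  obtain M where M: "\<And>x. norm (u x) \<le> M" using ub by (auto simp: bounded_iff)
  obtain Vb where Vb: "\<And>x. \<bar>V x\<bar> \<le> Vb" using V_bd by (auto simp: bounded_iff)
  have u1b: "norm (u1 x) \<le> 2 * M + (Vb * M + G)" for x
  proof (rule derivative_interpolation[OF u M])
    fix y
    have "\<bar>V y\<bar> * norm (u y) \<le> Vb * M"
      by (rule mult_mono[OF Vb M order_trans[OF abs_ge_zero Vb] norm_ge_zero])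
    then show "norm (of_real (V y) * u y + g y) \<le> Vb * M + G"
      using norm_triangle_ineq[of "of_real (V y) * u y" "g y"] gb[of y] by (simp add: norm_mult)
  qed
  define W where "W x = of_real (h x) * u1 x - of_real (h1 x) * u x" for x
  have dW: "(W has_vector_derivative of_real (h x) * g x) (at x)" for x
  proof -
    have "(W has_vector_derivative (of_real (h x) * (of_real (V x) * u x + g x) + of_real (h1 x) * u1 x)
          - (of_real (h1 x) * u1 x + of_real (V x * h x) * u x)) (at x)"
      unfolding W_def by (intro has_vector_derivative_diff has_vector_derivative_mult dh second_derivD[OF u])
    then show ?thesis by (simp add: algebra_simps)
  qed
  have Wb: "norm (W x) \<le> C * (3 * M + Vb * M + G) * exp (- \<kappa> * \<bar>x\<bar>)" for x
  proof -
    have "norm (W x) \<le> norm (of_real (h x) * u1 x) + norm (of_real (h1 x) * u x)"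
      unfolding W_def by (rule norm_triangle_ineq4)
    also have "\<dots> \<le> (C * exp (- \<kappa> * \<bar>x\<bar>)) * (2 * M + (Vb * M + G)) + (C * exp (- \<kappa> * \<bar>x\<bar>)) * M"
      unfolding norm_mult using C_nonneg by (intro add_mono mult_mono u1b M) (use h_bd[of x] h1_bd[of x] in auto)
    finally show ?thesis by (simp add: algebra_simps)
  qed
  note W0 = exp_bound_tendsto_0[OF kappa Wb]
  have "(\<integral>x. of_real (h x) * g x \<partial>lborel) = 0 - 0"
    by (rule integral_line_eq_limits[OF dW _ h_pairing(1)[OF gc gb] W0(2,1)]) (intro continuous_intros h_cont gc)
  then show "(\<integral>x. of_real (h x) * g x \<partial>lborel) = 0" by simp
  assume g0: "\<And>x. g x = 0"
  have const: "F x = F 0" if "\<And>x. (F has_vector_derivative 0) (at x)" for F :: "real \<Rightarrow> complex" and x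
  proof -
    have "\<exists>c. \<forall>x. F x = c"
      by (rule has_vector_derivative_zero_constant[OF convex_UNIV, of F]) (use that in auto)
    then show ?thesis by metis
  qed
  have Wc: "W x = W 0" for x
  proof (rule const)
    show "(W has_vector_derivative 0) (at x)" for x using dW[of x] g0[of x] by simp
  qed
  have Wz: "W x = 0" for x
  proof -
    have "(W \<longlongrightarrow> W 0) at_top" by (rule tendsto_eventually, rule always_eventually) (intro allI Wc)
    then have "W 0 = 0" by (rule tendsto_unique[OF trivial_limit_at_top_linorder _ W0(1)])
    then show ?thesis using trans[OF Wc[of x]] by blast
  qed
  define X where "X x = u x * of_real (k1 x) - u1 x * of_real (k x)" for x
  have dX: "(X has_vector_derivative 0) (at x)" for x
  proof -
    have "(X has_vector_derivative (u x * of_real (V x * k x) + u1 x * of_real (k1 x))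
       - (u1 x * of_real (k1 x) + (of_real (V x) * u x + g x) * of_real (k x))) (at x)"
      unfolding X_def by (intro has_vector_derivative_diff has_vector_derivative_mult dk second_derivD[OF u])
    then show ?thesis using g0 by (simp add: algebra_simps)
  qed
  have "u x = X 0 * of_real (h x)" for x
  proof -
    have "u x = u x * (of_real (h x) * of_real (k1 x) - of_real (h1 x) * of_real (k x))" by (simp add: wronskian_c)
    also have "\<dots> = X x * of_real (h x) + W x * of_real (k x)" by (simp add: X_def W_def algebra_simps)
    finally show ?thesis unfolding const[OF dX, of x] by (simp add: Wz)
  qed
  then show "\<exists>c. \<forall>x. u x = c * of_real (h x)" by blast
qed

definition hh :: real where "hh = (\<integral>x. h x * h x \<partial>lborel)"

lemma hh_c: "(\<integral>x. of_real (h x) * of_real (h x) \<partial>lborel) = complex_of_real hh"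
  unfolding hh_def by (simp flip: of_real_mult)

lemma h_bounded: "\<bar>h x\<bar> \<le> C"
  using h_bd[of x] mult_left_mono[of "exp (- \<kappa> * \<bar>x\<bar>)" 1 C] C_nonneg kappa by simp

lemma hh_pos: "hh > 0"
proof -
  have i: "integrable lborel (\<lambda>x. h x * h x)"
  proof (rule exp_bound_integral(1)[OF kappa])
    show "continuous_on UNIV (\<lambda>x. h x * h x)" by (intro continuous_intros h_cont)
    show "norm (h x * h x) \<le> C * C * exp (- \<kappa> * \<bar>x\<bar>)" for x
      using mult_mono[OF h_bd[of x] h_bounded[of x]] C_nonneg by (simp add: abs_mult mult_ac)
  qed
  have "\<exists>x. h x \<noteq> 0"
  proof (rule ccontr)
    assume "\<nexists>x. h x \<noteq> 0"
    then have z: "h = (\<lambda>x. 0)" by auto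
    then have "(h has_vector_derivative 0) (at 0)" by simp
    then have "h1 0 = 0" using second_derivD(1)[OF h, of 0] vector_derivative_unique_at by blast
    then show False using wronskian[of 0] z by simp
  qed
  then obtain x0 where x0: "h x0 \<noteq> 0" by blast
  show ?thesis unfolding hh_def
    by (rule integral_continuous_pos[where x=x0]) (use i x0 in \<open>auto intro!: continuous_intros h_cont simp: zero_less_mult_iff\<close>)
qed

text \<open>The first factor is the bound of \<open>particular_solution\<close>. Each of the other
  two bounds one projection along \<open>h\<close>: of the forcing, to make it solvable, and of the
  solution, to normalize it.\<close>

definition K0 :: real where
  "K0 = (2 * C\<^sup>2 / \<kappa>) * (1 + 4 * C * C / (\<kappa> * hh)) * (1 + 4 * C * C / (\<kappa> * hh))"

lemma K0_nonneg: "K0 \<ge> 0" unfolding K0_def using C_nonneg kappa hh_pos by simp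

lemma projection_bound:
  fixes g :: "real \<Rightarrow> complex"
  assumes gc: "continuous_on UNIV g" and gb: "\<And>x. norm (g x) \<le> G"
  defines "s \<equiv> - (\<integral>x. of_real (h x) * g x \<partial>lborel) / of_real hh"
  shows "norm (g x + s * of_real (h x)) \<le> (1 + 4 * C * C / (\<kappa> * hh)) * G"
    and "(\<integral>x. of_real (h x) * (g x + s * of_real (h x)) \<partial>lborel) = 0"
proof -
  have "norm s = norm (\<integral>x. of_real (h x) * g x \<partial>lborel) / hh"
    using hh_pos by (simp add: s_def norm_divide)
  also have "\<dots> \<le> 4 * (C * G) / \<kappa> / hh"
    by (rule divide_right_mono[OF h_pairing(2)[OF gc gb]]) (use hh_pos in simp)
  finally have "norm s \<le> 4 * (C * G) / \<kappa> / hh" .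
  then have "norm (s * of_real (h x)) \<le> 4 * (C * G) / \<kappa> / hh * C"
    unfolding norm_mult using h_bounded[of x] by (intro mult_mono) (auto intro: order_trans[OF norm_ge_zero])
  then show "norm (g x + s * of_real (h x)) \<le> (1 + 4 * C * C / (\<kappa> * hh)) * G"
    using norm_triangle_ineq[of "g x" "s * of_real (h x)"] gb[of x] by (simp add: field_simps)
  have hi: "integrable lborel (\<lambda>x. of_real (h x) * complex_of_real (h x))"
    using h_pairing(1)[of "\<lambda>x. of_real (h x)" C] h_bounded by (auto intro: continuous_intros h_cont)
  have "(\<integral>x. of_real (h x) * (g x + s * of_real (h x)) \<partial>lborel)
      = (\<integral>x. of_real (h x) * g x + s * (of_real (h x) * of_real (h x)) \<partial>lborel)"
    by (simp add: algebra_simps)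
  also have "\<dots> = (\<integral>x. of_real (h x) * g x \<partial>lborel) + s * of_real hh"
    using h_pairing(1)[OF gc gb] hi by (simp add: hh_c)
  finally show "(\<integral>x. of_real (h x) * (g x + s * of_real (h x)) \<partial>lborel) = 0"
    using hh_pos by (simp add: s_def)
qed

text \<open>Bordered form of the equation: the multiplier \<open>s\<close> absorbs the component of
  \<open>g\<close> that obstructs solvability, and the orthogonality condition removes the freedom
  of adding multiples of \<open>h\<close>. In this form the problem is uniquely solvable for every
  bounded \<open>g\<close>.\<close>

lemma scalar_exists_bounded:
  fixes g :: "real \<Rightarrow> complex"
  assumes gc: "continuous_on UNIV g" and gb: "\<And>x. norm (g x) \<le> G"
  obtains w w1 s where "second_deriv w w1 (\<lambda>x. of_real (V x) * w x + g x + s * of_real (h x))"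
    "\<And>x. norm (w x) \<le> K0 * G" "(\<integral>x. of_real (h x) * w x \<partial>lborel) = 0"
proof -
  define s where "s = - (\<integral>x. of_real (h x) * g x \<partial>lborel) / of_real hh"
  note pb = projection_bound[OF gc gb, folded s_def]
  have c: "continuous_on UNIV (\<lambda>x. g x + s * of_real (h x))" by (intro continuous_intros gc h_cont)
  obtain u u1 where u: "second_deriv u u1 (\<lambda>x. of_real (V x) * u x + (g x + s * of_real (h x)))"
    and ub: "\<And>x. norm (u x) \<le> 2 * C\<^sup>2 / \<kappa> * ((1 + 4 * C * C / (\<kappa> * hh)) * G)"
    using particular_solution[OF c pb(1) pb(2)] by blast
  have uc: "continuous_on UNIV u" using second_deriv_continuous[OF u] by auto
  define t where "t = - (\<integral>x. of_real (h x) * u x \<partial>lborel) / of_real hh"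
  note pb2 = projection_bound[OF uc ub, folded t_def]
  show thesis
  proof
    have "second_deriv (\<lambda>x. u x + t * of_real (h x)) (\<lambda>x. u1 x + t * of_real (h1 x))
       (\<lambda>x. (of_real (V x) * u x + (g x + s * of_real (h x))) + t * of_real (V x * h x))"
      unfolding second_deriv_def
      by (intro conjI allI has_vector_derivative_add has_vector_derivative_mult_right dh second_derivD[OF u])
    moreover have "(\<lambda>x. (of_real (V x) * u x + (g x + s * of_real (h x))) + t * of_real (V x * h x))
       = (\<lambda>x. of_real (V x) * (u x + t * of_real (h x)) + g x + s * of_real (h x))"
      by (auto simp: algebra_simps)
    ultimately show "second_deriv (\<lambda>x. u x + t * of_real (h x)) (\<lambda>x. u1 x + t * of_real (h1 x))
       (\<lambda>x. of_real (V x) * (u x + t * of_real (h x)) + g x + s * of_real (h x))" by simp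
    show "norm (u x + t * of_real (h x)) \<le> K0 * G" for x
      using pb2(1)[of x] by (simp add: K0_def mult_ac)
    show "(\<integral>x. of_real (h x) * (u x + t * of_real (h x)) \<partial>lborel) = 0" by (rule pb2(2))
  qed
qed

text \<open>Comparison with the solution constructed above: the difference has forcing (s - t) h,
  solvability forces s = t, so the difference is a multiple of \<open>h\<close>, and the
  normalization makes it zero.\<close>

lemma scalar_apriori:
  fixes g :: "real \<Rightarrow> complex"
  assumes gc: "continuous_on UNIV g" and gb: "\<And>x. norm (g x) \<le> G"
    and w: "second_deriv w w1 (\<lambda>x. of_real (V x) * w x + g x + s * of_real (h x))"
    and wb: "bounded (range w)" and orth: "(\<integral>x. of_real (h x) * w x \<partial>lborel) = 0"
  shows "norm (w x) \<le> K0 * G"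
proof -
  obtain v v1 t where v: "second_deriv v v1 (\<lambda>x. of_real (V x) * v x + g x + t * of_real (h x))"
    and vb: "\<And>x. norm (v x) \<le> K0 * G" and vo: "(\<integral>x. of_real (h x) * v x \<partial>lborel) = 0"
    using scalar_exists_bounded[OF gc gb] by blast
  define d where "d x = w x - v x" for x
  have "second_deriv d (\<lambda>x. w1 x - v1 x) (\<lambda>x. (of_real (V x) * w x + g x + s * of_real (h x))
      - (of_real (V x) * v x + g x + t * of_real (h x)))"
    unfolding d_def by (rule second_deriv_diff[OF w v])
  moreover have "(\<lambda>x. (of_real (V x) * w x + g x + s * of_real (h x)) - (of_real (V x) * v x + g x + t * of_real (h x)))
     = (\<lambda>x. of_real (V x) * d x + (s - t) * of_real (h x))" by (auto simp: d_def algebra_simps)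
  ultimately have d: "second_deriv d (\<lambda>x. w1 x - v1 x) (\<lambda>x. of_real (V x) * d x + (s - t) * of_real (h x))" by simp
  have "bounded (range v)" using vb by (auto simp: bounded_iff)
  then have db: "bounded (range d)" unfolding d_def by (rule bounded_minus_comp[OF wb])
  have hb: "norm ((s - t) * of_real (h x)) \<le> norm (s - t) * C" for x
    using h_bounded[of x] by (simp add: norm_mult mult_left_mono)
  have hcont: "continuous_on UNIV (\<lambda>x. (s - t) * of_real (h x))" by (intro continuous_intros h_cont)
  have "(\<integral>x. of_real (h x) * ((s - t) * of_real (h x)) \<partial>lborel) = 0"
    by (rule bounded_solution_orthogonal(1)[OF hcont hb d db])
  moreover have "(\<integral>x. of_real (h x) * ((s - t) * of_real (h x)) \<partial>lborel)
      = (\<integral>x. (s - t) * (of_real (h x) * of_real (h x)) \<partial>lborel)" by (simp add: mult_ac)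
  ultimately have "s - t = 0" using hh_pos by (simp add: hh_c)
  then obtain c where c: "\<And>x. d x = c * of_real (h x)"
    using bounded_solution_orthogonal(2)[OF hcont hb d db] by auto
  obtain Mw where Mw: "\<And>x. norm (w x) \<le> Mw" using wb by (auto simp: bounded_iff)
  have wi: "integrable lborel (\<lambda>x. of_real (h x) * w x)"
    by (rule h_pairing(1)[OF _ Mw]) (rule second_deriv_continuous[OF w])
  have vi: "integrable lborel (\<lambda>x. of_real (h x) * v x)"
    by (rule h_pairing(1)[OF _ vb]) (rule second_deriv_continuous[OF v])
  have "(\<integral>x. of_real (h x) * d x \<partial>lborel) = 0"
    unfolding d_def right_diff_distrib using wi vi orth vo by simp
  moreover have "(\<integral>x. of_real (h x) * d x \<partial>lborel) = (\<integral>x. c * (of_real (h x) * of_real (h x)) \<partial>lborel)"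
    by (simp add: c mult_ac)
  ultimately have "c = 0" using hh_pos by (simp add: hh_c)
  then show ?thesis using c[of x] vb[of x] by (simp add: d_def)
qed

end

subsection \<open>Two-component systems\<close>

definition m2 :: "'a::zero \<Rightarrow> 'a \<Rightarrow> 'a \<Rightarrow> 'a \<Rightarrow> 'a^2^2" where
  "m2 a b c d = vector [vector [a, b], vector [c, d]]"

lemma scaleR_complex: "r *\<^sub>R (z::complex) = of_real r * z" by (rule scaleR_conv_of_real)

lemma m2_nth [simp]: "m2 a b c d $ 1 $ 1 = a" "m2 a b c d $ 1 $ 2 = b"
  "m2 a b c d $ 2 $ 1 = c" "m2 a b c d $ 2 $ 2 = d"
  by (simp_all add: m2_def)

lemma mult_vec_2 [simp]:
  fixes M :: "'a::semiring_1^2^2"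
  shows "(M *v x) $ 1 = M$1$1 * x$1 + M$1$2 * x$2" "(M *v x) $ 2 = M$2$1 * x$1 + M$2$2 * x$2"
  by (simp_all add: matrix_vector_mult_def sum_2)

definition cvec :: "real^2 \<Rightarrow> complex^2" where "cvec v = (\<chi> i. of_real (v $ i))"

lemma cvec_nth [simp]: "cvec v $ i = of_real (v $ i)" by (simp add: cvec_def)

text \<open>Bilinear, without conjugation: the pairing is complex linear in the second argument and
  commutes with conjugation of it. The test functions are always real.\<close>

definition bdot :: "real^2 \<Rightarrow> complex^2 \<Rightarrow> complex" where
  "bdot f v = of_real (f $ 1) * v $ 1 + of_real (f $ 2) * v $ 2"

definition pair :: "(real \<Rightarrow> real^2) \<Rightarrow> (real \<Rightarrow> complex^2) \<Rightarrow> complex" where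
  "pair f v = (\<integral>x. bdot (f x) (v x) \<partial>lborel)"

definition mnorm :: "complex^2^2 \<Rightarrow> real" where
  "mnorm M = cmod (M$1$1) + cmod (M$1$2) + cmod (M$2$1) + cmod (M$2$2)"

lemma norm_le_components: "norm (v::complex^2) \<le> cmod (v$1) + cmod (v$2)"
  using L2_set_le_sum[of "UNIV::2 set" "\<lambda>i. cmod (v $ i)"] by (simp add: norm_vec_def sum_2)

lemma norm_le_components_real: "norm (v::real^2) \<le> \<bar>v$1\<bar> + \<bar>v$2\<bar>"
  using L2_set_le_sum[of "UNIV::2 set" "\<lambda>i. norm (v $ i)"] by (simp add: norm_vec_def sum_2)

lemma norm_smult [simp]: "norm (c *s (v::complex^2)) = cmod c * norm v"
proof -
  have "(norm (c *s v))\<^sup>2 = (cmod c * norm v)\<^sup>2"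
    by (simp add: norm_vec_def L2_set_def sum_2 norm_mult power_mult_distrib distrib_left)
  then show ?thesis by (rule power2_eq_imp_eq) auto
qed

lemma norm_cvec [simp]: "norm (cvec v) = norm v" by (simp add: norm_vec_def cvec_def)

lemma mnorm_nonneg: "mnorm M \<ge> 0" by (simp add: mnorm_def)

lemma norm_mult_vec: "norm (M *v v) \<le> mnorm M * norm (v::complex^2)"
proof -
  have c: "cmod (v$i) \<le> norm v" for i by (rule Finite_Cartesian_Product.norm_nth_le)
  have *: "cmod (a * v$1 + b * v$2) \<le> cmod a * norm v + cmod b * norm v" for a b
    using norm_triangle_ineq[of "a * v$1" "b * v$2"] mult_left_mono[OF c[of 1], of "cmod a"]
      mult_left_mono[OF c[of 2], of "cmod b"] by (simp add: norm_mult)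
  show ?thesis
    using norm_le_components[of "M *v v"] *[of "M$1$1" "M$1$2"] *[of "M$2$1" "M$2$2"]
    by (simp add: mnorm_def distrib_right)
qed

lemma mnorm_add: "mnorm (M + N) \<le> mnorm M + mnorm N"
  using norm_triangle_ineq[of "M$1$1" "N$1$1"] norm_triangle_ineq[of "M$1$2" "N$1$2"]
    norm_triangle_ineq[of "M$2$1" "N$2$1"] norm_triangle_ineq[of "M$2$2" "N$2$2"]
  by (simp add: mnorm_def)

lemma norm_bdot: "cmod (bdot f v) \<le> 2 * norm f * norm v"
proof -
  have "\<bar>f$i\<bar> * cmod (v$i) \<le> norm f * norm v" for i
    by (intro mult_mono component_le_norm_cart Finite_Cartesian_Product.norm_nth_le) auto
  from this[of 1] this[of 2] show ?thesis
    using norm_triangle_ineq[of "of_real (f $ 1) * v $ 1" "of_real (f $ 2) * v $ 2"]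
    by (simp add: bdot_def norm_mult)
qed

lemma bounded_linear_smult: "bounded_linear (\<lambda>v::complex^2. c *s v)"
proof (rule bounded_linear_intro)
  show "norm (c *s v) \<le> norm v * cmod c" for v :: "complex^2" by simp
qed (auto simp: vec_eq_iff algebra_simps scaleR_complex)

lemma bounded_linear_cvec: "bounded_linear cvec"
  by (rule bounded_linear_intro[where K=1]) (auto simp: vec_eq_iff scaleR_complex)

lemma continuous_on_vec_2:
  fixes f :: "'a::topological_space \<Rightarrow> 'b::topological_space^2"
  assumes "continuous_on S (\<lambda>x. f x $ 1)" "continuous_on S (\<lambda>x. f x $ 2)"
  shows "continuous_on S f"
proof -
  have "continuous_on S (\<lambda>x. \<chi> i. f x $ i)"
    by (rule continuous_on_vec_lambda) (use assms exhaust_2 in metis)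
  then show ?thesis by simp
qed

lemma continuous_on_nth [continuous_intros]:
  "continuous_on S f \<Longrightarrow> continuous_on S (\<lambda>x. (f x :: 'b::topological_space^'n) $ i)"
  by (rule continuous_on_component)

lemma continuous_on_mult_vec [continuous_intros]:
  fixes M :: "'a::topological_space \<Rightarrow> 'b::real_normed_algebra_1^2^2"
  assumes "continuous_on S M" "continuous_on S v"
  shows "continuous_on S (\<lambda>x. M x *v v x)"
  by (rule continuous_on_vec_2) (auto intro!: continuous_intros assms)

lemma continuous_on_smult [continuous_intros]:
  fixes v :: "'a::topological_space \<Rightarrow> complex^2"
  assumes "continuous_on S v"
  shows "continuous_on S (\<lambda>x. c *s v x)"
  by (rule continuous_on_vec_2) (auto intro!: continuous_intros assms)

lemma continuous_on_cvec [continuous_intros]: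
  assumes "continuous_on S v"
  shows "continuous_on S (\<lambda>x. cvec (v x))"
  by (rule continuous_on_vec_2) (auto intro!: continuous_intros assms)

lemma continuous_on_bdot [continuous_intros]:
  assumes "continuous_on S f" "continuous_on S v"
  shows "continuous_on S (\<lambda>x. bdot (f x) (v x))"
  unfolding bdot_def by (auto intro!: continuous_intros assms)

lemma has_vector_derivative_bdot:
  assumes "(f has_vector_derivative f') (at x)" "(v has_vector_derivative v') (at x)"
  shows "((\<lambda>x. bdot (f x) (v x)) has_vector_derivative (bdot (f x) v' + bdot f' (v x))) (at x)"
proof -
  have f: "((\<lambda>x. complex_of_real (f x $ i)) has_vector_derivative of_real (f' $ i)) (at x)" for i
    by (intro bounded_linear.has_vector_derivative[OF bounded_linear_of_real]
      bounded_linear.has_vector_derivative[OF bounded_linear_vec_nth] assms(1))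
  have v: "((\<lambda>x. v x $ i) has_vector_derivative v' $ i) (at x)" for i
    by (intro bounded_linear.has_vector_derivative[OF bounded_linear_vec_nth] assms(2))
  show ?thesis
    unfolding bdot_def
    by (rule has_vector_derivative_eq_rhs[OF has_vector_derivative_add[OF
      has_vector_derivative_mult[OF f v] has_vector_derivative_mult[OF f v]]]) (simp add: algebra_simps)
qed

section \<open>Pairing bounded functions with exponentially decaying test functions; parity\<close>

definition expdec :: "(real \<Rightarrow> 'a::real_normed_vector) \<Rightarrow> bool" where
  "expdec f \<longleftrightarrow> continuous_on UNIV f \<and> (\<exists>C k. k > 0 \<and> (\<forall>x. norm (f x) \<le> C * exp (- k * \<bar>x\<bar>)))"

lemma bdot_exp_bound:
  assumes f: "norm (f x) \<le> C * exp (- k * \<bar>x\<bar>)" and v: "norm (v x) \<le> M"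
  shows "norm (bdot (f x) (v x)) \<le> 2 * C * M * exp (- k * \<bar>x\<bar>)"
proof -
  have "norm (bdot (f x) (v x)) \<le> 2 * (norm (f x) * norm (v x))" using norm_bdot by (simp add: mult.assoc)
  also have "\<dots> \<le> 2 * ((C * exp (- k * \<bar>x\<bar>)) * M)"
    using order_trans[OF norm_ge_zero f] by (intro mult_left_mono mult_mono f v) auto
  finally show ?thesis by (simp add: mult_ac)
qed

lemma pair_integrable:
  assumes "expdec f" "v \<in> bcontfun"
  shows "integrable lborel (\<lambda>x. bdot (f x) (v x))"
proof -
  obtain C k where k: "k > 0" and C: "\<And>x. norm (f x) \<le> C * exp (- k * \<bar>x\<bar>)"
    and fc: "continuous_on UNIV f" using assms by (auto simp: expdec_def)
  obtain M where M: "\<And>x. norm (v x) \<le> M" and vc: "continuous_on UNIV v"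
    using assms by (auto simp: bcontfun_def bounded_iff)
  have b: "norm (bdot (f x) (v x)) \<le> 2 * C * M * exp (- k * \<bar>x\<bar>)" for x by (rule bdot_exp_bound[OF C M])
  show ?thesis
    by (rule exp_bound_integral(1)[OF k _ b]) (intro continuous_intros fc vc)
qed

lemma pair_bound:
  assumes k: "k > 0" and fc: "continuous_on UNIV f" and C: "\<And>x. norm (f x) \<le> C * exp (- k * \<bar>x\<bar>)"
    and vc: "continuous_on UNIV v" and M: "\<And>x. norm (v x) \<le> M"
  shows "cmod (pair f v) \<le> 8 * C * M / k"
proof -
  have b: "norm (bdot (f x) (v x)) \<le> 2 * C * M * exp (- k * \<bar>x\<bar>)" for x by (rule bdot_exp_bound[OF C M])
  have "continuous_on UNIV (\<lambda>x. bdot (f x) (v x))" by (intro continuous_intros fc vc)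
  from exp_bound_integral(2)[OF k this b] show ?thesis by (simp add: pair_def mult_ac)
qed

lemma bcontfunI': "continuous_on UNIV v \<Longrightarrow> (\<And>x. norm (v x) \<le> M) \<Longrightarrow> v \<in> bcontfun"
  by (auto simp: bcontfun_def bounded_iff)

lemma bcontfun_smult: "v \<in> bcontfun \<Longrightarrow> (\<lambda>x. c *s (v x::complex^2)) \<in> bcontfun"
proof -
  assume v: "v \<in> bcontfun"
  then obtain M where "\<And>x. norm (v x) \<le> M" by (auto simp: bcontfun_def bounded_iff)
  then show ?thesis
    using v by (intro bcontfunI'[where M="cmod c * M"]) (auto simp: bcontfun_def mult_left_mono intro: continuous_intros)
qed

lemma bcontfun_add: "v \<in> bcontfun \<Longrightarrow> w \<in> bcontfun \<Longrightarrow> (\<lambda>x. v x + w x :: 'a::real_normed_vector) \<in> bcontfun"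
  by (auto simp: bcontfun_def intro: continuous_intros bounded_plus_comp)

lemma bcontfun_diff: "v \<in> bcontfun \<Longrightarrow> w \<in> bcontfun \<Longrightarrow> (\<lambda>x. v x - w x :: 'a::real_normed_vector) \<in> bcontfun"
  by (auto simp: bcontfun_def intro: continuous_intros bounded_minus_comp)

lemma expdec_bcontfun: "expdec f \<Longrightarrow> f \<in> bcontfun"
proof -
  assume "expdec f"
  then obtain C k where k: "k > 0" and C: "\<And>x. norm (f x) \<le> C * exp (- k * \<bar>x\<bar>)"
    and fc: "continuous_on UNIV f" by (auto simp: expdec_def)
  have C0: "C \<ge> 0" using order_trans[OF norm_ge_zero C[of 0]] by simp
  show ?thesis
  proof (rule bcontfunI'[OF fc])
    show "norm (f x) \<le> C" for x
      using C[of x] mult_left_mono[OF _ C0, of "exp (- k * \<bar>x\<bar>)" 1] k by simp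
  qed
qed

lemma expdec_cvec: "expdec f \<Longrightarrow> expdec (\<lambda>x. cvec (f x))"
  by (auto simp: expdec_def intro: continuous_intros)

lemma bdot_minus [simp]: "bdot (- f) v = - bdot f v" "bdot f (- v) = - bdot f v"
  by (simp_all add: bdot_def)
lemma bdot_add: "bdot f (v + w) = bdot f v + bdot f w" by (simp add: bdot_def algebra_simps)
lemma bdot_diff: "bdot f (v - w) = bdot f v - bdot f w" by (simp add: bdot_def algebra_simps)
lemma bdot_smult: "bdot f (c *s v) = c * bdot f v" by (simp add: bdot_def algebra_simps)

lemma pair_add: "expdec f \<Longrightarrow> v \<in> bcontfun \<Longrightarrow> w \<in> bcontfun \<Longrightarrow> pair f (\<lambda>x. v x + w x) = pair f v + pair f w"
  unfolding pair_def bdot_add by (intro Bochner_Integration.integral_add pair_integrable)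

lemma pair_diff: "expdec f \<Longrightarrow> v \<in> bcontfun \<Longrightarrow> w \<in> bcontfun \<Longrightarrow> pair f (\<lambda>x. v x - w x) = pair f v - pair f w"
  unfolding pair_def bdot_diff by (intro Bochner_Integration.integral_diff pair_integrable)

lemma pair_smult: "pair f (\<lambda>x. c *s v x) = c * pair f v"
  unfolding pair_def bdot_smult by simp

text \<open>Parity is a sign, 1 for even and -1 for odd, so that both sectors are handled by the
  same statements.\<close>

definition par :: "real \<Rightarrow> (real \<Rightarrow> 'a::real_vector) \<Rightarrow> bool" where
  "par p u \<longleftrightarrow> (\<forall>x. u (- x) = p *\<^sub>R u x)"

lemma integral_reflect_line:
  fixes f :: "real \<Rightarrow> 'a::euclidean_space"
  shows "(\<integral>x. f (- x) \<partial>lborel) = (\<integral>x. f x \<partial>lborel)"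
  using lborel_integral_real_affine[of "-1" f 0] by simp

lemma bdot_scaleR: "bdot (a *\<^sub>R f) (b *\<^sub>R v) = of_real (a * b) * bdot f v"
  by (simp add: bdot_def scaleR_complex algebra_simps)

lemma pair_opposite_parity:
  assumes "par (- p) f" "par p v" "p = 1 \<or> p = - 1"
  shows "pair f v = 0"
proof -
  have "pair f v = (\<integral>x. bdot (f (- x)) (v (- x)) \<partial>lborel)"
    unfolding pair_def using integral_reflect_line[of "\<lambda>x. bdot (f x) (v x)"] by simp
  also have "\<dots> = (\<integral>x. - bdot (f x) (v x) \<partial>lborel)"
    using assms by (intro Bochner_Integration.integral_cong) (auto simp: par_def bdot_scaleR)
  finally show ?thesis by (simp add: pair_def)
qed

section \<open>The decoupled two-component system and its small perturbations\<close>

locale coupled_pair =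
  a: decay_pair ha ha1 ka ka1 Va C \<kappa> + b: decay_pair hb hb1 kb kb1 Vb C \<kappa>
  for ha ha1 ka ka1 Va hb hb1 kb kb1 Vb :: "real \<Rightarrow> real" and C \<kappa> +
  assumes ha_odd: "\<And>x. ha (- x) = - ha x" and hb_even: "\<And>x. hb (- x) = hb x"
    and Va_cont: "continuous_on UNIV Va" and Vb_cont: "continuous_on UNIV Vb"
begin

text \<open>The two kernel functions of the decoupled system. They have opposite parity, so each
  parity sector contains exactly one of them; this is what later makes the eigenvalue problem
  one-dimensional in each sector.\<close>

definition phi_odd :: "real \<Rightarrow> real^2" where "phi_odd x = vector [ha x, 0]"
definition phi_even :: "real \<Rightarrow> real^2" where "phi_even x = vector [0, hb x]"
definition V0 :: "real \<Rightarrow> complex^2^2" where "V0 x = m2 (of_real (Va x)) 0 0 (of_real (Vb x))"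

lemma phi_nth [simp]: "phi_odd x $ 1 = ha x" "phi_odd x $ 2 = 0" "phi_even x $ 1 = 0" "phi_even x $ 2 = hb x"
  by (simp_all add: phi_odd_def phi_even_def)

lemma phi_cont: "continuous_on S phi_odd" "continuous_on S phi_even"
  by (intro continuous_on_vec_2; simp add: a.h_cont b.h_cont)+

lemma V0_cont: "continuous_on UNIV V0"
  unfolding V0_def by (intro continuous_on_vec_2; simp; intro continuous_intros Va_cont Vb_cont)

lemma phi_expdec: "expdec phi_odd" "expdec phi_even"
proof -
  have "norm (phi_odd x) \<le> C * exp (- \<kappa> * \<bar>x\<bar>)" "norm (phi_even x) \<le> C * exp (- \<kappa> * \<bar>x\<bar>)" for x
    using norm_le_components_real[of "phi_odd x"] a.h_bd[of x]
      norm_le_components_real[of "phi_even x"] b.h_bd[of x] by auto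
  then show "expdec phi_odd" "expdec phi_even"
    using a.kappa phi_cont by (auto simp: expdec_def)
qed

lemma phi_par: "par (- 1) phi_odd" "par 1 phi_even"
  by (auto simp: par_def vec_eq_iff forall_2 ha_odd hb_even)

lemma pair_phi: "pair phi_odd v = (\<integral>x. of_real (ha x) * v x $ 1 \<partial>lborel)"
    "pair phi_even v = (\<integral>x. of_real (hb x) * v x $ 2 \<partial>lborel)"
  by (simp_all add: pair_def bdot_def)

text \<open>The summand 1 makes the constant strictly positive, so that it can be divided
  by.\<close>

definition KK :: real where "KK = a.K0 + b.K0 + 1"

lemma KK_pos: "KK > 0" using a.K0_nonneg b.K0_nonneg by (simp add: KK_def)

lemma nth_comp: "second_deriv w w1 w2 \<Longrightarrow> second_deriv (\<lambda>x. w x $ i) (\<lambda>x. w1 x $ i) (\<lambda>x. w2 x $ i)"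
  for w :: "real \<Rightarrow> complex^2"
  by (rule second_deriv_linear[OF bounded_linear_vec_nth])

lemma apriori_unperturbed:
  assumes gc: "continuous_on UNIV g" and gb: "\<And>x. norm (g x) \<le> G"
    and w: "second_deriv w w1 (\<lambda>x. V0 x *v w x + g x + s *s cvec (phi_odd x) + t *s cvec (phi_even x))"
    and wb: "bounded (range w)" and o: "pair phi_odd w = 0" "pair phi_even w = 0"
  shows "norm (w x) \<le> KK * G"
proof -
  have gi: "continuous_on UNIV (\<lambda>x. g x $ i)" "cmod (g x $ i) \<le> G" for i x
    using gc gb[of x] by (auto intro: continuous_intros order_trans[OF Finite_Cartesian_Product.norm_nth_le])
  have wi: "bounded (range (\<lambda>x. w x $ i))" for i
    using wb by (auto simp: bounded_iff intro: order_trans[OF Finite_Cartesian_Product.norm_nth_le])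
  have w1: "second_deriv (\<lambda>x. w x $ 1) (\<lambda>x. w1 x $ 1) (\<lambda>x. of_real (Va x) * w x $ 1 + g x $ 1 + s * of_real (ha x))"
    using nth_comp[OF w, of 1] by (simp add: V0_def)
  have w2: "second_deriv (\<lambda>x. w x $ 2) (\<lambda>x. w1 x $ 2) (\<lambda>x. of_real (Vb x) * w x $ 2 + g x $ 2 + t * of_real (hb x))"
    using nth_comp[OF w, of 2] by (simp add: V0_def)
  have "norm (w x $ 1) \<le> a.K0 * G"
    by (rule a.scalar_apriori[OF gi(1) gi(2) w1 wi o(1)[unfolded pair_phi]])
  moreover have "norm (w x $ 2) \<le> b.K0 * G"
    by (rule b.scalar_apriori[OF gi(1) gi(2) w2 wi o(2)[unfolded pair_phi]])
  moreover have "0 \<le> G" using order_trans[OF norm_ge_zero gb] .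
  ultimately show ?thesis
    using norm_le_components[of "w x"] by (simp add: KK_def algebra_simps)
qed

lemma exists_unperturbed:
  assumes gc: "g \<in> bcontfun"
  shows "\<exists>w w1 s t. second_deriv w w1 (\<lambda>x. V0 x *v w x + g x + s *s cvec (phi_odd x) + t *s cvec (phi_even x))
    \<and> bounded (range w) \<and> pair phi_odd w = 0 \<and> pair phi_even w = 0"
proof -
  obtain G where gb: "\<And>x. norm (g x) \<le> G" and gc: "continuous_on UNIV g"
    using gc by (auto simp: bcontfun_def bounded_iff)
  have gi: "continuous_on UNIV (\<lambda>x. g x $ i)" "cmod (g x $ i) \<le> G" for i x
    using gc gb[of x] by (auto intro: continuous_intros order_trans[OF Finite_Cartesian_Product.norm_nth_le])
  obtain u u1 s where u: "second_deriv u u1 (\<lambda>x. of_real (Va x) * u x + g x $ 1 + s * of_real (ha x))"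
    "\<And>x. norm (u x) \<le> a.K0 * G" "(\<integral>x. of_real (ha x) * u x \<partial>lborel) = 0"
    by (rule a.scalar_exists_bounded[OF gi(1)[where i=1] gi(2)[where i=1]]) blast
  obtain v v1 t where v: "second_deriv v v1 (\<lambda>x. of_real (Vb x) * v x + g x $ 2 + t * of_real (hb x))"
    "\<And>x. norm (v x) \<le> b.K0 * G" "(\<integral>x. of_real (hb x) * v x \<partial>lborel) = 0"
    by (rule b.scalar_exists_bounded[OF gi(1)[where i=2] gi(2)[where i=2]]) blast
  define e where "e c = (\<chi> i::2. if i = 1 then c else (0::complex))" for c
  define f where "f c = (\<chi> i::2. if i = 1 then 0 else (c::complex))" for c
  have e: "bounded_linear e" unfolding e_def
    by (rule bounded_linear_intro[where K=1]) (auto simp: vec_eq_iff norm_vec_def L2_set_def sum_2)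
  have f: "bounded_linear f" unfolding f_def
    by (rule bounded_linear_intro[where K=1]) (auto simp: vec_eq_iff norm_vec_def L2_set_def sum_2)
  have n: "e c $ 1 = c" "e c $ 2 = 0" "f c $ 1 = 0" "f c $ 2 = c" for c by (simp_all add: e_def f_def)
  define w where "w x = e (u x) + f (v x)" for x
  have w: "second_deriv w (\<lambda>x. e (u1 x) + f (v1 x)) (\<lambda>x. e (of_real (Va x) * u x + g x $ 1 + s * of_real (ha x))
       + f (of_real (Vb x) * v x + g x $ 2 + t * of_real (hb x)))"
    unfolding w_def by (rule second_deriv_add[OF second_deriv_linear[OF e u(1)] second_deriv_linear[OF f v(1)]])
  have "(\<lambda>x. e (of_real (Va x) * u x + g x $ 1 + s * of_real (ha x)) + f (of_real (Vb x) * v x + g x $ 2 + t * of_real (hb x)))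
     = (\<lambda>x. V0 x *v w x + g x + s *s cvec (phi_odd x) + t *s cvec (phi_even x))"
    by (auto simp: fun_eq_iff vec_eq_iff forall_2 n V0_def w_def)
  note w = w[unfolded this]
  have "norm (w x) \<le> a.K0 * G + b.K0 * G" for x
    using norm_le_components[of "w x"] u(2)[of x] v(2)[of x] by (simp add: w_def n)
  then have "bounded (range w)" by (auto simp: bounded_iff)
  moreover have "pair phi_odd w = 0" "pair phi_even w = 0" using u(3) v(3) by (auto simp: pair_phi w_def n)
  ultimately show ?thesis using w by blast
qed

text \<open>With this threshold the perturbation, followed by the solution operator of norm at most
  \<open>KK\<close>, is a contraction with constant 1/2.\<close>

definition near :: "(real \<Rightarrow> complex^2^2) \<Rightarrow> bool" where
  "near N \<longleftrightarrow> continuous_on UNIV N \<and> (\<forall>x. mnorm (N x - V0 x) \<le> 1 / (2 * KK))"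

lemma near_diff:
  assumes "near N" "w \<in> bcontfun"
  shows "(\<lambda>x. (N x - V0 x) *v w x) \<in> bcontfun"
    "\<And>M x. norm (w x) \<le> M \<Longrightarrow> norm ((N x - V0 x) *v w x) \<le> M / (2 * KK)"
proof -
  show *: "norm ((N x - V0 x) *v w x) \<le> M / (2 * KK)" if "norm (w x) \<le> M" for M x
  proof -
    have "norm ((N x - V0 x) *v w x) \<le> mnorm (N x - V0 x) * norm (w x)" by (rule norm_mult_vec)
    also have "\<dots> \<le> 1 / (2 * KK) * M"
      using assms that KK_pos by (intro mult_mono) (auto simp: near_def)
    finally show ?thesis by simp
  qed
  obtain M where "\<And>x. norm (w x) \<le> M" using assms by (auto simp: bcontfun_def bounded_iff)
  then show "(\<lambda>x. (N x - V0 x) *v w x) \<in> bcontfun"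
    using assms by (intro bcontfunI'[OF _ *]) (auto intro!: continuous_intros V0_cont simp: near_def bcontfun_def)
qed

text \<open>The perturbation is moved into the forcing. The supremum \<open>M\<close> of the
  solution, finite by assumption, then satisfies M <= M/2 + KK G, and half of it is
  absorbed.\<close>

lemma apriori_near:
  assumes N: "near N" and gc: "continuous_on UNIV g" and gb: "\<And>x. norm (g x) \<le> G"
    and w: "second_deriv w w1 (\<lambda>x. N x *v w x + g x + s *s cvec (phi_odd x) + t *s cvec (phi_even x))"
    and wb: "bounded (range w)" and o: "pair phi_odd w = 0" "pair phi_even w = 0"
  shows "norm (w x) \<le> 2 * KK * G"
proof -
  define M where "M = (SUP x. norm (w x))"
  have bdd: "bdd_above (range (\<lambda>x. norm (w x)))"
    using wb by (auto simp: bounded_iff bdd_above_def)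
  have M: "norm (w x) \<le> M" for x unfolding M_def by (rule cSUP_upper[OF _ bdd]) simp
  have wc: "w \<in> bcontfun" using wb second_deriv_continuous[OF w] by (auto simp: bcontfun_def)
  have "norm (w x) \<le> KK * (M / (2 * KK) + G)" for x
  proof (rule apriori_unperturbed[OF _ _ _ wb o])
    show "continuous_on UNIV (\<lambda>x. (N x - V0 x) *v w x + g x)"
      using near_diff(1)[OF N wc] gc by (auto simp: bcontfun_def intro: continuous_intros)
    show "norm ((N x - V0 x) *v w x + g x) \<le> M / (2 * KK) + G" for x
      using norm_triangle_ineq[of "(N x - V0 x) *v w x" "g x"] near_diff(2)[OF N wc M[of x]] gb[of x] by simp
    show "second_deriv w w1 (\<lambda>x. V0 x *v w x + ((N x - V0 x) *v w x + g x) + s *s cvec (phi_odd x) + t *s cvec (phi_even x))"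
      using w by (simp add: matrix_vector_mult_diff_rdistrib add.assoc)
  qed
  then have "M \<le> KK * (M / (2 * KK) + G)" unfolding M_def by (intro cSUP_least) auto
  then have "M \<le> 2 * KK * G" using KK_pos by (simp add: field_simps)
  then show ?thesis using M[of x] by simp
qed

text \<open>Banach fixed point in bounded continuous functions: \<open>W v\<close> solves the
  unperturbed bordered problem with the perturbation evaluated at \<open>v\<close>. The choice of
  \<open>W v\<close> is harmless, since the a priori estimate applies to the difference of any two
  such solutions and gives the Lipschitz constant 1/2.\<close>

lemma exists_near:
  assumes N: "near N" and g: "g \<in> bcontfun"
  shows "\<exists>w w1 s t. second_deriv w w1 (\<lambda>x. N x *v w x + g x + s *s cvec (phi_odd x) + t *s cvec (phi_even x))
    \<and> bounded (range w) \<and> pair phi_odd w = 0 \<and> pair phi_even w = 0"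
proof -
  define S where "S f w w1 s t \<longleftrightarrow>
     second_deriv w w1 (\<lambda>x. V0 x *v w x + f x + s *s cvec (phi_odd x) + t *s cvec (phi_even x))
    \<and> bounded (range w) \<and> pair phi_odd w = 0 \<and> pair phi_even w = 0" for f w w1 s t
  define rhs where "rhs v = (\<lambda>x. (N x - V0 x) *v v x + g x)" for v
  have rhs: "rhs v \<in> bcontfun" if "v \<in> bcontfun" for v
    unfolding rhs_def by (intro bcontfun_add near_diff N that g)
  have "\<exists>w w1 s t. S (rhs (apply_bcontfun v)) w w1 s t" for v
    unfolding S_def by (rule exists_unperturbed[OF rhs[OF apply_bcontfun]])
  then obtain W W1 s t where W: "\<And>v. S (rhs (apply_bcontfun v)) (W v) (W1 v) (s v) (t v)" by metis
  have Wc: "W v \<in> bcontfun" for v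
    using W[of v] second_deriv_continuous(1) unfolding S_def bcontfun_def by blast
  have "\<exists>!v. Bcontfun (W v) = v"
  proof (rule banach_fix_type[where c="1/2"])
    show "\<forall>v v'. dist (Bcontfun (W v)) (Bcontfun (W v')) \<le> 1 / 2 * dist v v'"
    proof (intro allI dist_bound)
      fix v v' :: "real \<Rightarrow>\<^sub>C (complex^2)" and x
      have vv: "norm (v x - v' x) \<le> dist v v'" for x using dist_bounded[of v x v'] by (simp add: dist_norm)
      have vc: "(\<lambda>x. v x - v' x) \<in> bcontfun" by (intro bcontfun_diff apply_bcontfun)
      note nd = near_diff[OF N vc]
      have "norm (W v x - W v' x) \<le> KK * (dist v v' / (2 * KK))"
      proof (rule apriori_unperturbed[where s="s v - s v'" and t="t v - t v'"])
        show "continuous_on UNIV (\<lambda>x. (N x - V0 x) *v (v x - v' x))" using nd(1) by (auto simp: bcontfun_def)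
        show "norm ((N x - V0 x) *v (v x - v' x)) \<le> dist v v' / (2 * KK)" for x by (rule nd(2)[OF vv])
        have "second_deriv (\<lambda>x. W v x - W v' x) (\<lambda>x. W1 v x - W1 v' x)
          (\<lambda>x. (V0 x *v W v x + rhs v x + s v *s cvec (phi_odd x) + t v *s cvec (phi_even x))
             - (V0 x *v W v' x + rhs v' x + s v' *s cvec (phi_odd x) + t v' *s cvec (phi_even x)))"
          using W by (intro second_deriv_diff) (auto simp: S_def)
        then show "second_deriv (\<lambda>x. W v x - W v' x) (\<lambda>x. W1 v x - W1 v' x)
          (\<lambda>x. V0 x *v (W v x - W v' x) + (N x - V0 x) *v (v x - v' x)
             + (s v - s v') *s cvec (phi_odd x) + (t v - t v') *s cvec (phi_even x))"
          by (rule back_subst[of "second_deriv _ _"])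
             (auto simp: fun_eq_iff rhs_def vec_eq_iff forall_2 algebra_simps)
        show "bounded (range (\<lambda>x. W v x - W v' x))" using bcontfun_diff[OF Wc Wc] by (auto simp: bcontfun_def)
        show "pair phi_odd (\<lambda>x. W v x - W v' x) = 0" "pair phi_even (\<lambda>x. W v x - W v' x) = 0"
          using W[of v] W[of v'] by (auto simp: S_def pair_diff[OF phi_expdec(1) Wc Wc] pair_diff[OF phi_expdec(2) Wc Wc])
      qed
      then show "dist (Bcontfun (W v) x) (Bcontfun (W v') x) \<le> 1 / 2 * dist v v'"
        using KK_pos by (simp add: Bcontfun_inverse Wc dist_norm)
    qed
  qed auto
  then obtain v where "Bcontfun (W v) = v" by blast
  then have v: "W v = v" using Bcontfun_inverse[OF Wc] by metis
  have *: "V0 x *v v x + rhs v x = N x *v v x + g x" for x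
    by (simp add: rhs_def matrix_vector_mult_diff_rdistrib)
  show ?thesis using W[of v] unfolding v S_def * by blast
qed

definition psi :: "real \<Rightarrow> real \<Rightarrow> real^2" where "psi p = (if p = 1 then phi_even else phi_odd)"

lemma psi_expdec: "expdec (psi p)" using phi_expdec by (auto simp: psi_def)
lemma psi_cont: "continuous_on S (psi p)" using phi_cont by (auto simp: psi_def)

lemma apriori_sector:
  assumes p: "p = 1 \<or> p = - 1" and N: "near N" and gc: "continuous_on UNIV g" and gb: "\<And>x. norm (g x) \<le> G"
    and w: "second_deriv w w1 (\<lambda>x. N x *v w x + g x + s *s cvec (psi p x))"
    and wb: "bounded (range w)" and pw: "par p w" and o: "pair (psi p) w = 0"
  shows "norm (w x) \<le> 2 * KK * G"
proof (cases "p = 1")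
  case True
  show ?thesis
    by (rule apriori_near[OF N gc gb _ wb, where s=0 and t=s])
       (use w o pw pair_opposite_parity[OF _ pw] phi_par True in \<open>auto simp: psi_def\<close>)
next
  case False
  then have p: "p = -1" using p by simp
  show ?thesis
    by (rule apriori_near[OF N gc gb _ wb, where s=s and t=0])
       (use w o pw pair_opposite_parity[OF _ pw] phi_par p in \<open>auto simp: psi_def\<close>)
qed

text \<open>The reflected solution \<open>v\<close> solves the same bordered problem with
  multipliers - p s and p t. By the a priori estimate both agree, so the solution has parity
  \<open>p\<close>, and the multiplier of the kernel function of the other parity must
  vanish.\<close>

lemma exists_sector:
  assumes p: "p = 1 \<or> p = - 1" and N: "near N" and Ne: "\<And>x. N (- x) = N x"
    and g: "g \<in> bcontfun" and pg: "par p g"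
  shows "\<exists>w w1 s. second_deriv w w1 (\<lambda>x. N x *v w x + g x + s *s cvec (psi p x))
    \<and> bounded (range w) \<and> par p w \<and> pair (psi p) w = 0"
proof -
  obtain w w1 s t where w: "second_deriv w w1 (\<lambda>x. N x *v w x + g x + s *s cvec (phi_odd x) + t *s cvec (phi_even x))"
    and wb: "bounded (range w)" and o: "pair phi_odd w = 0" "pair phi_even w = 0"
    using exists_near[OF N g] by blast
  have wc: "w \<in> bcontfun" using wb second_deriv_continuous[OF w] by (auto simp: bcontfun_def)
  define v where "v x = p *\<^sub>R w (- x)" for x
  have pp: "p * p = 1" using p by auto
  have po: "phi_odd (- x) = - phi_odd x" and pe: "phi_even (- x) = phi_even x" for x
    using phi_par by (auto simp: par_def)
  have pg': "g (- x) = p *\<^sub>R g x" for x using pg by (simp add: par_def)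
  have "second_deriv v (\<lambda>x. p *\<^sub>R - w1 (- x)) (\<lambda>x. p *\<^sub>R (N (-x) *v w (-x) + g (-x) + s *s cvec (phi_odd (-x)) + t *s cvec (phi_even (-x))))"
    unfolding v_def by (rule second_deriv_linear[OF bounded_linear_scaleR_right second_deriv_reflect[OF w]])
  moreover have "p *\<^sub>R (N (-x) *v w (-x) + g (-x) + s *s cvec (phi_odd (-x)) + t *s cvec (phi_even (-x)))
    = N x *v v x + g x + (- of_real p * s) *s cvec (phi_odd x) + (of_real p * t) *s cvec (phi_even x)" for x
    using pp p by (auto simp: vec_eq_iff forall_2 Ne po pe pg' v_def scaleR_complex algebra_simps)
  ultimately have v: "second_deriv v (\<lambda>x. p *\<^sub>R - w1 (- x))
     (\<lambda>x. N x *v v x + g x + (- of_real p * s) *s cvec (phi_odd x) + (of_real p * t) *s cvec (phi_even x))" by simp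
  have vb: "bounded (range v)"
  proof -
    obtain M where "\<And>x. norm (w x) \<le> M" using wb by (auto simp: bounded_iff)
    then have "norm (v x) \<le> M" for x using p by (auto simp: v_def)
    then show ?thesis by (auto simp: bounded_iff)
  qed
  have vc: "v \<in> bcontfun" using vb second_deriv_continuous[OF v] by (auto simp: bcontfun_def)
  have refl: "pair f v = of_real (p * q) * pair f w" if "par q f" "q = 1 \<or> q = -1" for q f
  proof -
    have "pair f v = (\<integral>x. bdot (f (- x)) (v (- x)) \<partial>lborel)"
      unfolding pair_def using integral_reflect_line[of "\<lambda>x. bdot (f x) (v x)"] by simp
    also have "\<dots> = (\<integral>x. of_real (p * q) * bdot (f x) (w x) \<partial>lborel)"
      using that by (intro Bochner_Integration.integral_cong) (auto simp: par_def v_def bdot_scaleR mult.commute)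
    finally show ?thesis by (simp add: pair_def)
  qed
  have vo: "pair phi_odd v = 0" "pair phi_even v = 0" using refl[OF phi_par(1)] refl[OF phi_par(2)] o by auto
  have d: "second_deriv (\<lambda>x. w x - v x) (\<lambda>x. w1 x - p *\<^sub>R - w1 (- x))
    (\<lambda>x. N x *v (w x - v x) + 0 + (s + of_real p * s) *s cvec (phi_odd x) + (t - of_real p * t) *s cvec (phi_even x))"
    by (rule back_subst[of "second_deriv _ _", OF second_deriv_diff[OF w v]])
       (auto simp: fun_eq_iff vec_eq_iff forall_2 algebra_simps)
  have "norm (w x - v x) \<le> 2 * KK * 0" for x
    by (rule apriori_near[OF N _ _ d])
       (use bcontfun_diff[OF wc vc] o vo in \<open>auto simp: bcontfun_def pair_diff[OF phi_expdec(1) wc vc] pair_diff[OF phi_expdec(2) wc vc]\<close>)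
  then have wv: "w x = v x" for x by simp
  have pw: "par p w" unfolding par_def
  proof
    fix x
    have "p *\<^sub>R w x = p *\<^sub>R v x" by (rule arg_cong[OF wv])
    also have "\<dots> = w (- x)" using pp by (simp add: v_def)
    finally show "w (- x) = p *\<^sub>R w x" ..
  qed
  \<comment> \<open>The difference of the two solutions is the zero function, so its second
    derivative, given by the right-hand sides, vanishes too; this is where the multipliers become
    comparable.\<close>
  have z: "N x *v (w x - v x) + 0 + (s + of_real p * s) *s cvec (phi_odd x) + (t - of_real p * t) *s cvec (phi_even x) = 0" for x
  proof -
    have "(\<lambda>x. w x - v x) = (\<lambda>x. 0)" by (rule ext) (simp only: right_minus_eq wv)
    then have "second_deriv (\<lambda>x. w x - v x) (\<lambda>x. 0) (\<lambda>x. 0)" by (simp add: second_deriv_def)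
    from fun_cong[OF second_deriv_unique(2)[OF d this], of x] show ?thesis .
  qed
  have hz: "\<exists>x. ha x \<noteq> 0" "\<exists>x. hb x \<noteq> 0"
  proof -
    have "ha \<noteq> (\<lambda>x. 0)" "hb \<noteq> (\<lambda>x. 0)" using a.hh_pos b.hh_pos by (auto simp: a.hh_def b.hh_def)
    then show "\<exists>x. ha x \<noteq> 0" "\<exists>x. hb x \<noteq> 0" by auto
  qed
  show ?thesis
  proof (cases "p = 1")
    case True
    have "s = 0"
    proof -
      obtain x where x: "ha x \<noteq> 0" using hz by blast
      have "(N x *v (w x - v x) + 0 + (s + of_real p * s) *s cvec (phi_odd x) + (t - of_real p * t) *s cvec (phi_even x)) $ 1 = 0"
        unfolding z by simp
      then show ?thesis using x wv[of x] True by simp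
    qed
    then show ?thesis using w wb pw o True by (intro exI[of _ w] exI[of _ w1] exI[of _ t]) (simp add: psi_def)
  next
    case False
    then have p: "p = -1" using p by simp
    have "t = 0"
    proof -
      obtain x where x: "hb x \<noteq> 0" using hz by blast
      have "(N x *v (w x - v x) + 0 + (s + of_real p * s) *s cvec (phi_odd x) + (t - of_real p * t) *s cvec (phi_even x)) $ 2 = 0"
        unfolding z by simp
      then show ?thesis using x wv[of x] p by simp
    qed
    then show ?thesis using w wb pw o p by (intro exI[of _ w] exI[of _ w1] exI[of _ s]) (simp add: psi_def)
  qed
qed

end

subsection \<open>Reduction to a scalar equation in a parity sector\<close>

lemma J_m2: "J = m2 0 (-1) 1 0" by (simp add: J_def m2_def)

lemma J_nth [simp]: "J $ 1 $ 1 = 0" "J $ 1 $ 2 = -1" "J $ 2 $ 1 = 1" "J $ 2 $ 2 = 0"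
  by (simp_all add: J_m2)

lemma cplx_nth [simp]: "cplx M $ i $ j = of_real (M $ i $ j)" by (simp add: map_matrix_def)

lemma bdot_J: "bdot f (cplx J *v w) = - bdot (J *v f) w" by (simp add: bdot_def)

lemma bdot_J_self: "bdot f (cplx J *v cvec f) = 0" by (simp add: bdot_def)

lemma pair_J: "pair f (\<lambda>x. cplx J *v w x) = - pair (\<lambda>x. J *v f x) w"
  unfolding pair_def bdot_J by simp

definition cscm :: "complex \<Rightarrow> complex^2^2 \<Rightarrow> complex^2^2" where "cscm c M = (\<chi> i j. c * M $ i $ j)"

lemma cscm_mult: "cscm c M *v v = c *s (M *v v)"
  by (simp add: cscm_def vec_eq_iff forall_2 algebra_simps)

lemma mnorm_cscm: "mnorm (cscm c M) = cmod c * mnorm M"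
  by (simp add: mnorm_def cscm_def norm_mult algebra_simps)

lemma expdec_pair_bound:
  assumes "expdec f"
  obtains T where "T > 0" "\<And>v m. v \<in> bcontfun \<Longrightarrow> (\<And>x. norm (v x) \<le> m) \<Longrightarrow> cmod (pair f v) \<le> T * m"
proof -
  obtain C k where k: "k > 0" and C: "\<And>x. norm (f x) \<le> C * exp (- k * \<bar>x\<bar>)" and fc: "continuous_on UNIV f"
    using assms by (auto simp: expdec_def)
  have C0: "C \<ge> 0" using order_trans[OF norm_ge_zero C[of 0]] by simp
  show thesis
  proof (rule that[of "8 * C / k + 1"])
    fix v :: "real \<Rightarrow> complex^2" and m assume v: "v \<in> bcontfun" "\<And>x. norm (v x) \<le> m"
    have "cmod (pair f v) \<le> 8 * C * m / k"
      by (rule pair_bound[OF k fc C _ v(2)]) (use v in \<open>auto simp: bcontfun_def\<close>)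
    moreover have "m \<ge> 0" using order_trans[OF norm_ge_zero v(2)] .
    ultimately show "cmod (pair f v) \<le> (8 * C / k + 1) * m" by (simp add: algebra_simps)
  qed (use C0 k in \<open>simp add: add_nonneg_pos\<close>)
qed

text \<open>Closeness as functionals on bounded functions, which amounts to closeness in L^1.
  Uniform closeness of \<open>f\<close> and \<open>g\<close> would not control the pairing over the
  whole line.\<close>

definition pclose :: "real \<Rightarrow> (real \<Rightarrow> real^2) \<Rightarrow> (real \<Rightarrow> real^2) \<Rightarrow> bool" where
  "pclose e f g \<longleftrightarrow> expdec f \<and> (\<forall>v\<in>bcontfun. \<forall>m. (\<forall>x. norm (v x) \<le> m) \<longrightarrow> cmod (pair f v - pair g v) \<le> e * m)"

lemma pcloseD:
  assumes "pclose e f g"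
  shows "expdec f" "v \<in> bcontfun \<Longrightarrow> (\<And>x. norm (v x) \<le> m) \<Longrightarrow> cmod (pair f v - pair g v) \<le> e * m"
  using assms by (auto simp: pclose_def)

definition cnjv :: "complex^2 \<Rightarrow> complex^2" where "cnjv v = (\<chi> i. cnj (v $ i))"

lemma cnjv_nth [simp]: "cnjv v $ i = cnj (v $ i)" by (simp add: cnjv_def)

lemma bounded_linear_cnjv: "bounded_linear cnjv"
  by (rule bounded_linear_intro[where K=1]) (auto simp: vec_eq_iff cnjv_def norm_vec_def L2_set_def)

lemma norm_cnjv [simp]: "norm (cnjv v) = norm v" by (simp add: cnjv_def norm_vec_def)

lemma cnjv_bcontfun: "v \<in> bcontfun \<Longrightarrow> (\<lambda>x. cnjv (v x)) \<in> bcontfun"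
  using linear_continuous_on[OF bounded_linear_cnjv, of UNIV]
  by (auto simp: bcontfun_def bounded_iff intro: continuous_on_compose2)

lemma pair_cnjv: "pair f (\<lambda>x. cnjv (v x)) = cnj (pair f v)"
proof -
  have "bdot g (cnjv z) = cnj (bdot g z)" for g z by (simp add: bdot_def)
  then show ?thesis unfolding pair_def by simp
qed

lemma par_diff: "par p u \<Longrightarrow> par p v \<Longrightarrow> par p (\<lambda>x. u x - v x)"
  and par_add: "par p u \<Longrightarrow> par p v \<Longrightarrow> par p (\<lambda>x. u x + v x)"
  by (auto simp: par_def algebra_simps)

lemma par_smult: "par p u \<Longrightarrow> par p (\<lambda>x. c *s (u x :: complex^2))"
  by (auto simp: par_def vec_eq_iff scaleR_complex algebra_simps)

lemma par_cnjv: "par p u \<Longrightarrow> par p (\<lambda>x. cnjv (u x))"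
  by (auto simp: par_def vec_eq_iff scaleR_complex)

lemma par_cvec: "par p u \<Longrightarrow> par p (\<lambda>x. cvec (u x))"
  by (auto simp: par_def vec_eq_iff scaleR_complex)

lemma par_mult_vec: "par p u \<Longrightarrow> par p (\<lambda>x. (M::complex^2^2) *v u x)"
  by (auto simp: par_def vec_eq_iff forall_2 scaleR_complex algebra_simps)

lemma bcontfun_mult_vec: "v \<in> bcontfun \<Longrightarrow> (\<lambda>x. (M::complex^2^2) *v v x) \<in> bcontfun"
proof -
  assume v: "v \<in> bcontfun"
  then obtain m where m: "\<And>x. norm (v x) \<le> m" by (auto simp: bcontfun_def bounded_iff)
  show ?thesis
  proof (rule bcontfunI')
    show "norm (M *v v x) \<le> mnorm M * m" for x
      using norm_mult_vec[of M "v x"] mult_left_mono[OF m[of x] mnorm_nonneg[of M]] by simp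
  qed (use v in \<open>auto simp: bcontfun_def intro!: continuous_intros\<close>)
qed

text \<open>Here \<open>v0\<close> generates the Jordan chain over the kernel function \<open>psi p\<close> at \<open>\<epsilon> = 0\<close>. For \<open>\<epsilon> > 0\<close>
  the chain breaks up, and the double eigenvalue \<open>0\<close> splits into \<open>0\<close> and \<open>- \<epsilon> q / c + o(\<epsilon>)\<close>.\<close>

locale sector_setup = coupled_pair +
  fixes p :: real and M :: "real \<Rightarrow> real \<Rightarrow> real^2^2" and E Bm :: "real \<Rightarrow> real^2^2"
    and \<phi> \<theta> :: "real \<Rightarrow> real \<Rightarrow> real^2" and \<theta>0 :: "real \<Rightarrow> real^2"
    and v0 v01 :: "real \<Rightarrow> complex^2" and m0 c q :: real
  assumes p: "p = 1 \<or> p = - 1"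
    and v0: "second_deriv v0 v01 (\<lambda>x. V0 x *v v0 x + cplx J *v cvec (psi p x))"
    and v0_bd: "\<And>x. norm (v0 x) \<le> m0" and v0_par: "par p v0" and v0_orth: "pair (psi p) v0 = 0"
    and theta0: "expdec \<theta>0" and q: "pair \<theta>0 v0 = of_real q" "q \<noteq> 0"
    and c: "pair (\<lambda>x. J *v psi p x) v0 = of_real c" "c \<noteq> 0"
begin

text \<open>The eigenvalue equation is solved for the highest derivative. The spectral parameter
  then enters through the coefficient matrix, multiplied by \<open>E\<close>, which tends to
  \<open>J\<close>.\<close>

definition NN :: "real \<Rightarrow> complex \<Rightarrow> real \<Rightarrow> complex^2^2" where
  "NN \<epsilon> \<mu> x = cplx (M \<epsilon> x) + cscm \<mu> (cplx (E \<epsilon>))"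

definition sol :: "real \<Rightarrow> complex \<Rightarrow> (real \<Rightarrow> complex^2) \<Rightarrow> (real \<Rightarrow> complex^2) \<Rightarrow> bool" where
  "sol \<epsilon> \<mu> w g \<longleftrightarrow> w \<in> bcontfun \<and> par p w \<and> (\<exists>w1. second_deriv w w1 (\<lambda>x. NN \<epsilon> \<mu> x *v w x + g x))"

text \<open>The full list of what the sector argument uses about the perturbed problem at one
  \<epsilon>; the single number \<open>e\<close> bounds all deviations from the limit. The final
  clause is the equation tested with \<open>\<phi>\<close>: since the adjoint sends
  \<open>\<phi>\<close> to \<open>\<epsilon> \<theta>\<close>, its first term carries an exact
  factor \<epsilon>.\<close>

definition basic :: "real \<Rightarrow> real \<Rightarrow> bool" where
  "basic e \<epsilon> \<longleftrightarrow> 0 < \<epsilon> \<and> \<epsilon> \<le> e \<and> continuous_on UNIV (M \<epsilon>) \<and> (\<forall>x. M \<epsilon> (- x) = M \<epsilon> x) \<and>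
    (\<forall>x. mnorm (cplx (M \<epsilon> x) - V0 x) \<le> e) \<and> mnorm (cplx (E \<epsilon>) - cplx J) \<le> e \<and>
    mnorm (cplx (Bm \<epsilon>) - mat 1) \<le> e \<and> Bm \<epsilon> ** E \<epsilon> = J \<and>
    par p (\<phi> \<epsilon>) \<and> sol \<epsilon> 0 (\<lambda>x. cvec (\<phi> \<epsilon> x)) (\<lambda>x. 0) \<and> (\<forall>x. norm (\<phi> \<epsilon> x - psi p x) \<le> e) \<and>
    pclose e (\<phi> \<epsilon>) (psi p) \<and> pclose e (\<lambda>x. J *v \<phi> \<epsilon> x) (\<lambda>x. J *v psi p x) \<and> pclose e (\<theta> \<epsilon>) \<theta>0 \<and>
    (\<forall>\<mu> w g. sol \<epsilon> \<mu> w g \<longrightarrow> g \<in> bcontfun \<longrightarrow>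
       of_real \<epsilon> * pair (\<theta> \<epsilon>) w + \<mu> * pair (\<lambda>x. J *v \<phi> \<epsilon> x) w = pair (\<phi> \<epsilon>) (\<lambda>x. cplx (Bm \<epsilon>) *v g x))"

lemma basicD:
  assumes "basic e \<epsilon>"
  shows "0 < \<epsilon>" "\<epsilon> \<le> e" "continuous_on UNIV (M \<epsilon>)" "M \<epsilon> (- x) = M \<epsilon> x"
    "mnorm (cplx (M \<epsilon> x) - V0 x) \<le> e" "mnorm (cplx (E \<epsilon>) - cplx J) \<le> e"
    "mnorm (cplx (Bm \<epsilon>) - mat 1) \<le> e" "Bm \<epsilon> ** E \<epsilon> = J"
    "par p (\<phi> \<epsilon>)" "sol \<epsilon> 0 (\<lambda>x. cvec (\<phi> \<epsilon> x)) (\<lambda>x. 0)" "norm (\<phi> \<epsilon> x - psi p x) \<le> e"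
    "pclose e (\<phi> \<epsilon>) (psi p)" "pclose e (\<lambda>x. J *v \<phi> \<epsilon> x) (\<lambda>x. J *v psi p x)" "pclose e (\<theta> \<epsilon>) \<theta>0"
    "sol \<epsilon> \<mu> w g \<Longrightarrow> g \<in> bcontfun \<Longrightarrow>
       of_real \<epsilon> * pair (\<theta> \<epsilon>) w + \<mu> * pair (\<lambda>x. J *v \<phi> \<epsilon> x) w = pair (\<phi> \<epsilon>) (\<lambda>x. cplx (Bm \<epsilon>) *v g x)"
  using assms unfolding basic_def by auto

lemma psi_bd: "norm (psi p x) \<le> C"
  using norm_le_components_real[of "psi p x"] a.h_bounded[of x] b.h_bounded[of x]
  by (auto simp: psi_def split: if_splits)

lemma C_nonneg: "0 \<le> C" using a.C_nonneg .

lemma m0_nonneg: "0 \<le> m0" using order_trans[OF norm_ge_zero v0_bd] .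

lemma v0_bc: "v0 \<in> bcontfun"
  by (rule bcontfunI'[OF _ v0_bd]) (rule second_deriv_continuous[OF v0])

lemma psi_bc: "(\<lambda>x. cvec (psi p x)) \<in> bcontfun"
  by (rule expdec_bcontfun[OF expdec_cvec[OF psi_expdec]])

lemma sol_diff:
  assumes "sol \<epsilon> \<mu> w g" "sol \<epsilon> \<mu> v f"
  shows "sol \<epsilon> \<mu> (\<lambda>x. w x - v x) (\<lambda>x. g x - f x)"
proof -
  obtain w1 v1 where "second_deriv w w1 (\<lambda>x. NN \<epsilon> \<mu> x *v w x + g x)" "second_deriv v v1 (\<lambda>x. NN \<epsilon> \<mu> x *v v x + f x)"
    using assms by (auto simp: sol_def)
  from second_deriv_diff[OF this]
  have "second_deriv (\<lambda>x. w x - v x) (\<lambda>x. w1 x - v1 x) (\<lambda>x. NN \<epsilon> \<mu> x *v (w x - v x) + (g x - f x))"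
    by (simp add: matrix_vector_mult_diff_distrib algebra_simps)
  then show ?thesis using assms by (auto simp: sol_def intro: bcontfun_diff par_diff)
qed

lemma sol_smult:
  assumes "sol \<epsilon> \<mu> w g"
  shows "sol \<epsilon> \<mu> (\<lambda>x. t *s w x) (\<lambda>x. t *s g x)"
proof -
  obtain w1 where "second_deriv w w1 (\<lambda>x. NN \<epsilon> \<mu> x *v w x + g x)" using assms by (auto simp: sol_def)
  from second_deriv_linear[OF bounded_linear_smult this, of t]
  have "second_deriv (\<lambda>x. t *s w x) (\<lambda>x. t *s w1 x) (\<lambda>x. NN \<epsilon> \<mu> x *v (t *s w x) + t *s g x)"
    by (rule back_subst[of "second_deriv _ _"]) (auto simp: fun_eq_iff vec_eq_iff forall_2 algebra_simps)
  then show ?thesis using assms by (auto simp: sol_def intro: bcontfun_smult par_smult)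
qed

text \<open>Part of the spectral term is moved to the forcing; in this way solutions for different
  spectral parameters become comparable.\<close>

lemma sol_change: 
  assumes "sol \<epsilon> \<nu> w g"
  shows "sol \<epsilon> \<mu> w (\<lambda>x. g x + (\<nu> - \<mu>) *s (cplx (E \<epsilon>) *v w x))"
proof -
  have "NN \<epsilon> \<nu> x *v w x + g x = NN \<epsilon> \<mu> x *v w x + (g x + (\<nu> - \<mu>) *s (cplx (E \<epsilon>) *v w x))" for x
    unfolding NN_def matrix_vector_mult_add_rdistrib cscm_mult
    by (simp add: vec_eq_iff algebra_simps)
  then have "(\<lambda>x. NN \<epsilon> \<nu> x *v w x + g x) = (\<lambda>x. NN \<epsilon> \<mu> x *v w x + (g x + (\<nu> - \<mu>) *s (cplx (E \<epsilon>) *v w x)))"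
    by (rule ext)
  from assms[unfolded sol_def this] show ?thesis unfolding sol_def .
qed

lemma sol_cnjv:
  assumes "sol \<epsilon> \<mu> w g"
  shows "sol \<epsilon> (cnj \<mu>) (\<lambda>x. cnjv (w x)) (\<lambda>x. cnjv (g x))"
proof -
  obtain w1 where w1: "second_deriv w w1 (\<lambda>x. NN \<epsilon> \<mu> x *v w x + g x)" using assms by (auto simp: sol_def)
  have "cnjv (NN \<epsilon> \<mu> x *v w x + g x) = NN \<epsilon> (cnj \<mu>) x *v cnjv (w x) + cnjv (g x)" for x
    by (simp add: vec_eq_iff forall_2 NN_def cscm_def)
  with second_deriv_linear[OF bounded_linear_cnjv w1] show ?thesis
    using assms by (auto simp: sol_def intro: cnjv_bcontfun par_cnjv)
qed

text \<open>Since \<open>\<phi>\<close> is in the kernel, \<open>\<phi> + \<mu> v\<close> is an eigenfunction for \<open>\<mu>\<close> exactly if \<open>v\<close> satisfies this with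
  multiplier \<open>s = 0\<close>, up to the normalization of \<open>v\<close>.\<close>

definition VS :: "real \<Rightarrow> complex \<Rightarrow> (real \<Rightarrow> complex^2) \<Rightarrow> complex \<Rightarrow> bool" where
  "VS \<epsilon> \<mu> v s \<longleftrightarrow> pair (psi p) v = 0 \<and>
     sol \<epsilon> \<mu> v (\<lambda>x. cplx (E \<epsilon>) *v cvec (\<phi> \<epsilon> x) + s *s cvec (psi p x))"

text \<open>For spectral parameters of modulus at most D \<epsilon>, \<open>K1 D * e\<close> bounds
  the distance of \<open>v\<close> from \<open>v0\<close>, and \<open>K3 D\<close> is the Lipschitz
  constant of \<open>v\<close> in the parameter. The term 1 + 3 D comes from the deviation of the
  coefficient matrix, C + 3 from that of the forcing, and 3 bounds the matrix
  \<open>E\<close>.\<close>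

definition K1 :: "real \<Rightarrow> real" where "K1 D = 2 * KK * ((1 + 3 * D) * m0 + (C + 3))"
definition K3 :: "real \<Rightarrow> real" where "K3 D = 2 * KK * (3 * (m0 + K1 D))"

lemma K1_nonneg: "D > 0 \<Longrightarrow> K1 D \<ge> 0" unfolding K1_def using KK_pos m0_nonneg C_nonneg by simp
lemma K3_nonneg: "D > 0 \<Longrightarrow> K3 D \<ge> 0" unfolding K3_def using KK_pos m0_nonneg K1_nonneg by simp

text \<open>A fixed \<epsilon> and the disc of radius D \<epsilon>. The last assumption keeps the
  coefficient matrix in the contraction range for every parameter in the disc, since the spectral
  term is at most 3 D \<epsilon>.\<close>

context
  fixes e \<epsilon> D :: real
  assumes bas: "basic e \<epsilon>" and e1: "e \<le> 1" and D: "D > 0" and small: "e * (1 + 3 * D) \<le> 1 / (2 * KK)"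
begin

lemma E_bd: "mnorm (cplx (E \<epsilon>)) \<le> 3"
proof -
  have "mnorm ((cplx (E \<epsilon>) - cplx J) + cplx J) \<le> mnorm (cplx (E \<epsilon>) - cplx J) + mnorm (cplx J)" by (rule mnorm_add)
  also have "\<dots> \<le> 1 + 2" using basicD(6)[OF bas] e1 by (intro add_mono) (auto simp: mnorm_def)
  finally show ?thesis by simp
qed

lemma E_mult_bd: "norm (cplx (E \<epsilon>) *v z) \<le> 3 * norm z"
  using norm_mult_vec[of "cplx (E \<epsilon>)" z] mult_right_mono[OF E_bd norm_ge_zero[of z]] by simp

lemma near_NN:
  assumes "cmod \<mu> \<le> D * \<epsilon>"
  shows "near (NN \<epsilon> \<mu>)" "NN \<epsilon> \<mu> (- x) = NN \<epsilon> \<mu> x"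
proof -
  show "NN \<epsilon> \<mu> (- x) = NN \<epsilon> \<mu> x" using basicD(4)[OF bas] by (simp add: NN_def)
  have "continuous_on UNIV (NN \<epsilon> \<mu>)"
    unfolding NN_def
    by (intro continuous_on_vec_2; simp; intro continuous_intros basicD(3)[OF bas])
  moreover have "mnorm (NN \<epsilon> \<mu> x - V0 x) \<le> 1 / (2 * KK)" for x
  proof -
    have "mnorm ((cplx (M \<epsilon> x) - V0 x) + cscm \<mu> (cplx (E \<epsilon>))) \<le> e + cmod \<mu> * mnorm (cplx (E \<epsilon>))"
      using mnorm_add basicD(5)[OF bas] unfolding mnorm_cscm[symmetric] by (meson add_right_mono order_trans)
    also have "\<dots> \<le> e + (D * e) * 3"
      using assms basicD(1,2)[OF bas] D E_bd
      by (intro add_left_mono mult_mono) (auto intro: order_trans[OF _ mult_left_mono] mnorm_nonneg)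
    also have "\<dots> \<le> 1 / (2 * KK)" using small by (simp add: algebra_simps)
    finally show ?thesis by (simp add: NN_def algebra_simps)
  qed
  ultimately show "near (NN \<epsilon> \<mu>)" by (simp add: near_def)
qed

lemma sol_bound:
  assumes mu: "cmod \<mu> \<le> D * \<epsilon>" and s: "sol \<epsilon> \<mu> w (\<lambda>x. g x + s *s cvec (psi p x))"
    and g: "continuous_on UNIV g" "\<And>x. norm (g x) \<le> G" and o: "pair (psi p) w = 0"
  shows "norm (w x) \<le> 2 * KK * G"
proof -
  obtain w1 where w1: "second_deriv w w1 (\<lambda>x. NN \<epsilon> \<mu> x *v w x + g x + s *s cvec (psi p x))"
    using s by (auto simp: sol_def add.assoc)
  show ?thesis
    by (rule apriori_sector[OF p near_NN(1)[OF mu] g w1 _ _ o]) (use s in \<open>auto simp: sol_def bcontfun_def\<close>)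
qed

lemma phi_bc: "(\<lambda>x. cvec (\<phi> \<epsilon> x)) \<in> bcontfun" using basicD(10)[OF bas] by (simp add: sol_def)

lemma phi_bd: "norm (\<phi> \<epsilon> x) \<le> C + 1"
proof -
  have "norm (\<phi> \<epsilon> x) \<le> norm (psi p x) + norm (\<phi> \<epsilon> x - psi p x)" by (metis add.commute diff_add_cancel norm_triangle_ineq)
  then show ?thesis using psi_bd[of x] basicD(11)[OF bas, of x] e1 by simp
qed

lemma VS_exists:
  assumes mu: "cmod \<mu> \<le> D * \<epsilon>"
  obtains v s where "VS \<epsilon> \<mu> v s"
proof -
  have "\<exists>w w1 s. second_deriv w w1 (\<lambda>x. NN \<epsilon> \<mu> x *v w x + cplx (E \<epsilon>) *v cvec (\<phi> \<epsilon> x) + s *s cvec (psi p x))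
    \<and> bounded (range w) \<and> par p w \<and> pair (psi p) w = 0"
    by (rule exists_sector[OF p near_NN[OF mu]])
      (intro bcontfun_mult_vec phi_bc par_mult_vec par_cvec basicD(9)[OF bas])+
  then obtain w w1 s where w: "second_deriv w w1 (\<lambda>x. NN \<epsilon> \<mu> x *v w x + cplx (E \<epsilon>) *v cvec (\<phi> \<epsilon> x) + s *s cvec (psi p x))"
    "bounded (range w)" "par p w" "pair (psi p) w = 0" by blast
  then have "VS \<epsilon> \<mu> w s"
    using second_deriv_continuous(1)[OF w(1)] by (auto simp: VS_def sol_def bcontfun_def add.assoc)
  then show thesis by (rule that)
qed

text \<open>The function \<open>v0\<close> itself solves the perturbed equation up to the small
  forcing - (NN - V0) v0, so the a priori estimate applies to the difference
  \<open>w - v0\<close>.\<close>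

lemma approx_v0:
  assumes mu: "cmod \<mu> \<le> D * \<epsilon>" and w: "sol \<epsilon> \<mu> w (\<lambda>x. g x + s *s cvec (psi p x))"
    and o: "pair (psi p) w = 0" and gc: "continuous_on UNIV g"
    and gd: "\<And>x. norm (g x - cplx J *v cvec (psi p x)) \<le> d"
  shows "norm (w x - v0 x) \<le> 2 * KK * (e * (1 + 3 * D) * m0 + d)"
proof -
  have eq: "V0 x *v v0 x + cplx J *v cvec (psi p x)
     = NN \<epsilon> \<mu> x *v v0 x + (cplx J *v cvec (psi p x) - (NN \<epsilon> \<mu> x - V0 x) *v v0 x)" for x
    by (simp add: matrix_vector_mult_diff_rdistrib)
  have v0s: "sol \<epsilon> \<mu> v0 (\<lambda>x. cplx J *v cvec (psi p x) - (NN \<epsilon> \<mu> x - V0 x) *v v0 x)"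
    using v0 v0_bc v0_par unfolding sol_def eq by auto
  have "sol \<epsilon> \<mu> (\<lambda>x. w x - v0 x) (\<lambda>x. ((g x - cplx J *v cvec (psi p x)) + (NN \<epsilon> \<mu> x - V0 x) *v v0 x) + s *s cvec (psi p x))"
    by (rule back_subst[of "sol \<epsilon> \<mu> _", OF sol_diff[OF w v0s]]) (auto simp: fun_eq_iff algebra_simps)
  then show ?thesis
  proof (rule sol_bound[OF mu])
    have "continuous_on UNIV (NN \<epsilon> \<mu>)" using near_NN(1)[OF mu] by (simp add: near_def)
    then show "continuous_on UNIV (\<lambda>x. (g x - cplx J *v cvec (psi p x)) + (NN \<epsilon> \<mu> x - V0 x) *v v0 x)"
      by (intro continuous_intros gc psi_cont V0_cont second_deriv_continuous[OF v0])
    show "pair (psi p) (\<lambda>x. w x - v0 x) = 0"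
      using w o v0_orth v0_bc by (simp add: pair_diff psi_expdec sol_def)
    fix x
    have "norm ((NN \<epsilon> \<mu> x - V0 x) *v v0 x) \<le> mnorm (NN \<epsilon> \<mu> x - V0 x) * norm (v0 x)" by (rule norm_mult_vec)
    also have "\<dots> \<le> (e * (1 + 3 * D)) * m0"
    proof (intro mult_mono v0_bd)
      have "mnorm ((cplx (M \<epsilon> x) - V0 x) + cscm \<mu> (cplx (E \<epsilon>))) \<le> e + cmod \<mu> * mnorm (cplx (E \<epsilon>))"
        using mnorm_add basicD(5)[OF bas] unfolding mnorm_cscm[symmetric] by (meson add_right_mono order_trans)
      also have "\<dots> \<le> e + (D * e) * 3"
        using mu basicD(1,2)[OF bas] D E_bd
        by (intro add_left_mono mult_mono) (auto intro: order_trans[OF _ mult_left_mono] mnorm_nonneg)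
      finally show "mnorm (NN \<epsilon> \<mu> x - V0 x) \<le> e * (1 + 3 * D)" by (simp add: NN_def algebra_simps)
      show "0 \<le> e * (1 + 3 * D)" using basicD(1,2)[OF bas] D by simp
    qed simp
    finally show "norm ((g x - cplx J *v cvec (psi p x)) + (NN \<epsilon> \<mu> x - V0 x) *v v0 x) \<le> e * (1 + 3 * D) * m0 + d"
      using norm_triangle_ineq[of "g x - cplx J *v cvec (psi p x)" "(NN \<epsilon> \<mu> x - V0 x) *v v0 x"] gd[of x] by simp
  qed
qed

lemma E_phi_close: "norm (cplx (E \<epsilon>) *v cvec (\<phi> \<epsilon> x) - cplx J *v cvec (psi p x)) \<le> e * (C + 3)"
proof -
  have e0: "e \<ge> 0" using basicD(1,2)[OF bas] by simp
  have cd: "cvec a - cvec b = cvec (a - b)" for a b by (simp add: vec_eq_iff)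
  have "cplx (E \<epsilon>) *v cvec (\<phi> \<epsilon> x) - cplx J *v cvec (psi p x)
    = (cplx (E \<epsilon>) - cplx J) *v cvec (\<phi> \<epsilon> x) + cplx J *v cvec (\<phi> \<epsilon> x - psi p x)"
    by (simp add: matrix_vector_mult_diff_rdistrib matrix_vector_mult_diff_distrib cd[symmetric])
  also have "norm \<dots> \<le> norm ((cplx (E \<epsilon>) - cplx J) *v cvec (\<phi> \<epsilon> x)) + norm (cplx J *v cvec (\<phi> \<epsilon> x - psi p x))"
    by (rule norm_triangle_ineq)
  also have "\<dots> \<le> e * (C + 1) + 2 * e"
  proof (rule add_mono)
    show "norm ((cplx (E \<epsilon>) - cplx J) *v cvec (\<phi> \<epsilon> x)) \<le> e * (C + 1)"
      using norm_mult_vec[of "cplx (E \<epsilon>) - cplx J" "cvec (\<phi> \<epsilon> x)"]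
        mult_mono[OF basicD(6)[OF bas] phi_bd[of x] e0] by simp
    have "mnorm (cplx J) = 2" by (simp add: mnorm_def)
    then show "norm (cplx J *v cvec (\<phi> \<epsilon> x - psi p x)) \<le> 2 * e"
      using norm_mult_vec[of "cplx J" "cvec (\<phi> \<epsilon> x - psi p x)"] basicD(11)[OF bas, of x] by simp
  qed
  finally show ?thesis by (simp add: algebra_simps)
qed

lemma E_phi_bc: "(\<lambda>x. cplx (E \<epsilon>) *v cvec (\<phi> \<epsilon> x)) \<in> bcontfun"
  by (intro bcontfun_mult_vec phi_bc)

lemma VS_bc: "VS \<epsilon> \<mu> v s \<Longrightarrow> v \<in> bcontfun" by (simp add: VS_def sol_def)

lemma VS_close:
  assumes mu: "cmod \<mu> \<le> D * \<epsilon>" and v: "VS \<epsilon> \<mu> v s"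
  shows "norm (v x - v0 x) \<le> K1 D * e" "norm (v x) \<le> m0 + K1 D"
proof -
  have "norm (v x - v0 x) \<le> 2 * KK * (e * (1 + 3 * D) * m0 + e * (C + 3))"
    by (rule approx_v0[OF mu _ _ _ E_phi_close, where s=s]) (use v E_phi_bc in \<open>auto simp: VS_def bcontfun_def\<close>)
  then show 1: "norm (v x - v0 x) \<le> K1 D * e" by (simp add: K1_def algebra_simps)
  have "K1 D * e \<le> K1 D * 1" by (rule mult_left_mono[OF e1 K1_nonneg[OF D]])
  moreover have "norm (v x) \<le> norm (v0 x) + norm (v x - v0 x)" by (metis add.commute diff_add_cancel norm_triangle_ineq)
  ultimately show "norm (v x) \<le> m0 + K1 D" using 1 v0_bd[of x] by simp
qed

text \<open>Rewriting the equation of \<open>v'\<close> for the parameter \<mu> costs the forcing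
  (\<nu> - \<mu>) E v', which the a priori estimate turns into a Lipschitz bound.\<close>

lemma VS_lipschitz:
  assumes mu: "cmod \<mu> \<le> D * \<epsilon>" and nu: "cmod \<nu> \<le> D * \<epsilon>" and v: "VS \<epsilon> \<mu> v s" and v': "VS \<epsilon> \<nu> v' s'"
  shows "norm (v x - v' x) \<le> K3 D * cmod (\<mu> - \<nu>)"
proof -
  have bc: "v \<in> bcontfun" "v' \<in> bcontfun" using v v' by (auto simp: VS_bc)
  have s': "sol \<epsilon> \<mu> v' (\<lambda>x. (cplx (E \<epsilon>) *v cvec (\<phi> \<epsilon> x) + s' *s cvec (psi p x)) + (\<nu> - \<mu>) *s (cplx (E \<epsilon>) *v v' x))"
    by (rule sol_change) (use v' in \<open>simp add: VS_def\<close>)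
  have s: "sol \<epsilon> \<mu> v (\<lambda>x. cplx (E \<epsilon>) *v cvec (\<phi> \<epsilon> x) + s *s cvec (psi p x))" using v by (simp add: VS_def)
  have "sol \<epsilon> \<mu> (\<lambda>x. v x - v' x) (\<lambda>x. (\<mu> - \<nu>) *s (cplx (E \<epsilon>) *v v' x) + (s - s') *s cvec (psi p x))"
    by (rule back_subst[of "sol \<epsilon> \<mu> _", OF sol_diff[OF s s']]) (auto simp: fun_eq_iff vec_eq_iff algebra_simps)
  then have "norm (v x - v' x) \<le> 2 * KK * (cmod (\<mu> - \<nu>) * (3 * (m0 + K1 D)))"
  proof (rule sol_bound[OF mu])
    show "continuous_on UNIV (\<lambda>x. (\<mu> - \<nu>) *s (cplx (E \<epsilon>) *v v' x))"
      using bc by (intro continuous_intros) (auto simp: bcontfun_def)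
    show "norm ((\<mu> - \<nu>) *s (cplx (E \<epsilon>) *v v' x)) \<le> cmod (\<mu> - \<nu>) * (3 * (m0 + K1 D))" for x
      unfolding norm_smult using E_mult_bd[of "v' x"] VS_close(2)[OF nu v', of x]
      by (intro mult_left_mono) auto
    show "pair (psi p) (\<lambda>x. v x - v' x) = 0"
      using v v' by (simp add: pair_diff psi_expdec bc VS_def)
  qed
  then show ?thesis by (simp add: K3_def mult_ac)
qed

lemma VS_unique:
  assumes "cmod \<mu> \<le> D * \<epsilon>" "VS \<epsilon> \<mu> v s" "VS \<epsilon> \<mu> v' s'"
  shows "v = v'"
  using VS_lipschitz[OF assms(1,1,2,3)] by (auto simp: fun_eq_iff)

lemma VS_cnjv:
  assumes "VS \<epsilon> \<mu> v s"
  shows "VS \<epsilon> (cnj \<mu>) (\<lambda>x. cnjv (v x)) (cnj s)"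
proof -
  have "sol \<epsilon> (cnj \<mu>) (\<lambda>x. cnjv (v x)) (\<lambda>x. cnjv (cplx (E \<epsilon>) *v cvec (\<phi> \<epsilon> x) + s *s cvec (psi p x)))"
    by (rule sol_cnjv) (use assms in \<open>simp add: VS_def\<close>)
  moreover have "cnjv (cplx (E \<epsilon>) *v cvec (\<phi> \<epsilon> x) + s *s cvec (psi p x)) = cplx (E \<epsilon>) *v cvec (\<phi> \<epsilon> x) + cnj s *s cvec (psi p x)" for x
    by (simp add: vec_eq_iff forall_2)
  ultimately show ?thesis using assms by (simp add: VS_def pair_cnjv)
qed

text \<open>The reduced equation. Testing with \<open>\<phi>\<close> turns the forcing E \<phi> into
  the pairing of \<open>\<phi>\<close> with J \<phi>, which is zero because \<open>J\<close> is
  antisymmetric; only the multiplier term survives. So the multiplier vanishes exactly where the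
  left-hand side does, provided the factor of \<open>s\<close> is nonzero.\<close>

lemma VS_identity:
  assumes "VS \<epsilon> \<mu> v s"
  shows "of_real \<epsilon> * pair (\<theta> \<epsilon>) v + \<mu> * pair (\<lambda>x. J *v \<phi> \<epsilon> x) v
    = s * pair (\<phi> \<epsilon>) (\<lambda>x. cplx (Bm \<epsilon>) *v cvec (psi p x))"
proof -
  note pe = pcloseD(1)[OF basicD(12)[OF bas]]
  have BE: "cplx (Bm \<epsilon>) *v (cplx (E \<epsilon>) *v z) = cplx J *v z" for z
  proof -
    have "cplx (Bm \<epsilon>) *v (cplx (E \<epsilon>) *v z) = cplx (Bm \<epsilon> ** E \<epsilon>) *v z"
      by (simp add: vec_eq_iff forall_2 matrix_matrix_mult_def sum_2 algebra_simps)
    then show ?thesis using basicD(8)[OF bas] by simp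
  qed
  have bc: "(\<lambda>x. cplx (E \<epsilon>) *v cvec (\<phi> \<epsilon> x) + s *s cvec (psi p x)) \<in> bcontfun"
    by (intro bcontfun_add E_phi_bc bcontfun_smult psi_bc)
  have "of_real \<epsilon> * pair (\<theta> \<epsilon>) v + \<mu> * pair (\<lambda>x. J *v \<phi> \<epsilon> x) v
    = pair (\<phi> \<epsilon>) (\<lambda>x. cplx (Bm \<epsilon>) *v (cplx (E \<epsilon>) *v cvec (\<phi> \<epsilon> x) + s *s cvec (psi p x)))"
    by (rule basicD(15)[OF bas _ bc]) (use assms in \<open>simp add: VS_def\<close>)
  also have "\<dots> = pair (\<phi> \<epsilon>) (\<lambda>x. cplx J *v cvec (\<phi> \<epsilon> x) + s *s (cplx (Bm \<epsilon>) *v cvec (psi p x)))"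
  proof -
    have "cplx (Bm \<epsilon>) *v (cplx (E \<epsilon>) *v cvec (\<phi> \<epsilon> x) + s *s cvec (psi p x))
      = cplx J *v cvec (\<phi> \<epsilon> x) + s *s (cplx (Bm \<epsilon>) *v cvec (psi p x))" for x
      unfolding matrix_vector_right_distrib BE by (simp add: vec_eq_iff forall_2 algebra_simps)
    then show ?thesis by simp
  qed
  also have "\<dots> = pair (\<phi> \<epsilon>) (\<lambda>x. cplx J *v cvec (\<phi> \<epsilon> x)) + s * pair (\<phi> \<epsilon>) (\<lambda>x. cplx (Bm \<epsilon>) *v cvec (psi p x))"
    by (simp add: pair_add[OF pe] bcontfun_mult_vec bcontfun_smult phi_bc psi_bc pair_smult)
  also have "pair (\<phi> \<epsilon>) (\<lambda>x. cplx J *v cvec (\<phi> \<epsilon> x)) = 0" by (simp add: pair_def bdot_J_self)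
  finally show ?thesis by simp
qed

lemma eigenfunction_of_VS:
  assumes "VS \<epsilon> \<mu> v s"
  shows "sol \<epsilon> \<mu> (\<lambda>x. cvec (\<phi> \<epsilon> x) + \<mu> *s v x) (\<lambda>x. (\<mu> * s) *s cvec (psi p x))"
proof -
  have s: "sol \<epsilon> \<mu> (\<lambda>x. cvec (\<phi> \<epsilon> x)) (\<lambda>x. 0 + (0 - \<mu>) *s (cplx (E \<epsilon>) *v cvec (\<phi> \<epsilon> x)))"
    by (rule sol_change[OF basicD(10)[OF bas]])
  have s2: "sol \<epsilon> \<mu> (\<lambda>x. (- \<mu>) *s v x) (\<lambda>x. (- \<mu>) *s (cplx (E \<epsilon>) *v cvec (\<phi> \<epsilon> x) + s *s cvec (psi p x)))"
    by (rule sol_smult) (use assms in \<open>simp add: VS_def\<close>)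
  have eq: "cvec (\<phi> \<epsilon> x) - (- \<mu>) *s v x = cvec (\<phi> \<epsilon> x) + \<mu> *s v x"
    "(0 + (0 - \<mu>) *s (cplx (E \<epsilon>) *v cvec (\<phi> \<epsilon> x))) - (- \<mu>) *s (cplx (E \<epsilon>) *v cvec (\<phi> \<epsilon> x) + s *s cvec (psi p x))
     = (\<mu> * s) *s cvec (psi p x)" for x
    by (simp_all add: vec_eq_iff algebra_simps)
  show ?thesis using sol_diff[OF s s2] unfolding eq .
qed

text \<open>Subtracting the multiple \<open>t\<close> makes the difference orthogonal to
  \<open>psi p\<close>; its forcing is a multiple of \<open>psi p\<close>, so the a priori estimate
  with bound 0 kills it. What is left of the equation is t \<mu> s psi = 0, which forces \<mu> s = 0
  for a nontrivial solution.\<close>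

lemma eigenfunction_unique:
  assumes mu: "cmod \<mu> \<le> D * \<epsilon>" and v: "VS \<epsilon> \<mu> v s" and u: "sol \<epsilon> \<mu> u (\<lambda>x. 0)"
    and nz: "pair (psi p) (\<lambda>x. cvec (\<phi> \<epsilon> x)) \<noteq> 0"
  obtains t where "\<And>x. u x = t *s (cvec (\<phi> \<epsilon> x) + \<mu> *s v x)" "(\<exists>x. u x \<noteq> 0) \<Longrightarrow> \<mu> * s = 0"
proof -
  define t where "t = pair (psi p) u / pair (psi p) (\<lambda>x. cvec (\<phi> \<epsilon> x))"
  have ubc: "u \<in> bcontfun" using u by (simp add: sol_def)
  note ef = eigenfunction_of_VS[OF v]
  have pf: "pair (psi p) (\<lambda>x. cvec (\<phi> \<epsilon> x) + \<mu> *s v x) = pair (psi p) (\<lambda>x. cvec (\<phi> \<epsilon> x))"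
    using v by (simp add: pair_add psi_expdec phi_bc bcontfun_smult VS_bc[OF v] pair_smult) (simp add: VS_def)
  have efbc: "(\<lambda>x. cvec (\<phi> \<epsilon> x) + \<mu> *s v x) \<in> bcontfun" using ef by (simp add: sol_def)
  have s1: "sol \<epsilon> \<mu> (\<lambda>x. u x - t *s (cvec (\<phi> \<epsilon> x) + \<mu> *s v x)) (\<lambda>x. 0 - t *s ((\<mu> * s) *s cvec (psi p x)))"
    by (rule sol_diff[OF u sol_smult[OF ef]])
  then have s: "sol \<epsilon> \<mu> (\<lambda>x. u x - t *s (cvec (\<phi> \<epsilon> x) + \<mu> *s v x)) (\<lambda>x. 0 + (- t * (\<mu> * s)) *s cvec (psi p x))"
    by (rule back_subst[of "sol \<epsilon> \<mu> _"]) (auto simp: fun_eq_iff vec_eq_iff)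
  have "norm (u x - t *s (cvec (\<phi> \<epsilon> x) + \<mu> *s v x)) \<le> 2 * KK * 0" for x
  proof (rule sol_bound[OF mu s])
    have "pair (psi p) (\<lambda>x. u x - t *s (cvec (\<phi> \<epsilon> x) + \<mu> *s v x)) = pair (psi p) u - t * pair (psi p) (\<lambda>x. cvec (\<phi> \<epsilon> x))"
      by (simp only: pair_diff[OF psi_expdec ubc bcontfun_smult[OF efbc]] pair_smult pf)
    then show "pair (psi p) (\<lambda>x. u x - t *s (cvec (\<phi> \<epsilon> x) + \<mu> *s v x)) = 0" using nz by (simp add: t_def)
  qed auto
  then have z: "u x = t *s (cvec (\<phi> \<epsilon> x) + \<mu> *s v x)" for x by simp
  show thesis
  proof (rule that[OF z])
    assume "\<exists>x. u x \<noteq> 0"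
    then have t: "t \<noteq> 0" using z by auto
    obtain w1 where w1: "second_deriv (\<lambda>x. u x - t *s (cvec (\<phi> \<epsilon> x) + \<mu> *s v x)) w1
       (\<lambda>x. NN \<epsilon> \<mu> x *v (u x - t *s (cvec (\<phi> \<epsilon> x) + \<mu> *s v x)) + (0 - t *s ((\<mu> * s) *s cvec (psi p x))))"
      using s1 by (auto simp: sol_def)
    have "(\<lambda>x. u x - t *s (cvec (\<phi> \<epsilon> x) + \<mu> *s v x)) = (\<lambda>x. 0)" by (rule ext) (simp only: right_minus_eq z)
    then have "second_deriv (\<lambda>x. u x - t *s (cvec (\<phi> \<epsilon> x) + \<mu> *s v x)) (\<lambda>x. 0) (\<lambda>x. 0)" by (simp add: second_deriv_def)
    from fun_cong[OF second_deriv_unique(2)[OF w1 this]]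
    have z2: "NN \<epsilon> \<mu> x *v (u x - t *s (cvec (\<phi> \<epsilon> x) + \<mu> *s v x)) + (0 - t *s ((\<mu> * s) *s cvec (psi p x))) = 0" for x .
    have "psi p \<noteq> (\<lambda>x. 0)" using nz by (auto simp: pair_def bdot_def)
    then obtain x i where x: "psi p x $ i \<noteq> 0" by (auto simp: fun_eq_iff vec_eq_iff)
    have "u x - t *s (cvec (\<phi> \<epsilon> x) + \<mu> *s v x) = 0" using z[of x] by simp
    then have "t *s ((\<mu> * s) *s cvec (psi p x)) = 0" using z2[of x] by simp
    from arg_cong[OF this, of "\<lambda>v. v $ i"] show "\<mu> * s = 0" using t x by simp
  qed
qed

text \<open>Here \<open>w\<close> is a candidate for the next function in a Jordan chain. Its
  forcing is close to J psi, so \<open>w\<close> is close to \<open>v0\<close> just like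
  \<open>v\<close>, while its tested equation has the right-hand side - \<mu> (J \<phi>, v) in place
  of a multiplier term. The two facts together will be contradictory.\<close>

lemma chain_close:
  assumes mu: "cmod \<mu> \<le> D * \<epsilon>" and v: "VS \<epsilon> \<mu> v s"
    and w: "sol \<epsilon> \<mu> w (\<lambda>x. cplx (E \<epsilon>) *v (cvec (\<phi> \<epsilon> x) + \<mu> *s v x))" and o: "pair (psi p) w = 0"
  shows "norm (w x - v0 x) \<le> (K1 D + K3 D * D) * e"
    and "of_real \<epsilon> * pair (\<theta> \<epsilon>) w + \<mu> * pair (\<lambda>x. J *v \<phi> \<epsilon> x) w = - \<mu> * pair (\<lambda>x. J *v \<phi> \<epsilon> x) v"
proof -
  note pe = pcloseD(1)[OF basicD(12)[OF bas]]
  have vbc: "v \<in> bcontfun" using v by (rule VS_bc)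
  have gbc: "(\<lambda>x. cplx (E \<epsilon>) *v (cvec (\<phi> \<epsilon> x) + \<mu> *s v x)) \<in> bcontfun"
    by (intro bcontfun_mult_vec bcontfun_add phi_bc bcontfun_smult vbc)
  have "norm (cplx (E \<epsilon>) *v (cvec (\<phi> \<epsilon> x) + \<mu> *s v x) - cplx J *v cvec (psi p x)) \<le> e * (C + 3) + D * e * (3 * (m0 + K1 D))" for x
  proof -
    have "cplx (E \<epsilon>) *v (cvec (\<phi> \<epsilon> x) + \<mu> *s v x) - cplx J *v cvec (psi p x)
      = (cplx (E \<epsilon>) *v cvec (\<phi> \<epsilon> x) - cplx J *v cvec (psi p x)) + \<mu> *s (cplx (E \<epsilon>) *v v x)"
      by (simp add: vec_eq_iff forall_2 algebra_simps)
    also have "norm \<dots> \<le> e * (C + 3) + cmod \<mu> * norm (cplx (E \<epsilon>) *v v x)"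
      using norm_triangle_ineq[of "cplx (E \<epsilon>) *v cvec (\<phi> \<epsilon> x) - cplx J *v cvec (psi p x)" "\<mu> *s (cplx (E \<epsilon>) *v v x)"]
        E_phi_close[of x] by simp
    also have "\<dots> \<le> e * (C + 3) + D * e * (3 * (m0 + K1 D))"
    proof (intro add_left_mono mult_mono)
      show "cmod \<mu> \<le> D * e" by (rule order_trans[OF mu mult_left_mono[OF basicD(2)[OF bas]]]) (use D in simp)
      show "norm (cplx (E \<epsilon>) *v v x) \<le> 3 * (m0 + K1 D)" using E_mult_bd[of "v x"] VS_close(2)[OF mu v, of x] by simp
    qed (use D basicD(1,2)[OF bas] in auto)
    finally show ?thesis .
  qed
  then have "norm (w x - v0 x) \<le> 2 * KK * (e * (1 + 3 * D) * m0 + (e * (C + 3) + D * e * (3 * (m0 + K1 D))))"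
    by (intro approx_v0[OF mu _ o, where s=0]) (use w gbc in \<open>auto simp: bcontfun_def\<close>)
  then show "norm (w x - v0 x) \<le> (K1 D + K3 D * D) * e"
    unfolding K3_def by (subst K1_def) (simp add: algebra_simps)
  have "of_real \<epsilon> * pair (\<theta> \<epsilon>) w + \<mu> * pair (\<lambda>x. J *v \<phi> \<epsilon> x) w
     = pair (\<phi> \<epsilon>) (\<lambda>x. cplx (Bm \<epsilon>) *v (cplx (E \<epsilon>) *v (cvec (\<phi> \<epsilon> x) + \<mu> *s v x)))"
    by (rule basicD(15)[OF bas w gbc])
  also have "\<dots> = pair (\<phi> \<epsilon>) (\<lambda>x. cplx J *v (cvec (\<phi> \<epsilon> x) + \<mu> *s v x))"
  proof -
    have "cplx (Bm \<epsilon>) *v (cplx (E \<epsilon>) *v z) = cplx (Bm \<epsilon> ** E \<epsilon>) *v z" for z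
      by (simp add: vec_eq_iff forall_2 matrix_matrix_mult_def sum_2 algebra_simps)
    then show ?thesis using basicD(8)[OF bas] by simp
  qed
  also have "\<dots> = pair (\<phi> \<epsilon>) (\<lambda>x. cplx J *v cvec (\<phi> \<epsilon> x)) + \<mu> * pair (\<phi> \<epsilon>) (\<lambda>x. cplx J *v v x)"
  proof -
    have "cplx J *v (cvec (\<phi> \<epsilon> x) + \<mu> *s v x) = cplx J *v cvec (\<phi> \<epsilon> x) + \<mu> *s (cplx J *v v x)" for x
      by (simp add: vec_eq_iff forall_2)
    then show ?thesis
      by (simp add: pair_add[OF pe] bcontfun_mult_vec bcontfun_smult phi_bc vbc pair_smult)
  qed
  also have "pair (\<phi> \<epsilon>) (\<lambda>x. cplx J *v cvec (\<phi> \<epsilon> x)) = 0" by (simp add: pair_def bdot_J_self)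
  finally show "of_real \<epsilon> * pair (\<theta> \<epsilon>) w + \<mu> * pair (\<lambda>x. J *v \<phi> \<epsilon> x) w = - \<mu> * pair (\<lambda>x. J *v \<phi> \<epsilon> x) v"
    by (simp add: pair_J)
qed

end

end

section \<open>Root of the reduced equation and simplicity of the eigenvalues in a sector\<close>

lemma eventually_small_mult:
  fixes a b :: real
  assumes "b > 0"
  shows "\<forall>\<^sub>F e in at_right 0. e * a < b"
proof -
  have "((\<lambda>e. e * a) \<longlongrightarrow> 0 * a) (at_right 0)" by (intro tendsto_intros)
  then show ?thesis using assms by (auto dest: order_tendstoD(2))
qed

context sector_setup
begin

text \<open>The inequality \<nu> c q < 0 records that \<nu> is nonzero with the sign of - q / c. The
  last two clauses say that each eigenvalue is geometrically simple and starts no Jordan chain,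
  within functions of parity \<open>p\<close>.\<close>

definition spectrum_in :: "real \<Rightarrow> real \<Rightarrow> real \<Rightarrow> bool" where
  "spectrum_in D \<epsilon> \<nu> \<longleftrightarrow> \<bar>\<nu>\<bar> \<le> D * \<epsilon> \<and> \<nu> * c * q < 0 \<and>
    (\<forall>\<mu>\<in>{0, of_real \<nu>}. \<exists>u. sol \<epsilon> \<mu> u (\<lambda>x. 0) \<and> (\<exists>x. u x \<noteq> 0)) \<and>
    (\<forall>\<mu> u. cmod \<mu> \<le> D * \<epsilon> \<longrightarrow> sol \<epsilon> \<mu> u (\<lambda>x. 0) \<longrightarrow> (\<exists>x. u x \<noteq> 0) \<longrightarrow>
       \<mu> \<in> {0, of_real \<nu>} \<and>
       (\<forall>u'. sol \<epsilon> \<mu> u' (\<lambda>x. 0) \<longrightarrow> (\<exists>t. \<forall>x. u' x = t *s u x)) \<and>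
       (\<nexists>w. sol \<epsilon> \<mu> w (\<lambda>x. cplx (E \<epsilon>) *v u x)))"

lemma pair_close:
  assumes f: "pclose e f g" and g: "expdec g" and e: "0 \<le> e" "e \<le> 1"
    and T: "\<And>v m. v \<in> bcontfun \<Longrightarrow> (\<And>x. norm (v x) \<le> m) \<Longrightarrow> cmod (pair g v) \<le> T * m" and T0: "T \<ge> 0"
  shows "w \<in> bcontfun \<Longrightarrow> (\<And>x. norm (w x - v0 x) \<le> d * e) \<Longrightarrow> cmod (pair f w - pair g v0) \<le> e * (m0 + d + T * d)"
    and "w \<in> bcontfun \<Longrightarrow> (\<And>x. norm (w x) \<le> d) \<Longrightarrow> cmod (pair f w) \<le> (T + 1) * d"
proof -
  assume w: "w \<in> bcontfun" and wd: "\<And>x. norm (w x - v0 x) \<le> d * e"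
  have de: "d * e \<ge> 0" using order_trans[OF norm_ge_zero wd[of 0]] .
  have d0: "d * e \<le> d \<or> e = 0" using de e by (cases "e = 0") (auto simp: zero_le_mult_iff intro: mult_left_le)
  have "norm (w x) \<le> m0 + d * e" for x
    using norm_triangle_ineq[of "v0 x" "w x - v0 x"] v0_bd[of x] wd[of x] by simp
  then have "cmod (pair f w - pair g w) \<le> e * (m0 + d * e)" by (rule pcloseD(2)[OF f w])
  also have "\<dots> \<le> e * (m0 + d)" using d0 e by (auto intro: mult_left_mono)
  finally have 1: "cmod (pair f w - pair g w) \<le> e * (m0 + d)" .
  have "cmod (pair g (\<lambda>x. w x - v0 x)) \<le> T * (d * e)" by (rule T[OF bcontfun_diff[OF w v0_bc] wd])
  then have 2: "cmod (pair g w - pair g v0) \<le> T * (d * e)" by (simp add: pair_diff[OF g w v0_bc])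
  show "cmod (pair f w - pair g v0) \<le> e * (m0 + d + T * d)"
    using norm_triangle_ineq[of "pair f w - pair g w" "pair g w - pair g v0"] 1 2 by (simp add: algebra_simps)
next
  assume w: "w \<in> bcontfun" and wd: "\<And>x. norm (w x) \<le> d"
  have d: "d \<ge> 0" using order_trans[OF norm_ge_zero wd[of 0]] .
  have "cmod (pair f w) \<le> cmod (pair f w - pair g w) + cmod (pair g w)" by (metis diff_add_cancel norm_triangle_ineq)
  also have "\<dots> \<le> e * d + T * d" by (intro add_mono pcloseD(2)[OF f w wd] T[OF w wd])
  also have "\<dots> \<le> 1 * d + T * d" by (intro add_right_mono mult_right_mono e d)
  finally show "cmod (pair f w) \<le> (T + 1) * d" by (simp add: algebra_simps)
qed

lemma psi_psi: obtains h where "h > 0" "pair (psi p) (\<lambda>x. cvec (psi p x)) = complex_of_real h"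
  using p a.hh_pos b.hh_pos a.hh_c b.hh_c by (auto simp: psi_def pair_phi)

text \<open>Simplified Newton iteration with the limiting derivative \<open>c\<close>: c g(\<mu>) =
  \<mu> (c - C'(\<mu>)) - \<epsilon> Q(\<mu>). The hypothesis \<open>self\<close> makes the disc
  invariant and \<open>small\<close> gives the contraction constant 1/2; Lipschitz dependence on
  \<mu> replaces analyticity.\<close>

lemma reduced_equation_root:
  fixes Q C' :: "complex \<Rightarrow> complex" and \<epsilon> :: real
  assumes Q: "\<And>\<mu>. cmod \<mu> \<le> r \<Longrightarrow> cmod (Q \<mu> - of_real q) \<le> k"
    and C': "\<And>\<mu>. cmod \<mu> \<le> r \<Longrightarrow> cmod (C' \<mu> - of_real c) \<le> k"
    and QL: "\<And>\<mu> \<nu>. cmod \<mu> \<le> r \<Longrightarrow> cmod \<nu> \<le> r \<Longrightarrow> cmod (Q \<mu> - Q \<nu>) \<le> L * cmod (\<mu> - \<nu>)"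
    and CL: "\<And>\<mu> \<nu>. cmod \<mu> \<le> r \<Longrightarrow> cmod \<nu> \<le> r \<Longrightarrow> cmod (C' \<mu> - C' \<nu>) \<le> L * cmod (\<mu> - \<nu>)"
    and eps: "\<epsilon> > 0" and r: "r \<ge> 0" and L: "L \<ge> 0"
    and small: "k + r * L + \<epsilon> * L \<le> \<bar>c\<bar> / 2" and self: "r * k + \<epsilon> * (\<bar>q\<bar> + k) \<le> r * \<bar>c\<bar>"
  shows "\<exists>!\<mu>. \<mu> \<in> cball 0 r \<and> of_real \<epsilon> * Q \<mu> + \<mu> * C' \<mu> = 0"
proof -
  have c0: "\<bar>c\<bar> > 0" using c by simp
  define g where "g \<mu> = \<mu> - (of_real \<epsilon> * Q \<mu> + \<mu> * C' \<mu>) / of_real c" for \<mu>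
  have g_alt: "of_real c * g \<mu> = \<mu> * (of_real c - C' \<mu>) - of_real \<epsilon> * Q \<mu>" for \<mu>
    using c by (simp add: g_def field_simps)
  have nc: "\<bar>c\<bar> * cmod z = cmod (of_real c * z)" for z by (simp add: norm_mult)
  have "\<exists>!\<mu>. \<mu> \<in> cball 0 r \<and> g \<mu> = \<mu>"
  proof (rule Banach_fix[where c="1/2"])
    show "complete (cball (0::complex) r)" by (simp add: compact_imp_complete)
    show "cball (0::complex) r \<noteq> {}" using r by simp
    show "g ` cball 0 r \<subseteq> cball 0 r"
    proof clarsimp
      fix \<mu> assume mu: "cmod \<mu> \<le> r"
      have "\<bar>c\<bar> * cmod (g \<mu>) \<le> cmod (\<mu> * (of_real c - C' \<mu>)) + cmod (of_real \<epsilon> * Q \<mu>)"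
        unfolding nc g_alt by (rule norm_triangle_ineq4)
      also have "\<dots> \<le> r * k + \<epsilon> * (\<bar>q\<bar> + k)"
      proof (rule add_mono)
        show "cmod (\<mu> * (of_real c - C' \<mu>)) \<le> r * k"
          unfolding norm_mult using C'[OF mu] by (intro mult_mono mu r) (auto simp: norm_minus_commute)
        have "cmod (Q \<mu>) \<le> \<bar>q\<bar> + k"
          using norm_triangle_ineq[of "of_real q" "Q \<mu> - of_real q"] Q[OF mu] by simp
        then show "cmod (of_real \<epsilon> * Q \<mu>) \<le> \<epsilon> * (\<bar>q\<bar> + k)" using eps by (simp add: norm_mult)
      qed
      also have "\<dots> \<le> \<bar>c\<bar> * r" using self by (simp add: mult.commute)
      finally show "cmod (g \<mu>) \<le> r" using c0 by simp
    qed
    show "dist (g \<mu>) (g \<nu>) \<le> 1/2 * dist \<mu> \<nu>" if "\<mu> \<in> cball 0 r" "\<nu> \<in> cball 0 r" for \<mu> \<nu>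
    proof -
      have mu: "cmod \<mu> \<le> r" and nu: "cmod \<nu> \<le> r" using that by auto
      have "of_real c * (g \<mu> - g \<nu>) = (\<mu> - \<nu>) * (of_real c - C' \<mu>) + (\<nu> * (C' \<nu> - C' \<mu>) - of_real \<epsilon> * (Q \<mu> - Q \<nu>))"
        unfolding right_diff_distrib[of "of_real c"] g_alt by (simp add: algebra_simps)
      then have "\<bar>c\<bar> * cmod (g \<mu> - g \<nu>) \<le> cmod ((\<mu> - \<nu>) * (of_real c - C' \<mu>)) + (cmod (\<nu> * (C' \<nu> - C' \<mu>)) + cmod (of_real \<epsilon> * (Q \<mu> - Q \<nu>)))"
        unfolding nc by (metis (no_types, lifting) add_left_mono norm_triangle_ineq norm_triangle_ineq4 order_trans)
      also have "\<dots> \<le> cmod (\<mu> - \<nu>) * k + (r * (L * cmod (\<mu> - \<nu>)) + \<epsilon> * (L * cmod (\<mu> - \<nu>)))"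
        unfolding norm_mult using C'[OF mu] CL[OF mu nu] QL[OF mu nu] eps r L nu
        by (intro add_mono mult_mono) (auto simp: norm_minus_commute)
      also have "\<dots> = (k + r * L + \<epsilon> * L) * cmod (\<mu> - \<nu>)" by (simp add: algebra_simps)
      also have "\<dots> \<le> \<bar>c\<bar> / 2 * cmod (\<mu> - \<nu>)" by (rule mult_right_mono[OF small]) simp
      finally have "\<bar>c\<bar> * cmod (g \<mu> - g \<nu>) \<le> \<bar>c\<bar> * (1 / 2 * cmod (\<mu> - \<nu>))" by simp
      then show ?thesis using c0 unfolding dist_norm by (simp only: mult_le_cancel_left_pos)
    qed
  qed auto
  then show ?thesis using c by (simp add: g_def)
qed

text \<open>The expected root has modulus about \<epsilon> |q| / |c|; the lower bound on
  \<open>D\<close> leaves a factor of more than 2, so the disc of radius D \<epsilon> is invariant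
  under the iteration.\<close>

lemma sector_spectrum:
  assumes D: "D \<ge> 2 * (\<bar>q\<bar> + 1) / \<bar>c\<bar>"
  shows "\<exists>e>0. \<forall>\<epsilon>. basic e \<epsilon> \<longrightarrow> (\<exists>\<nu>. spectrum_in D \<epsilon> \<nu>)"
proof -
  have c0: "\<bar>c\<bar> > 0" and q0: "\<bar>q\<bar> > 0" using c q by auto
  have D0: "D > 0" by (rule less_le_trans[OF _ D]) (use c0 in auto)
  have Jpsi: "expdec (\<lambda>x. J *v psi p x)"
  proof -
    obtain B k where k: "k > 0" and B: "\<And>x. norm (psi p x) \<le> B * exp (- k * \<bar>x\<bar>)"
      using psi_expdec[of p] by (auto simp: expdec_def)
    have "norm (J *v psi p x) \<le> (2 * B) * exp (- k * \<bar>x\<bar>)" for x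
      using norm_le_components_real[of "J *v psi p x"] component_le_norm_cart[of "psi p x" 1]
        component_le_norm_cart[of "psi p x" 2] B[of x] by simp
    then show ?thesis using k by (auto simp: expdec_def intro!: continuous_intros psi_cont)
  qed
  obtain T1 where T1: "T1 > 0" "\<And>v m. v \<in> bcontfun \<Longrightarrow> (\<And>x. norm (v x) \<le> m) \<Longrightarrow> cmod (pair \<theta>0 v) \<le> T1 * m"
    using expdec_pair_bound[OF theta0] by blast
  obtain T2 where T2: "T2 > 0" "\<And>v m. v \<in> bcontfun \<Longrightarrow> (\<And>x. norm (v x) \<le> m) \<Longrightarrow> cmod (pair (\<lambda>x. J *v psi p x) v) \<le> T2 * m"
    using expdec_pair_bound[OF Jpsi] by blast
  obtain T3 where T3: "T3 > 0" "\<And>v m. v \<in> bcontfun \<Longrightarrow> (\<And>x. norm (v x) \<le> m) \<Longrightarrow> cmod (pair (psi p) v) \<le> T3 * m"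
    using expdec_pair_bound[OF psi_expdec] by blast
  obtain h where h: "h > 0" "pair (psi p) (\<lambda>x. cvec (psi p x)) = complex_of_real h" by (rule psi_psi)
  define d where "d = K1 D + K3 D * D"
  have K: "K1 D \<ge> 0" "K3 D \<ge> 0"
    by (intro K1_nonneg K3_nonneg D0)+
  then have d0: "d \<ge> 0" "K1 D \<le> d" using D0 by (auto simp: d_def)
  define Kp where "Kp = m0 + d + (T1 + T2) * d"
  have Kp: "Kp \<ge> 0" "m0 + d + T1 * d \<le> Kp" "m0 + d + T2 * d \<le> Kp"
    using m0_nonneg d0 T1 T2 by (auto simp: Kp_def algebra_simps)
  define L where "L = (T1 + T2 + 1) * K3 D"
  have L: "L \<ge> 0" "(T1 + 1) * K3 D \<le> L" "(T2 + 1) * K3 D \<le> L"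
    using K T1 T2 by (auto simp: L_def intro!: mult_right_mono)
  \<comment> \<open>The bound by \<open>1 / (2 * KK)\<close> gives solvability in the disc;
    \<open>\<bar>c\<bar> / 4\<close> and \<open>e * Kp < 1\<close> serve the self-map;
    \<open>\<bar>c\<bar> / 4\<close> and \<open>\<bar>q\<bar> / 32\<close> exclude Jordan chains;
    \<open>\<bar>q\<bar> / 2\<close> fixes the sign of the root; \<open>\<bar>c\<bar> / 2\<close> is
    the contraction condition; the two bounds by \<open>h\<close> keep the pairings in
    \<open>nz1\<close> and \<open>nz2\<close> nonzero.\<close>
  have "\<forall>\<^sub>F e in at_right 0. 0 < e \<and> e * 1 < 1 \<and> e * (1 + 3 * D) < 1 / (2 * KK) \<and> e * Kp < 1 \<and>
     e * Kp < \<bar>c\<bar> / 4 \<and> e * Kp < \<bar>q\<bar> / 32 \<and> e * (Kp * (1 + D)) < \<bar>q\<bar> / 2 \<and>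
     e * (Kp + D * L + L) < \<bar>c\<bar> / 2 \<and> e * (3 * C + T3 * C) < h \<and> e * T3 < h"
    using c0 q0 KK_pos h
    by (intro eventually_conj eventually_small_mult eventually_at_right_less) auto
  from eventually_happens[OF this] obtain e where e: "0 < e" "e < 1" "e * (1 + 3 * D) < 1 / (2 * KK)" "e * Kp < 1"
     "e * Kp < \<bar>c\<bar> / 4" "e * Kp < \<bar>q\<bar> / 32" "e * (Kp * (1 + D)) < \<bar>q\<bar> / 2"
     "e * (Kp + D * L + L) < \<bar>c\<bar> / 2" "e * (3 * C + T3 * C) < h" "e * T3 < h" by auto
  have "\<exists>\<nu>. spectrum_in D \<epsilon> \<nu>" if bas: "basic e \<epsilon>" for \<epsilon>
  proof -
    note ctx = bas less_imp_le[OF e(2)] D0 less_imp_le[OF e(3)]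
    note bd = basicD[OF bas]
    define r where "r = D * \<epsilon>"
    have r: "0 \<le> r" "r \<le> D * e" using bd(1,2) D0 by (auto simp: r_def intro: mult_left_mono)
    have phibc: "(\<lambda>x. cvec (\<phi> \<epsilon> x)) \<in> bcontfun" by (rule phi_bc[OF ctx])
    have nz1: "pair (psi p) (\<lambda>x. cvec (\<phi> \<epsilon> x)) \<noteq> 0"
    proof
      assume z: "pair (psi p) (\<lambda>x. cvec (\<phi> \<epsilon> x)) = 0"
      have "cmod (pair (psi p) (\<lambda>x. cvec (\<phi> \<epsilon> x) - cvec (psi p x))) \<le> T3 * e"
      proof (rule T3(2)[OF bcontfun_diff[OF phibc psi_bc]])
        have "cvec a - cvec b = cvec (a - b)" for a b by (simp add: vec_eq_iff)
        then show "norm (cvec (\<phi> \<epsilon> x) - cvec (psi p x)) \<le> e" for x using bd(11)[of x] by simp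
      qed
      then show False using z h e(10) by (simp add: pair_diff psi_expdec phibc psi_bc mult.commute)
    qed
    define \<kappa>' where "\<kappa>' = pair (\<phi> \<epsilon>) (\<lambda>x. cplx (Bm \<epsilon>) *v cvec (psi p x))"
    have nz2: "\<kappa>' \<noteq> 0"
    proof
      assume z: "\<kappa>' = 0"
      have bc: "(\<lambda>x. cplx (Bm \<epsilon>) *v cvec (psi p x)) \<in> bcontfun" by (intro bcontfun_mult_vec psi_bc)
      have "mnorm ((cplx (Bm \<epsilon>) - mat 1) + mat 1) \<le> e + 2"
        by (rule order_trans[OF mnorm_add]) (use bd(7) in \<open>simp add: mnorm_def mat_def\<close>)
      then have B3: "mnorm (cplx (Bm \<epsilon>)) \<le> 3" using e(2) by simp
      have "cmod (\<kappa>' - pair (psi p) (\<lambda>x. cplx (Bm \<epsilon>) *v cvec (psi p x))) \<le> e * (3 * C)"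
        unfolding \<kappa>'_def
      proof (rule pcloseD(2)[OF bd(12) bc])
        show "norm (cplx (Bm \<epsilon>) *v cvec (psi p x)) \<le> 3 * C" for x
          using norm_mult_vec[of "cplx (Bm \<epsilon>)" "cvec (psi p x)"] mult_mono[OF B3 psi_bd[of x]] by simp
      qed
      moreover have "cmod (pair (psi p) (\<lambda>x. cplx (Bm \<epsilon>) *v cvec (psi p x) - cvec (psi p x))) \<le> T3 * (e * C)"
      proof (rule T3(2)[OF bcontfun_diff[OF bc psi_bc]])
        fix x
        have "cplx (Bm \<epsilon>) *v cvec (psi p x) - cvec (psi p x) = (cplx (Bm \<epsilon>) - mat 1) *v cvec (psi p x)"
          by (simp add: matrix_vector_mult_diff_rdistrib)
        then show "norm (cplx (Bm \<epsilon>) *v cvec (psi p x) - cvec (psi p x)) \<le> e * C"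
          using norm_mult_vec[of "cplx (Bm \<epsilon>) - mat 1" "cvec (psi p x)"] mult_mono[OF bd(7) psi_bd[of x]] e(1) by simp
      qed
      ultimately have "cmod (0 - complex_of_real h) \<le> e * (3 * C) + T3 * (e * C)"
        using z h norm_triangle_ineq[of "\<kappa>' - pair (psi p) (\<lambda>x. cplx (Bm \<epsilon>) *v cvec (psi p x))"
            "pair (psi p) (\<lambda>x. cplx (Bm \<epsilon>) *v cvec (psi p x)) - pair (psi p) (\<lambda>x. cvec (psi p x))"]
        by (simp add: pair_diff psi_expdec bc psi_bc)
      then show False using h(1) e(9) by (simp add: algebra_simps)
    qed
    have pc1: "cmod (pair (\<theta> \<epsilon>) w - of_real q) \<le> e * Kp" if "w \<in> bcontfun" "\<And>x. norm (w x - v0 x) \<le> d * e" for w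
      using order_trans[OF pair_close(1)[OF bd(14) theta0 less_imp_le[OF e(1)] less_imp_le[OF e(2)] T1(2) less_imp_le[OF T1(1)] that]
        mult_left_mono[OF Kp(2) less_imp_le[OF e(1)]]] by (simp add: q)
    have pc2: "cmod (pair (\<lambda>x. J *v \<phi> \<epsilon> x) w - of_real c) \<le> e * Kp" if "w \<in> bcontfun" "\<And>x. norm (w x - v0 x) \<le> d * e" for w
      using order_trans[OF pair_close(1)[OF bd(13) Jpsi less_imp_le[OF e(1)] less_imp_le[OF e(2)] T2(2) less_imp_le[OF T2(1)] that]
        mult_left_mono[OF Kp(3) less_imp_le[OF e(1)]]] by (simp add: c)
    have pl1: "cmod (pair (\<theta> \<epsilon>) w) \<le> L * m" if "w \<in> bcontfun" "\<And>x. norm (w x) \<le> K3 D * m" "m \<ge> 0" for w m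
      using order_trans[OF pair_close(2)[OF bd(14) theta0 less_imp_le[OF e(1)] less_imp_le[OF e(2)] T1(2) less_imp_le[OF T1(1)] that(1,2)]
        mult_right_mono[OF L(2) that(3), unfolded mult.assoc]] by simp
    have pl2: "cmod (pair (\<lambda>x. J *v \<phi> \<epsilon> x) w) \<le> L * m" if "w \<in> bcontfun" "\<And>x. norm (w x) \<le> K3 D * m" "m \<ge> 0" for w m
      using order_trans[OF pair_close(2)[OF bd(13) Jpsi less_imp_le[OF e(1)] less_imp_le[OF e(2)] T2(2) less_imp_le[OF T2(1)] that(1,2)]
        mult_right_mono[OF L(3) that(3), unfolded mult.assoc]] by simp
    have "\<exists>v s. cmod \<mu> \<le> r \<longrightarrow> VS \<epsilon> \<mu> v s" for \<mu>
      using VS_exists[OF ctx, of \<mu>] unfolding r_def by metis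
    then obtain v s where VS: "\<And>\<mu>. cmod \<mu> \<le> r \<Longrightarrow> VS \<epsilon> \<mu> (v \<mu>) (s \<mu>)" by metis
    have vbc: "v \<mu> \<in> bcontfun" if "cmod \<mu> \<le> r" for \<mu> using VS[OF that] by (simp add: VS_def sol_def)
    define Q where "Q \<mu> = pair (\<theta> \<epsilon>) (v \<mu>)" for \<mu>
    define C' where "C' \<mu> = pair (\<lambda>x. J *v \<phi> \<epsilon> x) (v \<mu>)" for \<mu>
    have vcl: "norm (v \<mu> x - v0 x) \<le> d * e" if "cmod \<mu> \<le> r" for \<mu> x
      by (rule order_trans[OF VS_close(1)[OF ctx that[unfolded r_def] VS[OF that]] mult_right_mono[OF d0(2)]]) (use e(1) in simp)
    have Q1: "cmod (Q \<mu> - of_real q) \<le> e * Kp" "cmod (C' \<mu> - of_real c) \<le> e * Kp" if "cmod \<mu> \<le> r" for \<mu>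
      unfolding Q_def C'_def using pc1[OF vbc[OF that] vcl[OF that]] pc2[OF vbc[OF that] vcl[OF that]] by auto
    have QL: "cmod (Q \<mu> - Q \<nu>) \<le> L * cmod (\<mu> - \<nu>)" "cmod (C' \<mu> - C' \<nu>) \<le> L * cmod (\<mu> - \<nu>)"
      if "cmod \<mu> \<le> r" "cmod \<nu> \<le> r" for \<mu> \<nu>
    proof -
      note lip = VS_lipschitz[OF ctx that[unfolded r_def] VS[OF that(1)] VS[OF that(2)]]
      note bcd = bcontfun_diff[OF vbc[OF that(1)] vbc[OF that(2)]]
      show "cmod (Q \<mu> - Q \<nu>) \<le> L * cmod (\<mu> - \<nu>)"
        using pl1[OF bcd lip] by (simp add: Q_def pair_diff[OF pcloseD(1)[OF bd(14)] vbc[OF that(1)] vbc[OF that(2)]])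
      show "cmod (C' \<mu> - C' \<nu>) \<le> L * cmod (\<mu> - \<nu>)"
        using pl2[OF bcd lip] by (simp add: C'_def pair_diff[OF pcloseD(1)[OF bd(13)] vbc[OF that(1)] vbc[OF that(2)]])
    qed
    have id: "of_real \<epsilon> * Q \<mu> + \<mu> * C' \<mu> = s \<mu> * \<kappa>'" if "cmod \<mu> \<le> r" for \<mu>
      unfolding Q_def C'_def \<kappa>'_def by (rule VS_identity[OF ctx VS[OF that]])
    have root_iff: "of_real \<epsilon> * Q \<mu> + \<mu> * C' \<mu> = 0 \<longleftrightarrow> s \<mu> = 0" if "cmod \<mu> \<le> r" for \<mu>
      using id[OF that] nz2 by simp
    have ex1: "\<exists>!\<mu>. \<mu> \<in> cball 0 r \<and> of_real \<epsilon> * Q \<mu> + \<mu> * C' \<mu> = 0"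
    proof (rule reduced_equation_root[where k="e * Kp" and L=L])
      have "r * L \<le> D * e * L" "\<epsilon> * L \<le> e * L" using r bd(2) L by (auto intro: mult_right_mono)
      then show "e * Kp + r * L + \<epsilon> * L \<le> \<bar>c\<bar> / 2" using e(8) by (simp add: algebra_simps)
      have "r * (e * Kp) \<le> r * (\<bar>c\<bar> / 4)" using e(5) r by (intro mult_left_mono) auto
      moreover have "\<epsilon> * (\<bar>q\<bar> + e * Kp) \<le> \<epsilon> * (\<bar>q\<bar> + 1)" using e(4) bd(1) by simp
      moreover have "\<epsilon> * (\<bar>q\<bar> + 1) \<le> \<epsilon> * (D * \<bar>c\<bar> / 2)"
        by (rule mult_left_mono) (use D bd(1) c0 in \<open>simp_all add: field_simps\<close>)
      moreover have "r * \<bar>c\<bar> \<ge> 0" using r by simp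
      ultimately show "r * (e * Kp) + \<epsilon> * (\<bar>q\<bar> + e * Kp) \<le> r * \<bar>c\<bar>" by (simp add: r_def algebra_simps)
    qed (use Q1 QL bd(1) r L in auto)
    obtain m where m': "m \<in> cball 0 r \<and> of_real \<epsilon> * Q m + m * C' m = 0"
      using ex1_implies_ex[OF ex1] by blast
    have m: "cmod m \<le> r" "of_real \<epsilon> * Q m + m * C' m = 0" using m' by simp_all
    have mu: "\<mu> = m" if "cmod \<mu> \<le> r" "of_real \<epsilon> * Q \<mu> + \<mu> * C' \<mu> = 0" for \<mu>
    proof -
      have "\<mu> \<in> cball 0 r \<and> of_real \<epsilon> * Q \<mu> + \<mu> * C' \<mu> = 0" using that by simp
      with ex1 m' show ?thesis by blast
    qed
    have sm: "s m = 0" using root_iff[OF m(1)] m(2) by simp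
    have "cnj m = m"
    proof (rule mu)
      show cm: "cmod (cnj m) \<le> r" using m(1) by simp
      have VSc: "VS \<epsilon> (cnj m) (\<lambda>x. cnjv (v m x)) 0" using VS_cnjv[OF ctx VS[OF m(1)]] sm by simp
      have "(\<lambda>x. cnjv (v m x)) = v (cnj m)" by (rule VS_unique[OF ctx cm[unfolded r_def] VSc VS[OF cm]])
      with VS_identity[OF ctx VSc] show "of_real \<epsilon> * Q (cnj m) + cnj m * C' (cnj m) = 0"
        by (simp add: Q_def C'_def)
    qed
    then obtain \<nu> where nu: "m = of_real \<nu>" by (metis Reals_cnj_iff Reals_cases)
    show ?thesis
    proof (rule exI[of _ \<nu>], unfold spectrum_in_def, intro conjI ballI allI impI)
      show "\<bar>\<nu>\<bar> \<le> D * \<epsilon>" using m(1) by (simp add: nu r_def)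
      show "\<nu> * c * q < 0"
      proof -
        \<comment> \<open>In the root equation \<open>Q\<close> and \<open>C'\<close> are replaced
          by their limits, with a total error below \<epsilon> |q| / 2. Multiplying by
          \<open>q\<close> gives \<nu> c q < - \<epsilon> q^2 / 2.\<close>
        have "of_real (c * \<nu> + \<epsilon> * q) = - (of_real \<epsilon> * (Q m - of_real q) + m * (C' m - of_real c))"
          using m(2) by (simp add: nu algebra_simps)
        then have "\<bar>c * \<nu> + \<epsilon> * q\<bar> = cmod (of_real \<epsilon> * (Q m - of_real q) + m * (C' m - of_real c))"
          by (metis norm_minus_cancel norm_of_real)
        also have "\<dots> \<le> \<epsilon> * (e * Kp) + r * (e * Kp)"
          using Q1[OF m(1)] m(1) bd(1) r(1)
          by (intro order_trans[OF norm_triangle_ineq] add_mono) (auto simp: norm_mult intro!: mult_mono)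
        also have "\<dots> = \<epsilon> * (e * (Kp * (1 + D)))" by (simp add: r_def algebra_simps)
        also have "\<dots> < \<epsilon> * (\<bar>q\<bar> / 2)" by (rule mult_strict_left_mono[OF e(7) bd(1)])
        finally have lt: "\<bar>c * \<nu> + \<epsilon> * q\<bar> < \<epsilon> * (\<bar>q\<bar> / 2)" .
        have "\<nu> * c * q + \<epsilon> * q\<^sup>2 = (c * \<nu> + \<epsilon> * q) * q" by (simp add: power2_eq_square algebra_simps)
        also have "\<dots> \<le> \<bar>c * \<nu> + \<epsilon> * q\<bar> * \<bar>q\<bar>" by (metis abs_ge_self abs_mult)
        also have "\<dots> < \<epsilon> * (\<bar>q\<bar> / 2) * \<bar>q\<bar>" by (rule mult_strict_right_mono[OF lt q0])
        also have "\<dots> = \<epsilon> * q\<^sup>2 / 2" by (simp add: power2_eq_square)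
        finally show ?thesis using bd(1) by (smt (verit) field_sum_of_halves mult_nonneg_nonneg zero_le_power2)
      qed
      fix \<mu> :: complex assume "\<mu> \<in> {0, of_real \<nu>}"
      then have mr: "cmod \<mu> \<le> r" and z: "\<mu> * s \<mu> = 0" using m(1) r sm nu by auto
      note ef = eigenfunction_of_VS[OF ctx VS[OF mr], unfolded z]
      have pe: "pair (psi p) (\<lambda>x. cvec (\<phi> \<epsilon> x) + \<mu> *s v \<mu> x) = pair (psi p) (\<lambda>x. cvec (\<phi> \<epsilon> x))"
        using VS[OF mr] by (simp add: pair_add psi_expdec phibc bcontfun_smult vbc[OF mr] pair_smult) (simp add: VS_def)
      have "\<exists>x. cvec (\<phi> \<epsilon> x) + \<mu> *s v \<mu> x \<noteq> 0"
      proof (rule ccontr)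
        assume "\<nexists>x. cvec (\<phi> \<epsilon> x) + \<mu> *s v \<mu> x \<noteq> 0"
        then have "(\<lambda>x. cvec (\<phi> \<epsilon> x) + \<mu> *s v \<mu> x) = (\<lambda>x. 0)" by blast
        moreover have "pair (psi p) (\<lambda>x. 0) = 0" by (simp add: pair_def bdot_def)
        ultimately show False using pe nz1 by simp
      qed
      then show "\<exists>u. sol \<epsilon> \<mu> u (\<lambda>x. 0) \<and> (\<exists>x. u x \<noteq> 0)"
        using ef by (intro exI[of _ "\<lambda>x. cvec (\<phi> \<epsilon> x) + \<mu> *s v \<mu> x"]) simp
    next
      fix \<mu> u assume mr: "cmod \<mu> \<le> D * \<epsilon>" and u: "sol \<epsilon> \<mu> u (\<lambda>x. 0)" "\<exists>x. u x \<noteq> 0"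
      note mr' = mr[folded r_def]
      obtain t where t: "\<And>x. u x = t *s (cvec (\<phi> \<epsilon> x) + \<mu> *s v \<mu> x)" and z: "\<mu> * s \<mu> = 0"
        using eigenfunction_unique[OF ctx mr VS[OF mr'] u(1) nz1] u(2) by metis
      have t0: "t \<noteq> 0" using u(2) t by auto
      show "\<mu> \<in> {0, of_real \<nu>}" using z root_iff[OF mr'] mu[OF mr'] nu by auto
      show "\<exists>t. \<forall>x. u' x = t *s u x" if u': "sol \<epsilon> \<mu> u' (\<lambda>x. 0)" for u'
      proof -
        obtain t' where t': "\<And>x. u' x = t' *s (cvec (\<phi> \<epsilon> x) + \<mu> *s v \<mu> x)"
          using eigenfunction_unique[OF ctx mr VS[OF mr'] u' nz1] by metis
        have "u' x = (t' / t) *s u x" for x unfolding t t' vector_smult_assoc using t0 by simp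
        then show ?thesis by blast
      qed
      show "\<nexists>w. sol \<epsilon> \<mu> w (\<lambda>x. cplx (E \<epsilon>) *v u x)"
      proof
        assume "\<exists>w. sol \<epsilon> \<mu> w (\<lambda>x. cplx (E \<epsilon>) *v u x)"
        then obtain w where w: "sol \<epsilon> \<mu> w (\<lambda>x. cplx (E \<epsilon>) *v u x)" by blast
        define us where "us = (\<lambda>x. cvec (\<phi> \<epsilon> x) + \<mu> *s v \<mu> x)"
        have us: "sol \<epsilon> \<mu> us (\<lambda>x. 0)" unfolding us_def using eigenfunction_of_VS[OF ctx VS[OF mr'], unfolded z] by simp
        have usbc: "us \<in> bcontfun" using us by (simp add: sol_def)
        have w': "sol \<epsilon> \<mu> (\<lambda>x. (1/t) *s w x) (\<lambda>x. (1/t) *s (cplx (E \<epsilon>) *v u x))" by (rule sol_smult[OF w])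
        have wbc: "w \<in> bcontfun" using w by (simp add: sol_def)
        have pus: "pair (psi p) us = pair (psi p) (\<lambda>x. cvec (\<phi> \<epsilon> x))"
          using VS[OF mr'] by (simp add: us_def pair_add psi_expdec phibc bcontfun_smult vbc[OF mr'] pair_smult) (simp add: VS_def)
        define a where "a = pair (psi p) (\<lambda>x. (1/t) *s w x) / pair (psi p) us"
        define W where "W = (\<lambda>x. (1/t) *s w x - a *s us x)"
        have W: "sol \<epsilon> \<mu> W (\<lambda>x. cplx (E \<epsilon>) *v (cvec (\<phi> \<epsilon> x) + \<mu> *s v \<mu> x))"
          unfolding W_def
          by (rule back_subst[of "sol \<epsilon> \<mu> _", OF sol_diff[OF w' sol_smult[OF us, of a]]])
             (use t0 t in \<open>auto simp: fun_eq_iff vec_eq_iff forall_2 field_simps\<close>)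
        have Wbc: "W \<in> bcontfun" using W by (simp add: sol_def)
        have Wo: "pair (psi p) W = 0"
          unfolding W_def pair_diff[OF psi_expdec bcontfun_smult[OF wbc] bcontfun_smult[OF usbc]] pair_smult[of _ a]
          using nz1 by (simp add: a_def pus)
        note ch = chain_close[OF ctx mr VS[OF mr'] W Wo]
        have qw: "cmod (pair (\<theta> \<epsilon>) W - of_real q) \<le> e * Kp" by (rule pc1[OF Wbc ch(1)[folded d_def]])
        have cw: "cmod (pair (\<lambda>x. J *v \<phi> \<epsilon> x) W - of_real c) \<le> e * Kp" by (rule pc2[OF Wbc ch(1)[folded d_def]])
        define qW where "qW = pair (\<theta> \<epsilon>) W"
        define cW where "cW = pair (\<lambda>x. J *v \<phi> \<epsilon> x) W"
        note id2 = ch(2)[folded qW_def cW_def C'_def]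
        have b1: "cmod qW \<ge> \<bar>q\<bar> - e * Kp" "cmod cW \<ge> \<bar>c\<bar> - e * Kp"
          using qw cw norm_triangle_ineq2[of "of_real q" qW] norm_triangle_ineq2[of "of_real c" cW]
          by (auto simp: qW_def cW_def norm_minus_commute)
        \<comment> \<open>For \<mu> = 0 the tested equation says \<epsilon> qW = 0, although
          \<open>qW\<close> is close to q. For \<mu> nonzero, subtracting the root equation gives
          \<mu> cW = \<epsilon> (Q - qW), where both \<open>Q\<close> and \<open>qW\<close> are
          close to q; so |\<mu>| |c| is less than \<epsilon> |q| / 8. The root equation alone makes
          it at least \<epsilon> |q| / 4.\<close>
        show False
        proof (cases "\<mu> = 0")
          case True
          then have "qW = 0" using id2 bd(1) by simp
          then show False using b1(1) e(6) q0 by simp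
        next
          case False
          then have "s \<mu> = 0" using z by simp
          then have r0: "of_real \<epsilon> * Q \<mu> + \<mu> * C' \<mu> = 0" using root_iff[OF mr'] by simp
          have "\<mu> * cW = of_real \<epsilon> * (Q \<mu> - qW)" using id2 r0 by (simp add: algebra_simps) (metis add_diff_cancel_left' add_eq_0_iff minus_diff_eq)
          then have e1: "cmod \<mu> * cmod cW = \<epsilon> * cmod (Q \<mu> - qW)" using bd(1) by (metis abs_of_pos norm_mult norm_of_real)
          have "cmod (Q \<mu> - qW) \<le> 2 * (e * Kp)"
            using norm_triangle_ineq4[of "Q \<mu> - of_real q" "qW - of_real q"] Q1(1)[OF mr'] qw by (simp add: qW_def)
          then have "cmod (Q \<mu> - qW) < \<bar>q\<bar> / 16" using e(6) by simp
          then have e2: "cmod \<mu> * cmod cW < \<epsilon> * (\<bar>q\<bar> / 16)" unfolding e1 using bd(1) by simp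
          have "\<mu> * C' \<mu> = - (of_real \<epsilon> * Q \<mu>)" using r0 by (simp add: add_eq_0_iff2)
          then have e3: "cmod \<mu> * cmod (C' \<mu>) = \<epsilon> * cmod (Q \<mu>)" using bd(1) by (metis abs_of_pos norm_minus_cancel norm_mult norm_of_real)
          have "cmod (Q \<mu>) \<ge> \<bar>q\<bar> - e * Kp"
            using Q1(1)[OF mr'] norm_triangle_ineq2[of "of_real q" "Q \<mu>"] by (simp add: norm_minus_commute)
          then have "cmod (Q \<mu>) \<ge> \<bar>q\<bar> / 2" using e(6) q0 by simp
          then have e4: "cmod \<mu> * cmod (C' \<mu>) \<ge> \<epsilon> * (\<bar>q\<bar> / 2)" unfolding e3 using bd(1) by simp
          have "cmod (C' \<mu>) \<le> \<bar>c\<bar> + e * Kp"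
            using Q1(2)[OF mr'] norm_triangle_ineq[of "of_real c" "C' \<mu> - of_real c"] by simp
          then have "cmod (C' \<mu>) \<le> 2 * \<bar>c\<bar>" using e(5) c0 by simp
          then have e5: "cmod \<mu> * cmod (C' \<mu>) \<le> cmod \<mu> * (2 * \<bar>c\<bar>)" by (intro mult_left_mono) auto
          have "cmod cW \<ge> \<bar>c\<bar> / 2" using b1(2) e(5) c0 by simp
          then have "cmod \<mu> * cmod cW \<ge> cmod \<mu> * (\<bar>c\<bar> / 2)" by (intro mult_left_mono) auto
          then have "cmod \<mu> * (\<bar>c\<bar> / 2) < \<epsilon> * (\<bar>q\<bar> / 16)" using e2 by linarith
          moreover have "\<epsilon> * (\<bar>q\<bar> / 2) \<le> cmod \<mu> * (2 * \<bar>c\<bar>)" using e4 e5 by linarith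
          ultimately have "8 * (cmod \<mu> * \<bar>c\<bar>) < \<epsilon> * \<bar>q\<bar>" "\<epsilon> * \<bar>q\<bar> \<le> 4 * (cmod \<mu> * \<bar>c\<bar>)"
            by (simp_all add: algebra_simps)
          moreover have "cmod \<mu> * \<bar>c\<bar> \<ge> 0" by (rule mult_nonneg_nonneg) simp_all
          ultimately show False by linarith
        qed
      qed
    qed
  qed
  then show ?thesis using e(1) by blast
qed

end

locale sector_family = sector_setup +
  assumes basic: "\<And>e. e > 0 \<Longrightarrow> \<forall>\<^sub>F \<epsilon> in at_right 0. basic e \<epsilon>"
begin

text \<open>One branch must serve all discs. It is selected in the smallest admissible disc; in a
  larger disc the nonzero eigenvalue is unique, and the selected one lies there, so the two
  coincide.\<close>

lemma sector_branch:
  obtains \<nu> :: "real \<Rightarrow> real" and D0 :: real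
  where "\<And>D. D \<ge> D0 \<Longrightarrow> \<forall>\<^sub>F \<epsilon> in at_right 0. spectrum_in D \<epsilon> (\<nu> \<epsilon>)"
proof -
  define D0 where "D0 = 2 * (\<bar>q\<bar> + 1) / \<bar>c\<bar>"
  have ev: "\<forall>\<^sub>F \<epsilon> in at_right 0. \<epsilon> > 0 \<and> (\<exists>\<nu>. spectrum_in D \<epsilon> \<nu>)" if "D \<ge> D0" for D
  proof -
    have "D \<ge> 2 * (\<bar>q\<bar> + 1) / \<bar>c\<bar>" using that by (simp only: D0_def)
    then obtain e where e: "e > 0" "\<And>\<epsilon>. basic e \<epsilon> \<Longrightarrow> \<exists>\<nu>. spectrum_in D \<epsilon> \<nu>"
      using sector_spectrum by blast
    show ?thesis using basic[OF e(1)] by eventually_elim (use e(2) basicD(1) in blast)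
  qed
  define \<nu> where "\<nu> \<epsilon> = (SOME n. spectrum_in D0 \<epsilon> n)" for \<epsilon>
  show thesis
  proof (rule that[of D0 \<nu>])
    fix D assume D: "D \<ge> D0"
    show "\<forall>\<^sub>F \<epsilon> in at_right 0. spectrum_in D \<epsilon> (\<nu> \<epsilon>)"
      using ev[OF D] ev[OF order_refl]
    proof eventually_elim
      case (elim \<epsilon>)
      then obtain n where n: "spectrum_in D \<epsilon> n" by blast
      have "spectrum_in D0 \<epsilon> (\<nu> \<epsilon>)" unfolding \<nu>_def using elim by (auto intro: someI_ex)
      then have b: "\<bar>\<nu> \<epsilon>\<bar> \<le> D0 * \<epsilon>" and nz: "\<nu> \<epsilon> \<noteq> 0"
        and "\<exists>u. sol \<epsilon> (of_real (\<nu> \<epsilon>)) u (\<lambda>x. 0) \<and> (\<exists>x. u x \<noteq> 0)"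
        unfolding spectrum_in_def by auto
      then obtain u where u: "sol \<epsilon> (of_real (\<nu> \<epsilon>)) u (\<lambda>x. 0)" "\<exists>x. u x \<noteq> 0" by blast
      have "D0 * \<epsilon> \<le> D * \<epsilon>" by (rule mult_right_mono[OF D]) (use elim in auto)
      with b have "\<bar>\<nu> \<epsilon>\<bar> \<le> D * \<epsilon>" by (rule order_trans)
      then have "complex_of_real (\<nu> \<epsilon>) \<in> {0, of_real n}"
        using n u unfolding spectrum_in_def by (metis norm_of_real)
      then show ?case using nz n by simp
    qed
  qed
qed

end

subsection \<open>The unperturbed solitary wave\<close>

lemma second_deriv_real:
  fixes u :: "real \<Rightarrow> real"
  assumes "\<And>x. (u has_real_derivative u1 x) (at x)" "\<And>x. (u1 has_real_derivative u2 x) (at x)"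
  shows "second_deriv u u1 u2"
  using assms by (simp add: second_deriv_def has_real_derivative_iff_has_vector_derivative)

lemma expdec_add:
  assumes "expdec f" "expdec g"
  shows "expdec (\<lambda>x. f x + g x)"
proof -
  obtain C k where k: "k > 0" and C: "\<And>x. norm (f x) \<le> C * exp (- k * \<bar>x\<bar>)" and fc: "continuous_on UNIV f"
    using assms by (auto simp: expdec_def)
  obtain D l where l: "l > 0" and D: "\<And>x. norm (g x) \<le> D * exp (- l * \<bar>x\<bar>)" and gc: "continuous_on UNIV g"
    using assms by (auto simp: expdec_def)
  have C0: "C \<ge> 0" "D \<ge> 0" using order_trans[OF norm_ge_zero C[of 0]] order_trans[OF norm_ge_zero D[of 0]] by auto
  have "norm (f x + g x) \<le> (C + D) * exp (- min k l * \<bar>x\<bar>)" for x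
  proof -
    have "exp (- k * \<bar>x\<bar>) \<le> exp (- min k l * \<bar>x\<bar>)" "exp (- l * \<bar>x\<bar>) \<le> exp (- min k l * \<bar>x\<bar>)"
      by (auto intro: mult_right_mono)
    from mult_left_mono[OF this(1) C0(1)] mult_left_mono[OF this(2) C0(2)] show ?thesis
      using norm_triangle_ineq[of "f x" "g x"] C[of x] D[of x] by (simp add: algebra_simps)
  qed
  then show ?thesis using k l fc gc unfolding expdec_def
    by (intro conjI exI[of _ "C + D"] exI[of _ "min k l"]) (auto intro: continuous_intros)
qed

lemma expdec_comparison:
  assumes "expdec f" "continuous_on UNIV g" "\<And>x. norm (g x) \<le> K * norm (f x)"
  shows "expdec g"
proof -
  obtain C k where k: "k > 0" and C: "\<And>x. norm (f x) \<le> C * exp (- k * \<bar>x\<bar>)"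
    using assms by (auto simp: expdec_def)
  have "norm (g x) \<le> (\<bar>K\<bar> * C) * exp (- k * \<bar>x\<bar>)" for x
  proof -
    have "norm (g x) \<le> \<bar>K\<bar> * norm (f x)" using assms(3)[of x] by (smt (verit) mult_right_mono norm_ge_zero)
    also have "\<dots> \<le> \<bar>K\<bar> * (C * exp (- k * \<bar>x\<bar>))" by (intro mult_left_mono C) auto
    finally show ?thesis by simp
  qed
  then show ?thesis using assms k unfolding expdec_def by blast
qed

lemma expdec_mult:
  fixes f g :: "real \<Rightarrow> real"
  assumes "expdec f" "g \<in> bcontfun"
  shows "expdec (\<lambda>x. f x * g x)"
proof -
  obtain M where "\<And>x. norm (g x) \<le> M" using assms by (auto simp: bcontfun_def bounded_iff)
  note M = this
  show ?thesis
  proof (rule expdec_comparison[OF assms(1), where K=M])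
    show "continuous_on UNIV (\<lambda>x. f x * g x)"
      using assms by (auto simp: expdec_def bcontfun_def intro!: continuous_intros)
    show "norm (f x * g x) \<le> M * norm (f x)" for x
      unfolding norm_mult mult.commute[of M] by (intro mult_left_mono M) simp
  qed
qed

lemma expdec_times_x:
  fixes f :: "real \<Rightarrow> real"
  assumes "expdec f"
  shows "expdec (\<lambda>x. x * f x)"
proof -
  obtain C k where k: "k > 0" and C: "\<And>x. norm (f x) \<le> C * exp (- k * \<bar>x\<bar>)" and fc: "continuous_on UNIV f"
    using assms by (auto simp: expdec_def)
  have C0: "C \<ge> 0" using order_trans[OF norm_ge_zero C[of 0]] by auto
  have "norm (x * f x) \<le> (2 / k * C) * exp (- (k/2) * \<bar>x\<bar>)" for x
  proof -
    have le: "k / 2 * \<bar>x\<bar> \<le> exp (k / 2 * \<bar>x\<bar>)" using exp_ge_add_one_self[of "k / 2 * \<bar>x\<bar>"] by linarith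
    have "\<bar>x\<bar> = 2 / k * (k / 2 * \<bar>x\<bar>)" using k by simp
    also have "\<dots> \<le> 2 / k * exp (k / 2 * \<bar>x\<bar>)" by (rule mult_left_mono[OF le]) (use k in simp)
    finally have x: "\<bar>x\<bar> \<le> 2 / k * exp (k / 2 * \<bar>x\<bar>)" .
    have "norm (x * f x) \<le> (2 / k * exp (k / 2 * \<bar>x\<bar>)) * (C * exp (- k * \<bar>x\<bar>))"
      unfolding real_norm_def abs_mult by (intro mult_mono x) (use C[of x] k in auto)
    also have "\<dots> = (2 / k * C) * (exp (k / 2 * \<bar>x\<bar>) * exp (- k * \<bar>x\<bar>))" by (simp add: mult_ac)
    also have "exp (k / 2 * \<bar>x\<bar>) * exp (- k * \<bar>x\<bar>) = exp (- (k/2) * \<bar>x\<bar>)"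
      unfolding exp_add[symmetric] by (rule arg_cong[of _ _ exp]) (simp add: field_simps)
    finally show ?thesis .
  qed
  then show ?thesis using k fc unfolding expdec_def
    by (intro conjI exI[of _ "2 / k * C"] exI[of _ "k / 2"]) (auto intro!: continuous_intros)
qed

lemma expdec_cmult:
  fixes f :: "real \<Rightarrow> real"
  assumes "expdec f"
  shows "expdec (\<lambda>x. c * f x)"
proof (rule expdec_comparison[OF assms, where K="\<bar>c\<bar>"])
  show "continuous_on UNIV (\<lambda>x. c * f x)" using assms by (auto simp: expdec_def intro: continuous_intros)
qed (simp add: abs_mult)

lemma expdec_mult2: "expdec f \<Longrightarrow> expdec g \<Longrightarrow> expdec (\<lambda>x. f x * g x)" for f g :: "real \<Rightarrow> real"
  by (rule expdec_mult[OF _ expdec_bcontfun])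

lemma expdec_power: "expdec f \<Longrightarrow> expdec (\<lambda>x. f x ^ Suc n)" for f :: "real \<Rightarrow> real"
  by (induction n) (auto intro!: expdec_mult2)

lemma expdec_uminus: "expdec f \<Longrightarrow> expdec (\<lambda>x. - f x)" for f :: "real \<Rightarrow> real"
  using expdec_cmult[of f "-1"] by simp

lemma expdec_diff: "expdec f \<Longrightarrow> expdec g \<Longrightarrow> expdec (\<lambda>x. f x - g x)" for f g :: "real \<Rightarrow> real"
  using expdec_add[OF _ expdec_uminus, of f g] by simp

lemma expdec_integrable: "expdec f \<Longrightarrow> integrable lborel f" for f :: "real \<Rightarrow> 'a::euclidean_space"
  unfolding expdec_def using exp_bound_integral(1) by blast

lemma expdec_tendsto:
  assumes "expdec f" shows "(f \<longlongrightarrow> 0) at_top" "(f \<longlongrightarrow> 0) at_bot"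
  using assms exp_bound_tendsto_0 unfolding expdec_def by blast+

lemma expdec_integral_deriv_0:
  fixes W :: "real \<Rightarrow> real"
  assumes "expdec W" "\<And>x. (W has_real_derivative w x) (at x)" "expdec w"
  shows "(\<integral>x. w x \<partial>lborel) = 0"
  using integral_line_eq_limits[of W w 0 0] assms expdec_tendsto[OF assms(1)] expdec_integrable[OF assms(3)]
  by (auto simp: has_real_derivative_iff_has_vector_derivative expdec_def)

locale soliton =
  fixes \<alpha> \<omega> :: real
  assumes omega: "\<omega> > 0" and alpha: "\<alpha> \<le> 0" and beta1: "beta \<alpha> \<omega> < 1"
begin

definition \<kappa> :: real where "\<kappa> = sqrt \<omega>"
definition \<beta> :: real where "\<beta> = beta \<alpha> \<omega>"
definition s :: real where "s = sqrt (1 - \<beta>)"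
definition c :: "real \<Rightarrow> real" where "c x = cosh (2 * \<kappa> * x)"
definition \<sigma> :: "real \<Rightarrow> real" where "\<sigma> x = sinh (2 * \<kappa> * x)"
definition D :: "real \<Rightarrow> real" where "D x = 1 + s * c x"
text \<open>With this variable all identities between the wave and its derivatives become polynomial
  algebra modulo r^2 D = 1 and c^2 = 1 + \<sigma>^2.\<close>

definition r :: "real \<Rightarrow> real" where "r x = 1 / sqrt (D x)"
definition R :: "real \<Rightarrow> real" where "R x = 2 * \<kappa> * r x"
definition R1 :: "real \<Rightarrow> real" where "R1 x = - 2 * \<kappa>\<^sup>2 * s * \<sigma> x * r x ^ 3"

lemma kappa: "\<kappa> > 0" "\<kappa>\<^sup>2 = \<omega>" using omega by (auto simp: \<kappa>_def)

lemma beta_eq: "\<beta> = - (16/3) * \<alpha> * \<omega>" "0 \<le> \<beta>" "\<beta> < 1"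
  using alpha omega beta1 by (auto simp: \<beta>_def beta_def mult_nonpos_nonneg)

lemma beta_kappa: "\<beta> = - (16/3) * \<alpha> * \<kappa>\<^sup>2" by (simp add: beta_eq kappa)

lemma s: "0 < s" "s \<le> 1" "s\<^sup>2 = 1 - \<beta>" using beta_eq by (auto simp: s_def)

lemma c_ge: "c x \<ge> 1" by (simp add: c_def cosh_real_ge_1)
lemma c_abs: "cosh (2 * \<kappa> * \<bar>x\<bar>) = c x" by (cases "x \<ge> 0") (simp_all add: c_def)
lemma c_sq: "(c x)\<^sup>2 = 1 + (\<sigma> x)\<^sup>2" by (simp add: c_def \<sigma>_def cosh_square_eq)
lemma D_gt: "D x > 1" using c_ge[of x] s mult_pos_pos[of s "c x"] by (simp add: D_def)

lemma r_pos: "r x > 0" and r_sq: "(r x)\<^sup>2 * D x = 1" and r_le: "r x \<le> 1"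
  using D_gt[of x] by (auto simp: r_def power_divide)

lemma R0_eq: "R0 \<alpha> \<omega> = R"
proof
  fix x
  have "R0 \<alpha> \<omega> x = sqrt (4 * \<omega> / D x)" by (simp add: R0_def D_def c_def s_def \<beta>_def \<kappa>_def)
  then show "R0 \<alpha> \<omega> x = R x"
    using omega by (simp add: R_def r_def \<kappa>_def real_sqrt_divide real_sqrt_mult)
qed

lemma deriv_c: "(c has_real_derivative 2 * \<kappa> * \<sigma> x) (at x)"
  and deriv_\<sigma>: "(\<sigma> has_real_derivative 2 * \<kappa> * c x) (at x)"
  unfolding c_def \<sigma>_def by (auto intro!: derivative_eq_intros)

lemma deriv_D: "(D has_real_derivative 2 * \<kappa> * s * \<sigma> x) (at x)"
  unfolding D_def by (auto intro!: derivative_eq_intros deriv_c)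

lemma deriv_r: "(r has_real_derivative - \<kappa> * s * \<sigma> x * r x ^ 3) (at x)"
proof -
  have "sqrt (D x) > 0" using D_gt[of x] by simp
  moreover have "(r has_real_derivative (0 * sqrt (D x) - 1 * (2 * \<kappa> * s * \<sigma> x * (inverse (sqrt (D x)) / 2))) / (sqrt (D x) * sqrt (D x))) (at x)"
    unfolding r_def using D_gt[of x] by (auto intro!: derivative_eq_intros deriv_D)
  ultimately show ?thesis by (simp add: r_def field_simps power3_eq_cube)
qed

lemma deriv_R: "(R has_real_derivative R1 x) (at x)"
  unfolding R_def R1_def by (auto intro!: derivative_eq_intros deriv_r simp: power2_eq_square)

text \<open>The first integral of the wave equation at energy zero. It reduces even powers of
  \<open>R1\<close> to polynomials in \<open>R\<close> in all later moment computations.\<close>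

lemma R1_sq: "(R1 x)\<^sup>2 = \<omega> * R x ^ 2 - R x ^ 4 / 2 - \<alpha> * R x ^ 6 / 3"
proof -
  have sc: "s * c x = D x - 1" by (simp add: D_def)
  have "s\<^sup>2 * (\<sigma> x)\<^sup>2 = (s * c x)\<^sup>2 - s\<^sup>2" by (simp add: power_mult_distrib c_sq algebra_simps)
  also have "\<dots> = (D x)\<^sup>2 - 2 * D x + \<beta>" unfolding sc s(3) by (simp add: power2_eq_square algebra_simps)
  finally have 1: "s\<^sup>2 * (\<sigma> x)\<^sup>2 = (D x)\<^sup>2 - 2 * D x + \<beta>" .
  have "(R1 x)\<^sup>2 = 4 * \<kappa>^4 * (s\<^sup>2 * (\<sigma> x)\<^sup>2) * r x ^ 6"
    by (simp add: R1_def power_mult_distrib flip: power_mult)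
  also have "\<dots> = 4 * \<kappa>^4 * ((r x)\<^sup>2 * ((r x)\<^sup>2 * D x)^2 - 2 * r x ^ 4 * ((r x)\<^sup>2 * D x) + \<beta> * r x ^ 6)"
    unfolding 1 by algebra
  also have "\<dots> = 4 * \<kappa>^4 * ((r x)\<^sup>2 - 2 * r x ^ 4 + \<beta> * r x ^ 6)" by (simp add: r_sq)
  also have "\<dots> = \<kappa>\<^sup>2 * R x ^ 2 - R x ^ 4 / 2 - \<alpha> * R x ^ 6 / 3"
    unfolding R_def beta_kappa by algebra
  finally show ?thesis by (simp add: kappa)
qed

definition R2 :: "real \<Rightarrow> real" where "R2 x = \<omega> * R x - R x ^ 3 - \<alpha> * R x ^ 5"
text \<open>\<open>Va\<close> and \<open>Vb\<close> are the potentials in the real and imaginary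
  component of the linearization at \<epsilon> = 0 (the operators usually called L+ and L-, up to
  sign); their decaying kernel functions are R' and R.\<close>

definition Va :: "real \<Rightarrow> real" where "Va x = \<omega> - 3 * R x ^ 2 - 5 * \<alpha> * R x ^ 4"
definition Vb :: "real \<Rightarrow> real" where "Vb x = \<omega> - R x ^ 2 - \<alpha> * R x ^ 4"

lemma deriv_R1: "(R1 has_real_derivative R2 x) (at x)"
proof -
  have sc: "s * c x = D x - 1" by (simp add: D_def)
  have "s\<^sup>2 * (\<sigma> x)\<^sup>2 = (s * c x)\<^sup>2 - s\<^sup>2" by (simp add: power_mult_distrib c_sq algebra_simps)
  also have "\<dots> = (D x)\<^sup>2 - 2 * D x + \<beta>" unfolding sc s(3) by (simp add: power2_eq_square algebra_simps)
  finally have 1: "s\<^sup>2 * (\<sigma> x)\<^sup>2 = (D x)\<^sup>2 - 2 * D x + \<beta>" .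
  have "(R1 has_real_derivative - 4 * \<kappa>^3 * (s * c x) * r x ^ 3 + 6 * \<kappa>^3 * (s\<^sup>2 * (\<sigma> x)\<^sup>2) * r x ^ 5) (at x)"
    unfolding R1_def by (auto intro!: derivative_eq_intros deriv_\<sigma> deriv_r; algebra)
  moreover have "- 4 * \<kappa>^3 * (s * c x) * r x ^ 3 + 6 * \<kappa>^3 * (s\<^sup>2 * (\<sigma> x)\<^sup>2) * r x ^ 5
     = - 4 * \<kappa>^3 * (r x * ((r x)\<^sup>2 * D x) - r x ^ 3) + 6 * \<kappa>^3 * (r x * ((r x)\<^sup>2 * D x)\<^sup>2 - 2 * r x ^ 3 * ((r x)\<^sup>2 * D x) + \<beta> * r x ^ 5)"
    unfolding 1 sc by algebra
  moreover have "\<dots> = 2 * \<kappa>^3 * r x - 8 * \<kappa>^3 * r x ^ 3 + 6 * \<beta> * \<kappa>^3 * r x ^ 5"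
    unfolding r_sq by (simp add: algebra_simps)
  moreover have "\<dots> = \<kappa>\<^sup>2 * R x - R x ^ 3 - \<alpha> * R x ^ 5"
    unfolding R_def beta_kappa by algebra
  moreover have "\<dots> = R2 x" by (simp add: R2_def kappa)
  ultimately show ?thesis by simp
qed

lemma deriv_R2: "(R2 has_real_derivative Va x * R1 x) (at x)"
  unfolding R2_def Va_def by (auto intro!: derivative_eq_intros deriv_R; algebra)

lemma R_second: "second_deriv R R1 (\<lambda>x. Vb x * R x)"
proof -
  have "R2 x = Vb x * R x" for x unfolding R2_def Vb_def by algebra
  then show ?thesis using second_deriv_real[OF deriv_R deriv_R1] by simp
qed

lemma R1_second: "second_deriv R1 R2 (\<lambda>x. Va x * R1 x)"
  by (rule second_deriv_real[OF deriv_R1 deriv_R2])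

section \<open>Growing second solutions of the two kernel equations\<close>

definition X :: "real \<Rightarrow> real" where "X x = (x + s * \<sigma> x / (2 * \<kappa>)) / (4 * \<omega>)"
definition kb :: "real \<Rightarrow> real" where "kb x = R x * X x"
definition kb1 :: "real \<Rightarrow> real" where "kb1 x = R1 x * X x + 1 / R x"

lemma R_pos: "R x > 0" using r_pos kappa by (simp add: R_def)

lemma R_sq_D: "(R x)\<^sup>2 * D x = 4 * \<omega>"
  using r_sq[of x] kappa by (simp add: R_def power_mult_distrib mult.assoc)

text \<open>Reduction of order: 1 / R^2 equals (1 + s cosh (2 \<kappa> x)) / (4 \<omega>) and
  integrates in closed form, and since \<open>R\<close> has no zero, \<open>R * X\<close> is a
  second solution everywhere.\<close>

lemma deriv_X: "(X has_real_derivative 1 / (R x)\<^sup>2) (at x)"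
proof -
  have "(X has_real_derivative (1 + s * (2 * \<kappa> * c x) / (2 * \<kappa>)) / (4 * \<omega>)) (at x)"
    unfolding X_def using omega kappa(1) by (auto intro!: derivative_eq_intros deriv_\<sigma> simp: field_simps)
  also have "1 + s * (2 * \<kappa> * c x) / (2 * \<kappa>) = D x" using kappa(1) by (simp add: D_def)
  also have "D x / (4 * \<omega>) = D x / ((R x)\<^sup>2 * D x)" by (simp only: R_sq_D)
  finally show ?thesis using D_gt[of x] by simp
qed

lemma kb_second: "second_deriv kb kb1 (\<lambda>x. Vb x * kb x)"
proof (rule second_deriv_real)
  fix x
  show "(kb has_real_derivative kb1 x) (at x)"
    unfolding kb_def kb1_def using R_pos[of x]
    by (auto intro!: derivative_eq_intros deriv_R deriv_X simp: power2_eq_square)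
  have "(kb1 has_real_derivative R2 x * X x + R1 x * (1 / (R x)\<^sup>2) + (0 * R x - 1 * R1 x) / (R x * R x)) (at x)"
    unfolding kb1_def using R_pos[of x] by (auto intro!: derivative_eq_intros deriv_R1 deriv_R deriv_X)
  moreover have "R2 x * X x + R1 x * (1 / (R x)\<^sup>2) + (0 * R x - 1 * R1 x) / (R x * R x) = Vb x * kb x"
    unfolding kb_def by (simp add: power2_eq_square R2_def Vb_def algebra_simps power_numeral_reduce)
  ultimately show "(kb1 has_real_derivative Vb x * kb x) (at x)" by simp
qed

lemma kb_wronskian: "R x * kb1 x - R1 x * kb x = 1"
  using R_pos[of x] by (simp add: kb_def kb1_def algebra_simps)

text \<open>The zero of \<open>R1\<close> at the origin rules out writing the second solution as \<open>R1\<close> times an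
  antiderivative of \<open>1 / R1\<^sup>2\<close>. The function \<open>ka\<close> is the closed form of this product.\<close>

definition E :: "real \<Rightarrow> real" where
  "E x = - (1 + 3 * s\<^sup>2) * c x - (3 * s + s ^ 3) + 3 * s\<^sup>2 * (2 * \<kappa> * x) * \<sigma> x + s ^ 3 * (\<sigma> x)\<^sup>2"
definition E1 :: "real \<Rightarrow> real" where
  "E1 x = - \<sigma> x + 3 * s\<^sup>2 * (2 * \<kappa> * x) * c x + 2 * s ^ 3 * \<sigma> x * c x"
definition E2 :: "real \<Rightarrow> real" where
  "E2 x = (3 * s\<^sup>2 - 1) * c x + 3 * s\<^sup>2 * (2 * \<kappa> * x) * \<sigma> x + 2 * s ^ 3 * ((c x)\<^sup>2 + (\<sigma> x)\<^sup>2)"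

lemma deriv_E: "(E has_real_derivative 2 * \<kappa> * E1 x) (at x)"
  unfolding E_def E1_def by (auto intro!: derivative_eq_intros deriv_c deriv_\<sigma>; algebra)

lemma deriv_E1: "(E1 has_real_derivative 2 * \<kappa> * E2 x) (at x)"
  unfolding E1_def E2_def by (auto intro!: derivative_eq_intros deriv_c deriv_\<sigma>; algebra)

text \<open>The kernel equation for r^3 E, written for \<open>E\<close> alone with respect to the
  variable 2 \<kappa> x and multiplied by \<open>D\<close>.\<close>

lemma E_ode: "E2 x * D x - 3 * s * \<sigma> x * E1 x + (2 * s * c x - 1) * E x = 0"
  using c_sq[of x] unfolding E_def E1_def E2_def D_def by algebra

text \<open>Scales the Wronskian to 1: without this factor it is - 4 \<kappa>^3 s (r^2 D)^3, which
  is constant because r^2 D = 1.\<close>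

definition N :: real where "N = - 1 / (4 * \<kappa> ^ 3 * s)"
definition ka :: "real \<Rightarrow> real" where "ka x = N * (r x ^ 3 * E x)"
definition ka1 :: "real \<Rightarrow> real" where
  "ka1 x = N * (r x ^ 3 * (2 * \<kappa> * E1 x) - 3 * \<kappa> * s * \<sigma> x * r x ^ 5 * E x)"

lemma ka_second: "second_deriv ka ka1 (\<lambda>x. Va x * ka x)"
proof (rule second_deriv_real)
  fix x
  show "(ka has_real_derivative ka1 x) (at x)"
    unfolding ka_def ka1_def by (auto intro!: derivative_eq_intros deriv_r deriv_E; algebra)
  have "(ka1 has_real_derivative 4 * \<kappa>\<^sup>2 * N * r x ^ 3 * (E2 x - 3 * s * \<sigma> x * (r x)\<^sup>2 * E1 x
      - (3/2) * s * c x * (r x)\<^sup>2 * E x + (15/4) * s\<^sup>2 * (\<sigma> x)\<^sup>2 * r x ^ 4 * E x)) (at x)"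
    unfolding ka1_def by (auto intro!: derivative_eq_intros deriv_r deriv_E deriv_E1 deriv_\<sigma>; algebra)
  moreover have "4 * \<kappa>\<^sup>2 * N * r x ^ 3 * (E2 x - 3 * s * \<sigma> x * (r x)\<^sup>2 * E1 x
      - (3/2) * s * c x * (r x)\<^sup>2 * E x + (15/4) * s\<^sup>2 * (\<sigma> x)\<^sup>2 * r x ^ 4 * E x) = Va x * ka x"
  proof -
    have V: "Va x = 4 * \<kappa>\<^sup>2 * (1/4 - 3 * (r x)\<^sup>2 + (15/4) * (1 - s\<^sup>2) * r x ^ 4)"
    proof -
      have "Va x = \<kappa>\<^sup>2 - 3 * R x ^ 2 - 5 * \<alpha> * R x ^ 4" by (simp add: Va_def kappa)
      also have "\<dots> = 4 * \<kappa>\<^sup>2 * (1/4 - 3 * (r x)\<^sup>2 + (15/4) * \<beta> * r x ^ 4)"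
        unfolding R_def beta_kappa by algebra
      finally show ?thesis by (simp add: s(3))
    qed
    have e1: "E2 x = (r x)\<^sup>2 * (3 * s * \<sigma> x * E1 x - (2 * s * c x - 1) * E x)"
    proof -
      have "E2 x = (r x)\<^sup>2 * D x * E2 x" by (simp add: r_sq)
      also have "\<dots> = (r x)\<^sup>2 * (E2 x * D x)" by simp
      also have "E2 x * D x = 3 * s * \<sigma> x * E1 x - (2 * s * c x - 1) * E x" using E_ode[of x] by simp
      finally show ?thesis .
    qed
    have sc: "s * c x = D x - 1" by (simp add: D_def)
    have sg: "s\<^sup>2 * (\<sigma> x)\<^sup>2 = (D x - 1)\<^sup>2 - s\<^sup>2"
      unfolding sc[symmetric] by (simp add: power_mult_distrib c_sq algebra_simps)
    have "E2 x - 3 * s * \<sigma> x * (r x)\<^sup>2 * E1 x - (3/2) * s * c x * (r x)\<^sup>2 * E x + (15/4) * s\<^sup>2 * (\<sigma> x)\<^sup>2 * r x ^ 4 * E x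
       = E x * ((r x)\<^sup>2 - (7/2) * (s * c x) * (r x)\<^sup>2 + (15/4) * (s\<^sup>2 * (\<sigma> x)\<^sup>2) * r x ^ 4)"
      unfolding e1 by algebra
    also have "\<dots> = E x * ((r x)\<^sup>2 - (7/2) * ((r x)\<^sup>2 * D x - (r x)\<^sup>2)
        + (15/4) * (((r x)\<^sup>2 * D x)\<^sup>2 - 2 * (r x)\<^sup>2 * ((r x)\<^sup>2 * D x) + (1 - s\<^sup>2) * r x ^ 4))"
      unfolding sg sc by algebra
    also have "\<dots> = E x * (1/4 - 3 * (r x)\<^sup>2 + (15/4) * (1 - s\<^sup>2) * r x ^ 4)"
      unfolding r_sq by (simp add: field_simps)
    finally show ?thesis unfolding V ka_def by simp
  qed
  ultimately show "(ka1 has_real_derivative Va x * ka x) (at x)" by simp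
qed

lemma ka_wronskian: "R1 x * ka1 x - R2 x * ka x = 1"
proof -
  have sc: "s * c x = D x - 1" by (simp add: D_def)
  have "R2 x = - 4 * \<kappa>^3 * (s * c x) * r x ^ 3 + 6 * \<kappa>^3 * (s\<^sup>2 * (\<sigma> x)\<^sup>2) * r x ^ 5"
  proof -
    have "(R1 has_real_derivative - 4 * \<kappa>^3 * (s * c x) * r x ^ 3 + 6 * \<kappa>^3 * (s\<^sup>2 * (\<sigma> x)\<^sup>2) * r x ^ 5) (at x)"
      unfolding R1_def by (auto intro!: derivative_eq_intros deriv_\<sigma> deriv_r; algebra)
    from DERIV_unique[OF deriv_R1 this] show ?thesis .
  qed
  then have "R1 x * ka1 x - R2 x * ka x = 4 * \<kappa>^3 * s * N * (r x ^ 6 * (c x * E x - \<sigma> x * E1 x))"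
    unfolding R1_def ka_def ka1_def by algebra
  also have "c x * E x - \<sigma> x * E1 x = - (D x ^ 3)"
    using c_sq[of x] unfolding E_def E1_def D_def by algebra
  also have "r x ^ 6 * - (D x ^ 3) = - (((r x)\<^sup>2 * D x) ^ 3)" by (simp add: power_mult_distrib flip: power_mult)
  also have "\<dots> = - 1" by (simp add: r_sq)
  finally show ?thesis using kappa s by (simp add: N_def)
qed

section \<open>Exponential bounds for the kernel functions and the second solutions\<close>

lemma r_exp: "r x \<le> sqrt (2 / s) * exp (- \<kappa> * \<bar>x\<bar>)"
proof -
  have "s * exp (2 * \<kappa> * \<bar>x\<bar>) / 2 \<le> D x"
  proof -
    have "exp (2 * \<kappa> * \<bar>x\<bar>) / 2 \<le> cosh (2 * \<kappa> * \<bar>x\<bar>)" by (simp add: cosh_def)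
    also have "\<dots> = c x" by (rule c_abs)
    finally have "s * (exp (2 * \<kappa> * \<bar>x\<bar>) / 2) \<le> s * c x" by (rule mult_left_mono) (use s in simp)
    then show ?thesis by (simp add: D_def)
  qed
  then have "sqrt (s * exp (2 * \<kappa> * \<bar>x\<bar>) / 2) \<le> sqrt (D x)" by simp
  then have "r x \<le> 1 / sqrt (s * exp (2 * \<kappa> * \<bar>x\<bar>) / 2)"
    unfolding r_def using s D_gt[of x] by (intro divide_left_mono) auto
  also have "sqrt (s * exp (2 * \<kappa> * \<bar>x\<bar>) / 2) = sqrt (s / 2) * exp (\<kappa> * \<bar>x\<bar>)"
  proof -
    have "exp (2 * \<kappa> * \<bar>x\<bar>) = (exp (\<kappa> * \<bar>x\<bar>))\<^sup>2" by (simp add: power2_eq_square flip: exp_add)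
    then show ?thesis by (simp add: real_sqrt_mult real_sqrt_divide)
  qed
  finally show ?thesis by (simp add: exp_minus real_sqrt_divide field_simps)
qed

lemma R1_le: "\<bar>R1 x\<bar> \<le> 2 * \<omega> * r x"
proof -
  have "\<bar>s * \<sigma> x\<bar> \<le> D x"
  proof -
    have "\<bar>\<sigma> x\<bar> \<le> c x" using c_sq[of x] c_ge[of x] by (intro abs_le_square_iff[THEN iffD2, THEN order_trans[OF _ eq_refl[OF abs_of_nonneg]]]) auto
    then have "s * \<bar>\<sigma> x\<bar> \<le> s * c x" by (rule mult_left_mono) (use s in simp)
    moreover have "\<bar>s * \<sigma> x\<bar> = s * \<bar>\<sigma> x\<bar>" using s by (simp add: abs_mult)
    ultimately show ?thesis unfolding D_def by linarith
  qed
  then have "\<bar>R1 x\<bar> \<le> 2 * \<kappa>\<^sup>2 * D x * r x ^ 3"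
    using r_pos[of x] by (simp add: R1_def abs_mult mult.assoc mult_left_mono mult_right_mono)
  also have "\<dots> = 2 * \<kappa>\<^sup>2 * r x * ((r x)\<^sup>2 * D x)" by algebra
  finally show ?thesis unfolding r_sq kappa by simp
qed

lemma R_expdec: "expdec R" and R1_expdec: "expdec R1"
proof -
  have c: "continuous_on UNIV R" "continuous_on UNIV R1"
    using second_deriv_continuous[OF R_second] by auto
  have r: "expdec r"
  proof -
    have "continuous_on UNIV r" by (rule DERIV_continuous_on, rule has_field_derivative_at_within, rule deriv_r)
    then show ?thesis unfolding expdec_def
      by (intro conjI exI[of _ "sqrt (2/s)"] exI[of _ \<kappa>]) (use r_exp r_pos kappa in \<open>auto simp: less_imp_le abs_of_pos\<close>)
  qed
  show "expdec R" by (rule expdec_comparison[OF r c(1), where K="2 * \<kappa>"]) (use kappa r_pos in \<open>auto simp: R_def abs_mult\<close>)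
  show "expdec R1" by (rule expdec_comparison[OF r c(2), where K="2 * \<omega>"]) (use R1_le r_pos in \<open>auto simp: abs_of_pos\<close>)
qed

lemma R_even: "R (- x) = R x" and R1_odd: "R1 (- x) = - R1 x"
  by (simp_all add: R_def R1_def r_def D_def c_def \<sigma>_def)

lemma Va_cont: "continuous_on S Va" and Vb_cont: "continuous_on S Vb"
  unfolding Va_def Vb_def by (auto intro!: continuous_intros second_deriv_continuous[OF R_second])

lemma R_le: "\<bar>R x\<bar> \<le> 2 * \<kappa>" using r_le[of x] r_pos[of x] kappa by (simp add: R_def)

lemma V_bounded: "bounded (range Va)" "bounded (range Vb)"
proof -
  have p: "\<bar>R x ^ n\<bar> \<le> (2 * \<kappa>) ^ n" for x n using power_mono[OF R_le[of x], of n] by (simp add: power_abs)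
  have "\<bar>Va x\<bar> \<le> \<omega> + 3 * (2 * \<kappa>) ^ 2 + \<bar>5 * \<alpha>\<bar> * (2 * \<kappa>) ^ 4" for x
  proof -
    have "\<bar>5 * \<alpha> * R x ^ 4\<bar> \<le> \<bar>5 * \<alpha>\<bar> * (2 * \<kappa>) ^ 4" unfolding abs_mult by (intro mult_left_mono) (use p[of x 4] in \<open>auto simp: abs_mult\<close>)
    then show ?thesis using p[of x 2] omega unfolding Va_def by linarith
  qed
  then show "bounded (range Va)" by (auto simp: bounded_iff)
  have "\<bar>Vb x\<bar> \<le> \<omega> + (2 * \<kappa>) ^ 2 + \<bar>\<alpha>\<bar> * (2 * \<kappa>) ^ 4" for x
  proof -
    have "\<bar>\<alpha> * R x ^ 4\<bar> \<le> \<bar>\<alpha>\<bar> * (2 * \<kappa>) ^ 4" unfolding abs_mult by (intro mult_left_mono) (use p[of x 4] in auto)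
    then show ?thesis using p[of x 2] omega unfolding Vb_def by linarith
  qed
  then show "bounded (range Vb)" by (auto simp: bounded_iff)
qed

lemma coupled: "\<exists>C. coupled_pair R1 R2 ka ka1 Va R R1 kb kb1 Vb C \<kappa>"
proof -
  define e where "e x = exp (\<kappa> * \<bar>x\<bar>)" for x
  have e: "e x \<ge> 1" "exp (- \<kappa> * \<bar>x\<bar>) * e x = 1" for x
    using kappa by (auto simp: e_def simp flip: exp_add)
  have e2: "exp (2 * \<kappa> * \<bar>x\<bar>) = e x ^ 2" for x unfolding e_def power2_eq_square exp_add[symmetric] by simp
  define B where "B = sqrt (2 / s)"
  have B: "B > 0" using s by (simp add: B_def)
  have re: "r x * e x \<le> B" for x
  proof -
    have "r x * e x \<le> (B * exp (- \<kappa> * \<bar>x\<bar>)) * e x"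
      using e(1)[of x] by (intro mult_right_mono r_exp[folded B_def]) auto
    then show ?thesis using e(2)[of x] by (simp add: mult.assoc)
  qed
  have ce: "c x \<le> e x ^ 2" "\<bar>\<sigma> x\<bar> \<le> e x ^ 2" "\<bar>2 * \<kappa> * x\<bar> \<le> e x ^ 2" for x
  proof -
    have eq: "c x = cosh (2 * \<kappa> * \<bar>x\<bar>)" by (rule c_abs[symmetric])
    have "exp (- (2 * \<kappa> * \<bar>x\<bar>)) \<le> exp (2 * \<kappa> * \<bar>x\<bar>)" using kappa by simp
    then show c1: "c x \<le> e x ^ 2" unfolding eq e2[symmetric] cosh_def by simp
    have "\<bar>\<sigma> x\<bar> \<le> c x" using c_sq[of x] c_ge[of x] by (intro abs_le_square_iff[THEN iffD2, THEN order_trans[OF _ eq_refl[OF abs_of_nonneg]]]) auto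
    with c1 show "\<bar>\<sigma> x\<bar> \<le> e x ^ 2" by simp
    have "\<bar>2 * \<kappa> * x\<bar> = 2 * \<kappa> * \<bar>x\<bar>" using kappa by (simp add: abs_mult)
    then show "\<bar>2 * \<kappa> * x\<bar> \<le> e x ^ 2" using exp_ge_add_one_self[of "2 * \<kappa> * \<bar>x\<bar>"] unfolding e2 by linarith
  qed
  \<comment> \<open>One summand for each of \<open>R\<close>, \<open>R1\<close>, \<open>R2\<close>,
    \<open>kb\<close> and \<open>ka\<close>. With e = exp (\<kappa> |x|), r e is at most
    \<open>B\<close>, \<open>X\<close> is of order e^2 and \<open>E\<close> of order e^4, so R X and
    r^3 E are both of order e. The 12 adds the four bounds 4, 4, 3 and 1 for the terms of
    \<open>E\<close>.\<close>
  define C where "C = (2 * \<kappa> + 2 * \<omega> + (\<omega> + (2*\<kappa>)^2 + \<bar>\<alpha>\<bar> * (2*\<kappa>)^4) * (2 * \<kappa>)) * B + 2 * \<kappa> * B / (4 * \<omega> * \<kappa>) + \<bar>N\<bar> * B ^ 3 * 12"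
  have Cp: "2 * \<kappa> * B \<le> C" "2 * \<omega> * B \<le> C" "(\<omega> + (2*\<kappa>)^2 + \<bar>\<alpha>\<bar> * (2*\<kappa>)^4) * (2 * \<kappa>) * B \<le> C"
     "2 * \<kappa> * B / (4 * \<omega> * \<kappa>) \<le> C" "\<bar>N\<bar> * B ^ 3 * 12 \<le> C"
  proof -
    have nn: "0 \<le> 2 * \<kappa> * B" "0 \<le> 2 * \<omega> * B" "0 \<le> (\<omega> + (2*\<kappa>)^2 + \<bar>\<alpha>\<bar> * (2*\<kappa>)^4) * (2 * \<kappa>) * B"
      "0 \<le> 2 * \<kappa> * B / (4 * \<omega> * \<kappa>)" "0 \<le> \<bar>N\<bar> * B ^ 3 * 12" using kappa B omega by auto
    have C: "C = 2 * \<kappa> * B + 2 * \<omega> * B + (\<omega> + (2*\<kappa>)^2 + \<bar>\<alpha>\<bar> * (2*\<kappa>)^4) * (2 * \<kappa>) * B + 2 * \<kappa> * B / (4 * \<omega> * \<kappa>) + \<bar>N\<bar> * B ^ 3 * 12"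
      unfolding C_def by (simp add: algebra_simps)
    show "2 * \<kappa> * B \<le> C" "2 * \<omega> * B \<le> C" "(\<omega> + (2*\<kappa>)^2 + \<bar>\<alpha>\<bar> * (2*\<kappa>)^4) * (2 * \<kappa>) * B \<le> C"
     "2 * \<kappa> * B / (4 * \<omega> * \<kappa>) \<le> C" "\<bar>N\<bar> * B ^ 3 * 12 \<le> C" unfolding C using nn by linarith+
  qed
  have mul: "A \<le> C * exp (- \<kappa> * \<bar>x\<bar>)" if "A \<le> K * r x" "K * B \<le> C" "K \<ge> 0" for A K x
  proof -
    have "A \<le> K * (B * exp (- \<kappa> * \<bar>x\<bar>))" using that r_exp[of x, folded B_def] by (meson mult_left_mono order_trans)
    also have "\<dots> \<le> C * exp (- \<kappa> * \<bar>x\<bar>)" using that by (simp add: mult_right_mono flip: mult.assoc)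
    finally show ?thesis .
  qed
  have b1: "\<bar>R x\<bar> \<le> C * exp (- \<kappa> * \<bar>x\<bar>)" for x
    by (rule mul[OF _ Cp(1)]) (use kappa r_pos[of x] in \<open>auto simp: R_def abs_mult\<close>)
  have b2: "\<bar>R1 x\<bar> \<le> C * exp (- \<kappa> * \<bar>x\<bar>)" for x
    by (rule mul[OF R1_le Cp(2)]) (use omega in auto)
  have b3: "\<bar>R2 x\<bar> \<le> C * exp (- \<kappa> * \<bar>x\<bar>)" for x
  proof (rule mul[OF _ Cp(3)])
    have p: "\<bar>R x ^ n\<bar> \<le> (2 * \<kappa>) ^ n" for n using power_mono[OF R_le[of x], of n] by (simp add: power_abs)
    have "\<bar>\<alpha> * R x ^ 4\<bar> \<le> \<bar>\<alpha>\<bar> * (2 * \<kappa>) ^ 4" unfolding abs_mult by (intro mult_left_mono) (use p[of 4] in auto)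
    then have "\<bar>Vb x\<bar> \<le> \<omega> + (2 * \<kappa>) ^ 2 + \<bar>\<alpha>\<bar> * (2 * \<kappa>) ^ 4" using p[of 2] omega unfolding Vb_def by linarith
    moreover have "R2 x = Vb x * R x" unfolding R2_def Vb_def by algebra
    ultimately show "\<bar>R2 x\<bar> \<le> (\<omega> + (2*\<kappa>)^2 + \<bar>\<alpha>\<bar> * (2*\<kappa>)^4) * (2 * \<kappa>) * r x"
      using kappa r_pos[of x] by (simp add: abs_mult R_def mult_right_mono)
  qed (use omega kappa in auto)
  have b4: "\<bar>kb x\<bar> \<le> C * exp (\<kappa> * \<bar>x\<bar>)" for x
  proof -
    have 1: "\<bar>X x\<bar> \<le> e x ^ 2 / (4 * \<omega> * \<kappa>)"
    proof -
      have "\<bar>s * \<sigma> x\<bar> \<le> e x ^ 2" using mult_mono[OF s(2) ce(2)[of x]] s by (simp add: abs_mult)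
      then have "\<bar>2 * \<kappa> * x + s * \<sigma> x\<bar> \<le> 2 * e x ^ 2" using ce(3)[of x] by linarith
      moreover have "X x = (2 * \<kappa> * x + s * \<sigma> x) / (2 * (4 * \<omega> * \<kappa>))" using kappa omega by (simp add: X_def field_simps)
      ultimately show ?thesis using kappa omega by (simp add: abs_divide abs_mult field_simps)
    qed
    have "\<bar>kb x\<bar> \<le> (2 * \<kappa> * r x) * (e x ^ 2 / (4 * \<omega> * \<kappa>))"
      unfolding kb_def abs_mult using kappa r_pos[of x] by (intro mult_mono 1) (auto simp: R_def abs_mult)
    also have "\<dots> = 2 * \<kappa> / (4 * \<omega> * \<kappa>) * (r x * e x) * e x" by (simp add: power2_eq_square)
    also have "\<dots> \<le> 2 * \<kappa> / (4 * \<omega> * \<kappa>) * B * e x"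
      using kappa omega e(1)[of x] by (intro mult_right_mono mult_left_mono re) auto
    also have "\<dots> \<le> C * e x" using Cp(4) e(1)[of x] by (intro mult_right_mono) auto
    finally show ?thesis by (simp add: e_def)
  qed
  have b5: "\<bar>ka x\<bar> \<le> C * exp (\<kappa> * \<bar>x\<bar>)" for x
  proof -
    have e4: "e x ^ 2 \<le> e x ^ 4" "1 \<le> e x ^ 4" using e(1)[of x] by (auto intro: power_increasing)
    have s': "s\<^sup>2 \<le> 1" "s^3 \<le> 1" "0 \<le> s\<^sup>2" "0 \<le> s^3" using s power_le_one[of s 3] power_le_one[of s 2] beta_eq by auto
    have t1: "\<bar>(1 + 3 * s\<^sup>2) * c x\<bar> \<le> 4 * e x ^ 4"
      unfolding abs_mult using s' ce(1)[of x] c_ge[of x] e4 by (intro mult_mono) auto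
    have t2: "\<bar>3 * s + s ^ 3\<bar> \<le> 4 * e x ^ 4" using s s' e4 by auto
    have "\<bar>(2 * \<kappa> * x) * \<sigma> x\<bar> \<le> e x ^ 2 * e x ^ 2" unfolding abs_mult[of "2 * \<kappa> * x"] by (intro mult_mono ce) auto
    then have "\<bar>(2 * \<kappa> * x) * \<sigma> x\<bar> \<le> e x ^ 4" by (simp flip: power_add)
    then have "\<bar>s\<^sup>2 * ((2 * \<kappa> * x) * \<sigma> x)\<bar> \<le> 1 * e x ^ 4"
      unfolding abs_mult[of "s\<^sup>2"] using s' by (intro mult_mono) auto
    then have t3: "\<bar>3 * s\<^sup>2 * (2 * \<kappa> * x) * \<sigma> x\<bar> \<le> 3 * e x ^ 4" by (simp add: abs_mult mult_ac)
    have "(\<sigma> x)\<^sup>2 \<le> (e x ^ 2)\<^sup>2" using power_mono[OF ce(2)[of x], of 2] by (simp only: power2_abs abs_ge_zero)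
    then have "s ^ 3 * (\<sigma> x)\<^sup>2 \<le> 1 * (e x ^ 2)\<^sup>2" using s' by (intro mult_mono) auto
    then have t4: "\<bar>s ^ 3 * (\<sigma> x)\<^sup>2\<bar> \<le> e x ^ 4" using s' by (simp add: abs_mult flip: power_mult)
    have "\<bar>E x\<bar> \<le> 12 * e x ^ 4" unfolding E_def using t1 t2 t3 t4 by linarith
    then have "\<bar>ka x\<bar> \<le> \<bar>N\<bar> * (r x ^ 3 * (12 * e x ^ 4))"
      unfolding ka_def abs_mult using r_pos[of x] by (intro mult_left_mono mult_mono) (auto simp: abs_mult)
    also have "\<dots> = \<bar>N\<bar> * 12 * (r x * e x) ^ 3 * e x" by algebra
    also have "\<dots> \<le> \<bar>N\<bar> * 12 * B ^ 3 * e x"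
      using e(1)[of x] r_pos[of x] by (intro mult_right_mono mult_left_mono power_mono re) auto
    also have "\<dots> \<le> C * e x" using Cp(5) e(1)[of x] by (intro mult_right_mono) (auto simp: mult_ac)
    finally show ?thesis by (simp add: e_def)
  qed
  have "coupled_pair R1 R2 ka ka1 Va R R1 kb kb1 Vb C \<kappa>"
  proof unfold_locales
    show "second_deriv R1 R2 (\<lambda>x. Va x * R1 x)" by (rule R1_second)
    show "second_deriv R R1 (\<lambda>x. Vb x * R x)" by (rule R_second)
    show "second_deriv ka ka1 (\<lambda>x. Va x * ka x)" by (rule ka_second)
    show "second_deriv kb kb1 (\<lambda>x. Vb x * kb x)" by (rule kb_second)
    show "R1 x * ka1 x - R2 x * ka x = 1" for x by (rule ka_wronskian)
    show "R x * kb1 x - R1 x * kb x = 1" for x by (rule kb_wronskian)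
  qed (use kappa b1 b2 b3 b4 b5 V_bounded Va_cont Vb_cont R_even R1_odd in auto)
  then show ?thesis by blast
qed

end

lemma bcontfun_mult: "f \<in> bcontfun \<Longrightarrow> g \<in> bcontfun \<Longrightarrow> (\<lambda>x. f x * g x :: real) \<in> bcontfun"
proof -
  assume fg: "f \<in> bcontfun" "g \<in> bcontfun"
  obtain F G where b: "\<And>x. norm (f x) \<le> F" "\<And>x. norm (g x) \<le> G"
    using fg by (auto simp: bcontfun_def bounded_iff)
  have "norm (f x * g x) \<le> F * G" for x
    unfolding norm_mult by (intro mult_mono b order_trans[OF norm_ge_zero b(1)]) simp
  then show ?thesis using fg by (intro bcontfunI') (auto simp: bcontfun_def intro: continuous_intros)
qed

lemma green_real:
  fixes f g :: "real \<Rightarrow> real"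
  assumes f: "second_deriv f f1 f2" and g: "second_deriv g g1 g2"
    and e: "expdec f" "expdec f1" and b: "g \<in> bcontfun" "g1 \<in> bcontfun" and w: "expdec w"
    and eq: "\<And>x. f x * g2 x - f2 x * g x = w x"
  shows "(\<integral>x. w x \<partial>lborel) = 0"
proof (rule expdec_integral_deriv_0[OF _ _ w])
  show "expdec (\<lambda>x. f x * g1 x - f1 x * g x)" by (intro expdec_diff expdec_mult e b)
  have d: "(f has_real_derivative f1 x) (at x)" "(f1 has_real_derivative f2 x) (at x)"
    "(g has_real_derivative g1 x) (at x)" "(g1 has_real_derivative g2 x) (at x)" for x
    using f g by (auto simp: second_deriv_def has_real_derivative_iff_has_vector_derivative)
  show "((\<lambda>x. f x * g1 x - f1 x * g x) has_real_derivative w x) (at x)" for x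
    by (rule DERIV_cong[OF DERIV_diff[OF DERIV_mult[OF d(1) d(4)] DERIV_mult[OF d(2) d(3)]]])
       (simp add: eq[symmetric] algebra_simps)
qed

text \<open>From sinh y >= y + y^3/6 and tanh y >= y - y^3/3 the quartic terms cancel, and y^6/36
  remains as the strict surplus. This inequality is the source of the signs of both
  \<omega>-derivatives.\<close>

lemma sinh_tanh_inequality:
  fixes y :: real
  assumes y: "y > 0"
  shows "2 * y\<^sup>2 < (sinh y)\<^sup>2 + y * tanh y"
proof -
  have mono: "0 \<le> f x" if "f 0 = 0" "\<And>x. (f has_real_derivative f' x) (at x)" "\<And>x. x \<ge> 0 \<Longrightarrow> f' x \<ge> 0" "x \<ge> 0"
    for f f' :: "real \<Rightarrow> real" and x
    using DERIV_nonneg_imp_nondecreasing[of 0 x f] that by fastforce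
  have sinh_ge: "sinh x \<ge> x" if "x \<ge> 0" for x :: real
  proof -
    have "0 \<le> sinh x - x"
      by (rule mono[where f="\<lambda>x. sinh x - x" and f'="\<lambda>x. cosh x - 1"])
         (use that in \<open>auto intro!: derivative_eq_intros simp: cosh_real_ge_1\<close>)
    then show ?thesis by simp
  qed
  have cosh_ge: "cosh x \<ge> 1 + x\<^sup>2 / 2" if "x \<ge> 0" for x :: real
  proof -
    have "0 \<le> cosh x - 1 - x\<^sup>2 / 2"
      by (rule mono[where f="\<lambda>x. cosh x - 1 - x\<^sup>2 / 2" and f'="\<lambda>x. sinh x - x"])
         (use that sinh_ge in \<open>auto intro!: derivative_eq_intros\<close>)
    then show ?thesis by simp
  qed
  have sinh3: "sinh x \<ge> x + x ^ 3 / 6" if "x \<ge> 0" for x :: real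
  proof -
    have "0 \<le> sinh x - x - x ^ 3 / 6"
    proof (rule mono[where f="\<lambda>x. sinh x - x - x ^ 3 / 6" and f'="\<lambda>x. cosh x - 1 - x\<^sup>2 / 2"])
      show "0 \<le> cosh x - 1 - x\<^sup>2 / 2" if "x \<ge> 0" for x :: real using cosh_ge[OF that] by simp
    qed (use that in \<open>auto intro!: derivative_eq_intros\<close>)
    then show ?thesis by simp
  qed
  have tanh_le: "tanh x \<le> x" if "x \<ge> 0" for x :: real
  proof -
    have "0 \<le> x - tanh x"
      by (rule mono[where f="\<lambda>x. x - tanh x" and f'="\<lambda>x. (tanh x)\<^sup>2"])
         (use that in \<open>auto intro!: derivative_eq_intros\<close>)
    then show ?thesis by simp
  qed
  have tanh3: "tanh x \<ge> x - x ^ 3 / 3" if "x \<ge> 0" for x :: real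
  proof -
    have "0 \<le> tanh x - x + x ^ 3 / 3"
    proof (rule mono[where f="\<lambda>x. tanh x - x + x ^ 3 / 3" and f'="\<lambda>x. x\<^sup>2 - (tanh x)\<^sup>2"])
      show "0 \<le> x\<^sup>2 - (tanh x)\<^sup>2" if "x \<ge> 0" for x :: real using power_mono[OF tanh_le[OF that], of 2] that by simp
    qed (use that in \<open>auto intro!: derivative_eq_intros\<close>)
    then show ?thesis by simp
  qed
  have "(y + y ^ 3 / 6)\<^sup>2 \<le> (sinh y)\<^sup>2" using sinh3[of y] y by (intro power_mono) auto
  moreover have "y * (y - y ^ 3 / 3) \<le> y * tanh y" using tanh3[of y] y by (intro mult_left_mono) auto
  moreover have "(y + y ^ 3 / 6)\<^sup>2 + y * (y - y ^ 3 / 3) = 2 * y\<^sup>2 + y ^ 6 / 36"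
    by (simp add: eval_nat_numeral field_simps)
  moreover have "y ^ 6 > 0" using y by simp
  ultimately show ?thesis by linarith
qed

text \<open>With t = tanh y and 1 - t^2 = 1 / cosh^2 y it becomes the preceding inequality. In the
  application t^2 = \<beta>, and \<open>m\<close> is the second moment of the wave divided by 4
  \<kappa>.\<close>

lemma artanh_quotient_inequality:
  fixes t :: real
  assumes t: "0 < t" "t < 1"
  defines "m \<equiv> artanh t / t"
  shows "(1 - t\<^sup>2) * (2 * m\<^sup>2 - m) < 1"
proof -
  define y where "y = artanh t"
  have ty: "t = tanh y"
  proof -
    have "exp (2 * y) = (1 + t) / (1 - t)" using t by (simp add: y_def artanh_def)
    then have "exp (- (2 * y)) = (1 - t) / (1 + t)" using t by (simp add: exp_minus)
    moreover have "tanh y = (1 - exp (- (2 * y))) / (1 + exp (- (2 * y)))" using tanh_real_altdef[of y] by simp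
    ultimately have "tanh y = (1 - (1 - t) / (1 + t)) / (1 + (1 - t) / (1 + t))" by simp
    also have "\<dots> = t" using t by (simp add: field_simps)
    finally show ?thesis ..
  qed
  have y: "y > 0" using t ty by simp
  have ch: "cosh y > 0" by simp
  have t2: "1 - t\<^sup>2 = 1 / (cosh y)\<^sup>2"
  proof -
    have "1 - t\<^sup>2 = ((cosh y)\<^sup>2 - (sinh y)\<^sup>2) / (cosh y)\<^sup>2"
      unfolding ty tanh_def power_divide diff_divide_distrib using ch by simp
    then show ?thesis by (simp add: cosh_square_eq)
  qed
  have "2 * y\<^sup>2 - y * t < (sinh y)\<^sup>2" using sinh_tanh_inequality[OF y] by (simp add: ty)
  also have "(sinh y)\<^sup>2 = (tanh y)\<^sup>2 * (cosh y)\<^sup>2" using ch unfolding tanh_def by (simp add: power_divide)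
  also have "tanh y = t" by (rule ty[symmetric])
  finally have lt: "2 * y\<^sup>2 - y * t < t\<^sup>2 * (cosh y)\<^sup>2" .
  have "t\<^sup>2 * (cosh y)\<^sup>2 > 0" using t(1) ch by simp
  with lt have "(2 * y\<^sup>2 - y * t) / (t\<^sup>2 * (cosh y)\<^sup>2) < 1" by (simp only: divide_less_eq_1_pos)
  moreover have "(1 - t\<^sup>2) * (2 * m\<^sup>2 - m) = (2 * y\<^sup>2 - y * t) / (t\<^sup>2 * (cosh y)\<^sup>2)"
    unfolding t2 m_def y_def[symmetric] using t ch by (simp add: field_simps power2_eq_square)
  ultimately show ?thesis by simp
qed

context soliton
begin

section \<open>Moments of the wave\<close>

definition L :: "nat \<Rightarrow> real" where "L n = (\<integral>x. R x ^ n \<partial>lborel)"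

lemma Lam_L: "Lam n \<alpha> \<omega> = L n" by (simp add: Lam_def L_def R0_eq)

lemma R_bc: "R \<in> bcontfun" and R1_bc: "R1 \<in> bcontfun"
  using R_expdec R1_expdec by (auto intro: expdec_bcontfun)

lemma R_pow_expdec: "expdec (\<lambda>x. R x ^ Suc n)" by (rule expdec_power[OF R_expdec])

lemma Rn: "expdec (\<lambda>x. R x ^ 2)" "expdec (\<lambda>x. R x ^ 3)" "expdec (\<lambda>x. R x ^ 4)" "expdec (\<lambda>x. R x ^ 5)" "expdec (\<lambda>x. R x ^ 6)"
  using R_pow_expdec[of 1] R_pow_expdec[of 2] R_pow_expdec[of 3] R_pow_expdec[of 4] R_pow_expdec[of 5]
  by (simp_all add: eval_nat_numeral)

lemma R2_expdec: "expdec R2"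
  unfolding R2_def by (intro expdec_diff expdec_cmult R_expdec Rn)

lemmas R_integrable = expdec_integrable[OF R_expdec] expdec_integrable[OF Rn(1)] expdec_integrable[OF Rn(2)]
  expdec_integrable[OF Rn(3)] expdec_integrable[OF Rn(4)] expdec_integrable[OF Rn(5)]

lemma L_pos: "L 2 > 0" "L 4 > 0"
proof -
  have c: "continuous_on UNIV R" using R_bc by (simp add: bcontfun_def)
  have "0 < (\<integral>x. R x ^ n \<partial>lborel)" if "expdec (\<lambda>x. R x ^ n)" for n
  proof (rule integral_continuous_pos[where x=0])
    show "0 \<le> R x ^ n" for x using R_pos[of x] by simp
    show "0 < R 0 ^ n" using R_pos[of 0] by simp
  qed (intro continuous_intros c, rule expdec_integrable[OF that])
  then show "L 2 > 0" "L 4 > 0" using Rn by (auto simp: L_def)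
qed

text \<open>Integral of the derivative of R R', with R'^2 and R'' written as polynomials in R. It
  also accounts for the formula that \<open>Lamd2\<close> uses when \<beta> is nonzero.\<close>

lemma L_identity: "2 * \<omega> * L 2 = 3 / 2 * L 4 + 4 / 3 * \<alpha> * L 6"
proof -
  have "(\<integral>x. 2 * \<omega> * R x ^ 2 - (3 / 2 * R x ^ 4 + 4 / 3 * \<alpha> * R x ^ 6) \<partial>lborel) = 0"
  proof (rule expdec_integral_deriv_0)
    show "expdec (\<lambda>x. R x * R1 x)" by (intro expdec_mult2 R_expdec R1_expdec)
    show "expdec (\<lambda>x. 2 * \<omega> * R x ^ 2 - (3 / 2 * R x ^ 4 + 4 / 3 * \<alpha> * R x ^ 6))"
      by (intro expdec_diff expdec_add expdec_cmult Rn)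
    fix x
    have "((\<lambda>x. R x * R1 x) has_real_derivative R1 x * R1 x + R2 x * R x) (at x)"
      by (rule DERIV_mult[OF deriv_R deriv_R1])
    moreover have "R1 x * R1 x + R2 x * R x = 2 * \<omega> * R x ^ 2 - (3 / 2 * R x ^ 4 + 4 / 3 * \<alpha> * R x ^ 6)"
      using R1_sq[of x] unfolding R2_def by algebra
    ultimately show "((\<lambda>x. R x * R1 x) has_real_derivative 2 * \<omega> * R x ^ 2 - (3 / 2 * R x ^ 4 + 4 / 3 * \<alpha> * R x ^ 6)) (at x)"
      by simp
  qed
  then show ?thesis using R_integrable by (simp add: L_def)
qed

definition K :: real where "K = (\<integral>x. (R1 x)\<^sup>2 \<partial>lborel)"

lemma K_eq: "K = L 4 / 4 + \<alpha> * L 6 / 3"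
proof -
  have "K = \<omega> * L 2 - L 4 / 2 - \<alpha> * L 6 / 3"
    using R_integrable by (simp add: K_def R1_sq L_def)
  then show ?thesis using L_identity by simp
qed

lemma K_pos: "K > 0"
proof -
  have c: "continuous_on UNIV R1" using R1_bc by (simp add: bcontfun_def)
  have i: "integrable lborel (\<lambda>x. (R1 x)\<^sup>2)"
    unfolding power2_eq_square by (intro expdec_integrable expdec_mult2 R1_expdec)
  have "R1 1 \<noteq> 0" using kappa(1) omega s(1) r_pos[of 1] by (simp add: R1_def \<sigma>_def)
  then show ?thesis unfolding K_def
    by (intro integral_continuous_pos[where x=1]) (use i in \<open>auto intro!: continuous_intros c\<close>)
qed

text \<open>The integrand is the derivative of \<open>W\<close> = - 2 R'/R, because R R'' - R'^2 is
  R^2 times a polynomial in R. By the first integral, the logarithmic derivative tends to the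
  exponential rates at both ends, so \<open>W\<close> runs from - 2 \<kappa> to 2 \<kappa>.\<close>

lemma L24_identity: "L 2 + 4 / 3 * \<alpha> * L 4 = 4 * \<kappa>"
proof -
  define W where "W x = - 2 * (R1 x / R x)" for x
  have dW: "(W has_real_derivative R x ^ 2 + 4 / 3 * \<alpha> * R x ^ 4) (at x)" for x
  proof -
    have d: "(W has_real_derivative - 2 * ((R2 x * R x - R1 x * R1 x) / (R x * R x))) (at x)"
      unfolding W_def by (rule DERIV_cmult[OF DERIV_divide[OF deriv_R1 deriv_R]]) (use R_pos[of x] in simp)
    have "R2 x * R x - R1 x * R1 x = (- 1/2) * (R x ^ 2 + 4 / 3 * \<alpha> * R x ^ 4) * (R x * R x)"
      using R1_sq[of x] unfolding R2_def by algebra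
    then have e: "(R2 x * R x - R1 x * R1 x) / (R x * R x) = (- 1/2) * (R x ^ 2 + 4 / 3 * \<alpha> * R x ^ 4)"
      using R_pos[of x] by simp
    show ?thesis by (rule DERIV_cong[OF d], unfold e) (simp add: field_simps)
  qed
  have R0: "(R \<longlongrightarrow> 0) at_top" by (rule expdec_tendsto[OF R_expdec])
  have "((\<lambda>x. 2 * sqrt (\<omega> - R x ^ 2 / 2 - \<alpha> * R x ^ 4 / 3)) \<longlongrightarrow> 2 * sqrt (\<omega> - 0 ^ 2 / 2 - \<alpha> * 0 ^ 4 / 3)) at_top"
    by (intro tendsto_intros R0) auto
  then have t: "((\<lambda>x. 2 * sqrt (\<omega> - R x ^ 2 / 2 - \<alpha> * R x ^ 4 / 3)) \<longlongrightarrow> 2 * \<kappa>) at_top" by (simp add: \<kappa>_def)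
  have eq: "W x = 2 * sqrt (\<omega> - R x ^ 2 / 2 - \<alpha> * R x ^ 4 / 3)" if "x \<ge> 0" for x
  proof -
    have "0 \<le> 2 * \<kappa>\<^sup>2 * s * \<sigma> x * r x ^ 3"
      using that kappa(1) s r_pos[of x] by (intro mult_nonneg_nonneg) (auto simp: \<sigma>_def)
    then have "R1 x \<le> 0" by (simp add: R1_def)
    then have "- R1 x / R x = sqrt ((R1 x / R x)\<^sup>2)" using R_pos[of x] by (simp add: abs_of_nonpos divide_nonpos_pos)
    also have "(R1 x / R x)\<^sup>2 = \<omega> - R x ^ 2 / 2 - \<alpha> * R x ^ 4 / 3"
    proof -
      have "(R1 x)\<^sup>2 = (\<omega> - R x ^ 2 / 2 - \<alpha> * R x ^ 4 / 3) * (R x)\<^sup>2" using R1_sq[of x] by algebra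
      then show ?thesis using R_pos[of x] by (simp add: power_divide)
    qed
    finally show ?thesis by (simp add: W_def)
  qed
  have Wt: "(W \<longlongrightarrow> 2 * \<kappa>) at_top"
    by (rule Lim_transform_eventually[OF t]) (auto intro!: eventually_at_top_linorderI[of 0] simp: eq)
  have "W (- x) = - W x" for x by (simp add: W_def R_even R1_odd)
  then have Wb: "(W \<longlongrightarrow> - (2 * \<kappa>)) at_bot" using tendsto_minus[OF Wt] by (simp add: filterlim_at_bot_mirror)
  have e: "expdec (\<lambda>x. R x ^ 2 + 4 / 3 * \<alpha> * R x ^ 4)" by (intro expdec_add expdec_cmult Rn)
  have "(\<integral>x. R x ^ 2 + 4 / 3 * \<alpha> * R x ^ 4 \<partial>lborel) = 2 * \<kappa> - - (2 * \<kappa>)"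
    by (rule integral_line_eq_limits[OF _ _ expdec_integrable[OF e] Wb Wt])
       (use dW e in \<open>auto simp: has_real_derivative_iff_has_vector_derivative expdec_def\<close>)
  then show ?thesis using R_integrable by (simp add: L_def)
qed

text \<open>The solution \<open>z\<close> of \<open>z'' - Va z = R\<close> is the derivative of the wave with respect to \<open>\<omega>\<close>.
  It is a combination of \<open>x R'\<close>, \<open>R\<close> and \<open>R\<^sup>3\<close>, since \<open>\<partial>\<^sup>2 - Va\<close> maps these into the
  span of \<open>R\<close>, \<open>R\<^sup>3\<close> and \<open>R\<^sup>5\<close>.\<close>

definition c3 :: real where "c3 = \<alpha> / (3 * \<omega> * (1 - \<beta>))"
definition c2 :: real where "c2 = (1 - \<beta> / 2) / (2 * \<omega> * (1 - \<beta>))"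
definition z :: "real \<Rightarrow> real" where "z x = 1 / (2 * \<omega>) * (x * R1 x) + c2 * R x + c3 * R x ^ 3"
definition z1 :: "real \<Rightarrow> real" where
  "z1 x = 1 / (2 * \<omega>) * (R1 x + x * R2 x) + c2 * R1 x + c3 * (3 * R x ^ 2 * R1 x)"

text \<open>These two equations are the cancellation of R^3 and R^5 in z'' - Va z. As a linear
  system for \<open>c2\<close> and \<open>c3\<close> they have determinant - 6 (1 - \<beta>), which
  is where \<beta> < 1 is essential.\<close>

lemma c23: "2 * c2 + 8 * \<omega> * c3 = 1 / \<omega>" "4 * \<alpha> * c2 - 3 * c3 = \<alpha> / \<omega>"
proof -
  define d where "d = 1 - \<beta>"
  have b: "d \<noteq> 0" "\<omega> \<noteq> 0" "\<beta> = 1 - d" using beta_eq omega by (auto simp: d_def)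
  have al: "\<alpha> = - 3 * (1 - d) / (16 * \<omega>)" using beta_eq(1) b by (simp add: field_simps)
  show "2 * c2 + 8 * \<omega> * c3 = 1 / \<omega>" "4 * \<alpha> * c2 - 3 * c3 = \<alpha> / \<omega>"
    unfolding c2_def c3_def d_def[symmetric] unfolding b(3) unfolding al using b(1,2) by (simp_all add: field_simps)
qed

lemma xR1_second: "second_deriv (\<lambda>x. x * R1 x) (\<lambda>x. R1 x + x * R2 x) (\<lambda>x. 2 * R2 x + x * (Va x * R1 x))"
  by (rule second_deriv_real) (auto intro!: derivative_eq_intros deriv_R1 deriv_R2)

lemma xR_second: "second_deriv (\<lambda>x. x * R x) (\<lambda>x. R x + x * R1 x) (\<lambda>x. 2 * R1 x + x * R2 x)"
  by (rule second_deriv_real) (auto intro!: derivative_eq_intros deriv_R deriv_R1)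

lemma R3_second: "second_deriv (\<lambda>x. R x ^ 3) (\<lambda>x. 3 * R x ^ 2 * R1 x) (\<lambda>x. 6 * R x * R1 x ^ 2 + 3 * R x ^ 2 * R2 x)"
  by (rule second_deriv_real) (auto intro!: derivative_eq_intros deriv_R deriv_R1 simp: power2_eq_square)

lemma R_second': "second_deriv R R1 R2" by (rule second_deriv_real[OF deriv_R deriv_R1])

lemma z_second: "second_deriv z z1 (\<lambda>x. Va x * z x + R x)"
proof -
  have m: "second_deriv (\<lambda>x. k * u x) (\<lambda>x. k * u1 x) (\<lambda>x. k * u2 x)" if "second_deriv u u1 u2" for k :: real and u u1 u2
    using second_deriv_linear[OF bounded_linear_mult_right that] .
  have "second_deriv z z1 (\<lambda>x. 1 / (2 * \<omega>) * (2 * R2 x + x * (Va x * R1 x)) + c2 * R2 x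
     + c3 * (6 * R x * R1 x ^ 2 + 3 * R x ^ 2 * R2 x))"
    unfolding z_def[abs_def] z1_def[abs_def] by (intro second_deriv_add m xR1_second R_second' R3_second)
  moreover have "1 / (2 * \<omega>) * (2 * R2 x + x * (Va x * R1 x)) + c2 * R2 x
     + c3 * (6 * R x * R1 x ^ 2 + 3 * R x ^ 2 * R2 x) = Va x * z x + R x" for x
  proof -
    define i where "i = 1 / (2 * \<omega>)"
    have i: "2 * \<omega> * i = 1" "2 * c2 + 8 * \<omega> * c3 = 2 * i" "4 * \<alpha> * c2 - 3 * c3 = 2 * \<alpha> * i"
      using c23 omega by (auto simp: i_def)
    have "i * (2 * R2 x + x * (Va x * R1 x)) + c2 * R2 x + c3 * (6 * R x * (R1 x)\<^sup>2 + 3 * R x ^ 2 * R2 x)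
      - Va x * (i * (x * R1 x) + c2 * R x + c3 * R x ^ 3)
      = (2 * \<omega> * i) * R x + (2 * c2 + 8 * \<omega> * c3 - 2 * i) * R x ^ 3 + (4 * \<alpha> * c2 - 3 * c3 - 2 * \<alpha> * i) * R x ^ 5"
      unfolding R1_sq R2_def Va_def by algebra
    also have "\<dots> = R x" unfolding i by simp
    finally show ?thesis by (simp add: z_def i_def)
  qed
  ultimately show ?thesis by simp
qed

lemma xR_expdec: "expdec (\<lambda>x. x * R x)" "expdec (\<lambda>x. x * R1 x)" "expdec (\<lambda>x. x * R2 x)"
  by (intro expdec_times_x R_expdec R1_expdec R2_expdec)+

lemma z_expdec: "expdec z"
  unfolding z_def[abs_def] by (intro expdec_add expdec_cmult xR_expdec R_expdec Rn)

lemma z1_expdec: "expdec z1"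
proof -
  have "expdec (\<lambda>x. R x ^ 2 * R1 x)" by (intro expdec_mult2 Rn R1_expdec)
  then show ?thesis
    unfolding z1_def[abs_def] mult.assoc[of 3] by (intro expdec_add expdec_cmult xR_expdec R1_expdec)
qed

lemma z_even: "z (- x) = z x" by (simp add: z_def R_even R1_odd)

section \<open>Moments against the frequency derivative of the wave\<close>

definition Z :: "nat \<Rightarrow> real" where "Z n = (\<integral>x. z x * R x ^ n \<partial>lborel)"

lemma zR_expdec: "expdec (\<lambda>x. z x * R x)" "expdec (\<lambda>x. z x * R x ^ 3)" "expdec (\<lambda>x. z x * R x ^ 5)"
  by (intro expdec_mult2 z_expdec R_expdec Rn)+

lemmas zR_integrable = expdec_integrable[OF zR_expdec(1)] expdec_integrable[OF zR_expdec(2)] expdec_integrable[OF zR_expdec(3)]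

lemma xRR1_integral: "(\<integral>x. x * R x * R1 x \<partial>lborel) = - L 2 / 2" "integrable lborel (\<lambda>x. x * R x * R1 x)"
proof -
  have e: "expdec (\<lambda>x. x * R x * R1 x)" by (rule expdec_mult2[OF xR_expdec(1) R1_expdec])
  then show i: "integrable lborel (\<lambda>x. x * R x * R1 x)" by (rule expdec_integrable)
  have "(\<integral>x. R x ^ 2 + 2 * (x * R x * R1 x) \<partial>lborel) = 0"
  proof (rule expdec_integral_deriv_0)
    show "expdec (\<lambda>x. x * R x ^ 2)" by (intro expdec_times_x Rn)
    show "expdec (\<lambda>x. R x ^ 2 + 2 * (x * R x * R1 x))" by (intro expdec_add expdec_cmult Rn e)
    show "((\<lambda>x. x * R x ^ 2) has_real_derivative R x ^ 2 + 2 * (x * R x * R1 x)) (at x)" for x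
      by (auto intro!: derivative_eq_intros deriv_R)
  qed
  then show "(\<integral>x. x * R x * R1 x \<partial>lborel) = - L 2 / 2" using i R_integrable by (simp add: L_def)
qed

text \<open>Green's identity for \<open>z\<close> against R, R^3 and x R'. Since the operator sends
  each of them to a combination of powers of R, every choice yields one linear relation between the
  moments.\<close>

lemma Z_equations:
  "2 * Z 3 + 4 * \<alpha> * Z 5 = L 2" "8 * \<omega> * Z 3 - 3 * Z 5 = L 4" "\<omega> * Z 1 - Z 3 - \<alpha> * Z 5 = - L 2 / 4"
proof -
  have b: "R \<in> bcontfun" "R1 \<in> bcontfun" "(\<lambda>x. R x ^ 3) \<in> bcontfun" "(\<lambda>x. 3 * R x ^ 2 * R1 x) \<in> bcontfun"
    "(\<lambda>x. x * R1 x) \<in> bcontfun" "(\<lambda>x. R1 x + x * R2 x) \<in> bcontfun"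
    by (intro R_bc R1_bc expdec_bcontfun[OF Rn(2)] bcontfun_mult const_bcontfun expdec_bcontfun[OF Rn(1)]
      expdec_bcontfun[OF xR_expdec(2)] expdec_bcontfun[OF xR_expdec(3)] bcontfun_add)+
  have "(\<integral>x. 2 * (z x * R x ^ 3) + 4 * \<alpha> * (z x * R x ^ 5) - R x ^ 2 \<partial>lborel) = 0"
    by (rule green_real[OF z_second R_second' z_expdec z1_expdec b(1,2)])
       (intro expdec_diff expdec_add expdec_cmult zR_expdec Rn, unfold R2_def Va_def, algebra)
  then show "2 * Z 3 + 4 * \<alpha> * Z 5 = L 2" using zR_integrable R_integrable by (simp add: Z_def L_def)
  have "(\<integral>x. 8 * \<omega> * (z x * R x ^ 3) - 3 * (z x * R x ^ 5) - R x ^ 4 \<partial>lborel) = 0"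
    by (rule green_real[OF z_second R3_second z_expdec z1_expdec b(3,4)])
       (intro expdec_diff expdec_add expdec_cmult zR_expdec Rn, unfold R1_sq R2_def Va_def, algebra)
  then show "8 * \<omega> * Z 3 - 3 * Z 5 = L 4" using zR_integrable R_integrable by (simp add: Z_def L_def)
  have "(\<integral>x. 2 * (\<omega> * (z x * R x) - z x * R x ^ 3 - \<alpha> * (z x * R x ^ 5)) - x * R x * R1 x \<partial>lborel) = 0"
    by (rule green_real[OF z_second xR1_second z_expdec z1_expdec b(5,6)])
       (intro expdec_diff expdec_add expdec_cmult zR_expdec Rn expdec_mult2[OF xR_expdec(1) R1_expdec], unfold R2_def Va_def, algebra)
  then show "\<omega> * Z 1 - Z 3 - \<alpha> * Z 5 = - L 2 / 4" using zR_integrable xRR1_integral by (simp add: Z_def)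
qed

text \<open>Eliminating \<open>Z 5\<close> leaves the combination of moments from
  \<open>L24_identity\<close>; this is why the value is elementary although \<open>L 2\<close> and
  \<open>L 4\<close> involve artanh.\<close>

lemma Z3_eq: "Z 3 = 2 * \<kappa> / (1 - \<beta>)"
proof -
  have "\<alpha> * (8 * \<omega> * Z 3 - 3 * Z 5) = \<alpha> * L 4" by (simp only: Z_equations)
  with Z_equations(1) have "2 * (1 - \<beta>) * Z 3 = L 2 + 4 / 3 * \<alpha> * L 4"
    by (simp add: beta_eq(1) algebra_simps)
  then show ?thesis using beta_eq(3) unfolding L24_identity by (simp add: field_simps)
qed

lemma Z1_eq: "2 * \<omega> * Z 1 = Z 3"
  using Z_equations(1,3) by (simp add: algebra_simps)

lemma Z_pos: "Z 3 > 0" "Z 1 > 0"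
proof -
  show Z3: "Z 3 > 0" unfolding Z3_eq using kappa beta_eq by simp
  then have "2 * \<omega> * Z 1 > 0" using Z1_eq by simp
  then show "Z 1 > 0" using omega by (simp add: zero_less_mult_iff)
qed

text \<open>Merges the two branches of \<open>Lamd2\<close>: for nonzero \<beta> the formula is
  \<open>L_identity\<close> solved for \<open>L 6\<close>.\<close>

lemma Lamd2_L6: "Lamd2 \<alpha> \<omega> * L 4 = L 6"
proof (cases "\<beta> = 0")
  case True
  then show ?thesis using L_pos by (simp add: Lamd2_def \<beta>_def[symmetric] Lam_L)
next
  case False
  then have a: "\<alpha> \<noteq> 0" using beta_eq by auto
  have "8 * \<omega> / \<beta> = - 3 / (2 * \<alpha>)" using a omega by (simp add: beta_eq(1) field_simps)
  then have "Lamd2 \<alpha> \<omega> = 3 / (2 * \<alpha>) * (\<omega> * (L 2 / L 4) - 3/4)"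
    using False by (simp add: Lamd2_def \<beta>_def[symmetric] Lam24_def Lam_L)
  then have "Lamd2 \<alpha> \<omega> * L 4 = 3 / (2 * \<alpha>) * ((\<omega> * (L 2 / L 4) - 3/4) * L 4)" by simp
  also have "(\<omega> * (L 2 / L 4) - 3/4) * L 4 = \<omega> * L 2 - 3/4 * L 4" using L_pos by (simp add: left_diff_distrib)
  also have "\<omega> * L 2 - 3/4 * L 4 = 2 / 3 * \<alpha> * L 6" using L_identity by simp
  finally show ?thesis using a by simp
qed

text \<open>Integration by parts in one stroke: the integrand, plus terms without the factor x, is
  the derivative of x (2 a R R'' - a R'^2 + b R^2 + d1 R^4 + d2 R^6). The terms without x are
  moments, collected by \<open>K_eq\<close> and \<open>L_identity\<close>.\<close>

lemma odd_moment:
  "(\<integral>x. x * R x * (2 * a * (Va x * R1 x) + (2 * b + 4 * d1 * R x ^ 2 + 6 * d2 * R x ^ 4) * R1 x) \<partial>lborel)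
    = 3 * a * K - b * L 2 - d1 * L 4 - d2 * L 6"
proof -
  have e1: "expdec (\<lambda>x. x * R x * (2 * a * (Va x * R1 x) + (2 * b + 4 * d1 * R x ^ 2 + 6 * d2 * R x ^ 4) * R1 x))"
  proof (rule expdec_mult[OF xR_expdec(1)])
    have V: "Va \<in> bcontfun" using V_bounded Va_cont by (simp add: bcontfun_def)
    show "(\<lambda>x. 2 * a * (Va x * R1 x) + (2 * b + 4 * d1 * R x ^ 2 + 6 * d2 * R x ^ 4) * R1 x) \<in> bcontfun"
      by (intro bcontfun_add bcontfun_mult V R1_bc const_bcontfun expdec_bcontfun[OF Rn(1)] expdec_bcontfun[OF Rn(3)])
  qed
  have R1sq: "expdec (\<lambda>x. (R1 x)\<^sup>2)" unfolding power2_eq_square by (intro expdec_mult2 R1_expdec)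
  have e2: "expdec (\<lambda>x. 2 * a * (\<omega> * R x ^ 2 - R x ^ 4 - \<alpha> * R x ^ 6) - a * (R1 x)\<^sup>2 + b * R x ^ 2 + d1 * R x ^ 4 + d2 * R x ^ 6)"
    by (intro expdec_add expdec_diff expdec_cmult Rn R1sq)
  have "(\<integral>x. x * R x * (2 * a * (Va x * R1 x) + (2 * b + 4 * d1 * R x ^ 2 + 6 * d2 * R x ^ 4) * R1 x)
     + (2 * a * (\<omega> * R x ^ 2 - R x ^ 4 - \<alpha> * R x ^ 6) - a * (R1 x)\<^sup>2 + b * R x ^ 2 + d1 * R x ^ 4 + d2 * R x ^ 6) \<partial>lborel) = 0"
  proof (rule expdec_integral_deriv_0[OF _ _ expdec_add[OF e1 e2]])
    show "expdec (\<lambda>x. x * (2 * a * (R x * R2 x) - a * (R1 x)\<^sup>2 + b * R x ^ 2 + d1 * R x ^ 4 + d2 * R x ^ 6))"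
      by (intro expdec_times_x expdec_add expdec_diff expdec_cmult Rn R1sq expdec_mult2[OF R_expdec R2_expdec])
    fix x
    have "((\<lambda>x. x * (2 * a * (R x * R2 x) - a * (R1 x)\<^sup>2 + b * R x ^ 2 + d1 * R x ^ 4 + d2 * R x ^ 6)) has_real_derivative
       (2 * a * (R x * R2 x) - a * (R1 x)\<^sup>2 + b * R x ^ 2 + d1 * R x ^ 4 + d2 * R x ^ 6)
       + x * (2 * a * (R1 x * R2 x + R x * (Va x * R1 x)) - a * (2 * R1 x * R2 x) + b * (2 * R x * R1 x) + d1 * (4 * R x ^ 3 * R1 x) + d2 * (6 * R x ^ 5 * R1 x))) (at x)"
      by (auto intro!: derivative_eq_intros deriv_R deriv_R1 deriv_R2; algebra)
    then show "((\<lambda>x. x * (2 * a * (R x * R2 x) - a * (R1 x)\<^sup>2 + b * R x ^ 2 + d1 * R x ^ 4 + d2 * R x ^ 6)) has_real_derivative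
       x * R x * (2 * a * (Va x * R1 x) + (2 * b + 4 * d1 * R x ^ 2 + 6 * d2 * R x ^ 4) * R1 x)
     + (2 * a * (\<omega> * R x ^ 2 - R x ^ 4 - \<alpha> * R x ^ 6) - a * (R1 x)\<^sup>2 + b * R x ^ 2 + d1 * R x ^ 4 + d2 * R x ^ 6)) (at x)"
      by (rule DERIV_cong) (unfold R2_def, algebra)
  qed
  moreover have "(\<integral>x. 2 * a * (\<omega> * R x ^ 2 - R x ^ 4 - \<alpha> * R x ^ 6) - a * (R1 x)\<^sup>2 + b * R x ^ 2 + d1 * R x ^ 4 + d2 * R x ^ 6 \<partial>lborel)
     = 2 * a * (\<omega> * L 2 - L 4 - \<alpha> * L 6) - a * K + b * L 2 + d1 * L 4 + d2 * L 6"
    using R_integrable expdec_integrable[OF R1sq] by (simp add: L_def K_def)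
  moreover have "\<omega> * L 2 - L 4 - \<alpha> * L 6 = - K" using K_eq L_identity by simp
  ultimately show ?thesis using expdec_integrable[OF e1] expdec_integrable[OF e2] by simp
qed

text \<open>The antiderivative of R^2 is 4 \<kappa> / t times artanh (\<rho> tanh (\<kappa> x)) with
  t = sqrt \<beta>. The constant \<rho> satisfies \<rho>^2 (1 + s) = 1 - s, which matches
  \<open>D\<close>, and 2 artanh \<rho> = artanh t, which gives the final form.\<close>

lemma L2_closed:
  assumes "\<alpha> < 0"
  shows "L 2 = 4 * \<kappa> / sqrt \<beta> * artanh (sqrt \<beta>)"
proof -
  define t where "t = sqrt \<beta>"
  have b0: "\<beta> > 0" using assms omega by (simp add: beta_eq(1) mult_neg_pos)
  have t: "0 < t" "t < 1" "t\<^sup>2 = \<beta>" using b0 beta_eq(3) by (auto simp: t_def)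
  define \<rho> where "\<rho> = t / (1 + s)"
  have \<rho>: "0 < \<rho>" "\<rho> < 1" using t s by (auto simp: \<rho>_def divide_less_eq)
  have w1: "\<bar>\<rho> * tanh x\<bar> < 1" for x
  proof -
    have "\<bar>tanh x\<bar> < 1" using tanh_real_bounds[of x] by auto
    then show ?thesis using \<rho> by (simp add: abs_mult) (smt (verit) mult_left_le mult_nonneg_nonneg abs_ge_zero)
  qed
  define W where "W x = 4 * \<kappa> / t * artanh (\<rho> * tanh (\<kappa> * x))" for x
  have dW: "(W has_real_derivative R x ^ 2) (at x)" for x
  proof -
    define C where "C = cosh (\<kappa> * x)"
    define S where "S = sinh (\<kappa> * x)"
    have C: "C > 0" "C\<^sup>2 = 1 + S\<^sup>2" by (auto simp: C_def S_def cosh_square_eq)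
    have T: "tanh (\<kappa> * x) = S / C" by (simp add: tanh_def C_def S_def)
    have "(W has_real_derivative 4 * \<kappa> / t * (\<rho> * ((1 - (tanh (\<kappa> * x))\<^sup>2) * \<kappa>) / (1 - (\<rho> * tanh (\<kappa> * x))\<^sup>2))) (at x)"
    proof -
      have "((\<lambda>x. \<rho> * tanh (\<kappa> * x)) has_real_derivative \<rho> * ((1 - (tanh (\<kappa> * x))\<^sup>2) * \<kappa>)) (at x)"
        by (auto intro!: derivative_eq_intros)
      from DERIV_cmult[OF DERIV_chain2[OF artanh_real_has_field_derivative[OF w1] this], of "4 * \<kappa> / t"]
      show ?thesis unfolding W_def by (rule DERIV_cong) simp
    qed
    moreover have "4 * \<kappa> / t * (\<rho> * ((1 - (tanh (\<kappa> * x))\<^sup>2) * \<kappa>) / (1 - (\<rho> * tanh (\<kappa> * x))\<^sup>2)) = R x ^ 2"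
    proof -
      have Dx: "D x = (1 + s) * (C\<^sup>2 - \<rho>\<^sup>2 * S\<^sup>2)"
      proof -
        have "c x = 2 * C\<^sup>2 - 1" unfolding c_def C_def using cosh_double_cosh[of "\<kappa> * x"] by (simp add: mult.assoc)
        then have "D x = 1 + s * (2 * C\<^sup>2 - 1)" by (simp add: D_def)
        moreover have "\<rho>\<^sup>2 * (1 + s) = 1 - s"
        proof -
          have "\<rho>\<^sup>2 * (1 + s) = t\<^sup>2 / (1 + s)" using s by (simp add: \<rho>_def power_divide power2_eq_square)
          also have "t\<^sup>2 = (1 - s) * (1 + s)" using s(3) t(3) by (simp add: power2_eq_square algebra_simps)
          finally show ?thesis using s by simp
        qed
        ultimately show ?thesis using C(2) by algebra
      qed
      have "1 - (S / C)\<^sup>2 = (C\<^sup>2 - S\<^sup>2) / C\<^sup>2" using C(1) by (simp add: power_divide diff_divide_distrib)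
      then have n1: "1 - (S / C)\<^sup>2 = 1 / C\<^sup>2" by (simp add: C(2))
      have n2: "1 - (\<rho> * (S / C))\<^sup>2 = (C\<^sup>2 - \<rho>\<^sup>2 * S\<^sup>2) / C\<^sup>2"
        using C(1) by (simp add: power_mult_distrib power_divide diff_divide_distrib)
      have P: "C\<^sup>2 - \<rho>\<^sup>2 * S\<^sup>2 > 0" 
        by (rule zero_less_mult_pos[of "1 + s"]) (use Dx D_gt[of x] s in linarith)+
      have "4 * \<kappa> / t * (\<rho> * ((1 - (tanh (\<kappa> * x))\<^sup>2) * \<kappa>) / (1 - (\<rho> * tanh (\<kappa> * x))\<^sup>2))
         = 4 * \<kappa>\<^sup>2 * (\<rho> / t) / (C\<^sup>2 - \<rho>\<^sup>2 * S\<^sup>2)"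
        unfolding T n1 n2 using C(1) P by (simp add: power2_eq_square)
      also have "\<rho> / t = 1 / (1 + s)" using t by (simp add: \<rho>_def)
      also have "4 * \<kappa>\<^sup>2 * (1 / (1 + s)) / (C\<^sup>2 - \<rho>\<^sup>2 * S\<^sup>2) = 4 * \<omega> / D x" by (simp add: Dx kappa)
      also have "\<dots> = R x ^ 2" using R_sq_D[of x] D_gt[of x] by (simp add: field_simps)
      finally show ?thesis .
    qed
    ultimately show ?thesis by simp
  qed
  have lt: "filterlim (\<lambda>x. \<kappa> * x) at_top at_top"
    by (rule filterlim_tendsto_pos_mult_at_top[OF tendsto_const kappa(1) filterlim_ident])
  have tt: "((\<lambda>x. tanh (\<kappa> * x)) \<longlongrightarrow> 1) at_top"
    by (rule filterlim_compose[OF tanh_real_at_top lt])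
  have ic: "isCont (artanh :: real \<Rightarrow> real) (\<rho> * 1)"
    using \<rho> by (intro isCont_artanh continuous_ident) auto
  have "((\<lambda>x. artanh (\<rho> * tanh (\<kappa> * x))) \<longlongrightarrow> artanh (\<rho> * 1)) at_top"
    by (rule isCont_tendsto_compose[OF ic]) (intro tendsto_intros tt)
  then have Wt: "(W \<longlongrightarrow> 4 * \<kappa> / t * artanh \<rho>) at_top"
    unfolding W_def using tendsto_mult_left[of "\<lambda>x. artanh (\<rho> * tanh (\<kappa> * x))" "artanh \<rho>" at_top "4 * \<kappa> / t"] by simp
  have "W (- x) = - W x" for x using w1[of "\<kappa> * x"] by (simp add: W_def artanh_minus_real)
  then have Wb: "(W \<longlongrightarrow> - (4 * \<kappa> / t * artanh \<rho>)) at_bot" using tendsto_minus[OF Wt] by (simp add: filterlim_at_bot_mirror)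
  have "L 2 = 4 * \<kappa> / t * artanh \<rho> - - (4 * \<kappa> / t * artanh \<rho>)"
    unfolding L_def
    by (rule integral_line_eq_limits[OF _ _ expdec_integrable[OF Rn(1)] Wb Wt])
       (use dW Rn(1) in \<open>auto simp: has_real_derivative_iff_has_vector_derivative expdec_def\<close>)
  also have "\<dots> = 4 * \<kappa> / t * (2 * artanh \<rho>)" by simp
  also have "2 * artanh \<rho> = artanh t"
  proof -
    have pos: "1 + s + t > 0" "1 + s - t > 0" using t s by auto
    have "((1 + \<rho>) / (1 - \<rho>)) ^ 2 = (1 + t) / (1 - t)"
    proof -
      have s2: "s\<^sup>2 = 1 - t\<^sup>2" using s(3) t(3) by simp
      have "(1 + \<rho>) / (1 - \<rho>) = (1 + s + t) / (1 + s - t)"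
      proof -
        have "1 + \<rho> = (1 + s + t) / (1 + s)" "1 - \<rho> = (1 + s - t) / (1 + s)"
          using s by (simp_all add: \<rho>_def add_divide_distrib diff_divide_distrib)
        then show ?thesis using s by simp
      qed
      moreover have "(1 + s + t)\<^sup>2 * (1 - t) = (1 + t) * (1 + s - t)\<^sup>2" using s2 by algebra
      ultimately show ?thesis using pos t by (simp add: power_divide frac_eq_eq)
    qed
    moreover have "(1 + \<rho>) / (1 - \<rho>) > 0" using \<rho> by simp
    ultimately have "ln ((1 + t) / (1 - t)) = 2 * ln ((1 + \<rho>) / (1 - \<rho>))"
      by (metis ln_realpow of_nat_numeral)
    then show ?thesis by (simp add: artanh_def)
  qed
  finally show ?thesis by (simp add: t_def)
qed

section \<open>Derivatives of the constants with respect to \<omega> and their signs\<close>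

lemma nearby: "\<forall>\<^sub>F w in nhds \<omega>. soliton \<alpha> w"
proof -
  have "((\<lambda>w. beta \<alpha> w) \<longlongrightarrow> beta \<alpha> \<omega>) (nhds \<omega>)"
    unfolding beta_def by (intro tendsto_intros filterlim_ident)
  then have "\<forall>\<^sub>F w in nhds \<omega>. beta \<alpha> w < 1" using beta1 by (rule order_tendstoD(2))
  moreover have "\<forall>\<^sub>F w in nhds \<omega>. w > 0" by (rule order_tendstoD(1)[OF filterlim_ident omega])
  ultimately show ?thesis by eventually_elim (use alpha in \<open>simp add: soliton_def\<close>)
qed

lemma Lam4_eq: "\<alpha> < 0 \<Longrightarrow> Lam 4 \<alpha> \<omega> = 3 / (4 * \<alpha>) * (4 * sqrt \<omega> - Lam 2 \<alpha> \<omega>)"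
  using L24_identity by (simp add: Lam_L \<kappa>_def field_simps)

lemma Lam2_eq: "\<alpha> < 0 \<Longrightarrow> Lam 2 \<alpha> \<omega> = 4 / sqrt (- 16 / 3 * \<alpha>) * artanh (sqrt (- 16 / 3 * \<alpha>) * sqrt \<omega>)"
proof -
  assume a: "\<alpha> < 0"
  have "sqrt \<beta> = sqrt (- 16 / 3 * \<alpha>) * sqrt \<omega>" by (simp add: beta_eq(1) flip: real_sqrt_mult)
  moreover have "sqrt \<omega> > 0" using omega by simp
  ultimately show ?thesis using L2_closed[OF a] by (simp add: Lam_L \<kappa>_def)
qed

text \<open>The purely cubic case. The third identity integrates the derivative of R^3 R'; the other
  two are the general identities with the quintic term removed.\<close>

lemma Lam_zero: "\<alpha> = 0 \<Longrightarrow> Lam 2 \<alpha> \<omega> = 4 * sqrt \<omega>" "\<alpha> = 0 \<Longrightarrow> Lam 4 \<alpha> \<omega> = 16 / 3 * (\<omega> * sqrt \<omega>)"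
  "\<alpha> = 0 \<Longrightarrow> Lam 6 \<alpha> \<omega> = 8 / 5 * \<omega> * Lam 4 \<alpha> \<omega>"
proof -
  assume a: "\<alpha> = 0"
  have "4 / 3 * \<alpha> * L 4 = 0" "4 / 3 * \<alpha> * L 6 = 0" using a by simp_all
  then have "L 2 = 4 * \<kappa>" and 4: "2 * \<omega> * L 2 = 3 / 2 * L 4"
    using L24_identity L_identity by linarith+
  then have 2: "L 2 = 4 * sqrt \<omega>" by (simp add: \<kappa>_def)
  show "Lam 2 \<alpha> \<omega> = 4 * sqrt \<omega>" using 2 by (simp add: Lam_L)
  show "Lam 4 \<alpha> \<omega> = 16 / 3 * (\<omega> * sqrt \<omega>)" using 4 unfolding 2 by (simp add: Lam_L)
  have "(\<integral>x. 4 * \<omega> * R x ^ 4 - 5 / 2 * R x ^ 6 \<partial>lborel) = 0"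
  proof (rule expdec_integral_deriv_0)
    show "expdec (\<lambda>x. R x ^ 3 * R1 x)" by (intro expdec_mult2 Rn R1_expdec)
    show "expdec (\<lambda>x. 4 * \<omega> * R x ^ 4 - 5 / 2 * R x ^ 6)" by (intro expdec_diff expdec_cmult Rn)
    fix x
    have "\<alpha> * R x ^ 6 / 3 = 0" "\<alpha> * R x ^ 5 = 0" using a by simp_all
    then have r: "(R1 x)\<^sup>2 = \<omega> * R x ^ 2 - R x ^ 4 / 2" "R2 x = \<omega> * R x - R x ^ 3"
      using R1_sq[of x] R2_def[of x] by linarith+
    have "((\<lambda>x. R x ^ 3 * R1 x) has_real_derivative 3 * R x ^ 2 * (R1 x)\<^sup>2 + R x ^ 3 * R2 x) (at x)"
      by (auto intro!: derivative_eq_intros deriv_R deriv_R1 simp: power2_eq_square)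
    then show "((\<lambda>x. R x ^ 3 * R1 x) has_real_derivative 4 * \<omega> * R x ^ 4 - 5 / 2 * R x ^ 6) (at x)"
      by (rule DERIV_cong) (unfold r, simp add: eval_nat_numeral field_simps)
  qed
  then have "4 * \<omega> * L 4 = 5 / 2 * L 6" using R_integrable by (simp add: L_def)
  then show "Lam 6 \<alpha> \<omega> = 8 / 5 * \<omega> * Lam 4 \<alpha> \<omega>" by (simp add: Lam_L)
qed

lemma beta_zero: "\<alpha> = 0 \<Longrightarrow> \<beta> = 0"
  by (subst beta_eq(1)) simp

lemma beta_lt: "\<alpha> < 0 \<Longrightarrow> \<beta> > 0"
  using omega by (simp add: beta_eq(1) mult_neg_pos)

lemma Lamd2_zero: "\<alpha> = 0 \<Longrightarrow> Lamd2 \<alpha> \<omega> = 8 / 5 * \<omega>"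
proof -
  assume "\<alpha> = 0"
  then have "Lamd2 \<alpha> \<omega> * L 4 = (8 / 5 * \<omega>) * L 4"
    using Lam_zero(3) unfolding Lamd2_L6 Lam_L by blast
  then show ?thesis using L_pos(2) by simp
qed

lemma two_Z1: "2 * Z 1 = 2 / ((1 - \<beta>) * sqrt \<omega>)"
proof -
  have so: "sqrt \<omega> > 0" "sqrt \<omega> * sqrt \<omega> = \<omega>" using omega by auto
  have "2 * Z 1 = Z 3 / \<omega>" using Z1_eq omega by (simp add: field_simps)
  also have "\<dots> = 2 * sqrt \<omega> / ((1 - \<beta>) * (sqrt \<omega> * sqrt \<omega>))" unfolding Z3_eq so(2) by (simp add: \<kappa>_def)
  also have "\<dots> = 2 / ((1 - \<beta>) * sqrt \<omega>)"
  proof -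
    have "2 * y / (d * (y * y)) = 2 / (d * y)" if "y \<noteq> 0" for y d :: real using that by (simp add: field_simps)
    then show ?thesis using so(1) by (simp only: less_imp_neq not_sym)
  qed
  finally show ?thesis .
qed

text \<open>The value is what differentiation under the integral would give, as \<open>z\<close> is
  the \<omega>-derivative of \<open>R\<close>. It is proved from the closed forms, valid for all
  nearby \<omega>, and matched with the known value of \<open>Z 1\<close>; the case \<alpha> = 0 is
  separate because the closed form divides by sqrt \<beta>.\<close>

lemma dLam2: "(Lam 2 \<alpha> has_real_derivative 2 * Z 1) (at \<omega>)"
proof -
  have so: "sqrt \<omega> > 0" "sqrt \<omega> * sqrt \<omega> = \<omega>" using omega by auto
  note Z = two_Z1
  show ?thesis
  proof (cases "\<alpha> = 0")
    case True
    have "((\<lambda>w. 4 * sqrt w) has_real_derivative 2 * Z 1) (at \<omega>)"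
      unfolding Z using omega so beta_zero[OF True] by (auto intro!: derivative_eq_intros simp: field_simps)
    moreover have "\<forall>\<^sub>F w in nhds \<omega>. 4 * sqrt w = Lam 2 \<alpha> w"
      using nearby by eventually_elim (simp add: soliton.Lam_zero(1)[OF _ True])
    ultimately show ?thesis by (subst (asm) DERIV_cong_ev[OF refl _ refl])
  next
    case False
    then have a: "\<alpha> < 0" using alpha by simp
    define g where "g = sqrt (- 16 / 3 * \<alpha>)"
    have g: "g > 0" "g\<^sup>2 = - 16 / 3 * \<alpha>" using a by (auto simp: g_def)
    have gb: "(g * sqrt \<omega>)\<^sup>2 = \<beta>" using omega g(2) by (simp add: power_mult_distrib beta_eq(1))
    have lt: "\<bar>g * sqrt \<omega>\<bar> < 1" using gb beta_eq(3) by (metis abs_square_less_1)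
    have inner: "((\<lambda>w. g * sqrt w) has_real_derivative g / (2 * sqrt \<omega>)) (at \<omega>)"
      using omega by (auto intro!: derivative_eq_intros simp: field_simps)
    have "((\<lambda>w. 4 / g * artanh (g * sqrt w)) has_real_derivative 4 / g * (1 / (1 - (g * sqrt \<omega>)\<^sup>2) * (g / (2 * sqrt \<omega>)))) (at \<omega>)"
      by (rule DERIV_cmult[OF DERIV_chain2[OF artanh_real_has_field_derivative[OF lt] inner]])
    then have "((\<lambda>w. 4 / g * artanh (g * sqrt w)) has_real_derivative 2 * Z 1) (at \<omega>)"
      by (rule DERIV_cong) (unfold Z gb, use g(1) so(1) in \<open>simp add: mult.commute\<close>)
    moreover have "\<forall>\<^sub>F w in nhds \<omega>. 4 / g * artanh (g * sqrt w) = Lam 2 \<alpha> w"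
      using nearby by eventually_elim (simp add: soliton.Lam2_eq[OF _ a] g_def)
    ultimately show ?thesis by (subst (asm) DERIV_cong_ev[OF refl _ refl])
  qed
qed

lemma dLam4: "(Lam 4 \<alpha> has_real_derivative 4 * Z 3) (at \<omega>)"
proof -
  have so: "sqrt \<omega> > 0" "sqrt \<omega> * sqrt \<omega> = \<omega>" using omega by auto
  have Z: "4 * Z 3 = 8 * sqrt \<omega> / (1 - \<beta>)" using Z3_eq by (simp add: \<kappa>_def)
  show ?thesis
  proof (cases "\<alpha> = 0")
    case True
    have "((\<lambda>w. 16 / 3 * (w * sqrt w)) has_real_derivative 16 / 3 * (1 * sqrt \<omega> + (inverse (sqrt \<omega>) / 2) * \<omega>)) (at \<omega>)"
      using omega by (intro DERIV_cmult DERIV_mult DERIV_ident DERIV_real_sqrt)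
    moreover have "16 / 3 * (1 * sqrt \<omega> + (inverse (sqrt \<omega>) / 2) * \<omega>) = 4 * Z 3"
    proof -
      have "inverse (sqrt \<omega>) / 2 * \<omega> = sqrt \<omega> / 2"
        using real_div_sqrt[of \<omega>] omega by (simp add: field_simps)
      moreover note beta_zero[OF True]
      ultimately show ?thesis unfolding Z by simp
    qed
    ultimately have "((\<lambda>w. 16 / 3 * (w * sqrt w)) has_real_derivative 4 * Z 3) (at \<omega>)" by simp
    moreover have "\<forall>\<^sub>F w in nhds \<omega>. 16 / 3 * (w * sqrt w) = Lam 4 \<alpha> w"
      using nearby by eventually_elim (simp add: soliton.Lam_zero(2)[OF _ True])
    ultimately show ?thesis by (subst (asm) DERIV_cong_ev[OF refl _ refl])
  next
    case False
    then have a: "\<alpha> < 0" using alpha by simp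
    have "((\<lambda>w. 3 / (4 * \<alpha>) * (4 * sqrt w - Lam 2 \<alpha> w)) has_real_derivative
        3 / (4 * \<alpha>) * (4 * (inverse (sqrt \<omega>) / 2) - 2 * Z 1)) (at \<omega>)"
      using omega by (intro DERIV_cmult DERIV_diff dLam2 DERIV_real_sqrt)
    moreover have "3 / (4 * \<alpha>) * (4 * (inverse (sqrt \<omega>) / 2) - 2 * Z 1) = 4 * Z 3"
    proof -
      have "4 * (inverse (sqrt \<omega>) / 2) - 2 * Z 1 = - 2 * \<beta> / ((1 - \<beta>) * sqrt \<omega>)"
        unfolding two_Z1 using so(1) beta_eq(3) by (simp add: field_simps)
      also have "- 2 * \<beta> = 32 / 3 * \<alpha> * \<omega>" by (simp add: beta_eq(1))
      also have "32 / 3 * \<alpha> * \<omega> / ((1 - \<beta>) * sqrt \<omega>) = 32 / 3 * \<alpha> * (\<omega> / sqrt \<omega>) / (1 - \<beta>)"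
        by (simp add: mult.commute mult.left_commute)
      also have "\<omega> / sqrt \<omega> = sqrt \<omega>" using omega by (simp add: real_div_sqrt)
      finally have F: "4 * (inverse (sqrt \<omega>) / 2) - 2 * Z 1 = 32 / 3 * \<alpha> * sqrt \<omega> / (1 - \<beta>)" .
      show ?thesis unfolding F Z using a beta_eq(3) by (simp add: field_simps)
    qed
    ultimately have "((\<lambda>w. 3 / (4 * \<alpha>) * (4 * sqrt w - Lam 2 \<alpha> w)) has_real_derivative 4 * Z 3) (at \<omega>)" by simp
    moreover have "\<forall>\<^sub>F w in nhds \<omega>. 3 / (4 * \<alpha>) * (4 * sqrt w - Lam 2 \<alpha> w) = Lam 4 \<alpha> w"
      using nearby by eventually_elim (simp add: soliton.Lam4_eq[OF _ a])
    ultimately show ?thesis by (subst (asm) DERIV_cong_ev[OF refl _ refl])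
  qed
qed

lemma dLam24: "(Lam24 \<alpha> has_real_derivative (2 * Z 1 - 4 * Lam24 \<alpha> \<omega> * Z 3) / L 4) (at \<omega>)"
proof -
  have "((\<lambda>w. Lam 2 \<alpha> w / Lam 4 \<alpha> w) has_real_derivative (2 * Z 1 * L 4 - L 2 * (4 * Z 3)) / (L 4 * L 4)) (at \<omega>)"
    using DERIV_divide[OF dLam2 dLam4] L_pos by (simp add: Lam_L)
  moreover have "(2 * Z 1 * L 4 - L 2 * (4 * Z 3)) / (L 4 * L 4) = (2 * Z 1 - 4 * Lam24 \<alpha> \<omega> * Z 3) / L 4"
    using L_pos by (simp add: Lam24_def Lam_L field_simps)
  ultimately show ?thesis unfolding Lam24_def[abs_def] by simp
qed

text \<open>This is the quotient rule for \<open>L 6 / L 4\<close> with 6 Z 5 as the derivative of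
  \<open>L 6\<close>. For nonzero \<alpha> it is obtained through \<open>Lam24\<close>, on which
  \<open>Lamd2\<close> depends explicitly, with \<open>Z_equations\<close> linking
  \<open>Z 5\<close> to the other moments.\<close>

lemma dLamd2: "(Lamd2 \<alpha> has_real_derivative (6 * Z 5 - 4 * Lamd2 \<alpha> \<omega> * Z 3) / L 4) (at \<omega>)"
proof (cases "\<alpha> = 0")
  case True
  have "((\<lambda>w. 8 / 5 * w) has_real_derivative 8 / 5) (at \<omega>)" by (auto intro!: derivative_eq_intros)
  moreover have "8 / 5 = (6 * Z 5 - 4 * Lamd2 \<alpha> \<omega> * Z 3) / L 4"
  proof -
    have l: "Lamd2 \<alpha> \<omega> = 8 / 5 * \<omega>" by (rule Lamd2_zero[OF True])
    have p: "\<omega> * sqrt \<omega> > 0" using omega by simp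
    have L4: "L 4 = 16 / 3 * (\<omega> * sqrt \<omega>)" using Lam_zero(2)[OF True] by (simp add: Lam_L)
    have Z3: "Z 3 = 2 * sqrt \<omega>" using Z3_eq beta_zero[OF True] by (simp add: \<kappa>_def)
    have Z5: "3 * Z 5 = 8 * \<omega> * Z 3 - L 4" using Z_equations(2) by simp
    have num: "6 * Z 5 - 4 * Lamd2 \<alpha> \<omega> * Z 3 = (128 / 15) * (\<omega> * sqrt \<omega>)"
      using Z5 unfolding l Z3 L4 by (simp add: algebra_simps)
    show ?thesis unfolding num L4 using omega by simp
  qed
  moreover have "\<forall>\<^sub>F w in nhds \<omega>. 8 / 5 * w = Lamd2 \<alpha> w"
    using nearby
  proof eventually_elim
    case (elim w)
    have "Lam 4 \<alpha> w > 0" using soliton.L_pos(2)[OF elim] soliton.Lam_L[OF elim] by simp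
    then show ?case using soliton.Lam_zero(3)[OF elim True] True by (simp add: Lamd2_def beta_def)
  qed
  ultimately show ?thesis by (subst (asm) DERIV_cong_ev[OF refl _ refl]) simp_all
next
  case False
  have "((\<lambda>w. 3 / (2 * \<alpha>) * (w * Lam24 \<alpha> w - 3/4)) has_real_derivative
     3 / (2 * \<alpha>) * ((1 * Lam24 \<alpha> \<omega> + (2 * Z 1 - 4 * Lam24 \<alpha> \<omega> * Z 3) / L 4 * \<omega>) - 0)) (at \<omega>)"
    by (intro DERIV_cmult DERIV_diff DERIV_mult DERIV_ident dLam24 DERIV_const)
  moreover have "3 / (2 * \<alpha>) * ((1 * Lam24 \<alpha> \<omega> + (2 * Z 1 - 4 * Lam24 \<alpha> \<omega> * Z 3) / L 4 * \<omega>) - 0)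
     = (6 * Z 5 - 4 * Lamd2 \<alpha> \<omega> * Z 3) / L 4"
  proof -
    have L: "Lam24 \<alpha> \<omega> * L 4 = L 2" using L_pos by (simp add: Lam24_def Lam_L)
    have "8 * \<omega> / \<beta> = - 3 / (2 * \<alpha>)" using False omega by (simp add: beta_eq(1) field_simps)
    then have d: "Lamd2 \<alpha> \<omega> = 3 / (2 * \<alpha>) * (\<omega> * Lam24 \<alpha> \<omega> - 3/4)"
      using False omega by (simp add: Lamd2_def \<beta>_def[symmetric] beta_eq(1))
    have fac: "k * A - 4 * (k * B) * y = k * (A - 4 * B * y)" for k A B y :: real by (simp add: algebra_simps)
    have br': "L 2 - 2 * Z 3 - 4 * (\<omega> * Lam24 \<alpha> \<omega> - 3/4) * Z 3 = L 2 + Z 3 - 4 * \<omega> * Lam24 \<alpha> \<omega> * Z 3"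
      by (simp add: algebra_simps)
    have "L 2 - 2 * Z 3 = 4 * \<alpha> * Z 5" using Z_equations(1) by linarith
    then have z5: "6 * Z 5 = 3 / (2 * \<alpha>) * (L 2 - 2 * Z 3)" using False by simp
    have "6 * Z 5 - 4 * Lamd2 \<alpha> \<omega> * Z 3 = 3 / (2 * \<alpha>) * (L 2 + Z 3 - 4 * \<omega> * Lam24 \<alpha> \<omega> * Z 3)"
      unfolding d z5 fac br' ..
    also have "L 2 + Z 3 - 4 * \<omega> * Lam24 \<alpha> \<omega> * Z 3 = (Lam24 \<alpha> \<omega> + (2 * Z 1 - 4 * Lam24 \<alpha> \<omega> * Z 3) / L 4 * \<omega>) * L 4"
      using L_pos L Z1_eq by (simp add: field_simps)
    finally show ?thesis using L_pos by simp
  qed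
  ultimately have "((\<lambda>w. 3 / (2 * \<alpha>) * (w * Lam24 \<alpha> w - 3/4)) has_real_derivative
     (6 * Z 5 - 4 * Lamd2 \<alpha> \<omega> * Z 3) / L 4) (at \<omega>)" by simp
  moreover have "\<forall>\<^sub>F w in nhds \<omega>. 3 / (2 * \<alpha>) * (w * Lam24 \<alpha> w - 3/4) = Lamd2 \<alpha> w"
    using nearby
  proof eventually_elim
    case (elim w)
    then have w: "w > 0" by (simp add: soliton_def)
    have "8 * w / beta \<alpha> w = - 3 / (2 * \<alpha>)" using False w by (simp add: beta_def field_simps)
    then show ?case using False w by (simp add: Lamd2_def beta_def)
  qed
  ultimately show ?thesis by (subst (asm) DERIV_cong_ev[OF refl _ refl])
qed

text \<open>For \<alpha> < 0 both signs come from the single inequality br < 0, which is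
  \<open>artanh_quotient_inequality\<close> up to a positive factor; for \<alpha> = 0 all moments
  are explicit.\<close>

lemma derivative_signs:
  "(2 * Z 1 - 4 * Lam24 \<alpha> \<omega> * Z 3) / L 4 < 0" "(6 * Z 5 - 4 * Lamd2 \<alpha> \<omega> * Z 3) / L 4 > 0"
proof -
  have "(2 * Z 1 - 4 * Lam24 \<alpha> \<omega> * Z 3) / L 4 < 0 \<and> (6 * Z 5 - 4 * Lamd2 \<alpha> \<omega> * Z 3) / L 4 > 0"
  proof (cases "\<alpha> = 0")
    case True
    have so: "sqrt \<omega> > 0" "sqrt \<omega> * sqrt \<omega> = \<omega>" using omega by auto
    have l: "Lamd2 \<alpha> \<omega> = 8 / 5 * \<omega>" by (rule Lamd2_zero[OF True])
    have p: "\<omega> * sqrt \<omega> > 0" using omega by simp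
    have L4: "L 4 = 16 / 3 * (\<omega> * sqrt \<omega>)" using Lam_zero(2)[OF True] by (simp add: Lam_L)
    have L2: "L 2 = 4 * sqrt \<omega>" using Lam_zero(1)[OF True] by (simp add: Lam_L)
    have Z3: "Z 3 = 2 * sqrt \<omega>" using Z3_eq beta_zero[OF True] by (simp add: \<kappa>_def)
    have Z5: "3 * Z 5 = 8 * \<omega> * Z 3 - L 4" using Z_equations(2) by simp
    have Z1: "2 * Z 1 = Z 3 / \<omega>" using Z1_eq omega by (simp add: field_simps)
    have l24: "Lam24 \<alpha> \<omega> = 3 / (4 * \<omega>)" unfolding Lam24_def Lam_L L2 L4 using omega so(1) by (simp add: field_simps)
    have "2 * Z 1 - 4 * Lam24 \<alpha> \<omega> * Z 3 = - 2 * Z 3 / \<omega>" unfolding Z1 l24 using omega by (simp add: field_simps)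
    also have "\<dots> < 0" using omega Z_pos by (simp add: divide_neg_pos)
    finally have 1: "2 * Z 1 - 4 * Lam24 \<alpha> \<omega> * Z 3 < 0" .
    have "6 * Z 5 - 4 * Lamd2 \<alpha> \<omega> * Z 3 = (128 / 15) * (\<omega> * sqrt \<omega>)"
      using Z5 unfolding l Z3 L4 by (simp add: algebra_simps)
    then have "6 * Z 5 - 4 * Lamd2 \<alpha> \<omega> * Z 3 > 0" using p by simp
    with 1 show ?thesis using L_pos by (simp add: divide_neg_pos)
  next
    case False
    then have a: "\<alpha> < 0" using alpha by simp
    define t where "t = sqrt \<beta>"
    have t: "0 < t" "t < 1" "t\<^sup>2 = \<beta>" using beta_lt[OF a] beta_eq(3) by (auto simp: t_def)
    \<comment> \<open>In this variable L 2 = 4 \<kappa> m and \<beta> L 4 = 16 \<kappa>^3 (m - 1),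
      so every quantity below is rational in m, \<kappa> and \<beta>.\<close>
    define m where "m = artanh t / t"
    have star: "(1 - \<beta>) * (2 * m\<^sup>2 - m) < 1"
      using artanh_quotient_inequality[OF t(1,2)] unfolding m_def t(3) .
    have L2: "L 2 = 4 * \<kappa> * m" using L2_closed[OF a] by (simp add: m_def t_def)
    have L4: "\<beta> * L 4 = 16 * \<kappa> ^ 3 * (m - 1)"
    proof -
      have "4 / 3 * \<alpha> * L 4 = 4 * \<kappa> * (1 - m)" using L24_identity L2 by (simp add: algebra_simps)
      have "\<beta> * L 4 = - (4 * \<kappa>\<^sup>2) * (4 / 3 * \<alpha> * L 4)" by (subst beta_kappa) simp
      also have "4 / 3 * \<alpha> * L 4 = 4 * \<kappa> * (1 - m)" by fact
      finally show ?thesis by (simp add: algebra_simps power2_eq_square power3_eq_cube)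
    qed
    have "16 * \<kappa> ^ 3 * (m - 1) > 0" unfolding L4[symmetric] using t L_pos beta_lt[OF a] by simp
    then have m1: "m > 1" using kappa(1) by (simp add: zero_less_mult_iff)
    define d where "d = 1 - \<beta>"
    have d: "d > 0" using beta_eq(3) by (simp add: d_def)
    have Z3: "Z 3 = 2 * \<kappa> / d" using Z3_eq by (simp add: d_def)
    have l24: "4 * \<omega> * Lam24 \<alpha> \<omega> = m * \<beta> / (m - 1)"
    proof -
      have "L 4 = 16 * \<kappa> ^ 3 * (m - 1) / \<beta>" using L4 beta_lt[OF a] by (simp add: field_simps)
      then have "4 * \<kappa>\<^sup>2 * (L 2 / L 4) = m * \<beta> / (m - 1)"
        unfolding L2 using m1 kappa(1) beta_lt[OF a] by (simp add: power2_eq_square power3_eq_cube)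
      then show ?thesis by (simp add: Lam24_def Lam_L kappa)
    qed
    \<comment> \<open>The numerator for \<open>Lam24\<close> times \<omega> is br - L 2, and the
      numerator for \<open>Lamd2\<close> is 3 / (2 \<alpha>) times br. With \<alpha> < 0, a negative
      \<open>br\<close> settles both.\<close>
    define br where "br = L 2 + Z 3 - (4 * \<omega> * Lam24 \<alpha> \<omega>) * Z 3"
    have "br = 2 * \<kappa> / (d * (m - 1)) * (2 * m * (m - 1) * d + (m - 1) - m * \<beta>)"
      unfolding br_def l24 Z3 L2 using d m1 by (simp add: field_simps)
    also have "2 * m * (m - 1) * d + (m - 1) - m * \<beta> = (1 - \<beta>) * (2 * m\<^sup>2 - m) - 1"
      by (simp add: d_def power2_eq_square algebra_simps)
    also have "2 * \<kappa> / (d * (m - 1)) * ((1 - \<beta>) * (2 * m\<^sup>2 - m) - 1) < 0"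
      using star d m1 kappa(1) by (intro mult_pos_neg) auto
    finally have br: "br < 0" .
    have "\<omega> * (2 * Z 1 - 4 * Lam24 \<alpha> \<omega> * Z 3) = br - L 2"
      using Z1_eq by (simp add: br_def algebra_simps)
    then have "\<omega> * (2 * Z 1 - 4 * Lam24 \<alpha> \<omega> * Z 3) < 0" using br L_pos by simp
    then have 1: "2 * Z 1 - 4 * Lam24 \<alpha> \<omega> * Z 3 < 0" using omega by (simp add: mult_less_0_iff)
    have "8 * \<omega> / \<beta> = - 3 / (2 * \<alpha>)" using False omega by (simp add: beta_eq(1) field_simps)
    then have dd: "Lamd2 \<alpha> \<omega> = 3 / (2 * \<alpha>) * (\<omega> * Lam24 \<alpha> \<omega> - 3/4)"
      using False omega by (simp add: Lamd2_def \<beta>_def[symmetric] beta_eq(1))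
    have fac: "k * A - 4 * (k * B) * y = k * (A - 4 * B * y)" for k A B y :: real by (simp add: algebra_simps)
    have br': "L 2 - 2 * Z 3 - 4 * (\<omega> * Lam24 \<alpha> \<omega> - 3/4) * Z 3 = L 2 + Z 3 - 4 * \<omega> * Lam24 \<alpha> \<omega> * Z 3"
      by (simp add: algebra_simps)
    have "L 2 - 2 * Z 3 = 4 * \<alpha> * Z 5" using Z_equations(1) by linarith
    then have z5: "6 * Z 5 = 3 / (2 * \<alpha>) * (L 2 - 2 * Z 3)" using False by simp
    have "6 * Z 5 - 4 * Lamd2 \<alpha> \<omega> * Z 3 = 3 / (2 * \<alpha>) * br"
      unfolding dd br_def z5 fac br' ..
    also have "\<dots> > 0" using a br by (intro mult_neg_neg) (auto simp: divide_pos_neg)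
    finally show ?thesis using 1 L_pos by (simp add: divide_neg_pos)
  qed
  then show "(2 * Z 1 - 4 * Lam24 \<alpha> \<omega> * Z 3) / L 4 < 0" "(6 * Z 5 - 4 * Lamd2 \<alpha> \<omega> * Z 3) / L 4 > 0" by auto
qed

end

subsection \<open>Families that converge uniformly and decay uniformly\<close>

definition uclose :: "(real \<Rightarrow> real \<Rightarrow> 'a::metric_space) \<Rightarrow> (real \<Rightarrow> 'a) \<Rightarrow> bool" where
  "uclose f f0 \<longleftrightarrow> (\<forall>d>0. \<forall>\<^sub>F \<epsilon> in at_right 0. \<forall>x. dist (f \<epsilon> x) (f0 x) \<le> d)"

text \<open>The range of the limit is bounded, so for small \<epsilon> all values lie in a compact
  ball, on which \<open>G\<close> is uniformly continuous.\<close>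

lemma uclose_compose:
  fixes f0 :: "real \<Rightarrow> 'a::heine_borel" and G :: "'a \<Rightarrow> 'b::metric_space"
  assumes f: "uclose f f0" and b: "bounded (range f0)" and G: "continuous_on UNIV G"
  shows "uclose (\<lambda>\<epsilon> x. G (f \<epsilon> x)) (\<lambda>x. G (f0 x))"
  unfolding uclose_def
proof (intro allI impI)
  fix d :: real assume d: "d > 0"
  obtain y r where r: "range f0 \<subseteq> cball y r" using b bounded_subset_cball by blast
  define K where "K = cball y (r + 1)"
  have "uniformly_continuous_on K G"
    by (rule compact_uniformly_continuous) (auto simp: K_def intro: continuous_on_subset[OF G])
  then obtain e where e: "e > 0" "\<And>u v. u \<in> K \<Longrightarrow> v \<in> K \<Longrightarrow> dist v u < e \<Longrightarrow> dist (G v) (G u) < d"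
    unfolding uniformly_continuous_on_def using d by metis
  have "min (e/2) 1 > 0" using e by simp
  then have "\<forall>\<^sub>F \<epsilon> in at_right 0. \<forall>x. dist (f \<epsilon> x) (f0 x) \<le> min (e/2) 1"
    using f unfolding uclose_def by blast
  then show "\<forall>\<^sub>F \<epsilon> in at_right 0. \<forall>x. dist (G (f \<epsilon> x)) (G (f0 x)) \<le> d"
  proof eventually_elim
    case (elim \<epsilon>)
    show ?case
    proof
      fix x
      have 1: "dist (f \<epsilon> x) (f0 x) \<le> e/2" "dist (f \<epsilon> x) (f0 x) \<le> 1" using elim by auto
      have 2: "dist y (f0 x) \<le> r" using subsetD[OF r rangeI[of f0 x]] by simp
      then have "f0 x \<in> K" "f \<epsilon> x \<in> K"
        using 1(2) dist_triangle[of y "f \<epsilon> x" "f0 x"] by (auto simp: K_def dist_commute)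
      then show "dist (G (f \<epsilon> x)) (G (f0 x)) \<le> d" using e 1(1) by (intro less_imp_le e(2)) auto
    qed
  qed
qed

lemma uclose_Pair:
  assumes "uclose f f0" "uclose g g0"
  shows "uclose (\<lambda>\<epsilon> x. (f \<epsilon> x, g \<epsilon> x)) (\<lambda>x. (f0 x, g0 x))"
  unfolding uclose_def
proof (intro allI impI)
  fix d :: real assume d: "d > 0"
  then have "d / 2 > 0" by simp
  then have "\<forall>\<^sub>F \<epsilon> in at_right 0. \<forall>x. dist (f \<epsilon> x) (f0 x) \<le> d/2" "\<forall>\<^sub>F \<epsilon> in at_right 0. \<forall>x. dist (g \<epsilon> x) (g0 x) \<le> d/2"
    using assms unfolding uclose_def by blast+
  then show "\<forall>\<^sub>F \<epsilon> in at_right 0. \<forall>x. dist (f \<epsilon> x, g \<epsilon> x) (f0 x, g0 x) \<le> d"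
  proof eventually_elim
    case (elim \<epsilon>)
    show ?case
    proof
      fix x
      have "dist (f \<epsilon> x, g \<epsilon> x) (f0 x, g0 x) \<le> dist (f \<epsilon> x) (f0 x) + dist (g \<epsilon> x) (g0 x)"
        unfolding dist_prod_def by (simp add: sqrt_sum_squares_le_sum)
      then show "dist (f \<epsilon> x, g \<epsilon> x) (f0 x, g0 x) \<le> d" using elim(1)[rule_format, of x] elim(2)[rule_format, of x] by simp
    qed
  qed
qed

lemma uclose_const:
  assumes "(h \<longlongrightarrow> h0) (at_right 0)"
  shows "uclose (\<lambda>\<epsilon> x. h \<epsilon>) (\<lambda>x. h0)"
  unfolding uclose_def
proof (intro allI impI)
  fix d :: real assume "d > 0"
  then have "\<forall>\<^sub>F \<epsilon> in at_right 0. dist (h \<epsilon>) h0 < d" using assms by (rule tendstoD[rotated])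
  then show "\<forall>\<^sub>F \<epsilon> in at_right 0. \<forall>x::real. dist (h \<epsilon>) h0 \<le> d" by eventually_elim simp
qed

lemma uclose_mult_vec:
  fixes f0 :: "real \<Rightarrow> real^2" and M0 :: "real \<Rightarrow> real^2^2"
  assumes "uclose M M0" "bounded (range M0)" "uclose f f0" "bounded (range f0)"
  shows "uclose (\<lambda>\<epsilon> x. M \<epsilon> x *v f \<epsilon> x) (\<lambda>x. M0 x *v f0 x)"
proof -
  have "bounded (range (\<lambda>x. (M0 x, f0 x)))"
    by (rule bounded_subset[OF bounded_Times[OF assms(2,4)]]) auto
  moreover have "continuous_on UNIV (\<lambda>p :: (real^2^2) \<times> (real^2). fst p *v snd p)"
    by (intro continuous_intros)
  ultimately show ?thesis
    using uclose_compose[OF uclose_Pair[OF assms(1,3)], of "\<lambda>p. fst p *v snd p"] by simp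
qed

text \<open>Both the constant and the rate are independent of \<epsilon>; this uniformity lets
  pairings pass to the limit.\<close>

definition famdec :: "(real \<Rightarrow> real \<Rightarrow> 'a::real_normed_vector) \<Rightarrow> bool" where
  "famdec f \<longleftrightarrow> (\<exists>C k. k > 0 \<and> (\<forall>\<^sub>F \<epsilon> in at_right 0. \<forall>x. norm (f \<epsilon> x) \<le> C * exp (- k * \<bar>x\<bar>)))"

lemma norm_mult_vec_real: "norm ((M::real^2^2) *v v) \<le> 4 * norm M * norm v"
proof -
  have "norm (cvec (M *v v)) = norm (cplx M *v cvec v)"
    by (rule arg_cong[of _ _ norm]) (simp add: vec_eq_iff forall_2)
  also have "\<dots> \<le> mnorm (cplx M) * norm v" using norm_mult_vec[of "cplx M" "cvec v"] by simp
  also have "mnorm (cplx M) \<le> 4 * norm M"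
  proof -
    have "\<bar>M $ i $ j\<bar> \<le> norm M" for i j
      using order_trans[OF component_le_norm_cart[of "M $ i" j] Finite_Cartesian_Product.norm_nth_le[of M i]] .
    from this[of 1 1] this[of 1 2] this[of 2 1] this[of 2 2] show ?thesis by (simp add: mnorm_def)
  qed
  then have "mnorm (cplx M) * norm v \<le> 4 * norm M * norm v" by (rule mult_right_mono) simp
  finally show ?thesis by simp
qed

lemma famdec_mult_vec:
  fixes f :: "real \<Rightarrow> real \<Rightarrow> real^2" and M0 :: "real \<Rightarrow> real^2^2"
  assumes "uclose M M0" "bounded (range M0)" "famdec f"
  shows "famdec (\<lambda>\<epsilon> x. M \<epsilon> x *v f \<epsilon> x)"
proof -
  obtain C k where k: "k > 0" and C: "\<forall>\<^sub>F \<epsilon> in at_right 0. \<forall>x. norm (f \<epsilon> x) \<le> C * exp (- k * \<bar>x\<bar>)"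
    using assms(3) by (auto simp: famdec_def)
  obtain m where m: "\<And>x. norm (M0 x) \<le> m" using assms(2) by (auto simp: bounded_iff)
  have m0: "m \<ge> 0" using order_trans[OF norm_ge_zero m] .
  have "\<forall>\<^sub>F \<epsilon> in at_right 0. \<forall>x. dist (M \<epsilon> x) (M0 x) \<le> 1" using assms(1) by (auto simp: uclose_def)
  with C have "\<forall>\<^sub>F \<epsilon> in at_right 0. \<forall>x. norm (M \<epsilon> x *v f \<epsilon> x) \<le> (4 * (m + 1) * C) * exp (- k * \<bar>x\<bar>)"
  proof eventually_elim
    case (elim \<epsilon>)
    show ?case
    proof
      fix x
      have "norm (M \<epsilon> x) \<le> m + 1"
        using elim(2)[rule_format, of x] m[of x] norm_triangle_ineq2[of "M \<epsilon> x" "M0 x"] by (simp add: dist_norm)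
      then have "4 * norm (M \<epsilon> x) * norm (f \<epsilon> x) \<le> 4 * (m + 1) * (C * exp (- k * \<bar>x\<bar>))"
        using elim(1)[rule_format, of x] m0 by (intro mult_mono) auto
      then show "norm (M \<epsilon> x *v f \<epsilon> x) \<le> (4 * (m + 1) * C) * exp (- k * \<bar>x\<bar>)"
        using norm_mult_vec_real[of "M \<epsilon> x" "f \<epsilon> x"] by (simp add: mult.assoc)
    qed
  qed
  then show ?thesis using k unfolding famdec_def by blast
qed

lemma famdec_limit:
  fixes f0 :: "real \<Rightarrow> 'a::real_normed_vector"
  assumes "uclose f f0" and C: "\<forall>\<^sub>F \<epsilon> in at_right 0. \<forall>x. norm (f \<epsilon> x) \<le> C * exp (- k * \<bar>x\<bar>)"
  shows "norm (f0 x) \<le> C * exp (- k * \<bar>x\<bar>)"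
proof (rule field_le_epsilon)
  fix d :: real assume "d > 0"
  then have "\<forall>\<^sub>F \<epsilon> in at_right 0. \<forall>x. dist (f \<epsilon> x) (f0 x) \<le> d" using assms by (auto simp: uclose_def)
  from eventually_happens[OF eventually_conj[OF this C]] obtain \<epsilon>
    where "dist (f \<epsilon> x) (f0 x) \<le> d" "norm (f \<epsilon> x) \<le> C * exp (- k * \<bar>x\<bar>)" by auto
  then show "norm (f0 x) \<le> C * exp (- k * \<bar>x\<bar>) + d"
    using norm_triangle_ineq2[of "f0 x" "f \<epsilon> x"] by (simp add: dist_norm norm_minus_commute)
qed

text \<open>Interpolating the uniform bound \<open>\<delta>\<close> and the decay \<open>2 C exp (-k |x|)\<close> by their geometric mean
  makes the difference small in \<open>L\<^sup>1\<close>.\<close>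

lemma uclose_famdec_pclose:
  assumes u: "uclose f f0" and d: "famdec f"
    and c: "\<forall>\<^sub>F \<epsilon> in at_right 0. continuous_on UNIV (f \<epsilon>)" and c0: "continuous_on UNIV f0" and e: "e > 0"
  shows "\<forall>\<^sub>F \<epsilon> in at_right 0. pclose e (f \<epsilon>) f0" and "expdec f0"
proof -
  obtain C k where k: "k > 0" and C: "\<forall>\<^sub>F \<epsilon> in at_right 0. \<forall>x. norm (f \<epsilon> x) \<le> C * exp (- k * \<bar>x\<bar>)"
    using d by (auto simp: famdec_def)
  note C0 = famdec_limit[OF u C]
  have Cn: "C \<ge> 0" using order_trans[OF norm_ge_zero C0[of 0]] by simp
  show e0: "expdec f0" using c0 k C0 by (auto simp: expdec_def)
  \<comment> \<open>\<open>pair_bound\<close> at rate k/2 has the factor 16 B / k, which is then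
    exactly e. Below, \<open>\<delta>\<close> makes the product of the two available bounds equal to
    the square of the target bound; the 1 in 2 C + 1 avoids a zero denominator.\<close>
  define B where "B = e * k / 16"
  have B: "B > 0" using e k by (simp add: B_def)
  define \<delta> where "\<delta> = B\<^sup>2 / (2 * C + 1)"
  have \<delta>: "\<delta> > 0" using B Cn by (simp add: \<delta>_def)
  have "\<forall>\<^sub>F \<epsilon> in at_right 0. \<forall>x. dist (f \<epsilon> x) (f0 x) \<le> \<delta>" using u \<delta> by (auto simp: uclose_def)
  with C c show "\<forall>\<^sub>F \<epsilon> in at_right 0. pclose e (f \<epsilon>) f0"
  proof eventually_elim
    case (elim \<epsilon>)
    have ef: "expdec (f \<epsilon>)" using elim k by (auto simp: expdec_def)
    have b: "norm (f \<epsilon> x - f0 x) \<le> B * exp (- (k/2) * \<bar>x\<bar>)" for x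
    proof -
      have 1: "norm (f \<epsilon> x - f0 x) \<le> \<delta>" using elim(3) by (simp add: dist_norm)
      have 2: "norm (f \<epsilon> x - f0 x) \<le> (2 * C + 1) * exp (- k * \<bar>x\<bar>)"
      proof -
        have "norm (f \<epsilon> x - f0 x) \<le> C * exp (- k * \<bar>x\<bar>) + C * exp (- k * \<bar>x\<bar>)"
          by (rule order_trans[OF norm_triangle_ineq4 add_mono[OF _ C0]]) (use elim(1) in blast)
        also have "\<dots> \<le> (2 * C + 1) * exp (- k * \<bar>x\<bar>)"
          using exp_ge_zero[of "- k * \<bar>x\<bar>"] by (simp add: algebra_simps)
        finally show ?thesis .
      qed
      have "(norm (f \<epsilon> x - f0 x))\<^sup>2 \<le> \<delta> * ((2 * C + 1) * exp (- k * \<bar>x\<bar>))"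
        unfolding power2_eq_square by (rule mult_mono[OF 1 2]) (use \<delta> in simp_all)
      also have "\<dots> = (B * exp (- (k/2) * \<bar>x\<bar>))\<^sup>2"
      proof -
        have "exp (- k * \<bar>x\<bar>) = (exp (- (k/2) * \<bar>x\<bar>))\<^sup>2" by (simp add: power2_eq_square flip: exp_add)
        then show ?thesis using Cn by (simp add: \<delta>_def power_mult_distrib)
      qed
      finally show ?thesis by (rule power2_le_imp_le) (use B in simp)
    qed
    have cd: "continuous_on UNIV (\<lambda>x. f \<epsilon> x - f0 x)" by (intro continuous_intros elim c0)
    have bd: "bdot (x - y) v = bdot x v - bdot y v" for x y v by (simp add: bdot_def algebra_simps)
    have "cmod (pair (f \<epsilon>) v - pair f0 v) \<le> e * m" if v: "v \<in> bcontfun" and m: "\<And>x. norm (v x) \<le> m" for v m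
    proof -
      have "pair (f \<epsilon>) v - pair f0 v = pair (\<lambda>x. f \<epsilon> x - f0 x) v"
        unfolding pair_def bd using pair_integrable[OF ef v] pair_integrable[OF e0 v] by simp
      moreover have "cmod (pair (\<lambda>x. f \<epsilon> x - f0 x) v) \<le> 8 * B * m / (k/2)"
        by (rule pair_bound[OF _ cd b _ m]) (use k v in \<open>auto simp: bcontfun_def\<close>)
      ultimately show ?thesis using k by (simp add: B_def)
    qed
    then show ?case using ef by (simp add: pclose_def)
  qed
qed

text \<open>Where the coefficient matrix is within \<omega>/2 of \<omega> times the identity, u .
  u'' is at least \<omega>/2 |u|^2, which is the hypothesis of the comparison argument with k = sqrt
  \<omega>.\<close>

lemma decay_of_solution:
  fixes u :: "real \<Rightarrow> complex^2"
  assumes w: "\<omega> > 0" and u: "second_deriv u u1 (\<lambda>x. N x *v u x)" and b: "\<And>x. norm (u x) \<le> m"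
    and N: "\<And>x. \<bar>x\<bar> \<ge> X \<Longrightarrow> mnorm (N x - m2 (of_real \<omega>) 0 0 (of_real \<omega>)) \<le> \<omega> / 2"
  shows "norm (u x) \<le> m * exp (sqrt \<omega> * X / 2) * exp (- (sqrt \<omega> / 2) * \<bar>x\<bar>)"
proof (rule exponential_decay_line[OF u _ _ b])
  show "sqrt \<omega> > 0" using w by simp
  fix x assume x: "\<bar>x\<bar> \<ge> X"
  define M where "M = N x - m2 (of_real \<omega>) 0 0 (of_real \<omega>)"
  have "N x *v u x = \<omega> *\<^sub>R u x + M *v u x"
    by (simp add: M_def vec_eq_iff forall_2 scaleR_complex algebra_simps)
  then have eq: "u x \<bullet> (N x *v u x) = \<omega> * (norm (u x))\<^sup>2 + u x \<bullet> (M *v u x)"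
    by (simp only: inner_add_right inner_scaleR_right power2_norm_eq_inner)
  have le: "\<bar>u x \<bullet> (M *v u x)\<bar> \<le> \<omega> / 2 * (norm (u x))\<^sup>2"
  proof -
    have "\<bar>u x \<bullet> (M *v u x)\<bar> \<le> norm (u x) * norm (M *v u x)" by (rule Cauchy_Schwarz_ineq2)
    also have "\<dots> \<le> norm (u x) * (\<omega> / 2 * norm (u x))"
      using norm_mult_vec[of M "u x"] mult_right_mono[OF N[OF x, folded M_def] norm_ge_zero[of "u x"]]
      by (intro mult_left_mono) auto
    finally show ?thesis by (simp add: power2_eq_square mult_ac)
  qed
  have "k / 2 * n \<le> k * n + y" if "\<bar>y\<bar> \<le> k / 2 * n" for k n y :: real using that by (simp add: abs_le_iff)
  from this[OF le] have "\<omega> / 2 * (norm (u x))\<^sup>2 \<le> u x \<bullet> (N x *v u x)" unfolding eq .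
  then show "(sqrt \<omega>)\<^sup>2 / 2 * (norm (u x))\<^sup>2 \<le> u x \<bullet> (N x *v u x)" using w by simp
qed

lemma green_pairing:
  assumes f: "second_deriv f f1 f2" and e: "expdec f" "expdec f1"
    and w: "second_deriv w w1 w2" and b: "w \<in> bcontfun" "w1 \<in> bcontfun"
    and r: "integrable lborel r" "continuous_on UNIV r" and eq: "\<And>x. bdot (f x) (w2 x) - bdot (f2 x) (w x) = r x"
  shows "(\<integral>x. r x \<partial>lborel) = 0"
proof -
  define W where "W x = bdot (f x) (w1 x) - bdot (f1 x) (w x)" for x
  have dW: "(W has_vector_derivative r x) (at x)" for x
    unfolding W_def
    by (rule has_vector_derivative_eq_rhs[OF has_vector_derivative_diff[OF
          has_vector_derivative_bdot[OF second_derivD(1)[OF f] second_derivD(2)[OF w]]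
          has_vector_derivative_bdot[OF second_derivD(2)[OF f] second_derivD(1)[OF w]]]])
       (simp add: eq[symmetric])
  have "expdec (\<lambda>x. bdot (g x) (v x))" if g: "expdec g" and v: "v \<in> bcontfun" for g v
  proof -
    obtain m where m: "\<And>x. norm (v x) \<le> m" using v by (auto simp: bcontfun_def bounded_iff)
    show ?thesis
    proof (rule expdec_comparison[OF g, where K="2 * m"])
      show "continuous_on UNIV (\<lambda>x. bdot (g x) (v x))"
        using g v by (intro continuous_intros) (auto simp: expdec_def bcontfun_def)
      show "norm (bdot (g x) (v x)) \<le> 2 * m * norm (g x)" for x
        using norm_bdot[of "g x" "v x"] mult_left_mono[OF m[of x], of "2 * norm (g x)"] by (simp add: mult_ac)
    qed
  qed
  note x = this[OF e(1) b(2)] this[OF e(2) b(1)]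
  have t: "(W \<longlongrightarrow> 0 - 0) at_top" "(W \<longlongrightarrow> 0 - 0) at_bot"
    unfolding W_def by (intro tendsto_diff expdec_tendsto x)+
  show ?thesis using integral_line_eq_limits[OF dW r(2,1) t(2,1)] by simp
qed

subsection \<open>The branch of solitary waves\<close>

lemma bounded_continuous_compose:
  fixes f0 :: "real \<Rightarrow> 'a::heine_borel" and G :: "'a \<Rightarrow> 'b::metric_space"
  assumes "bounded (range f0)" "continuous_on UNIV G"
  shows "bounded (range (\<lambda>x. G (f0 x)))"
proof -
  have "compact (G ` closure (range f0))"
    using assms by (intro compact_continuous_image) (auto intro: continuous_on_subset simp: compact_closure)
  then have "bounded (G ` closure (range f0))" by (rule compact_imp_bounded)
  then show ?thesis by (rule bounded_subset) (auto intro: subsetD[OF closure_subset])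
qed

locale branch = soliton +
  fixes a b d2 :: real and d1s :: "real \<Rightarrow> real" and A :: "real \<Rightarrow> real \<Rightarrow>\<^sub>C (real^2)"
  assumes branch: "bright_branch \<alpha> a b d2 \<omega> d1s A"
begin

section \<open>Algebra of the nonlinearity, its derivative and the adjoint\<close>

definition rho :: "real^2 \<Rightarrow> real" where "rho v = (v $ 1)\<^sup>2 + (v $ 2)\<^sup>2"
definition mm :: "real^2 \<Rightarrow> real" where "mm v = - \<omega> + rho v + \<alpha> * (rho v)\<^sup>2"
definition nn :: "real \<Rightarrow> real^2 \<Rightarrow> real" where "nn d v = b + d * rho v + d2 * (rho v)\<^sup>2"
definition mm1 :: "real^2 \<Rightarrow> real" where "mm1 v = 1 + 2 * \<alpha> * rho v"
definition nn1 :: "real \<Rightarrow> real^2 \<Rightarrow> real" where "nn1 d v = d + 2 * d2 * rho v"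
text \<open>\<open>F\<close> acts as a combination of the identity and \<open>J\<close> whose
  coefficients depend on |v|^2 only, which is its rotation invariance. \<open>mm1\<close> and
  \<open>nn1\<close> are the derivatives of these coefficients in |v|^2, from which
  \<open>DFm\<close> is the Jacobian matrix.\<close>

definition Cm :: "real \<Rightarrow> real \<Rightarrow> real^2 \<Rightarrow> real^2^2" where
  "Cm e d v = m2 (mm v) (- (e * nn d v)) (e * nn d v) (mm v)"
definition DFm :: "real \<Rightarrow> real \<Rightarrow> real^2 \<Rightarrow> real^2^2" where
  "DFm e d v = m2
     (mm v + 2 * v$1 * (mm1 v * v$1 - e * nn1 d v * v$2)) (- (e * nn d v) + 2 * v$2 * (mm1 v * v$1 - e * nn1 d v * v$2))
     (e * nn d v + 2 * v$1 * (mm1 v * v$2 + e * nn1 d v * v$1)) (mm v + 2 * v$2 * (mm1 v * v$2 + e * nn1 d v * v$1))"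
definition Binv :: "real \<Rightarrow> real^2^2" where
  "Binv e = m2 (1 / (1 + (e * a)\<^sup>2)) (e * a / (1 + (e * a)\<^sup>2)) (- (e * a) / (1 + (e * a)\<^sup>2)) (1 / (1 + (e * a)\<^sup>2))"
text \<open>After multiplication by the inverse of \<open>B\<close>, the wave satisfies A'' = GG A,
  its linearization is u'' = MM u, and \<open>Em\<close> carries the spectral parameter.\<close>

definition Em :: "real \<Rightarrow> real^2^2" where "Em e = Binv e ** J"
definition GG :: "real \<Rightarrow> real \<Rightarrow> real^2 \<Rightarrow> real^2^2" where "GG e d v = - (Binv e ** Cm e d v)"
definition MM :: "real \<Rightarrow> real \<Rightarrow> real^2 \<Rightarrow> real^2^2" where "MM e d v = - (Binv e ** DFm e d v)"

lemma mat_mult_nth [simp]: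
  fixes P Q :: "'a::semiring_1^2^2"
  shows "(P ** Q) $ i $ j = P $ i $ 1 * Q $ 1 $ j + P $ i $ 2 * Q $ 2 $ j"
  by (simp add: matrix_matrix_mult_def sum_2)

lemma B_nth [simp]: "B a e $ 1 $ 1 = 1" "B a e $ 1 $ 2 = - (e * a)" "B a e $ 2 $ 1 = e * a" "B a e $ 2 $ 2 = 1"
  by (simp_all add: B_def mat_def)

lemma den: "1 + (e * a)\<^sup>2 \<noteq> 0" by (metis add_pos_nonneg less_irrefl zero_le_power2 zero_less_one)

lemma Binv_nth [simp]:
  "Binv e $ 1 $ 1 = 1 / (1 + (e * a)\<^sup>2)" "Binv e $ 1 $ 2 = e * a / (1 + (e * a)\<^sup>2)"
  "Binv e $ 2 $ 1 = - (e * a) / (1 + (e * a)\<^sup>2)" "Binv e $ 2 $ 2 = 1 / (1 + (e * a)\<^sup>2)"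
  by (simp_all add: Binv_def)

lemma B_Binv: "B a e ** Binv e = mat 1" "Binv e ** B a e = mat 1"
  using den[of e, unfolded power2_eq_square]
  by (simp_all add: vec_eq_iff forall_2 mat_def power2_eq_square flip: add_divide_distrib)

lemma B_Em: "B a e ** Em e = J"
  unfolding Em_def matrix_mul_assoc B_Binv by simp

lemma cplx_mult: "cplx (P ** Q) *v v = cplx P *v (cplx Q *v v)"
  by (simp add: vec_eq_iff forall_2 algebra_simps)

lemma cplx_mat1: "cplx (mat 1) *v v = v" by (simp add: vec_eq_iff forall_2 mat_def)

lemma rho_norm: "(norm v)\<^sup>2 = rho v"
  by (simp add: rho_def norm_vec_def L2_set_def sum_2)

lemma F_eq: "F \<alpha> b d d2 \<omega> e v = Cm e d v *v v"
proof -
  have "(norm v) ^ 4 = (rho v)\<^sup>2" using rho_norm[of v] by (simp flip: power_mult rho_norm)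
  then show ?thesis
    by (simp add: F_def vec_eq_iff forall_2 rho_norm mat_def Cm_def mm_def nn_def algebra_simps)
qed

lemma F_deriv: "(F \<alpha> b d d2 \<omega> e has_derivative (\<lambda>h. DFm e d v *v h)) (at v)"
proof -
  have n: "((\<lambda>v::real^2. v $ i) has_derivative (\<lambda>h. h $ i)) (at v)" for i
    by (rule bounded_linear_imp_has_derivative[OF bounded_linear_vec_nth])
  have rho': "(rho has_derivative (\<lambda>h. 2 * v$1 * h$1 + 2 * v$2 * h$2)) (at v)"
    unfolding rho_def by (auto intro!: derivative_eq_intros n)
  have mm': "(mm has_derivative (\<lambda>h. mm1 v * (2 * v$1 * h$1 + 2 * v$2 * h$2))) (at v)"
    unfolding mm_def by (auto intro!: derivative_eq_intros rho' simp: mm1_def algebra_simps)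
  have nn': "(nn d has_derivative (\<lambda>h. nn1 d v * (2 * v$1 * h$1 + 2 * v$2 * h$2))) (at v)"
    unfolding nn_def by (auto intro!: derivative_eq_intros rho' simp: nn1_def algebra_simps)
  have f1: "((\<lambda>v. mm v * v$1 - e * nn d v * v$2) has_derivative (\<lambda>h. (DFm e d v *v h) $ 1)) (at v)"
    by (auto intro!: derivative_eq_intros n mm' nn' simp: DFm_def algebra_simps)
  have f2: "((\<lambda>v. mm v * v$2 + e * nn d v * v$1) has_derivative (\<lambda>h. (DFm e d v *v h) $ 2)) (at v)"
    by (auto intro!: derivative_eq_intros n mm' nn' simp: DFm_def algebra_simps)
  have "((\<lambda>v. (mm v * v$1 - e * nn d v * v$2) *\<^sub>R axis 1 1 + (mm v * v$2 + e * nn d v * v$1) *\<^sub>R (axis 2 1 :: real^2))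
     has_derivative (\<lambda>h. (DFm e d v *v h) $ 1 *\<^sub>R axis 1 1 + (DFm e d v *v h) $ 2 *\<^sub>R axis 2 1)) (at v)"
    by (intro has_derivative_add has_derivative_scaleR_left f1 f2)
  moreover have "F \<alpha> b d d2 \<omega> e = (\<lambda>v. (mm v * v$1 - e * nn d v * v$2) *\<^sub>R axis 1 1 + (mm v * v$2 + e * nn d v * v$1) *\<^sub>R (axis 2 1 :: real^2))"
    by (rule ext) (simp add: F_eq vec_eq_iff forall_2 Cm_def axis_def)
  moreover have "(\<lambda>h. (DFm e d v *v h) $ 1 *\<^sub>R axis 1 1 + (DFm e d v *v h) $ 2 *\<^sub>R axis 2 1) = (\<lambda>h. DFm e d v *v h)"
    by (rule ext) (simp add: vec_eq_iff forall_2 axis_def)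
  ultimately show ?thesis by simp
qed

lemma matrix_frechet_F: "matrix (frechet_derivative (F \<alpha> b d d2 \<omega> e) (at v)) = DFm e d v"
  unfolding frechet_derivative_at[OF F_deriv, symmetric] by (rule matrix_of_matrix_vector_mul)

text \<open>Multiplication by \<open>B\<^sup>-\<^sup>1 J\<close> turns the eigenvalue equation into a system \<open>u'' = (M + \<mu> E) u\<close>.\<close>

lemma eigen_equation:
  "mJL \<alpha> a b d d2 \<omega> e f u x - \<mu> *s u x = g \<longleftrightarrow>
   Dx (Dx u) x = (cplx (MM e d (f x)) + cscm \<mu> (cplx (Em e))) *v u x + cplx (Em e) *v g"
  (is "?l \<longleftrightarrow> ?r")
proof -
  define w where "w = Dx (Dx u) x"
  define y where "y = cplx (DFm e d (f x)) *v u x"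
  have JJ: "cplx (- J) *v z = q \<longleftrightarrow> z = cplx J *v q" for z q
    by (simp add: vec_eq_iff forall_2) (metis minus_equation_iff)
  have BB: "cplx (B a e) *v z = q \<longleftrightarrow> z = cplx (Binv e) *v q" for z q
  proof
    assume "cplx (B a e) *v z = q"
    then have "cplx (Binv e) *v q = cplx (Binv e ** B a e) *v z" by (simp only: cplx_mult)
    then show "z = cplx (Binv e) *v q" by (simp only: B_Binv cplx_mat1)
  next
    assume "z = cplx (Binv e) *v q"
    then have "cplx (B a e) *v z = cplx (B a e ** Binv e) *v q" by (simp only: cplx_mult)
    then show "cplx (B a e) *v z = q" by (simp only: B_Binv cplx_mat1)
  qed
  have "?l \<longleftrightarrow> cplx (- J) *v (cplx (B a e) *v w + y) = \<mu> *s u x + g"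
    unfolding mJL_def lin_def matrix_frechet_F w_def y_def by (simp add: algebra_simps)
  also have "\<dots> \<longleftrightarrow> cplx (B a e) *v w = cplx J *v (\<mu> *s u x + g) - y"
    unfolding JJ by (auto simp: algebra_simps)
  also have "\<dots> \<longleftrightarrow> w = cplx (Binv e) *v (cplx J *v (\<mu> *s u x + g) - y)" by (rule BB)
  also have "cplx (Binv e) *v (cplx J *v (\<mu> *s u x + g) - y)
     = (cplx (MM e d (f x)) + cscm \<mu> (cplx (Em e))) *v u x + cplx (Em e) *v g"
    unfolding y_def MM_def Em_def
    by (simp add: vec_eq_iff forall_2 cscm_def algebra_simps del: Binv_nth J_nth)
  finally show ?thesis unfolding w_def .
qed

text \<open>The infinitesimal form of rotation invariance of \<open>F\<close>. It makes J A a kernel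
  function of the linearization.\<close>

lemma DFm_J: "DFm e d v *v (J *v v) = J *v (Cm e d v *v v)"
  by (simp add: vec_eq_iff forall_2 DFm_def Cm_def algebra_simps power2_eq_square)

lemma MM_J: "MM e d v *v (J *v v) = J *v (GG e d v *v v)"
proof -
  have m: "(- (X ** Y)) *v z = - (X *v (Y *v z))" for X Y :: "real^2^2" and z
    by (simp add: vec_eq_iff forall_2 algebra_simps)
  have comm: "Binv e *v (J *v z) = J *v (Binv e *v z)" for z by (simp add: vec_eq_iff forall_2)
  have neg: "- (J *v z) = J *v (- z)" for z by (simp add: vec_eq_iff forall_2)
  show ?thesis unfolding MM_def GG_def m DFm_J comm neg ..
qed

text \<open>\<epsilon> times this is the difference of the off-diagonal entries of the Jacobian, so
  that transposing it changes it by - \<epsilon> gg J. It measures the failure of self-adjointness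
  of the zeroth-order part.\<close>

definition gg :: "real \<Rightarrow> real^2 \<Rightarrow> real" where "gg d v = 2 * b + 4 * d * rho v + 6 * d2 * (rho v)\<^sup>2"

lemma B_GG: "B a e *v (GG e d v *v v) = - (Cm e d v *v v)"
proof -
  have "B a e *v (GG e d v *v v) = - ((B a e ** Binv e) *v (Cm e d v *v v))"
    unfolding GG_def by (simp add: vec_eq_iff forall_2 algebra_simps del: Binv_nth B_nth)
  then show ?thesis by (simp add: B_Binv)
qed

lemma B_MM: "B a e *v (MM e d v *v y) = - (DFm e d v *v y)"
proof -
  have "B a e *v (MM e d v *v y) = - ((B a e ** Binv e) *v (DFm e d v *v y))"
    unfolding MM_def by (simp add: vec_eq_iff forall_2 algebra_simps del: Binv_nth B_nth)
  then show ?thesis by (simp add: B_Binv)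
qed

text \<open>Operator minus adjoint is exactly \<epsilon> times an explicit operator:
  \<open>B\<close> contributes 2 a J and the Jacobian \<open>gg d v\<close> times \<open>J\<close>.
  The kernel equation for J A removes everything else. The same reason gives the odd case with A' in
  place of J A.\<close>

lemma adjoint_even:
  assumes w: "B a e *v w = - (Cm e d v *v v)"
  shows "transpose (B a e) *v (J *v w) + transpose (DFm e d v) *v (J *v v) = e *\<^sub>R ((2 * a) *\<^sub>R w + gg d v *\<^sub>R v)"
proof -
  have 1: "w$1 - e * a * w$2 = - (mm v * v$1 - e * nn d v * v$2)" "e * a * w$1 + w$2 = - (e * nn d v * v$1 + mm v * v$2)"
    using arg_cong[OF w, of "\<lambda>z. z$1"] arg_cong[OF w, of "\<lambda>z. z$2"] by (simp_all add: Cm_def)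
  have g: "gg d v = 2 * nn d v + 2 * rho v * nn1 d v" by (simp add: gg_def nn_def nn1_def power2_eq_square algebra_simps)
  have "- w$2 + e * a * w$1 + (- v$2 * (mm v + 2 * v$1 * (mm1 v * v$1 - e * nn1 d v * v$2))
       + v$1 * (e * nn d v + 2 * v$1 * (mm1 v * v$2 + e * nn1 d v * v$1))) = e * (2 * a * w$1 + gg d v * v$1)"
    unfolding g using 1(2) unfolding rho_def by algebra
  moreover have "e * a * w$2 + w$1 + (- v$2 * (- (e * nn d v) + 2 * v$2 * (mm1 v * v$1 - e * nn1 d v * v$2))
       + v$1 * (mm v + 2 * v$2 * (mm1 v * v$2 + e * nn1 d v * v$1))) = e * (2 * a * w$2 + gg d v * v$2)"
    unfolding g using 1(1) unfolding rho_def by algebra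
  ultimately show ?thesis by (simp add: vec_eq_iff forall_2 transpose_def DFm_def algebra_simps)
qed

lemma adjoint_odd:
  assumes w: "B a e *v w = - (DFm e d v *v y)"
  shows "transpose (B a e) *v w + transpose (DFm e d v) *v y = e *\<^sub>R (- (J *v ((2 * a) *\<^sub>R w + gg d v *\<^sub>R y)))"
proof -
  have 1: "w$1 - e * a * w$2 = - (DFm e d v $1$1 * y$1 + DFm e d v $1$2 * y$2)" "e * a * w$1 + w$2 = - (DFm e d v $2$1 * y$1 + DFm e d v $2$2 * y$2)"
    using arg_cong[OF w, of "\<lambda>y. y$1"] arg_cong[OF w, of "\<lambda>y. y$2"] by (simp_all)
  have g: "DFm e d v $2$1 - DFm e d v $1$2 = e * gg d v"
    by (simp add: DFm_def gg_def nn_def nn1_def rho_def power2_eq_square algebra_simps)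
  have "w$1 + e * a * w$2 + (DFm e d v $1$1 * y$1 + DFm e d v $2$1 * y$2) = e * (2 * a * w$2 + gg d v * y$2)"
    using 1(1) g by algebra
  moreover have "- (e * a) * w$1 + w$2 + (DFm e d v $1$2 * y$1 + DFm e d v $2$2 * y$2) = - (e * (2 * a * w$1 + gg d v * y$1))"
    using 1(2) g by algebra
  ultimately show ?thesis by (simp add: vec_eq_iff forall_2 transpose_def algebra_simps)
qed

definition A1 :: "real \<Rightarrow> real \<Rightarrow> real^2" where "A1 \<epsilon> = Dx (A \<epsilon>)"
text \<open>The second and third derivative of the wave, expressed through lower ones by the
  equation; convergence and decay of \<open>A\<close> and \<open>A1\<close> then carry over to them
  without differentiation.\<close>

definition A2 :: "real \<Rightarrow> real \<Rightarrow> real^2" where "A2 \<epsilon> x = GG \<epsilon> (d1s \<epsilon>) (A \<epsilon> x) *v A \<epsilon> x"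
definition A3 :: "real \<Rightarrow> real \<Rightarrow> real^2" where "A3 \<epsilon> x = MM \<epsilon> (d1s \<epsilon>) (A \<epsilon> x) *v A1 \<epsilon> x"

lemma wave_derivatives:
  assumes "stationary \<alpha> a b (d1s \<epsilon>) d2 \<omega> \<epsilon> (A \<epsilon>)"
  shows "second_deriv (A \<epsilon>) (A1 \<epsilon>) (A2 \<epsilon>)" "second_deriv (A1 \<epsilon>) (A2 \<epsilon>) (A3 \<epsilon>)"
proof -
  have td: "twice_diff (A \<epsilon>)" and eq: "\<And>x. B a \<epsilon> *v Dx (Dx (A \<epsilon>)) x + F \<alpha> b (d1s \<epsilon>) d2 \<omega> \<epsilon> (A \<epsilon> x) = 0"
    using assms by (auto simp: stationary_def)
  have x2: "Dx (Dx (A \<epsilon>)) x = - (Binv \<epsilon> *v F \<alpha> b (d1s \<epsilon>) d2 \<omega> \<epsilon> (A \<epsilon> x))" for x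
  proof -
    have "B a \<epsilon> *v Dx (Dx (A \<epsilon>)) x = - F \<alpha> b (d1s \<epsilon>) d2 \<omega> \<epsilon> (A \<epsilon> x)" using eq[of x] by (simp add: eq_neg_iff_add_eq_0)
    then have "(Binv \<epsilon> ** B a \<epsilon>) *v Dx (Dx (A \<epsilon>)) x = Binv \<epsilon> *v (- F \<alpha> b (d1s \<epsilon>) d2 \<omega> \<epsilon> (A \<epsilon> x))"
      by (simp only: matrix_vector_mul_assoc[symmetric])
    then show ?thesis by (simp add: B_Binv vec_eq_iff forall_2 del: Binv_nth)
  qed
  have x2': "Dx (Dx (A \<epsilon>)) = A2 \<epsilon>"
    by (rule ext) (simp add: x2 A2_def GG_def F_eq vec_eq_iff forall_2 algebra_simps del: Binv_nth)
  show 1: "second_deriv (A \<epsilon>) (A1 \<epsilon>) (A2 \<epsilon>)" using twice_diff_second_deriv[OF td] by (simp add: A1_def x2')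
  have "(A2 \<epsilon> has_vector_derivative A3 \<epsilon> x) (at x)" for x
  proof -
    have "((F \<alpha> b (d1s \<epsilon>) d2 \<omega> \<epsilon> \<circ> A \<epsilon>) has_vector_derivative (DFm \<epsilon> (d1s \<epsilon>) (A \<epsilon> x) *v A1 \<epsilon> x)) (at x)"
      using vector_derivative_diff_chain_within[of "A \<epsilon>" "A1 \<epsilon> x" x UNIV, OF _ has_derivative_at_withinI[OF F_deriv]]
        second_derivD(1)[OF 1] by simp
    moreover have "bounded_linear (\<lambda>z. - (Binv \<epsilon> *v z))"
      by (intro bounded_linear_minus matrix_vector_mul_bounded_linear)
    ultimately have "((\<lambda>x. - (Binv \<epsilon> *v ((F \<alpha> b (d1s \<epsilon>) d2 \<omega> \<epsilon> \<circ> A \<epsilon>) x))) has_vector_derivative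
       - (Binv \<epsilon> *v (DFm \<epsilon> (d1s \<epsilon>) (A \<epsilon> x) *v A1 \<epsilon> x))) (at x)"
      by (rule bounded_linear.has_vector_derivative[rotated])
    moreover have "(\<lambda>x. - (Binv \<epsilon> *v ((F \<alpha> b (d1s \<epsilon>) d2 \<omega> \<epsilon> \<circ> A \<epsilon>) x))) = A2 \<epsilon>"
      unfolding x2'[symmetric] by (rule ext) (simp add: x2)
    moreover have "- (Binv \<epsilon> *v (DFm \<epsilon> (d1s \<epsilon>) (A \<epsilon> x) *v A1 \<epsilon> x)) = A3 \<epsilon> x"
      by (simp add: A3_def MM_def vec_eq_iff forall_2 algebra_simps del: Binv_nth)
    ultimately show ?thesis by simp
  qed
  then show "second_deriv (A1 \<epsilon>) (A2 \<epsilon>) (A3 \<epsilon>)" using second_derivD(2)[OF 1] by (simp add: second_deriv_def)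
qed

definition d0 :: real where "d0 = d1_lead \<alpha> a b d2 \<omega>"
definition A0 :: "real \<Rightarrow> real^2" where "A0 x = vector [R x, 0]"
definition A01 :: "real \<Rightarrow> real^2" where "A01 x = vector [R1 x, 0]"
definition A02 :: "real \<Rightarrow> real^2" where "A02 x = vector [R2 x, 0]"

lemma A0_nth [simp]: "A0 x $ 1 = R x" "A0 x $ 2 = 0" "A01 x $ 1 = R1 x" "A01 x $ 2 = 0" "A02 x $ 1 = R2 x" "A02 x $ 2 = 0"
  by (simp_all add: A0_def A01_def A02_def)

lemma A_at_0: "apply_bcontfun (A 0) = A0"
  using branch by (auto simp: bright_branch_def A0_def R0_eq)

lemma A0_second: "second_deriv A0 A01 A02"
proof -
  have bl: "bounded_linear (\<lambda>t. t *\<^sub>R (axis 1 1 :: real^2))" by (rule bounded_linear_scaleR_left)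
  have eq: "(\<lambda>x. f x *\<^sub>R (axis 1 1 :: real^2)) = (\<lambda>x. vector [f x, 0])" for f :: "real \<Rightarrow> real"
    by (rule ext) (simp add: vec_eq_iff forall_2 axis_def)
  show ?thesis using second_deriv_linear[OF bl R_second'] unfolding eq A0_def[abs_def] A01_def[abs_def] A02_def[abs_def] .
qed

lemma A02_eq: "A02 x = GG 0 d0 (A0 x) *v A0 x"
  by (simp add: vec_eq_iff forall_2 GG_def Cm_def mm_def nn_def rho_def R2_def algebra_simps power2_eq_square eval_nat_numeral)

lemma MM_0: "MM 0 d0 (A0 x) = m2 (Va x) 0 0 (Vb x)"
  by (simp add: vec_eq_iff forall_2 MM_def DFm_def mm_def mm1_def nn_def nn1_def rho_def Va_def Vb_def algebra_simps power2_eq_square eval_nat_numeral)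

text \<open>All coefficient matrices are continuous functions of this triple, so uniform convergence
  of the triple to \<open>st0\<close> handles every one of them at once.\<close>

definition st :: "real \<Rightarrow> real \<Rightarrow> real \<times> real \<times> (real^2)" where "st \<epsilon> x = (\<epsilon>, d1s \<epsilon>, A \<epsilon> x)"
definition st0 :: "real \<Rightarrow> real \<times> real \<times> (real^2)" where "st0 x = (0, d0, A0 x)"

lemma d1s_tendsto: "(d1s \<longlongrightarrow> d0) (at_right 0)"
proof -
  have "(\<lambda>\<epsilon>. d1s \<epsilon> - d0) \<in> O[at_right 0](\<lambda>\<epsilon>. \<epsilon>)" using branch by (simp add: bright_branch_def d0_def)
  then obtain k where "\<forall>\<^sub>F \<epsilon> in at_right 0. norm (d1s \<epsilon> - d0) \<le> k * norm \<epsilon>" by (rule landau_o.bigE)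
  moreover have "((\<lambda>\<epsilon>::real. k * norm \<epsilon>) \<longlongrightarrow> k * norm (0::real)) (at_right 0)"
    by (intro tendsto_intros tendsto_ident_at)
  ultimately have "((\<lambda>\<epsilon>. d1s \<epsilon> - d0) \<longlongrightarrow> 0) (at_right 0)" by (auto intro: Lim_null_comparison)
  then show ?thesis by (simp add: Lim_null[symmetric])
qed

end

section \<open>Derivatives of convergent families; families with all limit properties\<close>

lemma mnorm_cplx_le: "mnorm (cplx P) \<le> 4 * norm P"
proof -
  have "\<bar>P $ i $ j\<bar> \<le> norm P" for i j
    using order_trans[OF component_le_norm_cart[of "P $ i" j] Finite_Cartesian_Product.norm_nth_le[of P i]] .
  from this[of 1 1] this[of 1 2] this[of 2 1] this[of 2 2] show ?thesis by (simp add: mnorm_def)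
qed

lemma cplx_diff: "cplx P - cplx Q = cplx (P - Q)" by (simp add: vec_eq_iff)

text \<open>Interpolation between the function and its second derivative on [x, x+1]; moving by at
  most 1 changes the exponential by at most the factor \<open>exp m\<close>.\<close>

lemma famdec_derivative:
  assumes d: "\<forall>\<^sub>F \<epsilon> in at_right 0. second_deriv (f \<epsilon>) (f1 \<epsilon>) (f2 \<epsilon>)" and f: "famdec f" "famdec f2"
  shows "famdec f1"
proof -
  obtain C k where k: "k > 0" and C: "\<forall>\<^sub>F \<epsilon> in at_right 0. \<forall>x. norm (f \<epsilon> x) \<le> C * exp (- k * \<bar>x\<bar>)"
    using f(1) by (auto simp: famdec_def)
  obtain B l where l: "l > 0" and B: "\<forall>\<^sub>F \<epsilon> in at_right 0. \<forall>x. norm (f2 \<epsilon> x) \<le> B * exp (- l * \<bar>x\<bar>)"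
    using f(2) by (auto simp: famdec_def)
  define m where "m = min k l"
  have m: "m > 0" using k l by (simp add: m_def)
  from d C B have "\<forall>\<^sub>F \<epsilon> in at_right 0. \<forall>x. norm (f1 \<epsilon> x) \<le> ((2 * C + B) * exp m) * exp (- m * \<bar>x\<bar>)"
  proof eventually_elim
    case (elim \<epsilon>)
    have C0: "C \<ge> 0" "B \<ge> 0" using order_trans[OF norm_ge_zero elim(2)[rule_format, of 0]]
      order_trans[OF norm_ge_zero elim(3)[rule_format, of 0]] by auto
    show ?case
    proof
      fix x
      have le: "exp (- q * \<bar>y\<bar>) \<le> exp m * exp (- m * \<bar>x\<bar>)" if y: "y \<in> {x..x+1}" and q: "q \<ge> m" for y q
      proof -
        have "m * \<bar>x\<bar> \<le> m * (\<bar>y\<bar> + 1)" using y m by (intro mult_left_mono) auto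
        also have "m * (\<bar>y\<bar> + 1) \<le> q * \<bar>y\<bar> + m" using mult_right_mono[OF q abs_ge_zero[of y]] by (simp add: algebra_simps)
        finally show ?thesis by (simp add: exp_add[symmetric])
      qed
      have "norm (f1 \<epsilon> x) \<le> 2 * (C * (exp m * exp (- m * \<bar>x\<bar>))) + B * (exp m * exp (- m * \<bar>x\<bar>))"
      proof (rule derivative_interpolation[OF elim(1)])
        fix y assume y: "y \<in> {x..x+1}"
        show "norm (f \<epsilon> y) \<le> C * (exp m * exp (- m * \<bar>x\<bar>))"
          by (rule order_trans[OF elim(2)[rule_format] mult_left_mono[OF le[OF y] C0(1)]]) (simp add: m_def)
        show "norm (f2 \<epsilon> y) \<le> B * (exp m * exp (- m * \<bar>x\<bar>))"
          by (rule order_trans[OF elim(3)[rule_format] mult_left_mono[OF le[OF y] C0(2)]]) (simp add: m_def)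
      qed
      then show "norm (f1 \<epsilon> x) \<le> ((2 * C + B) * exp m) * exp (- m * \<bar>x\<bar>)" by (simp add: algebra_simps)
    qed
  qed
  then show ?thesis using m unfolding famdec_def by blast
qed

lemma uclose_derivative:
  assumes d: "\<forall>\<^sub>F \<epsilon> in at_right 0. second_deriv (f \<epsilon>) (f1 \<epsilon>) (f2 \<epsilon>)" and d0: "second_deriv g g1 g2"
    and u: "uclose f g" "uclose f2 g2"
  shows "uclose f1 g1"
  unfolding uclose_def
proof (intro allI impI)
  fix e :: real assume "e > 0"
  then have "e / 3 > 0" by simp
  then have "\<forall>\<^sub>F \<epsilon> in at_right 0. \<forall>x. dist (f \<epsilon> x) (g x) \<le> e / 3" "\<forall>\<^sub>F \<epsilon> in at_right 0. \<forall>x. dist (f2 \<epsilon> x) (g2 x) \<le> e / 3"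
    using u unfolding uclose_def by blast+
  with d show "\<forall>\<^sub>F \<epsilon> in at_right 0. \<forall>x. dist (f1 \<epsilon> x) (g1 x) \<le> e"
  proof eventually_elim
    case (elim \<epsilon>)
    show ?case
    proof
      fix x
      have "norm (f1 \<epsilon> x - g1 x) \<le> 2 * (e / 3) + e / 3"
        by (rule derivative_interpolation[OF second_deriv_diff[OF elim(1) d0]]) (use elim in \<open>auto simp: dist_norm\<close>)
      then show "dist (f1 \<epsilon> x) (g1 x) \<le> e" by (simp add: dist_norm)
    qed
  qed
qed

definition nice :: "(real \<Rightarrow> real \<Rightarrow> real^2) \<Rightarrow> (real \<Rightarrow> real^2) \<Rightarrow> bool" where
  "nice f f0 \<longleftrightarrow> uclose f f0 \<and> famdec f \<and> (\<forall>\<^sub>F \<epsilon> in at_right 0. continuous_on UNIV (f \<epsilon>)) \<and>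
     continuous_on UNIV f0 \<and> bounded (range f0)"

lemma nice_pclose:
  assumes "nice f f0"
  shows "e > 0 \<Longrightarrow> \<forall>\<^sub>F \<epsilon> in at_right 0. pclose e (f \<epsilon>) f0" "expdec f0" "\<forall>\<^sub>F \<epsilon> in at_right 0. expdec (f \<epsilon>)"
proof -
  show "e > 0 \<Longrightarrow> \<forall>\<^sub>F \<epsilon> in at_right 0. pclose e (f \<epsilon>) f0" "expdec f0"
    using assms uclose_famdec_pclose[of f f0] uclose_famdec_pclose(2)[of f f0 1] by (auto simp: nice_def)
  obtain C k where "k > 0" "\<forall>\<^sub>F \<epsilon> in at_right 0. \<forall>x. norm (f \<epsilon> x) \<le> C * exp (- k * \<bar>x\<bar>)"
    "\<forall>\<^sub>F \<epsilon> in at_right 0. continuous_on UNIV (f \<epsilon>)" using assms by (auto simp: nice_def famdec_def)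
  from this(2,3) show "\<forall>\<^sub>F \<epsilon> in at_right 0. expdec (f \<epsilon>)"
    by eventually_elim (use \<open>k > 0\<close> in \<open>auto simp: expdec_def\<close>)
qed

text \<open>Complex scalars act pointwise on these functions. This is the vector space whose
  dimension occurs in \<open>alg_mult\<close>.\<close>

interpretation fun_space: vector_space "\<lambda>(c::complex) (u::real \<Rightarrow> complex^2) x. c *s u x"
  by unfold_locales (auto simp: fun_eq_iff vec_eq_iff algebra_simps)

context branch
begin

lemma eventually_wave:
  "\<forall>\<^sub>F \<epsilon> in at_right 0. 0 < \<epsilon> \<and> stationary \<alpha> a b (d1s \<epsilon>) d2 \<omega> \<epsilon> (A \<epsilon>) \<and> (\<forall>x. A \<epsilon> (- x) = A \<epsilon> x)"
proof -
  obtain e0 where "e0 > 0" "\<forall>\<epsilon>\<in>{0<..<e0}. stationary \<alpha> a b (d1s \<epsilon>) d2 \<omega> \<epsilon> (A \<epsilon>) \<and> (\<forall>x. A \<epsilon> (- x) = A \<epsilon> x)"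
    using branch unfolding bright_branch_def by blast
  then show ?thesis unfolding eventually_at_right_field by (intro exI[of _ e0]) auto
qed

text \<open>The one-sided derivative of the branch at 0 gives continuity there in the supremum
  norm.\<close>

lemma uclose_A: "uclose (\<lambda>\<epsilon>. A \<epsilon>) A0"
  unfolding uclose_def
proof (intro allI impI)
  fix d :: real assume d: "d > 0"
  obtain e0 where e0: "e0 > 0" "smooth_curve_on {0..<e0} A"
    using branch unfolding bright_branch_def by blast
  then obtain Df where Df: "Df 0 = A" "\<forall>n::nat. \<forall>s\<in>{0..<e0}. (Df n has_vector_derivative Df (Suc n) s) (at s within {0..<e0})"
    unfolding smooth_curve_on_def by blast
  then have "(A has_vector_derivative Df (Suc 0) 0) (at 0 within {0..<e0})" using e0(1) by force
  then have "continuous (at 0 within {0..<e0}) A" by (rule has_vector_derivative_continuous)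
  then have "\<forall>\<^sub>F \<epsilon> in at 0 within {0..<e0}. dist (A \<epsilon>) (A 0) < d"
    unfolding continuous_within using d by (rule tendstoD)
  then obtain e where e: "e > 0" "\<And>\<epsilon>. \<epsilon> \<in> {0..<e0} \<Longrightarrow> \<epsilon> \<noteq> 0 \<Longrightarrow> dist \<epsilon> 0 < e \<Longrightarrow> dist (A \<epsilon>) (A 0) < d"
    unfolding eventually_at by blast
  show "\<forall>\<^sub>F \<epsilon> in at_right 0. \<forall>x. dist (A \<epsilon> x) (A0 x) \<le> d"
    unfolding eventually_at_right_field
  proof (intro exI[of _ "min e e0"] conjI allI impI)
    fix \<epsilon> x :: real assume "0 < \<epsilon>" "\<epsilon> < min e e0"
    then have "dist (A \<epsilon>) (A 0) < d" using e(2)[of \<epsilon>] by simp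
    moreover have "dist (A \<epsilon> x) (A 0 x) \<le> dist (A \<epsilon>) (A 0)" by (rule dist_bounded)
    ultimately show "dist (A \<epsilon> x) (A0 x) \<le> d" by (simp add: A_at_0)
  qed (use e e0 in auto)
qed

lemma uclose_st: "uclose st st0"
  unfolding st_def[abs_def] st0_def[abs_def]
  by (intro uclose_Pair uclose_const uclose_A d1s_tendsto tendsto_ident_at)

lemma A0_bounds: "bounded (range A0)" "bounded (range A01)" "continuous_on UNIV A0" "continuous_on UNIV A01"
proof -
  have r1: "\<bar>R1 x\<bar> \<le> 2 * \<omega>" for x
  proof -
    have "2 * \<omega> * r x \<le> 2 * \<omega> * 1" by (rule mult_left_mono[OF r_le]) (use omega in simp)
    then show ?thesis using R1_le[of x] by linarith
  qed
  have "norm (A0 x) \<le> 2 * \<kappa>" "norm (A01 x) \<le> 2 * \<omega>" for x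
    using norm_le_components_real[of "A0 x"] norm_le_components_real[of "A01 x"] R_le[of x] r1[of x] by auto
  then show "bounded (range A0)" "bounded (range A01)" by (auto simp: bounded_iff)
  show "continuous_on UNIV A0" "continuous_on UNIV A01" using second_deriv_continuous[OF A0_second] by auto
qed

lemma st0_bounded: "bounded (range st0)"
proof -
  have "bounded ({0::real} \<times> {d0} \<times> range A0)" by (intro bounded_Times A0_bounds) auto
  then show ?thesis by (rule bounded_subset) (auto simp: st0_def)
qed

lemma st_cont: "continuous_on UNIV (st \<epsilon>)" "continuous_on UNIV st0"
  unfolding st_def[abs_def] st0_def[abs_def] by (intro continuous_intros A0_bounds | simp)+

lemma matrix_family:
  fixes Q :: "real \<times> real \<times> (real^2) \<Rightarrow> real^2^2"
  assumes "continuous_on UNIV Q"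
  shows "uclose (\<lambda>\<epsilon> x. Q (st \<epsilon> x)) (\<lambda>x. Q (st0 x))" "bounded (range (\<lambda>x. Q (st0 x)))"
    "bounded (range (\<lambda>x. Q (st \<epsilon> x)))"
    "continuous_on UNIV (\<lambda>x. Q (st \<epsilon> x))" "continuous_on UNIV (\<lambda>x. Q (st0 x))"
proof -
  show "uclose (\<lambda>\<epsilon> x. Q (st \<epsilon> x)) (\<lambda>x. Q (st0 x))" by (rule uclose_compose[OF uclose_st st0_bounded assms])
  show "bounded (range (\<lambda>x. Q (st0 x)))" by (rule bounded_continuous_compose[OF st0_bounded assms])
  have "bounded ({\<epsilon>} \<times> {d1s \<epsilon>} \<times> range (A \<epsilon>))" by (intro bounded_Times) auto
  then have "bounded (range (st \<epsilon>))" by (rule bounded_subset) (auto simp: st_def)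
  then show "bounded (range (\<lambda>x. Q (st \<epsilon> x)))" by (rule bounded_continuous_compose[OF _ assms])
  show "continuous_on UNIV (\<lambda>x. Q (st \<epsilon> x))" "continuous_on UNIV (\<lambda>x. Q (st0 x))"
    by (auto intro: continuous_on_compose2[OF assms] st_cont)
qed

lemma nice_mult:
  assumes Q: "continuous_on UNIV Q" and f: "nice f f0"
  shows "nice (\<lambda>\<epsilon> x. Q (st \<epsilon> x) *v f \<epsilon> x) (\<lambda>x. Q (st0 x) *v f0 x)"
proof -
  note mf = matrix_family[OF Q]
  have f': "uclose f f0" "famdec f" "\<forall>\<^sub>F \<epsilon> in at_right 0. continuous_on UNIV (f \<epsilon>)" "continuous_on UNIV f0" "bounded (range f0)"
    using f by (auto simp: nice_def)
  have "\<forall>\<^sub>F \<epsilon> in at_right 0. continuous_on UNIV (\<lambda>x. Q (st \<epsilon> x) *v f \<epsilon> x)"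
    using f'(3) by eventually_elim (intro continuous_on_mult_vec mf(4))
  moreover have "bounded (range (\<lambda>x. Q (st0 x) *v f0 x))"
  proof -
    obtain p q where "\<And>x. norm (Q (st0 x)) \<le> p" "\<And>x. norm (f0 x) \<le> q" using mf(2) f'(5) by (auto simp: bounded_iff)
    then have "4 * norm (Q (st0 x)) * norm (f0 x) \<le> 4 * p * q" for x
      by (intro mult_mono) (auto intro: order_trans[OF norm_ge_zero])
    then have "norm (Q (st0 x) *v f0 x) \<le> 4 * p * q" for x using norm_mult_vec_real order_trans by blast
    then show ?thesis by (auto simp: bounded_iff)
  qed
  ultimately show ?thesis
    unfolding nice_def using uclose_mult_vec[OF mf(1,2) f'(1,5)] famdec_mult_vec[OF mf(1,2) f'(2)]
      continuous_on_mult_vec[OF mf(5) f'(4)] by blast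
qed

section \<open>Coefficient matrices along the branch, uniform decay, and the tested equation\<close>

definition GQ :: "real \<times> real \<times> (real^2) \<Rightarrow> real^2^2" where "GQ p = GG (fst p) (fst (snd p)) (snd (snd p))"
definition MQ :: "real \<times> real \<times> (real^2) \<Rightarrow> real^2^2" where "MQ p = MM (fst p) (fst (snd p)) (snd (snd p))"
definition gQ :: "real \<times> real \<times> (real^2) \<Rightarrow> real^2^2" where "gQ p = gg (fst (snd p)) (snd (snd p)) *\<^sub>R mat 1"
text \<open>\<open>\<theta>\<close>, the adjoint of the kernel function divided by \<epsilon>, is
  \<open>thE\<close> applied to A in the even sector and \<open>thO\<close> applied to A' in the odd
  sector; compare \<open>adjoint_even\<close> and \<open>adjoint_odd\<close>.\<close>

definition thE :: "real \<times> real \<times> (real^2) \<Rightarrow> real^2^2" where "thE p = (2 * a) *\<^sub>R GQ p + gQ p"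
definition thO :: "real \<times> real \<times> (real^2) \<Rightarrow> real^2^2" where "thO p = - (J ** ((2 * a) *\<^sub>R MQ p + gQ p))"

lemma Q_cont: "continuous_on UNIV GQ" "continuous_on UNIV MQ" "continuous_on UNIV gQ"
  "continuous_on UNIV thE" "continuous_on UNIV thO"
proof -
  have entry: "continuous_on UNIV (\<lambda>p. Q p $ i $ j)" if "continuous_on UNIV Q" for Q :: "real \<times> real \<times> (real^2) \<Rightarrow> real^2^2" and i j
    by (intro continuous_on_nth that)
  show g: "continuous_on UNIV GQ"
    unfolding GQ_def GG_def Cm_def mm_def nn_def rho_def
    by (intro continuous_on_vec_2; simp; intro continuous_intros; simp add: den)
  show m: "continuous_on UNIV MQ"
    unfolding MQ_def MM_def DFm_def mm_def nn_def mm1_def nn1_def rho_def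
    by (intro continuous_on_vec_2; simp; intro continuous_intros; simp add: den)
  show q: "continuous_on UNIV gQ"
    unfolding gQ_def gg_def rho_def by (intro continuous_intros)
  show "continuous_on UNIV thE" unfolding thE_def by (intro continuous_intros g q)
  have JP: "continuous_on UNIV (\<lambda>p. J ** P p)" if P: "continuous_on UNIV P" for P :: "real \<times> real \<times> (real^2) \<Rightarrow> real^2^2"
    by (intro continuous_on_vec_2) (simp_all add: entry[OF P] continuous_on_minus)
  have "continuous_on UNIV (\<lambda>p. (2 * a) *\<^sub>R MQ p + gQ p)" by (intro continuous_intros m q)
  then show "continuous_on UNIV thO" unfolding thO_def by (intro continuous_on_minus JP)
qed

lemma GQ_st: "GQ (st \<epsilon> x) = GG \<epsilon> (d1s \<epsilon>) (A \<epsilon> x)" "MQ (st \<epsilon> x) = MM \<epsilon> (d1s \<epsilon>) (A \<epsilon> x)"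
  "GQ (st0 x) = GG 0 d0 (A0 x)" "MQ (st0 x) = MM 0 d0 (A0 x)"
  by (simp_all add: GQ_def MQ_def st_def st0_def)

lemma Q_0: "GQ (0, d0, 0) = m2 \<omega> 0 0 \<omega>" "MQ (0, d0, 0) = m2 \<omega> 0 0 \<omega>"
  by (simp_all add: vec_eq_iff forall_2 GQ_def MQ_def GG_def MM_def Cm_def DFm_def mm_def nn_def mm1_def nn1_def rho_def)

text \<open>One threshold \<open>X\<close> serves all small \<epsilon>: the limit wave is small
  outside [-X, X], and the perturbed wave is uniformly close to it.\<close>

lemma coefficients_at_infinity:
  fixes Q :: "real \<times> real \<times> (real^2) \<Rightarrow> real^2^2"
  assumes Q: "continuous_on UNIV Q" "Q (0, d0, 0) = m2 \<omega> 0 0 \<omega>" and e: "e > 0"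
  obtains X where "\<forall>\<^sub>F \<epsilon> in at_right 0. \<forall>x. \<bar>x\<bar> \<ge> X \<longrightarrow> mnorm (cplx (Q (st \<epsilon> x)) - m2 (of_real \<omega>) 0 0 (of_real \<omega>)) \<le> e"
proof -
  have "isCont Q (0, d0, 0)" using Q(1) by (simp add: continuous_on_eq_continuous_at)
  moreover have "e / 4 > 0" using e by simp
  ultimately obtain h where h: "h > 0" "\<And>p. dist p (0, d0, 0) < h \<Longrightarrow> dist (Q p) (Q (0, d0, 0)) < e / 4"
    unfolding continuous_at_eps_delta by blast
  have h2: "h / 2 > 0" using h(1) by simp
  then have "\<forall>\<^sub>F x in at_top. dist (R x) 0 < h / 2" "\<forall>\<^sub>F x in at_bot. dist (R x) 0 < h / 2"
    by (rule tendstoD[OF expdec_tendsto(1)[OF R_expdec]], rule tendstoD[OF expdec_tendsto(2)[OF R_expdec]])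
  then obtain X1 X2 where X: "\<And>x. x \<ge> X1 \<Longrightarrow> dist (R x) 0 < h / 2" "\<And>x. x \<le> X2 \<Longrightarrow> dist (R x) 0 < h / 2"
    unfolding eventually_at_top_linorder eventually_at_bot_linorder by blast
  define X where "X = max X1 (- X2)"
  have A0X: "norm (A0 x) < h / 2" if "\<bar>x\<bar> \<ge> X" for x
  proof -
    have "dist (R x) 0 < h / 2" using that X by (cases "x \<ge> 0") (auto simp: X_def)
    then show ?thesis using norm_le_components_real[of "A0 x"] by simp
  qed
  have "\<forall>\<^sub>F \<epsilon> in at_right 0. \<forall>x. dist (st \<epsilon> x) (st0 x) \<le> h / 2" using uclose_st h2 unfolding uclose_def by blast
  then have "\<forall>\<^sub>F \<epsilon> in at_right 0. \<forall>x. \<bar>x\<bar> \<ge> X \<longrightarrow> mnorm (cplx (Q (st \<epsilon> x)) - m2 (of_real \<omega>) 0 0 (of_real \<omega>)) \<le> e"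
  proof eventually_elim
    case (elim \<epsilon>)
    show ?case
    proof (intro allI impI)
      fix x assume x: "\<bar>x\<bar> \<ge> X"
      have "dist (st0 x) (0, d0, 0) = norm (A0 x)" by (simp add: st0_def dist_Pair_Pair dist_norm)
      then have "dist (st \<epsilon> x) (0, d0, 0) < h"
        using dist_triangle[of "st \<epsilon> x" "(0, d0, 0)" "st0 x"] elim[rule_format, of x] A0X[OF x] by simp
      then have "norm (Q (st \<epsilon> x) - m2 \<omega> 0 0 \<omega>) < e / 4" using h(2) by (simp add: Q(2) dist_norm)
      moreover have "cplx (Q (st \<epsilon> x)) - m2 (of_real \<omega>) 0 0 (of_real \<omega>) = cplx (Q (st \<epsilon> x) - m2 \<omega> 0 0 \<omega>)"
        by (simp add: vec_eq_iff forall_2)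
      ultimately show "mnorm (cplx (Q (st \<epsilon> x)) - m2 (of_real \<omega>) 0 0 (of_real \<omega>)) \<le> e"
        using mnorm_cplx_le[of "Q (st \<epsilon> x) - m2 \<omega> 0 0 \<omega>"] by simp
    qed
  qed
  then show thesis by (rule that)
qed

text \<open>The nonlinear wave equation is read as the linear equation A'' = GG(A) A with known
  coefficients, which are close to \<omega> far out; the linear decay estimate then holds with
  constants independent of \<epsilon>.\<close>

lemma famdec_A: "famdec (\<lambda>\<epsilon>. A \<epsilon>)"
proof -
  have "\<omega> / 2 > 0" using omega by simp
  then obtain X where X: "\<forall>\<^sub>F \<epsilon> in at_right 0. \<forall>x. \<bar>x\<bar> \<ge> X \<longrightarrow> mnorm (cplx (GQ (st \<epsilon> x)) - m2 (of_real \<omega>) 0 0 (of_real \<omega>)) \<le> \<omega> / 2"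
    by (rule coefficients_at_infinity[OF Q_cont(1) Q_0(1)])
  obtain m where m: "\<And>x. norm (A0 x) \<le> m" using A0_bounds(1) by (auto simp: bounded_iff)
  have "\<forall>\<^sub>F \<epsilon> in at_right 0. \<forall>x. dist (A \<epsilon> x) (A0 x) \<le> 1" using uclose_A by (auto simp: uclose_def)
  with X eventually_wave
  have "\<forall>\<^sub>F \<epsilon> in at_right 0. \<forall>x. norm (A \<epsilon> x) \<le> ((m + 1) * exp (sqrt \<omega> * X / 2)) * exp (- (sqrt \<omega> / 2) * \<bar>x\<bar>)"
  proof eventually_elim
    case (elim \<epsilon>)
    have s: "second_deriv (\<lambda>x. cvec (A \<epsilon> x)) (\<lambda>x. cvec (A1 \<epsilon> x)) (\<lambda>x. cplx (GQ (st \<epsilon> x)) *v cvec (A \<epsilon> x))"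
    proof -
      have "second_deriv (A \<epsilon>) (A1 \<epsilon>) (A2 \<epsilon>)" using wave_derivatives(1) elim(2) by blast
      from second_deriv_linear[OF bounded_linear_cvec this]
      show ?thesis by (rule back_subst[of "second_deriv _ _"]) (auto simp: fun_eq_iff vec_eq_iff forall_2 A2_def GQ_st)
    qed
    show ?case
    proof
      fix x
      have "norm (cvec (A \<epsilon> x)) \<le> (m + 1) * exp (sqrt \<omega> * X / 2) * exp (- (sqrt \<omega> / 2) * \<bar>x\<bar>)"
      proof (rule decay_of_solution[OF omega s])
        show "norm (cvec (A \<epsilon> x)) \<le> m + 1" for x
          using elim(3)[rule_format, of x] m[of x] norm_triangle_ineq2[of "A \<epsilon> x" "A0 x"] by (simp add: dist_norm)
      qed (use elim(1) in blast)
      then show "norm (A \<epsilon> x) \<le> ((m + 1) * exp (sqrt \<omega> * X / 2)) * exp (- (sqrt \<omega> / 2) * \<bar>x\<bar>)" by simp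
    qed
  qed
  moreover have "sqrt \<omega> / 2 > 0" using omega by simp
  ultimately show ?thesis unfolding famdec_def by blast
qed

lemma nice_A: "nice (\<lambda>\<epsilon>. A \<epsilon>) A0"
  unfolding nice_def using uclose_A famdec_A A0_bounds by simp

lemma A2_Q: "A2 = (\<lambda>\<epsilon> x. GQ (st \<epsilon> x) *v A \<epsilon> x)" and A3_Q: "A3 = (\<lambda>\<epsilon> x. MQ (st \<epsilon> x) *v A1 \<epsilon> x)"
  and A02_Q: "A02 = (\<lambda>x. GQ (st0 x) *v A0 x)"
  by (auto simp: fun_eq_iff A2_def A3_def GQ_st A02_eq)

lemma nice_A2: "nice A2 A02"
  unfolding A2_Q A02_Q by (rule nice_mult[OF Q_cont(1) nice_A])

lemma nice_A1: "nice A1 A01"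
proof -
  have d: "\<forall>\<^sub>F \<epsilon> in at_right 0. second_deriv (A \<epsilon>) (A1 \<epsilon>) (A2 \<epsilon>)"
    using eventually_wave by eventually_elim (use wave_derivatives(1) in blast)
  have "\<forall>\<^sub>F \<epsilon> in at_right 0. continuous_on UNIV (A1 \<epsilon>)"
    using d by eventually_elim (rule second_deriv_continuous(2))
  then show ?thesis
    unfolding nice_def using uclose_derivative[OF d A0_second] famdec_derivative[OF d] nice_A nice_A2 A0_bounds
    by (auto simp: nice_def)
qed

text \<open>The matrix \<open>NN\<close> of the sector locale for the concrete branch, so that both
  sectors can be addressed without fixing the data of either.\<close>

definition NNb :: "real \<Rightarrow> complex \<Rightarrow> real \<Rightarrow> complex^2^2" where
  "NNb \<epsilon> \<mu> x = cplx (MQ (st \<epsilon> x)) + cscm \<mu> (cplx (Em \<epsilon>))"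

lemma NNb_bounded: "\<exists>k. \<forall>x. mnorm (NNb \<epsilon> \<mu> x) \<le> k"
proof -
  obtain q where q: "\<And>x. norm (MQ (st \<epsilon> x)) \<le> q" using matrix_family(3)[OF Q_cont(2)] by (auto simp: bounded_iff)
  have "mnorm (NNb \<epsilon> \<mu> x) \<le> 4 * q + cmod \<mu> * mnorm (cplx (Em \<epsilon>))" for x
    unfolding NNb_def mnorm_cscm[symmetric]
    using mnorm_add[of "cplx (MQ (st \<epsilon> x))" "cscm \<mu> (cplx (Em \<epsilon>))"] mnorm_cplx_le[of "MQ (st \<epsilon> x)"] q[of x] by simp
  then show ?thesis by blast
qed

lemma derivative_bounded:
  assumes w: "second_deriv w w1 (\<lambda>x. NNb \<epsilon> \<mu> x *v w x + g x)" and b: "w \<in> bcontfun" "g \<in> bcontfun"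
  shows "w1 \<in> bcontfun"
proof -
  obtain m G where m: "\<And>x. norm (w x) \<le> m" and G: "\<And>x. norm (g x) \<le> G" using b by (auto simp: bcontfun_def bounded_iff)
  obtain k where k: "\<And>x. mnorm (NNb \<epsilon> \<mu> x) \<le> k" using NNb_bounded by blast
  have le: "norm (NNb \<epsilon> \<mu> x *v w x + g x) \<le> k * m + G" for x
    using norm_triangle_ineq[of "NNb \<epsilon> \<mu> x *v w x" "g x"] norm_mult_vec[of "NNb \<epsilon> \<mu> x" "w x"]
      mult_mono[OF k[of x] m[of x] order_trans[OF mnorm_nonneg k] norm_ge_zero] G[of x] by linarith
  show ?thesis
  proof (rule bcontfunI'[OF second_deriv_continuous(2)[OF w]])
    show "norm (w1 x) \<le> 2 * m + (k * m + G)" for x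
      by (rule derivative_interpolation[OF w m le])
  qed
qed

lemma bdot_transpose: "bdot (transpose P *v f) v = bdot f (cplx P *v v)"
  by (simp add: bdot_def transpose_def algebra_simps)

text \<open>The adjoint operator maps \<open>\<phi>\<close> to \<open>\<epsilon> \<theta>\<close>. This is the source of the explicit factor \<open>\<epsilon>\<close> in the reduced
  equation.\<close>

lemma test_identity:
  assumes f: "second_deriv \<phi> \<phi>1 \<phi>2" and e: "expdec \<phi>" "expdec \<phi>1" "expdec \<theta>"
    and adj: "\<And>x. transpose (B a \<epsilon>) *v \<phi>2 x + transpose (DFm \<epsilon> (d1s \<epsilon>) (A \<epsilon> x)) *v \<phi> x = \<epsilon> *\<^sub>R \<theta> x"
    and w: "second_deriv w w1 (\<lambda>x. NNb \<epsilon> \<mu> x *v w x + g x)" and b: "w \<in> bcontfun" "g \<in> bcontfun"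
  shows "of_real \<epsilon> * pair \<theta> w + \<mu> * pair (\<lambda>x. J *v \<phi> x) w = pair \<phi> (\<lambda>x. cplx (B a \<epsilon>) *v g x)"
proof -
  note w1 = derivative_bounded[OF w b]
  have tr: "expdec (\<lambda>x. P *v h x)" if "expdec h" for P :: "real^2^2" and h :: "real \<Rightarrow> real^2"
    by (rule expdec_comparison[OF that, where K="4 * norm P"])
       (use that norm_mult_vec_real in \<open>auto simp: expdec_def intro: continuous_intros\<close>)
  have Jphi: "expdec (\<lambda>x. J *v \<phi> x)" by (rule tr[OF e(1)])
  have Bg: "(\<lambda>x. cplx (B a \<epsilon>) *v g x) \<in> bcontfun" by (rule bcontfun_mult_vec[OF b(2)])
  define r where "r x = bdot (\<phi> x) (cplx (B a \<epsilon>) *v g x) - (of_real \<epsilon> * bdot (\<theta> x) (w x) + \<mu> * bdot (J *v \<phi> x) (w x))" for x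
  have i: "integrable lborel (\<lambda>x. bdot (\<phi> x) (cplx (B a \<epsilon>) *v g x))" "integrable lborel (\<lambda>x. bdot (\<theta> x) (w x))"
    "integrable lborel (\<lambda>x. bdot (J *v \<phi> x) (w x))"
    using pair_integrable[OF e(1) Bg] pair_integrable[OF e(3) b(1)] pair_integrable[OF Jphi b(1)] by auto
  have "(\<integral>x. r x \<partial>lborel) = 0"
  proof (rule green_pairing)
    show "second_deriv (\<lambda>x. transpose (B a \<epsilon>) *v \<phi> x) (\<lambda>x. transpose (B a \<epsilon>) *v \<phi>1 x) (\<lambda>x. transpose (B a \<epsilon>) *v \<phi>2 x)"
      by (rule second_deriv_linear[OF matrix_vector_mul_bounded_linear f])
    show "integrable lborel r" unfolding r_def using i by simp
    show "continuous_on UNIV r" unfolding r_def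
      using e b Bg by (intro continuous_intros) (auto simp: expdec_def bcontfun_def)
    fix x
    have "cplx (B a \<epsilon>) *v (NNb \<epsilon> \<mu> x *v w x + g x)
      = - (cplx (DFm \<epsilon> (d1s \<epsilon>) (A \<epsilon> x)) *v w x) + \<mu> *s (cplx J *v w x) + cplx (B a \<epsilon>) *v g x"
    proof -
      have "cplx (B a \<epsilon>) *v (cplx (MQ (st \<epsilon> x)) *v w x) = - (cplx (DFm \<epsilon> (d1s \<epsilon>) (A \<epsilon> x)) *v w x)"
      proof -
        have "B a \<epsilon> ** MM \<epsilon> (d1s \<epsilon>) (A \<epsilon> x) = - ((B a \<epsilon> ** Binv \<epsilon>) ** DFm \<epsilon> (d1s \<epsilon>) (A \<epsilon> x))"
          unfolding MM_def by (simp add: vec_eq_iff forall_2 algebra_simps del: B_nth Binv_nth)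
        then have "B a \<epsilon> ** MM \<epsilon> (d1s \<epsilon>) (A \<epsilon> x) = - DFm \<epsilon> (d1s \<epsilon>) (A \<epsilon> x)" by (simp only: B_Binv matrix_mul_lid)
        then show ?thesis unfolding cplx_mult[symmetric] GQ_st
          by (simp add: vec_eq_iff forall_2 del: mat_mult_nth)
      qed
      moreover have "cplx (B a \<epsilon>) *v (cplx (Em \<epsilon>) *v w x) = cplx J *v w x"
        unfolding cplx_mult[symmetric] B_Em ..
      ultimately show ?thesis
        unfolding NNb_def matrix_vector_mult_add_rdistrib cscm_mult matrix_vector_right_distrib vector_scalar_commute
        by (simp only:)
    qed
    then have "bdot (transpose (B a \<epsilon>) *v \<phi> x) (NNb \<epsilon> \<mu> x *v w x + g x)
      = - bdot (\<phi> x) (cplx (DFm \<epsilon> (d1s \<epsilon>) (A \<epsilon> x)) *v w x) + \<mu> * bdot (\<phi> x) (cplx J *v w x) + bdot (\<phi> x) (cplx (B a \<epsilon>) *v g x)"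
      unfolding bdot_transpose by (simp only: bdot_add bdot_minus bdot_smult)
    moreover have "transpose (B a \<epsilon>) *v \<phi>2 x = \<epsilon> *\<^sub>R \<theta> x - transpose (DFm \<epsilon> (d1s \<epsilon>) (A \<epsilon> x)) *v \<phi> x"
      using adj[of x] by (simp add: algebra_simps)
    then have "bdot (transpose (B a \<epsilon>) *v \<phi>2 x) (w x) = of_real \<epsilon> * bdot (\<theta> x) (w x) - bdot (\<phi> x) (cplx (DFm \<epsilon> (d1s \<epsilon>) (A \<epsilon> x)) *v w x)"
    proof -
      assume t: "transpose (B a \<epsilon>) *v \<phi>2 x = \<epsilon> *\<^sub>R \<theta> x - transpose (DFm \<epsilon> (d1s \<epsilon>) (A \<epsilon> x)) *v \<phi> x"
      have "bdot (\<epsilon> *\<^sub>R f - g) v = of_real \<epsilon> * bdot f v - bdot g v" for f g v by (simp add: bdot_def algebra_simps)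
      then show ?thesis unfolding t by (simp only: bdot_transpose)
    qed
    ultimately show "bdot (transpose (B a \<epsilon>) *v \<phi> x) (NNb \<epsilon> \<mu> x *v w x + g x) - bdot (transpose (B a \<epsilon>) *v \<phi>2 x) (w x) = r x"
      by (simp only: r_def bdot_J) (simp add: algebra_simps)
  qed (rule tr[OF e(1)] tr[OF e(2)] w b(1) w1)+
  then show ?thesis using i by (simp add: r_def pair_def)
qed

lemma Em_tendsto: "uclose (\<lambda>\<epsilon> x. Em \<epsilon>) (\<lambda>x. J)" "uclose (\<lambda>\<epsilon> x. B a \<epsilon>) (\<lambda>x. mat 1)"
proof -
  have t: "((\<lambda>\<epsilon>::real. \<epsilon>) \<longlongrightarrow> 0) (at_right 0)" by (rule tendsto_ident_at)
  have cE: "continuous_on UNIV Em" unfolding Em_def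
    by (intro continuous_on_vec_2; simp; intro continuous_intros; simp add: den)
  have cB: "continuous_on UNIV (B a)"
    by (intro continuous_on_vec_2; simp; intro continuous_intros)
  have "(Em \<longlongrightarrow> Em 0) (at_right 0)" "(B a \<longlongrightarrow> B a 0) (at_right 0)"
    using cE cB by (auto simp: continuous_on_eq_continuous_at isCont_def intro: tendsto_mono[OF at_le])
  moreover have "Em 0 = J" "B a 0 = mat 1" by (simp_all add: vec_eq_iff forall_2 Em_def mat_def)
  ultimately show "uclose (\<lambda>\<epsilon> x. Em \<epsilon>) (\<lambda>x. J)" "uclose (\<lambda>\<epsilon> x. B a \<epsilon>) (\<lambda>x. mat 1)"
    by (auto intro: uclose_const)
qed

lemma uclose_mnorm:
  assumes "uclose Q Q0" "e > 0"
  shows "\<forall>\<^sub>F \<epsilon> in at_right 0. \<forall>x. mnorm (cplx (Q \<epsilon> x) - cplx (Q0 x)) \<le> e"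
proof -
  have "e / 4 > 0" using assms by simp
  then have "\<forall>\<^sub>F \<epsilon> in at_right 0. \<forall>x. dist (Q \<epsilon> x) (Q0 x) \<le> e / 4" using assms unfolding uclose_def by blast
  then show ?thesis
  proof eventually_elim
    case (elim \<epsilon>)
    show ?case
    proof
      fix x show "mnorm (cplx (Q \<epsilon> x) - cplx (Q0 x)) \<le> e"
        using elim[rule_format, of x] mnorm_cplx_le[of "Q \<epsilon> x - Q0 x"] unfolding cplx_diff dist_norm by linarith
    qed
  qed
qed

text \<open>For parameters of order \<epsilon> the coefficient matrix stays within \<omega>/2 of
  \<omega> far out, one quarter of \<omega> being spent on the wave and one on the spectral term.
  Hence bounded solutions near zero are square integrable.\<close>

lemma bounded_solution_expdec:
  assumes Q0: "Q > 0"
  shows "\<forall>\<^sub>F \<epsilon> in at_right 0. \<forall>\<mu> u u1. cmod \<mu> \<le> Q * \<epsilon> \<longrightarrow> second_deriv u u1 (\<lambda>x. NNb \<epsilon> \<mu> x *v u x) \<longrightarrow>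
     u \<in> bcontfun \<longrightarrow> expdec u"
proof -
  have "\<omega> / 4 > 0" using omega by simp
  then obtain X where X: "\<forall>\<^sub>F \<epsilon> in at_right 0. \<forall>x. \<bar>x\<bar> \<ge> X \<longrightarrow> mnorm (cplx (MQ (st \<epsilon> x)) - m2 (of_real \<omega>) 0 0 (of_real \<omega>)) \<le> \<omega> / 4"
    by (rule coefficients_at_infinity[OF Q_cont(2) Q_0(2)])
  have E: "\<forall>\<^sub>F \<epsilon> in at_right 0. \<forall>x::real. mnorm (cplx (Em \<epsilon>) - cplx J) \<le> 1" using uclose_mnorm[OF Em_tendsto(1), of 1] by simp
  have s: "\<forall>\<^sub>F \<epsilon> in at_right 0. \<epsilon> * (3 * Q) < \<omega> / 4" by (rule eventually_small_mult) (use omega in simp)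
  from X E s show ?thesis
  proof eventually_elim
    case (elim \<epsilon>)
    show ?case
    proof (intro allI impI)
      fix \<mu> u u1 assume mu: "cmod \<mu> \<le> Q * \<epsilon>" and u: "second_deriv u u1 (\<lambda>x. NNb \<epsilon> \<mu> x *v u x)" and ub: "u \<in> bcontfun"
      obtain m where m: "\<And>x. norm (u x) \<le> m" using ub by (auto simp: bcontfun_def bounded_iff)
      have "mnorm ((cplx (Em \<epsilon>) - cplx J) + cplx J) \<le> 1 + 2"
        by (rule order_trans[OF mnorm_add]) (use elim(2) in \<open>simp add: mnorm_def\<close>)
      then have E3: "mnorm (cplx (Em \<epsilon>)) \<le> 3" by simp
      have "mnorm (NNb \<epsilon> \<mu> x - m2 (of_real \<omega>) 0 0 (of_real \<omega>)) \<le> \<omega> / 2" if x: "\<bar>x\<bar> \<ge> X" for x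
      proof -
        have "NNb \<epsilon> \<mu> x - m2 (of_real \<omega>) 0 0 (of_real \<omega>) = (cplx (MQ (st \<epsilon> x)) - m2 (of_real \<omega>) 0 0 (of_real \<omega>)) + cscm \<mu> (cplx (Em \<epsilon>))"
          by (simp add: NNb_def)
        also have "mnorm \<dots> \<le> \<omega> / 4 + cmod \<mu> * mnorm (cplx (Em \<epsilon>))"
          by (rule order_trans[OF mnorm_add]) (use elim(1) x in \<open>simp add: mnorm_cscm\<close>)
        also have "cmod \<mu> * mnorm (cplx (Em \<epsilon>)) \<le> (Q * \<epsilon>) * 3"
          using mu E3 by (intro mult_mono) (auto intro: order_trans[OF norm_ge_zero] mnorm_nonneg)
        finally show ?thesis using elim(3) by (simp add: mult.assoc mult.commute[of \<epsilon>])
      qed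
      then have "norm (u x) \<le> (m * exp (sqrt \<omega> * X / 2)) * exp (- (sqrt \<omega> / 2) * \<bar>x\<bar>)" for x
        by (rule decay_of_solution[OF omega u m])
      then show "expdec u" unfolding expdec_def
        using second_deriv_continuous[OF u] omega
        by (intro conjI exI[of _ "m * exp (sqrt \<omega> * X / 2)"] exI[of _ "sqrt \<omega> / 2"]) auto
    qed
  qed
qed

subsection \<open>The two bifurcating eigenvalues\<close>

definition bsol :: "real \<Rightarrow> real \<Rightarrow> complex \<Rightarrow> (real \<Rightarrow> complex^2) \<Rightarrow> (real \<Rightarrow> complex^2) \<Rightarrow> bool" where
  "bsol p \<epsilon> \<mu> w g \<longleftrightarrow> w \<in> bcontfun \<and> par p w \<and> (\<exists>w1. second_deriv w w1 (\<lambda>x. NNb \<epsilon> \<mu> x *v w x + g x))"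

definition simple_spectrum :: "real \<Rightarrow> real \<Rightarrow> real \<Rightarrow> real \<Rightarrow> bool" where
  "simple_spectrum p d \<epsilon> \<nu> \<longleftrightarrow> \<bar>\<nu>\<bar> \<le> d * \<epsilon> \<and>
    (\<forall>\<mu>\<in>{0, of_real \<nu>}. \<exists>u. bsol p \<epsilon> \<mu> u (\<lambda>x. 0) \<and> (\<exists>x. u x \<noteq> 0)) \<and>
    (\<forall>\<mu> u. cmod \<mu> \<le> d * \<epsilon> \<longrightarrow> bsol p \<epsilon> \<mu> u (\<lambda>x. 0) \<longrightarrow> (\<exists>x. u x \<noteq> 0) \<longrightarrow>
       \<mu> \<in> {0, of_real \<nu>} \<and>
       (\<forall>u'. bsol p \<epsilon> \<mu> u' (\<lambda>x. 0) \<longrightarrow> (\<exists>t. \<forall>x. u' x = t *s u x)) \<and>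
       (\<nexists>w. bsol p \<epsilon> \<mu> w (\<lambda>x. cplx (Em \<epsilon>) *v u x)))"

definition ground :: "real \<Rightarrow> real \<Rightarrow> real^2" where
  "ground p = (if p = 1 then (\<lambda>x. vector [0, R x]) else A01)"

lemma nice_J: "nice f f0 \<Longrightarrow> nice (\<lambda>\<epsilon> x. J *v f \<epsilon> x) (\<lambda>x. J *v f0 x)"
  using nice_mult[of "\<lambda>_. J"] by simp

text \<open>The common part of both sectors: they differ only in the kernel function
  \<open>\<phi>\<close>, the function \<open>\<theta>\<close>, the chain generator \<open>wp\<close>
  and the two moments. The branch supplies everything that \<open>basic\<close> demands for
  arbitrarily small \<open>e\<close>.\<close>

lemma sector_result:
  assumes p: "p = 1 \<or> p = - 1"
    and wp: "second_deriv wp wd (\<lambda>x. m2 (of_real (Va x)) 0 0 (of_real (Vb x)) *v wp x + cplx J *v cvec (ground p x))"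
    and w_bd: "\<And>x. norm (wp x) \<le> m0" and w_par: "par p wp" and w_orth: "pair (ground p) wp = 0"
    and th: "nice \<theta> \<theta>a" and q: "pair \<theta>a wp = of_real q0" "q0 \<noteq> 0"
    and c: "pair (\<lambda>x. J *v ground p x) wp = of_real c0" "c0 \<noteq> 0"
    and ph: "nice \<phi> (ground p)"
    and wave: "\<forall>\<^sub>F \<epsilon> in at_right 0. par p (\<phi> \<epsilon>) \<and> second_deriv (\<phi> \<epsilon>) (\<phi>d \<epsilon>) (\<lambda>x. MQ (st \<epsilon> x) *v \<phi> \<epsilon> x) \<and>
      expdec (\<phi>d \<epsilon>) \<and>
      (\<forall>x. transpose (B a \<epsilon>) *v (MQ (st \<epsilon> x) *v \<phi> \<epsilon> x) + transpose (DFm \<epsilon> (d1s \<epsilon>) (A \<epsilon> x)) *v \<phi> \<epsilon> x = \<epsilon> *\<^sub>R \<theta> \<epsilon> x)"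
  shows "\<exists>\<nu> d0. \<forall>d\<ge>d0. \<forall>\<^sub>F \<epsilon> in at_right 0. simple_spectrum p d \<epsilon> (\<nu> \<epsilon>) \<and> \<nu> \<epsilon> * c0 * q0 < 0"
proof -
  obtain C where cp: "coupled_pair R1 R2 ka ka1 Va R R1 kb kb1 Vb C \<kappa>" using coupled by blast
  interpret cp: coupled_pair R1 R2 ka ka1 Va R R1 kb kb1 Vb C \<kappa> by (rule cp)
  have psi: "cp.psi p = ground p"
    by (simp add: cp.psi_def ground_def cp.phi_even_def[abs_def] cp.phi_odd_def[abs_def] A01_def[abs_def])
  interpret ss: sector_setup R1 R2 ka ka1 Va R R1 kb kb1 Vb C \<kappa> p "\<lambda>\<epsilon> x. MQ (st \<epsilon> x)" Em "B a" \<phi> \<theta> \<theta>a wp wd m0 c0 q0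
    by (unfold_locales; (unfold psi cp.V0_def)?) (rule p wp w_bd w_par w_orth nice_pclose(2)[OF th] q c)+
  have sol_eq: "ss.sol \<epsilon> \<mu> w g = bsol p \<epsilon> \<mu> w g" for \<epsilon> \<mu> w g
    by (simp add: ss.sol_def bsol_def ss.NN_def NNb_def)
  interpret sf: sector_family R1 R2 ka ka1 Va R R1 kb kb1 Vb C \<kappa> p "\<lambda>\<epsilon> x. MQ (st \<epsilon> x)" Em "B a" \<phi> \<theta> \<theta>a wp wd m0 c0 q0
  proof unfold_locales
    fix e :: real assume e: "e > 0"
    have V0: "cplx (MQ (st0 x)) = cp.V0 x" for x by (simp add: GQ_st MM_0 cp.V0_def vec_eq_iff forall_2)
    have M1: "cplx (mat 1) = mat 1" by (simp add: vec_eq_iff forall_2 mat_def)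
    have 1: "\<forall>\<^sub>F \<epsilon> in at_right 0. \<forall>x. mnorm (cplx (MQ (st \<epsilon> x)) - cp.V0 x) \<le> e"
      using uclose_mnorm[OF matrix_family(1)[OF Q_cont(2)] e] unfolding V0 .
    have 2: "\<forall>\<^sub>F \<epsilon> in at_right 0. \<forall>x::real. mnorm (cplx (Em \<epsilon>) - cplx J) \<le> e" by (rule uclose_mnorm[OF Em_tendsto(1) e])
    have 3: "\<forall>\<^sub>F \<epsilon> in at_right 0. \<forall>x::real. mnorm (cplx (B a \<epsilon>) - mat 1) \<le> e" using uclose_mnorm[OF Em_tendsto(2) e] unfolding M1 .
    have 4: "\<forall>\<^sub>F \<epsilon> in at_right 0. \<forall>x. norm (\<phi> \<epsilon> x - ground p x) \<le> e" using ph e by (simp add: nice_def uclose_def dist_norm)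
    have 5: "\<forall>\<^sub>F \<epsilon> in at_right 0. pclose e (\<phi> \<epsilon>) (ground p)" "\<forall>\<^sub>F \<epsilon> in at_right 0. pclose e (\<theta> \<epsilon>) \<theta>a"
      "\<forall>\<^sub>F \<epsilon> in at_right 0. pclose e (\<lambda>x. J *v \<phi> \<epsilon> x) (\<lambda>x. J *v ground p x)"
      by (intro nice_pclose(1) nice_J ph th e)+
    have 6: "\<forall>\<^sub>F \<epsilon> in at_right 0. expdec (\<phi> \<epsilon>)" "\<forall>\<^sub>F \<epsilon> in at_right 0. expdec (\<theta> \<epsilon>)"
      by (intro nice_pclose(3)[OF ph] nice_pclose(3)[OF th])+
    have 7: "\<forall>\<^sub>F \<epsilon> in at_right 0. \<epsilon> * 1 < e" by (rule eventually_small_mult[OF e])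
    show "\<forall>\<^sub>F \<epsilon> in at_right 0. ss.basic e \<epsilon>"
      using 1 2 3 4 5 6 7 eventually_wave wave
    proof eventually_elim
      case (elim \<epsilon>)
      have ev: "st \<epsilon> (- x) = st \<epsilon> x" for x using elim(11) by (simp add: st_def)
      have f: "second_deriv (\<phi> \<epsilon>) (\<phi>d \<epsilon>) (\<lambda>x. MQ (st \<epsilon> x) *v \<phi> \<epsilon> x)" and f1: "expdec (\<phi>d \<epsilon>)" and fp: "par p (\<phi> \<epsilon>)"
        and adj: "\<And>x. transpose (B a \<epsilon>) *v (MQ (st \<epsilon> x) *v \<phi> \<epsilon> x) + transpose (DFm \<epsilon> (d1s \<epsilon>) (A \<epsilon> x)) *v \<phi> \<epsilon> x = \<epsilon> *\<^sub>R \<theta> \<epsilon> x"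
        using elim(12) by auto
      have "bsol p \<epsilon> 0 (\<lambda>x. cvec (\<phi> \<epsilon> x)) (\<lambda>x. 0)" unfolding bsol_def
      proof (intro conjI exI)
        have "(\<lambda>x. NNb \<epsilon> 0 x *v cvec (\<phi> \<epsilon> x) + 0) = (\<lambda>x. cvec (MQ (st \<epsilon> x) *v \<phi> \<epsilon> x))"
          by (simp add: fun_eq_iff vec_eq_iff forall_2 NNb_def cscm_def)
        then show "second_deriv (\<lambda>x. cvec (\<phi> \<epsilon> x)) (\<lambda>x. cvec (\<phi>d \<epsilon> x)) (\<lambda>x. NNb \<epsilon> 0 x *v cvec (\<phi> \<epsilon> x) + 0)"
          using second_deriv_linear[OF bounded_linear_cvec f] by (simp only:)
      qed (use expdec_bcontfun[OF expdec_cvec[OF elim(8)]] par_cvec[OF fp] in auto)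
      moreover have "of_real \<epsilon> * pair (\<theta> \<epsilon>) w + \<mu> * pair (\<lambda>x. J *v \<phi> \<epsilon> x) w = pair (\<phi> \<epsilon>) (\<lambda>x. cplx (B a \<epsilon>) *v g x)"
        if w: "bsol p \<epsilon> \<mu> w g" and g: "g \<in> bcontfun" for \<mu> w g
        using test_identity[OF f elim(8) f1 elim(9) adj _ _ g] w unfolding bsol_def by blast
      ultimately show ?case
        unfolding ss.basic_def psi sol_eq B_Em
        using elim(1-7,10,11) ev fp matrix_family(4)[OF Q_cont(2)] by auto
    qed
  qed
  obtain \<nu> d0 where nu: "\<And>d. d \<ge> d0 \<Longrightarrow> \<forall>\<^sub>F \<epsilon> in at_right 0. ss.spectrum_in d \<epsilon> (\<nu> \<epsilon>)"
    using sf.sector_branch by blast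
  have imp: "simple_spectrum p d \<epsilon> n \<and> n * c0 * q0 < 0" if "ss.spectrum_in d \<epsilon> n" for d \<epsilon> n
    using that unfolding ss.spectrum_in_def sol_eq simple_spectrum_def by simp
  have "\<forall>\<^sub>F \<epsilon> in at_right 0. simple_spectrum p d \<epsilon> (\<nu> \<epsilon>) \<and> \<nu> \<epsilon> * c0 * q0 < 0" if "d \<ge> d0" for d
    using nu[OF that] by eventually_elim (rule imp)
  then show ?thesis by blast
qed

lemma pair_cvec:
  "pair f (\<lambda>x. cvec (v x)) = of_real (\<integral>x. f x $ 1 * v x $ 1 + f x $ 2 * v x $ 2 \<partial>lborel)"
  by (simp add: pair_def bdot_def flip: integral_complex_of_real)

lemma second_deriv_vec2:
  assumes "second_deriv f f1 f2" "second_deriv g g1 g2"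
  shows "second_deriv (\<lambda>x. cvec (vector [f x, g x])) (\<lambda>x. cvec (vector [f1 x, g1 x])) (\<lambda>x. cvec (vector [f2 x, g2 x]))"
proof -
  have e: "cvec (vector [s, t]) = cvec (s *\<^sub>R axis 1 1 + t *\<^sub>R axis 2 1)" for s t
    by (rule arg_cong[of _ _ cvec]) (simp add: vec_eq_iff forall_2 axis_def)
  show ?thesis unfolding e
    by (intro second_deriv_linear[OF bounded_linear_cvec] second_deriv_add second_deriv_linear[OF bounded_linear_scaleR_left] assms)
qed

section \<open>The moments and eigenvalues of the even and the odd sector\<close>

lemma gQ_st0: "gg d0 (A0 x) = 2 * b + 4 * d0 * R x ^ 2 + 6 * d2 * R x ^ 4"
  by (simp add: gg_def rho_def flip: power_mult)

text \<open>The even moment in the form that exhibits its zero at b = \<open>bstar\<close>;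
  \<open>q_even_eq\<close> rewrites it as the integral that the sector argument produces.\<close>

definition q_even :: real where
  "q_even = - (L 4 * (b * deriv (Lam24 \<alpha>) \<omega> + (d2 - \<alpha> * a / 3) * deriv (Lamd2 \<alpha>) \<omega>))"

text \<open>The balance of dissipative terms that selects the leading value of \<open>d1s\<close>:
  the gains b, d1 and d2 against diffusion a, integrated over the unperturbed wave.\<close>

lemma lead_relation: "b * L 2 + d0 * L 4 + d2 * L 6 = a * K"
proof -
  have "Lam24 \<alpha> \<omega> * L 4 = L 2" using L_pos by (simp add: Lam24_def Lam_L)
  then have L2: "L 2 = Lam24 \<alpha> \<omega> * L 4" and L6: "L 6 = Lamd2 \<alpha> \<omega> * L 4" using Lamd2_L6 by simp_all
  show ?thesis unfolding d0_def d1_lead_def K_eq L2 L6 by (simp add: algebra_simps)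
qed

text \<open>After inserting \<open>d0\<close>, the terms a Z 3 and 2 \<alpha> a Z 5 sum to a L 2 / 2
  and cancel the diffusion term by the first and third relation of \<open>Z_equations\<close>. What
  remains are the quotient-rule numerators of the derivatives of \<open>Lam24\<close> and
  \<open>Lamd2\<close>.\<close>

lemma q_even_eq:
  "q_even = - (2 * a * (\<omega> * Z 1 - Z 3 - \<alpha> * Z 5) + 2 * b * Z 1 + 4 * d0 * Z 3 + 6 * d2 * Z 5)"
proof -
  have L4: "L 4 \<noteq> 0" using L_pos by simp
  have 1: "L 4 * deriv (Lam24 \<alpha>) \<omega> = 2 * Z 1 - 4 * Lam24 \<alpha> \<omega> * Z 3"
    and 2: "L 4 * deriv (Lamd2 \<alpha>) \<omega> = 6 * Z 5 - 4 * Lamd2 \<alpha> \<omega> * Z 3"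
    unfolding DERIV_imp_deriv[OF dLam24] DERIV_imp_deriv[OF dLamd2] using L4 by simp_all
  have "q_even = - (b * (L 4 * deriv (Lam24 \<alpha>) \<omega>) + (d2 - \<alpha> * a / 3) * (L 4 * deriv (Lamd2 \<alpha>) \<omega>))"
    unfolding q_even_def by (simp add: algebra_simps)
  then show ?thesis
    unfolding 1 2 d0_def d1_lead_def using Z_equations(1,3) by algebra
qed

text \<open>The chain over the rotation mode is minus the \<omega>-derivative of the wave, (- z, 0).
  Its pairing with J (J A0) gives c = Z 1 > 0, so the sign of the eigenvalue is opposite to that of
  \<open>q_even\<close>.\<close>

lemma even_sector:
  assumes "q_even \<noteq> 0"
  shows "\<exists>\<nu> d0. \<forall>d\<ge>d0. \<forall>\<^sub>F \<epsilon> in at_right 0. simple_spectrum 1 d \<epsilon> (\<nu> \<epsilon>) \<and> \<nu> \<epsilon> * Z 1 * q_even < 0"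
proof -
  define v where "v x = cvec (vector [- z x, 0])" for x
  have g1: "ground 1 = (\<lambda>x. J *v A0 x)" by (simp add: ground_def fun_eq_iff vec_eq_iff forall_2)
  have ze: "expdec (\<lambda>x. z x * R x)" "expdec (\<lambda>x. z x * R x ^ 3)" "expdec (\<lambda>x. z x * R x ^ 5)" by (rule zR_expdec)+
  obtain m where m: "\<And>x. norm (z x) \<le> m" using expdec_bcontfun[OF z_expdec] by (auto simp: bcontfun_def bounded_iff)
  show ?thesis
  proof (rule sector_result[where p=1 and wp=v and \<phi>="\<lambda>\<epsilon> x. J *v A \<epsilon> x" and \<phi>d="\<lambda>\<epsilon> x. J *v A1 \<epsilon> x"
        and \<theta>="\<lambda>\<epsilon> x. thE (st \<epsilon> x) *v A \<epsilon> x" and \<theta>a="\<lambda>x. thE (st0 x) *v A0 x"])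
    have "second_deriv (\<lambda>x. - z x) (\<lambda>x. - z1 x) (\<lambda>x. - (Va x * z x + R x))"
      using second_deriv_linear[OF bounded_linear_minus[OF bounded_linear_ident] z_second] .
    moreover have "second_deriv (\<lambda>x::real. 0::real) (\<lambda>x. 0) (\<lambda>x. 0)" by (simp add: second_deriv_def)
    ultimately have "second_deriv v (\<lambda>x. cvec (vector [- z1 x, 0])) (\<lambda>x. cvec (vector [- (Va x * z x + R x), 0]))"
      unfolding v_def by (rule second_deriv_vec2)
    moreover have "(\<lambda>x. m2 (of_real (Va x)) 0 0 (of_real (Vb x)) *v v x + cplx J *v cvec (ground 1 x))
      = (\<lambda>x. cvec (vector [- (Va x * z x + R x), 0]))"
      by (simp add: fun_eq_iff vec_eq_iff forall_2 v_def g1)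
    ultimately show "second_deriv v (\<lambda>x. cvec (vector [- z1 x, 0]))
      (\<lambda>x. m2 (of_real (Va x)) 0 0 (of_real (Vb x)) *v v x + cplx J *v cvec (ground 1 x))" by simp
    show "norm (v x) \<le> m" for x
      using norm_le_components_real[of "vector [- z x, 0]"] m[of x] by (simp add: v_def)
    show "par 1 v" by (simp add: par_def v_def z_even)
    show "pair (ground 1) v = 0" unfolding v_def pair_cvec by (simp add: g1)
    show "nice (\<lambda>\<epsilon> x. thE (st \<epsilon> x) *v A \<epsilon> x) (\<lambda>x. thE (st0 x) *v A0 x)" by (rule nice_mult[OF Q_cont(4) nice_A])
    have i: "has_bochner_integral lborel (\<lambda>x. z x * R x) (Z 1)" "has_bochner_integral lborel (\<lambda>x. z x * R x ^ 3) (Z 3)"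
      "has_bochner_integral lborel (\<lambda>x. z x * R x ^ 5) (Z 5)"
      using zR_integrable by (simp_all add: Z_def has_bochner_integral_iff)
    have th1: "(thE (st0 x) *v A0 x) $ 1 = 2 * a * R2 x + gg d0 (A0 x) * R x" for x
    proof -
      have "(GQ (st0 x) *v A0 x) $ 1 = R2 x" using arg_cong[OF A02_eq[of x], of "\<lambda>v. v $ 1"] by (simp only: GQ_st A0_nth)
      then show ?thesis by (simp add: thE_def gQ_def st0_def mat_def algebra_simps)
    qed
    have "has_bochner_integral lborel (\<lambda>x. 2 * a * (\<omega> * (z x * R x) - z x * R x ^ 3 - \<alpha> * (z x * R x ^ 5))
        + 2 * b * (z x * R x) + 4 * d0 * (z x * R x ^ 3) + 6 * d2 * (z x * R x ^ 5)) (- q_even)"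
      unfolding q_even_eq minus_minus
      by (intro has_bochner_integral_add has_bochner_integral_diff has_bochner_integral_mult_right i)
    moreover have "2 * a * (\<omega> * (z x * R x) - z x * R x ^ 3 - \<alpha> * (z x * R x ^ 5))
        + 2 * b * (z x * R x) + 4 * d0 * (z x * R x ^ 3) + 6 * d2 * (z x * R x ^ 5) = - ((thE (st0 x) *v A0 x) $ 1 * (- z x))" for x
      unfolding th1 gQ_st0 R2_def by algebra
    ultimately have "has_bochner_integral lborel (\<lambda>x. - ((thE (st0 x) *v A0 x) $ 1 * (- z x))) (- q_even)" by (simp only:)
    from has_bochner_integral_minus[OF this]
    have "(\<integral>x. (thE (st0 x) *v A0 x) $ 1 * (- z x) \<partial>lborel) = q_even"
      unfolding minus_minus by (rule has_bochner_integral_integral_eq)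
    then show "pair (\<lambda>x. thE (st0 x) *v A0 x) v = of_real q_even"
      unfolding v_def pair_cvec by (simp del: mult_vec_2)
    show "pair (\<lambda>x. J *v ground 1 x) v = of_real (Z 1)" unfolding v_def pair_cvec by (simp add: g1 Z_def mult.commute)
    show "nice (\<lambda>\<epsilon> x. J *v A \<epsilon> x) (ground 1)" unfolding g1 by (rule nice_J[OF nice_A])
    show "\<forall>\<^sub>F \<epsilon> in at_right 0. par 1 (\<lambda>x. J *v A \<epsilon> x) \<and>
      second_deriv (\<lambda>x. J *v A \<epsilon> x) (\<lambda>x. J *v A1 \<epsilon> x) (\<lambda>x. MQ (st \<epsilon> x) *v (J *v A \<epsilon> x)) \<and> expdec (\<lambda>x. J *v A1 \<epsilon> x) \<and>
      (\<forall>x. transpose (B a \<epsilon>) *v (MQ (st \<epsilon> x) *v (J *v A \<epsilon> x)) + transpose (DFm \<epsilon> (d1s \<epsilon>) (A \<epsilon> x)) *v (J *v A \<epsilon> x)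
         = \<epsilon> *\<^sub>R (thE (st \<epsilon> x) *v A \<epsilon> x))"
      using eventually_wave nice_pclose(3)[OF nice_J[OF nice_A1]]
    proof eventually_elim
      case (elim \<epsilon>)
      have s: "second_deriv (A \<epsilon>) (A1 \<epsilon>) (A2 \<epsilon>)" using elim wave_derivatives(1) by blast
      have MJ: "MQ (st \<epsilon> x) *v (J *v A \<epsilon> x) = J *v A2 \<epsilon> x" for x by (simp only: GQ_st MM_J A2_def)
      have "transpose (B a \<epsilon>) *v (J *v A2 \<epsilon> x) + transpose (DFm \<epsilon> (d1s \<epsilon>) (A \<epsilon> x)) *v (J *v A \<epsilon> x)
         = \<epsilon> *\<^sub>R (thE (st \<epsilon> x) *v A \<epsilon> x)" for x
      proof -
        have "B a \<epsilon> *v A2 \<epsilon> x = - (Cm \<epsilon> (d1s \<epsilon>) (A \<epsilon> x) *v A \<epsilon> x)" unfolding A2_def by (rule B_GG)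
        from adjoint_even[OF this]
        show ?thesis
          unfolding A2_Q by (rule trans) (simp add: vec_eq_iff forall_2 thE_def gQ_def st_def mat_def algebra_simps)
      qed
      then show ?case
        unfolding MJ using elim second_deriv_linear[OF matrix_vector_mul_bounded_linear s, of J] by (auto simp: par_def)
    qed
  qed (use assms Z_pos in auto)
qed

text \<open>The chain over the translation mode is the Galilean mode (0, x R / 2). Here c = - L 2 /
  4, and \<open>odd_moment\<close> with \<open>lead_relation\<close> gives q = - a K, so the
  eigenvalue is - 4 \<epsilon> a K / L 2 to leading order, negative whatever b and d2 are.\<close>

lemma odd_sector:
  assumes "a > 0"
  shows "\<exists>\<nu> d0. \<forall>d\<ge>d0. \<forall>\<^sub>F \<epsilon> in at_right 0. simple_spectrum (- 1) d \<epsilon> (\<nu> \<epsilon>) \<and> \<nu> \<epsilon> * (- L 2 / 4) * (- (a * K)) < 0"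
proof -
  define v where "v x = cvec (vector [0, 1 / 2 * (x * R x)])" for x
  have g1: "ground (- 1) = A01" by (simp add: ground_def)
  obtain m where m: "\<And>x. norm (x * R x) \<le> m" using expdec_bcontfun[OF xR_expdec(1)] by (auto simp: bcontfun_def bounded_iff)
  have VbR: "Vb x * R x = R2 x" for x unfolding R2_def Vb_def by algebra
  show ?thesis
  proof (rule sector_result[where p="- 1" and wp=v and \<phi>=A1 and \<phi>d=A2
        and \<theta>="\<lambda>\<epsilon> x. thO (st \<epsilon> x) *v A1 \<epsilon> x" and \<theta>a="\<lambda>x. thO (st0 x) *v A01 x"])
    have "second_deriv (\<lambda>x. 1 / 2 * (x * R x)) (\<lambda>x. 1 / 2 * (R x + x * R1 x)) (\<lambda>x. 1 / 2 * (2 * R1 x + x * R2 x))"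
      using second_deriv_linear[OF bounded_linear_mult_right xR_second] .
    moreover have "second_deriv (\<lambda>x::real. 0::real) (\<lambda>x. 0) (\<lambda>x. 0)" by (simp add: second_deriv_def)
    ultimately have "second_deriv v (\<lambda>x. cvec (vector [0, 1 / 2 * (R x + x * R1 x)])) (\<lambda>x. cvec (vector [0, 1 / 2 * (2 * R1 x + x * R2 x)]))"
      unfolding v_def by (intro second_deriv_vec2)
    moreover have "(\<lambda>x. m2 (of_real (Va x)) 0 0 (of_real (Vb x)) *v v x + cplx J *v cvec (ground (- 1) x))
      = (\<lambda>x. cvec (vector [0, 1 / 2 * (2 * R1 x + x * R2 x)]))"
      by (simp add: fun_eq_iff vec_eq_iff forall_2 v_def g1 VbR[symmetric] field_simps)
    ultimately show "second_deriv v (\<lambda>x. cvec (vector [0, 1 / 2 * (R x + x * R1 x)]))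
      (\<lambda>x. m2 (of_real (Va x)) 0 0 (of_real (Vb x)) *v v x + cplx J *v cvec (ground (- 1) x))" by simp
    show "norm (v x) \<le> m" for x
      using norm_le_components_real[of "vector [0, 1 / 2 * (x * R x)]"] m[of x] norm_ge_zero[of "x * R x"] by (simp add: v_def)
    show "par (- 1) v" by (simp add: par_def v_def R_even vec_eq_iff forall_2)
    show "pair (ground (- 1)) v = 0" unfolding v_def pair_cvec by (simp add: g1)
    show "nice (\<lambda>\<epsilon> x. thO (st \<epsilon> x) *v A1 \<epsilon> x) (\<lambda>x. thO (st0 x) *v A01 x)" by (rule nice_mult[OF Q_cont(5) nice_A1])
    have th2: "(thO (st0 x) *v A01 x) $ 2 = - (2 * a * (Va x * R1 x) + (2 * b + 4 * d0 * R x ^ 2 + 6 * d2 * R x ^ 4) * R1 x)" for x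
    proof -
      have "MQ (st0 x) = m2 (Va x) 0 0 (Vb x)" by (simp only: GQ_st MM_0)
      then show ?thesis unfolding gQ_st0[symmetric] by (simp add: thO_def gQ_def st0_def mat_def algebra_simps)
    qed
    have "(\<integral>x. (thO (st0 x) *v A01 x) $ 2 * (1 / 2 * (x * R x)) \<partial>lborel)
      = (\<integral>x. (- (1 / 2)) * (x * R x * (2 * a * (Va x * R1 x) + (2 * b + 4 * d0 * R x ^ 2 + 6 * d2 * R x ^ 4) * R1 x)) \<partial>lborel)"
      unfolding th2 by (rule Bochner_Integration.integral_cong) (auto simp: algebra_simps)
    also have "\<dots> = - (1 / 2) * (3 * a * K - b * L 2 - d0 * L 4 - d2 * L 6)"
      unfolding odd_moment[symmetric] by (rule integral_mult_right_zero)
    also have "\<dots> = - (a * K)" using lead_relation by simp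
    finally show "pair (\<lambda>x. thO (st0 x) *v A01 x) v = of_real (- (a * K))"
      unfolding v_def pair_cvec by (simp del: mult_vec_2)
    have "(\<integral>x. (1 / 2) * (x * R x * R1 x) \<partial>lborel) = 1 / 2 * (- L 2 / 2)"
      unfolding xRR1_integral(1)[symmetric] by (rule integral_mult_right_zero)
    then show "pair (\<lambda>x. J *v ground (- 1) x) v = of_real (- L 2 / 4)"
      unfolding v_def pair_cvec by (simp add: g1 algebra_simps)
    show "nice A1 (ground (- 1))" unfolding g1 by (rule nice_A1)
    show "\<forall>\<^sub>F \<epsilon> in at_right 0. par (- 1) (A1 \<epsilon>) \<and> second_deriv (A1 \<epsilon>) (A2 \<epsilon>) (\<lambda>x. MQ (st \<epsilon> x) *v A1 \<epsilon> x) \<and> expdec (A2 \<epsilon>) \<and>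
      (\<forall>x. transpose (B a \<epsilon>) *v (MQ (st \<epsilon> x) *v A1 \<epsilon> x) + transpose (DFm \<epsilon> (d1s \<epsilon>) (A \<epsilon> x)) *v A1 \<epsilon> x
         = \<epsilon> *\<^sub>R (thO (st \<epsilon> x) *v A1 \<epsilon> x))"
      using eventually_wave nice_pclose(3)[OF nice_A2]
    proof eventually_elim
      case (elim \<epsilon>)
      have s: "second_deriv (A \<epsilon>) (A1 \<epsilon>) (A2 \<epsilon>)" "second_deriv (A1 \<epsilon>) (A2 \<epsilon>) (\<lambda>x. MQ (st \<epsilon> x) *v A1 \<epsilon> x)"
        using elim wave_derivatives unfolding A3_Q by blast+
      have "(\<lambda>x. A \<epsilon> (- x)) = apply_bcontfun (A \<epsilon>)" using elim by auto
      with second_deriv_reflect[OF s(1)] have "second_deriv (A \<epsilon>) (\<lambda>x. - A1 \<epsilon> (- x)) (\<lambda>x. A2 \<epsilon> (- x))" by simp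
      from second_deriv_unique(1)[OF this s(1)] have o: "- A1 \<epsilon> (- x) = A1 \<epsilon> x" for x by (rule fun_cong)
      have "A1 \<epsilon> (- x) = - A1 \<epsilon> x" for x using o[of x] by (simp add: minus_equation_iff)
      then have "par (- 1) (A1 \<epsilon>)" by (simp add: par_def)
      moreover have "transpose (B a \<epsilon>) *v (MQ (st \<epsilon> x) *v A1 \<epsilon> x) + transpose (DFm \<epsilon> (d1s \<epsilon>) (A \<epsilon> x)) *v A1 \<epsilon> x
         = \<epsilon> *\<^sub>R (thO (st \<epsilon> x) *v A1 \<epsilon> x)" for x
      proof -
        have "B a \<epsilon> *v (MM \<epsilon> (d1s \<epsilon>) (A \<epsilon> x) *v A1 \<epsilon> x) = - (DFm \<epsilon> (d1s \<epsilon>) (A \<epsilon> x) *v A1 \<epsilon> x)" by (rule B_MM)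
        from adjoint_odd[OF this]
        show ?thesis
          unfolding GQ_st by (rule trans) (simp add: vec_eq_iff forall_2 thO_def MQ_def gQ_def st_def mat_def algebra_simps)
      qed
      ultimately show ?case using elim(2) s(2) by blast
    qed
  qed (use assms L_pos K_pos in auto)
qed

subsection \<open>Eigenvalues and multiplicities of the linearization\<close>

definition T :: "real \<Rightarrow> (real \<Rightarrow> complex^2) \<Rightarrow> real \<Rightarrow> complex^2" where
  "T \<epsilon> = mJL \<alpha> a b (d1s \<epsilon>) d2 \<omega> \<epsilon> (A \<epsilon>)"

definition regular_at :: "real \<Rightarrow> real \<Rightarrow> bool" where
  "regular_at d \<epsilon> \<longleftrightarrow> 0 < \<epsilon> \<and> (\<forall>x. A \<epsilon> (- x) = A \<epsilon> x) \<and>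
     (\<forall>\<mu> u u1. cmod \<mu> \<le> d * \<epsilon> \<longrightarrow> second_deriv u u1 (\<lambda>x. NNb \<epsilon> \<mu> x *v u x) \<longrightarrow> u \<in> bcontfun \<longrightarrow> expdec u)"

lemma localized_solution:
  assumes u: "localized u" and eq: "\<And>x. T \<epsilon> u x - \<mu> *s u x = g x" and g: "g \<in> bcontfun"
  shows "u \<in> bcontfun" "second_deriv u (Dx u) (\<lambda>x. NNb \<epsilon> \<mu> x *v u x + cplx (Em \<epsilon>) *v g x)"
proof -
  have s: "second_deriv u (Dx u) (Dx (Dx u))" using u twice_diff_second_deriv by (auto simp: localized_def)
  have "Dx (Dx u) x = NNb \<epsilon> \<mu> x *v u x + cplx (Em \<epsilon>) *v g x" for x
    using eq[of x] unfolding T_def eigen_equation NNb_def GQ_st .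
  then have "Dx (Dx u) = (\<lambda>x. NNb \<epsilon> \<mu> x *v u x + cplx (Em \<epsilon>) *v g x)" by (rule ext)
  with s show s2: "second_deriv u (Dx u) (\<lambda>x. NNb \<epsilon> \<mu> x *v u x + cplx (Em \<epsilon>) *v g x)" by (simp only:)
  obtain k where k: "\<And>x. mnorm (NNb \<epsilon> \<mu> x) \<le> k" using NNb_bounded by blast
  obtain G where G: "\<And>x. norm (cplx (Em \<epsilon>) *v g x) \<le> G"
    using bcontfun_mult_vec[OF g, of "cplx (Em \<epsilon>)"] by (auto simp: bcontfun_def bounded_iff)
  have "bounded (range u)"
  proof (rule square_integrable_imp_bounded[OF s2])
    show "integrable lborel (\<lambda>x. (norm (u x))\<^sup>2)" using u by (simp add: localized_def)
    show "norm (NNb \<epsilon> \<mu> x *v u x + cplx (Em \<epsilon>) *v g x) \<le> k * norm (u x) + G" for x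
      using norm_triangle_ineq[of "NNb \<epsilon> \<mu> x *v u x" "cplx (Em \<epsilon>) *v g x"] norm_mult_vec[of "NNb \<epsilon> \<mu> x" "u x"]
        mult_right_mono[OF k norm_ge_zero[of "u x"], of x] G[of x] by linarith
  qed
  then show "u \<in> bcontfun" using second_deriv_continuous(1)[OF s2] by (simp add: bcontfun_def)
qed

definition ker :: "real \<Rightarrow> complex \<Rightarrow> (real \<Rightarrow> complex^2) set" where
  "ker \<epsilon> \<mu> = {u \<in> bcontfun. \<exists>u1. second_deriv u u1 (\<lambda>x. NNb \<epsilon> \<mu> x *v u x)}"

lemma bsol_ker: "bsol p \<epsilon> \<mu> u (\<lambda>x. 0) \<Longrightarrow> u \<in> ker \<epsilon> \<mu>"
  by (simp add: bsol_def ker_def)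

text \<open>Forward, square integrability gives boundedness by the local estimate; backward,
  boundedness gives exponential decay, which is where the restriction to a disc of order \<epsilon>
  enters.\<close>

lemma eigenfunction_iff:
  assumes "regular_at d \<epsilon>" "cmod \<mu> \<le> d * \<epsilon>"
  shows "localized u \<and> (\<forall>x. T \<epsilon> u x = \<mu> *s u x) \<longleftrightarrow> u \<in> ker \<epsilon> \<mu>"
proof
  assume u: "localized u \<and> (\<forall>x. T \<epsilon> u x = \<mu> *s u x)"
  have "(\<lambda>x::real. 0 :: complex^2) \<in> bcontfun" by (rule const_bcontfun)
  with u localized_solution[of u \<epsilon> \<mu> "\<lambda>x. 0"] show "u \<in> ker \<epsilon> \<mu>" by (auto simp: ker_def)
next
  assume "u \<in> ker \<epsilon> \<mu>"
  then obtain u1 where b: "u \<in> bcontfun" and s: "second_deriv u u1 (\<lambda>x. NNb \<epsilon> \<mu> x *v u x)" by (auto simp: ker_def)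
  have e: "expdec u" using assms s b unfolding regular_at_def by blast
  have "expdec (\<lambda>x. norm (u x))"
    by (rule expdec_comparison[OF e, where K=1]) (use e in \<open>auto simp: expdec_def intro: continuous_on_norm\<close>)
  from expdec_integrable[OF expdec_mult2[OF this this]]
  have "localized u" using second_deriv_Dx(1)[OF s] by (simp add: localized_def power2_eq_square)
  moreover have "T \<epsilon> u x - \<mu> *s u x = 0" for x
    unfolding T_def eigen_equation second_deriv_Dx(3)[OF s] NNb_def GQ_st by simp
  ultimately show "localized u \<and> (\<forall>x. T \<epsilon> u x = \<mu> *s u x)" by (simp only: right_minus_eq) simp
qed

definition half :: "real \<Rightarrow> (real \<Rightarrow> complex^2) \<Rightarrow> real \<Rightarrow> complex^2" where
  "half p w x = (1/2) *\<^sub>R (w x + p *\<^sub>R w (- x))"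

lemma half_sum: "w x = half 1 w x + half (- 1) w x"
  by (simp add: half_def vec_eq_iff scaleR_complex field_simps)

lemma half_bsol:
  assumes ev: "\<And>x. A \<epsilon> (- x) = A \<epsilon> x" and p: "p = 1 \<or> p = - 1" and b: "w \<in> bcontfun"
    and w: "second_deriv w w1 (\<lambda>x. NNb \<epsilon> \<mu> x *v w x + cplx (Em \<epsilon>) *v g x)"
  shows "bsol p \<epsilon> \<mu> (half p w) (\<lambda>x. cplx (Em \<epsilon>) *v half p g x)"
  unfolding bsol_def
proof (intro conjI exI)
  obtain m where m: "\<And>x. norm (w x) \<le> m" and wc: "continuous_on UNIV w" using b by (auto simp: bcontfun_def bounded_iff)
  show "half p w \<in> bcontfun"
  proof (rule bcontfunI')
    show "continuous_on UNIV (half p w)" unfolding half_def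
      by (intro continuous_intros wc continuous_on_compose2[OF wc]) auto
    show "norm (half p w x) \<le> m" for x
    proof -
      have "norm (w x + p *\<^sub>R w (- x)) \<le> m + m"
        using norm_triangle_ineq[of "w x" "p *\<^sub>R w (- x)"] m[of x] m[of "- x"] p by auto
      then show ?thesis by (simp add: half_def)
    qed
  qed
  show "par p (half p w)" using p by (auto simp: par_def half_def vec_eq_iff scaleR_complex algebra_simps)
  have N: "NNb \<epsilon> \<mu> (- x) = NNb \<epsilon> \<mu> x" for x by (simp add: NNb_def st_def ev)
  have "second_deriv (half p w) (\<lambda>x. (1/2) *\<^sub>R (w1 x + p *\<^sub>R (- w1 (- x))))
    (\<lambda>x. (1/2) *\<^sub>R ((NNb \<epsilon> \<mu> x *v w x + cplx (Em \<epsilon>) *v g x) + p *\<^sub>R (NNb \<epsilon> \<mu> (- x) *v w (- x) + cplx (Em \<epsilon>) *v g (- x))))"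
    unfolding half_def
    by (intro second_deriv_linear[OF bounded_linear_scaleR_right] second_deriv_add w second_deriv_reflect[OF w])
  moreover have "(\<lambda>x. (1/2) *\<^sub>R ((NNb \<epsilon> \<mu> x *v w x + cplx (Em \<epsilon>) *v g x) + p *\<^sub>R (NNb \<epsilon> \<mu> (- x) *v w (- x) + cplx (Em \<epsilon>) *v g (- x))))
    = (\<lambda>x. NNb \<epsilon> \<mu> x *v half p w x + cplx (Em \<epsilon>) *v half p g x)"
    unfolding N by (simp add: fun_eq_iff vec_eq_iff forall_2 half_def scaleR_complex algebra_simps add_divide_distrib)
  ultimately show "second_deriv (half p w) (\<lambda>x. (1/2) *\<^sub>R (w1 x + p *\<^sub>R (- w1 (- x))))
    (\<lambda>x. NNb \<epsilon> \<mu> x *v half p w x + cplx (Em \<epsilon>) *v half p g x)" by simp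
qed

lemma half_ker:
  assumes "\<And>x. A \<epsilon> (- x) = A \<epsilon> x" and "p = 1 \<or> p = - 1" and "u \<in> ker \<epsilon> \<mu>"
  shows "bsol p \<epsilon> \<mu> (half p u) (\<lambda>x. 0)"
proof -
  obtain u1 where "u \<in> bcontfun" "second_deriv u u1 (\<lambda>x. NNb \<epsilon> \<mu> x *v u x + cplx (Em \<epsilon>) *v 0)"
    using assms(3) by (auto simp: ker_def)
  from half_bsol[OF assms(1,2) this] show ?thesis by (simp add: half_def)
qed

lemma simple_spectrumD:
  assumes "simple_spectrum p d \<epsilon> n" "cmod \<mu> \<le> d * \<epsilon>" "bsol p \<epsilon> \<mu> u (\<lambda>x. 0)" "\<exists>x. u x \<noteq> 0"
  shows "\<mu> \<in> {0, of_real n}" "bsol p \<epsilon> \<mu> u' (\<lambda>x. 0) \<Longrightarrow> \<exists>t. \<forall>x. u' x = t *s u x"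
    "\<not> bsol p \<epsilon> \<mu> w (\<lambda>x. cplx (Em \<epsilon>) *v u x)"
proof -
  note * = conjunct2[OF conjunct2[OF assms(1)[unfolded simple_spectrum_def]], THEN spec, THEN spec, THEN mp, THEN mp, THEN mp,
    OF assms(2-4)]
  show "\<mu> \<in> {0, of_real n}" by (rule conjunct1[OF *])
  show "bsol p \<epsilon> \<mu> u' (\<lambda>x. 0) \<Longrightarrow> \<exists>t. \<forall>x. u' x = t *s u x"
    by (rule conjunct1[OF conjunct2[OF *], THEN spec, THEN mp])
  show "\<not> bsol p \<epsilon> \<mu> w (\<lambda>x. cplx (Em \<epsilon>) *v u x)" using conjunct2[OF conjunct2[OF *]] by simp
qed

definition spectral :: "real \<Rightarrow> real \<Rightarrow> real \<Rightarrow> real \<Rightarrow> bool" where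
  "spectral d \<epsilon> \<nu>o \<nu>e \<longleftrightarrow> regular_at d \<epsilon> \<and> simple_spectrum 1 d \<epsilon> \<nu>e \<and> simple_spectrum (- 1) d \<epsilon> \<nu>o"

lemma gen_kernel_1:
  assumes "regular_at d \<epsilon>" "cmod \<mu> \<le> d * \<epsilon>"
  shows "gen_kernel (T \<epsilon>) \<mu> (Suc 0) = ker \<epsilon> \<mu>"
  using eigenfunction_iff[OF assms] by (auto simp: fun_eq_iff)

text \<open>If T u - \<mu> u is in the kernel and has a nonzero even or odd part, the part of
  \<open>u\<close> of that parity continues a Jordan chain over it, which simplicity in the sector
  forbids. So generalized kernels never grow beyond the kernel.\<close>

lemma Union_gen_kernel:
  assumes sp: "spectral d \<epsilon> \<nu>o \<nu>e" and mu: "cmod \<mu> \<le> d * \<epsilon>"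
  shows "(\<Union>k. gen_kernel (T \<epsilon>) \<mu> k) = ker \<epsilon> \<mu>"
proof -
  have r: "regular_at d \<epsilon>" using sp by (simp add: spectral_def)
  have ev: "A \<epsilon> (- x) = A \<epsilon> x" for x using r by (simp add: regular_at_def)
  note k1 = gen_kernel_1[OF r mu]
  have step: "u \<in> ker \<epsilon> \<mu>" if u: "localized u" and v: "(\<lambda>x. T \<epsilon> u x - \<mu> *s u x) \<in> ker \<epsilon> \<mu>" for u
  proof -
    define v where "v x = T \<epsilon> u x - \<mu> *s u x" for x
    have vk: "v \<in> ker \<epsilon> \<mu>" using v unfolding v_def .
    then have vb: "v \<in> bcontfun" by (simp add: ker_def)
    note us = localized_solution[OF u v_def[symmetric] vb]
    have z: "half p v x = 0" if p: "p = 1 \<or> p = - 1" for p x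
    proof (rule ccontr)
      assume "half p v x \<noteq> 0"
      moreover obtain n where "simple_spectrum p d \<epsilon> n" using p sp by (auto simp: spectral_def)
      ultimately show False
        using simple_spectrumD(3)[OF _ mu half_ker[OF ev p vk]] half_bsol[OF ev p us] by blast
    qed
    have "v x = 0" for x using half_sum[of v x] z[of 1 x] z[of "- 1" x] by simp
    then have "T \<epsilon> u x = \<mu> *s u x" for x using v_def[of x] by simp
    then show ?thesis using u eigenfunction_iff[OF r mu] by blast
  qed
  have "gen_kernel (T \<epsilon>) \<mu> k \<subseteq> ker \<epsilon> \<mu>" for k
  proof (induction k)
    case 0
    have "second_deriv (\<lambda>x::real. 0::complex^2) (\<lambda>x. 0) (\<lambda>x. 0)" by (simp add: second_deriv_def)
    moreover have "(\<lambda>x::real. 0 :: complex^2) \<in> bcontfun" by (rule const_bcontfun)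
    ultimately show ?case by (auto simp: ker_def)
  next
    case (Suc k)
    then show ?case using step by auto
  qed
  then show ?thesis using k1 by blast
qed

definition has_mode :: "real \<Rightarrow> real \<Rightarrow> complex \<Rightarrow> bool" where
  "has_mode p \<epsilon> \<mu> \<longleftrightarrow> (\<exists>u. bsol p \<epsilon> \<mu> u (\<lambda>x. 0) \<and> (\<exists>x. u x \<noteq> 0))"

lemma has_mode_iff:
  assumes "simple_spectrum p d \<epsilon> n" "cmod \<mu> \<le> d * \<epsilon>"
  shows "has_mode p \<epsilon> \<mu> \<longleftrightarrow> \<mu> \<in> {0, of_real n}"
proof
  assume "has_mode p \<epsilon> \<mu>"
  then show "\<mu> \<in> {0, of_real n}" unfolding has_mode_def using simple_spectrumD(1)[OF assms] by blast
next
  assume "\<mu> \<in> {0, of_real n}"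
  then show "has_mode p \<epsilon> \<mu>" using assms(1) unfolding has_mode_def simple_spectrum_def by (elim conjE) (rule bspec)
qed

lemma is_eigenvalue_iff:
  assumes sp: "spectral d \<epsilon> \<nu>o \<nu>e" and mu: "cmod \<mu> \<le> d * \<epsilon>"
  shows "is_eigenvalue (T \<epsilon>) \<mu> \<longleftrightarrow> \<mu> \<in> {0, of_real \<nu>o, of_real \<nu>e}"
proof -
  have r: "regular_at d \<epsilon>" using sp by (simp add: spectral_def)
  then have ev: "A \<epsilon> (- x) = A \<epsilon> x" for x by (simp add: regular_at_def)
  have "is_eigenvalue (T \<epsilon>) \<mu> \<longleftrightarrow> (\<exists>u\<in>ker \<epsilon> \<mu>. \<exists>x. u x \<noteq> 0)"
    unfolding is_eigenvalue_def using eigenfunction_iff[OF r mu] by blast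
  also have "\<dots> \<longleftrightarrow> has_mode 1 \<epsilon> \<mu> \<or> has_mode (- 1) \<epsilon> \<mu>"
  proof
    assume "\<exists>u\<in>ker \<epsilon> \<mu>. \<exists>x. u x \<noteq> 0"
    then obtain u x where u: "u \<in> ker \<epsilon> \<mu>" "u x \<noteq> 0" by blast
    then have "half 1 u x \<noteq> 0 \<or> half (- 1) u x \<noteq> 0" using half_sum[of u x] by auto
    then show "has_mode 1 \<epsilon> \<mu> \<or> has_mode (- 1) \<epsilon> \<mu>"
      unfolding has_mode_def using half_ker[OF ev _ u(1), of 1] half_ker[OF ev _ u(1), of "- 1"] by blast
  qed (auto simp: has_mode_def intro: bsol_ker)
  also have "\<dots> \<longleftrightarrow> \<mu> \<in> {0, of_real \<nu>o, of_real \<nu>e}"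
    using sp has_mode_iff[OF _ mu, of 1] has_mode_iff[OF _ mu, of "- 1"] unfolding spectral_def by blast
  finally show ?thesis .
qed

text \<open>The kernel is the direct sum of its even and odd part, each of dimension at most one, so
  the contributions of the sectors add. This yields multiplicity 2 at zero, and also 2 if the two
  nonzero eigenvalues happen to coincide.\<close>

lemma alg_mult_eq:
  assumes sp: "spectral d \<epsilon> \<nu>o \<nu>e" and mu: "cmod \<mu> \<le> d * \<epsilon>"
  shows "alg_mult (T \<epsilon>) \<mu> = (if \<mu> \<in> {0, of_real \<nu>e} then 1 else 0) + (if \<mu> \<in> {0, of_real \<nu>o} then 1 else 0)"
proof -
  have r: "regular_at d \<epsilon>" using sp by (simp add: spectral_def)
  then have ev: "A \<epsilon> (- x) = A \<epsilon> x" for x by (simp add: regular_at_def)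
  have basis: "\<exists>S. S \<subseteq> ker \<epsilon> \<mu> \<and> (\<forall>u. bsol p \<epsilon> \<mu> u (\<lambda>x. 0) \<longrightarrow> u \<in> fun_space.span S) \<and>
     (if \<mu> \<in> {0, of_real n} then \<exists>u. S = {u} \<and> u \<noteq> 0 \<and> par p u else S = {})"
    if n: "simple_spectrum p d \<epsilon> n" for p n
  proof (cases "\<mu> \<in> {0, of_real n}")
    case True
    then obtain u where u: "bsol p \<epsilon> \<mu> u (\<lambda>x. 0)" "\<exists>x. u x \<noteq> 0" using has_mode_iff[OF n mu] unfolding has_mode_def by blast
    have "w \<in> fun_space.span {u}" if w: "bsol p \<epsilon> \<mu> w (\<lambda>x. 0)" for w
    proof -
      obtain t where "\<forall>x. w x = t *s u x" using simple_spectrumD(2)[OF n mu u w] by blast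
      then have "w = (\<lambda>x. t *s u x)" by auto
      then show ?thesis using fun_space.span_scale[OF fun_space.span_base[of u "{u}"], of t] by simp
    qed
    moreover have "u \<in> ker \<epsilon> \<mu>" "par p u" "u \<noteq> 0" using u bsol_ker[OF u(1)] by (auto simp: bsol_def)
    ultimately show ?thesis using True by (intro exI[of _ "{u}"]) auto
  next
    case False
    then have "w = 0" if "bsol p \<epsilon> \<mu> w (\<lambda>x. 0)" for w
      using has_mode_iff[OF n mu] that unfolding has_mode_def by (auto simp: fun_eq_iff)
    then show ?thesis using False by (intro exI[of _ "{}"]) auto
  qed
  have ss: "simple_spectrum 1 d \<epsilon> \<nu>e" "simple_spectrum (- 1) d \<epsilon> \<nu>o" using sp by (auto simp: spectral_def)
  obtain S where S: "S \<subseteq> ker \<epsilon> \<mu>" "\<And>u. bsol 1 \<epsilon> \<mu> u (\<lambda>x. 0) \<Longrightarrow> u \<in> fun_space.span S"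
    "if \<mu> \<in> {0, of_real \<nu>e} then \<exists>u. S = {u} \<and> u \<noteq> 0 \<and> par 1 u else S = {}" using basis[OF ss(1)] by blast
  obtain S' where S': "S' \<subseteq> ker \<epsilon> \<mu>" "\<And>u. bsol (- 1) \<epsilon> \<mu> u (\<lambda>x. 0) \<Longrightarrow> u \<in> fun_space.span S'"
    "if \<mu> \<in> {0, of_real \<nu>o} then \<exists>u. S' = {u} \<and> u \<noteq> 0 \<and> par (- 1) u else S' = {}" using basis[OF ss(2)] by blast
  have ker_span: "ker \<epsilon> \<mu> \<subseteq> fun_space.span (S \<union> S')"
  proof
    fix u assume u: "u \<in> ker \<epsilon> \<mu>"
    have "half 1 u \<in> fun_space.span (S \<union> S')" "half (- 1) u \<in> fun_space.span (S \<union> S')"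
      using S(2)[OF half_ker[OF ev _ u]] S'(2)[OF half_ker[OF ev _ u]] fun_space.span_mono[of S "S \<union> S'"] fun_space.span_mono[of S' "S \<union> S'"]
      by auto
    then have "half 1 u + half (- 1) u \<in> fun_space.span (S \<union> S')" by (rule fun_space.span_add)
    moreover have "half 1 u + half (- 1) u = u" using half_sum[of u] by (simp add: fun_eq_iff)
    ultimately show "u \<in> fun_space.span (S \<union> S')" by simp
  qed
  have both: "u = 0" if "par 1 u" "par (- 1) u" for u :: "real \<Rightarrow> complex^2"
  proof -
    have "u x = - u x" for x using that by (simp add: par_def)
    then have "u x $ i = - u x $ i" for x i by (metis vector_uminus_component)
    then show ?thesis by (simp add: fun_eq_iff vec_eq_iff)
  qed
  have ni: "u \<notin> fun_space.span {u'}" if u: "u \<noteq> 0" "par 1 u" "par (- 1) u'" for u u' :: "real \<Rightarrow> complex^2"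
  proof
    assume "u \<in> fun_space.span {u'}"
    then obtain t where "u = (\<lambda>x. t *s u' x)" by (auto simp: fun_space.span_singleton)
    then have "par (- 1) u" using par_smult[OF u(3), of t] by simp
    then show False using both u by blast
  qed
  have ind: "\<not> fun_space.dependent (S \<union> S')"
  proof (cases "\<mu> \<in> {0, of_real \<nu>e} \<and> \<mu> \<in> {0, of_real \<nu>o}")
    case True
    then obtain u u' where u: "S = {u}" "S' = {u'}" "u \<noteq> 0" "par 1 u" "u' \<noteq> 0" "par (- 1) u'" using S(3) S'(3) by auto
    then have "S \<union> S' = insert u {u'}" by auto
    moreover have "\<not> fun_space.dependent (insert u {u'})"
      by (rule fun_space.independent_insertI[OF ni[OF u(3,4,6)]]) (use u in \<open>simp add: fun_space.dependent_single\<close>)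
    ultimately show ?thesis by (simp only:) simp
  next
    case False
    then show ?thesis using S(3) S'(3) by (auto simp: fun_space.dependent_single fun_space.independent_empty split: if_splits)
  qed
  have "fun_space.dim (ker \<epsilon> \<mu>) = card (S \<union> S')"
    by (rule fun_space.dim_unique[OF _ ker_span ind]) (use S(1) S'(1) in auto)
  also have "\<dots> = card S + card S'"
  proof (rule card_Un_disjoint)
    show "S \<inter> S' = {}" using S(3) S'(3) both by (auto split: if_splits)
  qed (use S(3) S'(3) in \<open>auto split: if_splits\<close>)
  also have "card S = (if \<mu> \<in> {0, of_real \<nu>e} then 1 else 0)" using S(3) by (auto split: if_splits)
  also have "card S' = (if \<mu> \<in> {0, of_real \<nu>o} then 1 else 0)" using S'(3) by (auto split: if_splits)
  finally show ?thesis unfolding alg_mult_def Union_gen_kernel[OF sp mu] .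
qed

text \<open>For an arbitrary constant \<open>C\<close> the sector results are used in the disc of
  radius \<open>max q C\<close> times \<epsilon>; the branches do not depend on the disc, so the
  same two functions answer every \<open>C\<close>.\<close>

lemma order_eps_spectrum:
  assumes e: "\<And>d. d \<ge> dm \<Longrightarrow> \<forall>\<^sub>F \<epsilon> in at_right 0. simple_spectrum 1 d \<epsilon> (\<nu>e \<epsilon>)"
    and o: "\<And>d. d \<ge> dm \<Longrightarrow> \<forall>\<^sub>F \<epsilon> in at_right 0. simple_spectrum (- 1) d \<epsilon> (\<nu>o \<epsilon>)"
    and nz: "\<forall>\<^sub>F \<epsilon> in at_right 0. \<nu>e \<epsilon> \<noteq> 0 \<and> \<nu>o \<epsilon> \<noteq> 0"
  shows "order_eps_eigenvalues T \<nu>o \<nu>e"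
proof -
  define q where "q = max dm 1"
  have sp: "\<forall>\<^sub>F \<epsilon> in at_right 0. spectral d \<epsilon> (\<nu>o \<epsilon>) (\<nu>e \<epsilon>)" if d: "d \<ge> q" for d
  proof -
    have d': "d \<ge> dm" "d > 0" using d by (auto simp: q_def)
    show ?thesis
      using eventually_wave bounded_solution_expdec[OF d'(2)] e[OF d'(1)] o[OF d'(1)]
      by eventually_elim (auto simp: spectral_def regular_at_def)
  qed
  have b: "\<forall>\<^sub>F \<epsilon> in at_right 0. \<bar>\<nu>o \<epsilon>\<bar> \<le> q * \<bar>\<epsilon>\<bar> \<and> \<bar>\<nu>e \<epsilon>\<bar> \<le> q * \<bar>\<epsilon>\<bar>"
    using sp[OF order_refl] by eventually_elim (simp add: spectral_def simple_spectrum_def regular_at_def)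
  show ?thesis unfolding order_eps_eigenvalues_def
  proof (intro conjI allI impI)
    show "\<nu>o \<in> O[at_right 0](\<lambda>\<epsilon>. \<epsilon>)" "\<nu>e \<in> O[at_right 0](\<lambda>\<epsilon>. \<epsilon>)"
      by (rule bigoI[of _ q], use b in eventually_elim, simp)+
    show "\<forall>\<^sub>F \<epsilon> in at_right 0. is_eigenvalue (T \<epsilon>) (\<nu>o \<epsilon>) \<and> is_eigenvalue (T \<epsilon>) (\<nu>e \<epsilon>) \<and>
        alg_mult (T \<epsilon>) (\<nu>o \<epsilon>) = (if \<nu>o \<epsilon> = \<nu>e \<epsilon> then 2 else 1) \<and>
        alg_mult (T \<epsilon>) (\<nu>e \<epsilon>) = (if \<nu>o \<epsilon> = \<nu>e \<epsilon> then 2 else 1) \<and>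
        is_eigenvalue (T \<epsilon>) 0 \<and> alg_mult (T \<epsilon>) 0 = 2"
      using sp[OF order_refl] b nz eventually_wave
    proof eventually_elim
      case (elim \<epsilon>)
      have m: "cmod (of_real (\<nu>o \<epsilon>)) \<le> q * \<epsilon>" "cmod (of_real (\<nu>e \<epsilon>)) \<le> q * \<epsilon>" "cmod 0 \<le> q * \<epsilon>"
        using elim by (auto simp: q_def)
      show ?case
        using elim(3) unfolding is_eigenvalue_iff[OF elim(1) m(1)] is_eigenvalue_iff[OF elim(1) m(2)] is_eigenvalue_iff[OF elim(1) m(3)]
          alg_mult_eq[OF elim(1) m(1)] alg_mult_eq[OF elim(1) m(2)] alg_mult_eq[OF elim(1) m(3)] by auto
    qed
    fix C :: real
    have "\<forall>\<^sub>F \<epsilon> in at_right 0. spectral (max q C) \<epsilon> (\<nu>o \<epsilon>) (\<nu>e \<epsilon>)" by (rule sp) simp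
    then show "\<forall>\<^sub>F \<epsilon> in at_right 0. \<forall>\<mu>. is_eigenvalue (T \<epsilon>) \<mu> \<and> cmod \<mu> \<le> C * \<epsilon> \<longrightarrow>
        \<mu> \<in> {0, complex_of_real (\<nu>o \<epsilon>), complex_of_real (\<nu>e \<epsilon>)}"
      using eventually_wave
    proof eventually_elim
      case (elim \<epsilon>)
      have le: "C * \<epsilon> \<le> max q C * \<epsilon>" using elim(2) by (intro mult_right_mono) auto
      show ?case
      proof (intro allI impI)
        fix \<mu> assume m: "is_eigenvalue (T \<epsilon>) \<mu> \<and> cmod \<mu> \<le> C * \<epsilon>"
        then have "cmod \<mu> \<le> max q C * \<epsilon>" using le by linarith
        from is_eigenvalue_iff[OF elim(1) this] m show "\<mu> \<in> {0, complex_of_real (\<nu>o \<epsilon>), complex_of_real (\<nu>e \<epsilon>)}" by blast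
      qed
    qed
  qed
qed

lemma order_eps_no_unstable:
  assumes "order_eps_eigenvalues T \<mu>1 \<mu>2" and neg: "\<forall>\<^sub>F \<epsilon> in at_right 0. \<mu>1 \<epsilon> < 0 \<and> \<mu>2 \<epsilon> < 0" and "C > 0"
  shows "\<forall>\<^sub>F \<epsilon> in at_right 0. \<not> (\<exists>\<mu>. is_eigenvalue (T \<epsilon>) \<mu> \<and> cmod \<mu> \<le> C * \<epsilon> \<and> Re \<mu> > 0)"
proof -
  have "\<forall>\<^sub>F \<epsilon> in at_right 0. \<forall>\<mu>. is_eigenvalue (T \<epsilon>) \<mu> \<and> cmod \<mu> \<le> C * \<epsilon> \<longrightarrow>
        \<mu> \<in> {0, complex_of_real (\<mu>1 \<epsilon>), complex_of_real (\<mu>2 \<epsilon>)}"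
    using assms(1,3) unfolding order_eps_eigenvalues_def by blast
  with neg show ?thesis
  proof eventually_elim
    case (elim \<epsilon>)
    show ?case
    proof
      assume "\<exists>\<mu>. is_eigenvalue (T \<epsilon>) \<mu> \<and> cmod \<mu> \<le> C * \<epsilon> \<and> Re \<mu> > 0"
      then obtain \<mu> where "is_eigenvalue (T \<epsilon>) \<mu>" "cmod \<mu> \<le> C * \<epsilon>" and re: "Re \<mu> > 0" by blast
      then have "\<mu> \<in> {0, complex_of_real (\<mu>1 \<epsilon>), complex_of_real (\<mu>2 \<epsilon>)}" using elim(2) by blast
      then show False using re elim(1) by auto
    qed
  qed
qed

lemma bifurcating_eigenvalues:
  assumes a: "a > 0" and q: "q_even \<noteq> 0"
  obtains \<nu>o \<nu>e where "order_eps_eigenvalues T \<nu>o \<nu>e"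
    "\<forall>\<^sub>F \<epsilon> in at_right 0. \<nu>o \<epsilon> < 0 \<and> \<nu>e \<epsilon> * q_even < 0"
proof -
  obtain \<nu>e de where e: "\<And>d. d \<ge> de \<Longrightarrow> \<forall>\<^sub>F \<epsilon> in at_right 0. simple_spectrum 1 d \<epsilon> (\<nu>e \<epsilon>) \<and> \<nu>e \<epsilon> * Z 1 * q_even < 0"
    using even_sector[OF q] by blast
  obtain \<nu>o do where o: "\<And>d. d \<ge> do \<Longrightarrow> \<forall>\<^sub>F \<epsilon> in at_right 0. simple_spectrum (- 1) d \<epsilon> (\<nu>o \<epsilon>) \<and> \<nu>o \<epsilon> * (- L 2 / 4) * (- (a * K)) < 0"
    using odd_sector[OF a] by blast
  have eZ: "x * Z 1 * q_even < 0 \<Longrightarrow> x * q_even < 0" for x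
    using Z_pos(2) by (auto simp: mult_less_0_iff zero_less_mult_iff)
  have aK: "a * K > 0" "L 2 > 0" using a K_pos L_pos by auto
  have oZ: "x * (- L 2 / 4) * (- (a * K)) < 0 \<Longrightarrow> x < 0" for x
    using aK by (auto simp: mult_less_0_iff zero_less_mult_iff)
  have sgn: "\<forall>\<^sub>F \<epsilon> in at_right 0. \<nu>o \<epsilon> < 0 \<and> \<nu>e \<epsilon> * q_even < 0"
    using e[OF order_refl] o[OF order_refl] by eventually_elim (use eZ oZ in blast)
  show thesis
  proof (rule that[OF order_eps_spectrum[where dm="max de do"] sgn])
    show "\<forall>\<^sub>F \<epsilon> in at_right 0. simple_spectrum 1 d \<epsilon> (\<nu>e \<epsilon>)" if "d \<ge> max de do" for d
      by (rule eventually_mono[OF e]) (use that in auto)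
    show "\<forall>\<^sub>F \<epsilon> in at_right 0. simple_spectrum (- 1) d \<epsilon> (\<nu>o \<epsilon>)" if "d \<ge> max de do" for d
      by (rule eventually_mono[OF o]) (use that in auto)
    show "\<forall>\<^sub>F \<epsilon> in at_right 0. \<nu>e \<epsilon> \<noteq> 0 \<and> \<nu>o \<epsilon> \<noteq> 0" using sgn by eventually_elim auto
  qed
qed

text \<open>With p < 0 the \<omega>-derivative of \<open>Lam24\<close>, \<open>q_even\<close> equals
  - L 4 p (b - bstar), a positive multiple of b - bstar. The opposite sign of the derivative of
  \<open>Lamd2\<close> makes \<open>bstar\<close> negative.\<close>

lemma q_even_sign:
  shows "b < bstar \<alpha> a d2 \<omega> \<Longrightarrow> q_even < 0" "b > bstar \<alpha> a d2 \<omega> \<Longrightarrow> q_even > 0"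
    "d2 - \<alpha> * a / 3 < 0 \<Longrightarrow> bstar \<alpha> a d2 \<omega> < 0"
proof -
  define p where "p = deriv (Lam24 \<alpha>) \<omega>"
  define q where "q = deriv (Lamd2 \<alpha>) \<omega>"
  have pq: "p < 0" "q > 0"
    unfolding p_def q_def DERIV_imp_deriv[OF dLam24] DERIV_imp_deriv[OF dLamd2] by (rule derivative_signs)+
  have bs: "bstar \<alpha> a d2 \<omega> = - (q / p) * (d2 - \<alpha> * a / 3)" by (simp add: bstar_def p_def q_def)
  have "q_even = - (L 4 * (b * p + (d2 - \<alpha> * a / 3) * q))" by (simp add: q_even_def p_def q_def)
  also have "\<dots> = (L 4 * - p) * (b - bstar \<alpha> a d2 \<omega>)" unfolding bs using pq by (simp add: field_simps)
  finally have qe: "q_even = (L 4 * - p) * (b - bstar \<alpha> a d2 \<omega>)" .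
  define k where "k = L 4 * - p"
  have k: "k > 0" unfolding k_def using L_pos pq by (intro mult_pos_pos) auto
  then show "b < bstar \<alpha> a d2 \<omega> \<Longrightarrow> q_even < 0" "b > bstar \<alpha> a d2 \<omega> \<Longrightarrow> q_even > 0"
    unfolding qe k_def[symmetric] by (auto intro: mult_pos_neg mult_pos_pos)
  show "bstar \<alpha> a d2 \<omega> < 0" if "d2 - \<alpha> * a / 3 < 0"
    unfolding bs by (rule mult_pos_neg) (use that pq in \<open>auto simp: divide_pos_neg\<close>)
qed

end

theorem theorem1p1:
  fixes \<alpha> a b d2 \<omega> :: real
    and d1s :: "real \<Rightarrow> real"
    and A :: "real \<Rightarrow> real \<Rightarrow>\<^sub>C (real^2)"
  assumes "\<omega> > 0" and "\<alpha> \<le> 0" and "0 \<le> beta \<alpha> \<omega>" and "beta \<alpha> \<omega> < 1"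
    and "a > 0" and "d2 - \<alpha> * a / 3 < 0"
    and "bright_branch \<alpha> a b d2 \<omega> d1s A"
  shows "let T = (\<lambda>\<epsilon>. mJL \<alpha> a b (d1s \<epsilon>) d2 \<omega> \<epsilon> (A \<epsilon>)); bs = bstar \<alpha> a d2 \<omega> in
    bs < 0 \<and>
    (0 > bs \<and> bs > b \<longrightarrow>
      (\<exists>\<mu>1 \<mu>2. order_eps_eigenvalues T \<mu>1 \<mu>2 \<and>
         (\<forall>\<^sub>F \<epsilon> in at_right 0. \<mu>1 \<epsilon> < 0 \<and> 0 < \<mu>2 \<epsilon>))) \<and>
    (0 > b \<and> b > bs \<longrightarrow>
      (\<exists>\<mu>1 \<mu>2. order_eps_eigenvalues T \<mu>1 \<mu>2 \<and>
         (\<forall>\<^sub>F \<epsilon> in at_right 0. \<mu>1 \<epsilon> < 0 \<and> \<mu>2 \<epsilon> < 0)) \<and>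
      (\<forall>C>0. \<forall>\<^sub>F \<epsilon> in at_right 0.
         \<not> (\<exists>\<mu>. is_eigenvalue (T \<epsilon>) \<mu> \<and> cmod \<mu> \<le> C * \<epsilon> \<and> Re \<mu> > 0)))"
proof -
  interpret branch \<alpha> \<omega> a b d2 d1s A by unfold_locales (use assms in auto)
  have unstable: "\<exists>\<mu>1 \<mu>2. order_eps_eigenvalues T \<mu>1 \<mu>2 \<and> (\<forall>\<^sub>F \<epsilon> in at_right 0. \<mu>1 \<epsilon> < 0 \<and> 0 < \<mu>2 \<epsilon>)"
    if "bstar \<alpha> a d2 \<omega> > b"
  proof -
    have q: "q_even < 0" using q_even_sign(1)[OF that] .
    obtain \<nu>o \<nu>e where n: "order_eps_eigenvalues T \<nu>o \<nu>e" "\<forall>\<^sub>F \<epsilon> in at_right 0. \<nu>o \<epsilon> < 0 \<and> \<nu>e \<epsilon> * q_even < 0"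
      using bifurcating_eigenvalues[OF assms(5) less_imp_neq[OF q]] by blast
    have "\<forall>\<^sub>F \<epsilon> in at_right 0. \<nu>o \<epsilon> < 0 \<and> 0 < \<nu>e \<epsilon>"
      using n(2) by eventually_elim (use q in \<open>auto simp: mult_less_0_iff\<close>)
    with n(1) show ?thesis by blast
  qed
  have stable: "\<exists>\<mu>1 \<mu>2. order_eps_eigenvalues T \<mu>1 \<mu>2 \<and> (\<forall>\<^sub>F \<epsilon> in at_right 0. \<mu>1 \<epsilon> < 0 \<and> \<mu>2 \<epsilon> < 0)"
    if "b > bstar \<alpha> a d2 \<omega>"
  proof -
    have q: "q_even > 0" using q_even_sign(2)[OF that] .
    obtain \<nu>o \<nu>e where n: "order_eps_eigenvalues T \<nu>o \<nu>e" "\<forall>\<^sub>F \<epsilon> in at_right 0. \<nu>o \<epsilon> < 0 \<and> \<nu>e \<epsilon> * q_even < 0"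
      using bifurcating_eigenvalues[OF assms(5) less_imp_neq[OF q, symmetric]] by blast
    have "\<forall>\<^sub>F \<epsilon> in at_right 0. \<nu>o \<epsilon> < 0 \<and> \<nu>e \<epsilon> < 0"
      using n(2) by eventually_elim (use q in \<open>auto simp: mult_less_0_iff\<close>)
    with n(1) show ?thesis by blast
  qed
  show ?thesis
    unfolding Let_def T_def[symmetric, abs_def]
    using q_even_sign(3)[OF assms(6)] unstable stable order_eps_no_unstable by blast
qed

end
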